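(* Let $m>0$, $H_m=\alpha\cdot D+m\beta$ the free Dirac operator on $L^2(\mathbb{R}^3,\mathbb{C}^4)$, $U=\mathbb{R}\setminus[-m,m]$, and let $V$ be Hermitian-$4\times4$-matrix-valued with $|V(x)|\le C(1+|x|)^{-(2+\varepsilon)}$ for some $C,\varepsilon>0$ and all $x$. Let $H_m^V=H_m+V$ and fix $s$ with $\tfrac12<s<\tfrac{1+\varepsilon}{2}$. Let $$\Sigma^V_{H_m}=\{\lambda\in U:\ \exists\,0\ne\phi_\lambda\in L^{2,s}(\mathbb{R}^3,\mathbb{C}^4)\text{ with }\phi_\lambda=-VR_m^\pm(\lambda)\phi_\lambda\}.$$ Then $\Sigma^V_{H_m}$ equals the set of eigenvalues of $H_m^V$ in $U$, and this set is discrete, with all eigenvalues of finite multiplicity.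
   Context: $D=\frac1i\nabla_x$; $\alpha_j=\begin{pmatrix}0&\sigma_j\\ \sigma_j&0\end{pmatrix}$ with $\sigma_j$ the Pauli matrices, $\beta=\operatorname{diag}(I_2,-I_2)$. $H_m^V$ is self-adjoint with domain $H^1(\mathbb{R}^3,\mathbb{C}^4)$. $L^{2,s}=\{u:\int(1+|x|^2)^s|u|^2dx<\infty\}$. $R_m^\pm(\lambda)=\lim_{\delta\downarrow0}(H_m-\lambda\mp i\delta)^{-1}$ is the limiting resolvent of $H_m$, existing in $B(L^{2,s},H^{1,-s})$ for $|\lambda|>m$, $s>\tfrac12$; the equation $\phi=-VR_m^\pm(\lambda)\phi$ is taken with $R_m^+(\lambda)$ or $R_m^-(\lambda)$. *)

theory Defs
  imports "HOL-Analysis.Analysis"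
begin

section \<open>Dirac matrices (indices 1..4 of the numeral type 4; coordinates 1..3 of type 3)\<close>

definition alpha1 :: "complex^4^4" where
  "alpha1 = vector [vector [0,0,0,1], vector [0,0,1,0], vector [0,1,0,0], vector [1,0,0,0]]"

definition alpha2 :: "complex^4^4" where
  "alpha2 = vector [vector [0,0,0,-\<i>], vector [0,0,\<i>,0], vector [0,-\<i>,0,0], vector [\<i>,0,0,0]]"

definition alpha3 :: "complex^4^4" where
  "alpha3 = vector [vector [0,0,1,0], vector [0,0,0,-1], vector [1,0,0,0], vector [0,-1,0,0]]"

definition alpha :: "3 \<Rightarrow> complex^4^4" where
  "alpha j = (if j = 1 then alpha1 else if j = 2 then alpha2 else alpha3)"

definition beta :: "complex^4^4" where
  "beta = vector [vector [1,0,0,0], vector [0,1,0,0], vector [0,0,-1,0], vector [0,0,0,-1]]"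

definition hermitian4 :: "complex^4^4 \<Rightarrow> bool" where
  "hermitian4 A \<longleftrightarrow> (\<forall>a b. A $ a $ b = cnj (A $ b $ a))"

definition pderiv3 :: "(real^3 \<Rightarrow> complex) \<Rightarrow> 3 \<Rightarrow> real^3 \<Rightarrow> complex" where
  "pderiv3 f j x = frechet_derivative f (at x) (axis j 1)"

coinductive smooth3 :: "(real^3 \<Rightarrow> complex) \<Rightarrow> bool" where
  "(\<forall>x. f differentiable (at x)) \<Longrightarrow> (\<forall>j. smooth3 (pderiv3 f j)) \<Longrightarrow> smooth3 f"

definition test_fun :: "(real^3 \<Rightarrow> complex) \<Rightarrow> bool" where
  "test_fun \<phi> \<longleftrightarrow> smooth3 \<phi> \<and> compact (closure {x. \<phi> x \<noteq> 0})"

definition loc_int :: "(real^3 \<Rightarrow> complex^4) \<Rightarrow> bool" where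
  "loc_int u \<longleftrightarrow> (\<forall>K. compact K \<longrightarrow> (\<forall>k. set_integrable lborel K (\<lambda>x. u x $ k)))"

definition weak_deriv :: "(real^3 \<Rightarrow> complex^4) \<Rightarrow> 3 \<Rightarrow> (real^3 \<Rightarrow> complex^4) \<Rightarrow> bool" where
  "weak_deriv u j g \<longleftrightarrow> loc_int u \<and> loc_int g \<and>
     (\<forall>\<phi>. test_fun \<phi> \<longrightarrow> (\<forall>k.
        (\<integral>x. u x $ k * pderiv3 \<phi> j x \<partial>lborel) = - (\<integral>x. g x $ k * \<phi> x \<partial>lborel)))"

definition wd :: "(real^3 \<Rightarrow> complex^4) \<Rightarrow> 3 \<Rightarrow> real^3 \<Rightarrow> complex^4" where
  "wd u j = (SOME g. weak_deriv u j g)"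

definition weight :: "real \<Rightarrow> real^3 \<Rightarrow> real" where
  "weight s x = (1 + (norm x)\<^sup>2) powr s"

definition L2s :: "real \<Rightarrow> (real^3 \<Rightarrow> complex^4) \<Rightarrow> bool" where
  "L2s s u \<longleftrightarrow> u \<in> borel_measurable lborel \<and>
     integrable lborel (\<lambda>x. weight s x * (norm (u x))\<^sup>2)"

definition H1s :: "real \<Rightarrow> (real^3 \<Rightarrow> complex^4) \<Rightarrow> bool" where
  "H1s s u \<longleftrightarrow> L2s s u \<and> (\<exists>g. \<forall>j. weak_deriv u j (g j) \<and> L2s s (g j))"

definition H1s_norm :: "real \<Rightarrow> (real^3 \<Rightarrow> complex^4) \<Rightarrow> real" where
  "H1s_norm s u = sqrt ((\<integral>x. weight s x * (norm (u x))\<^sup>2 \<partial>lborel)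
      + (\<Sum>j\<in>UNIV. \<integral>x. weight s x * (norm (wd u j x))\<^sup>2 \<partial>lborel))"

definition dirac_eq :: "real \<Rightarrow> (real^3 \<Rightarrow> complex^4^4) \<Rightarrow> complex
      \<Rightarrow> (real^3 \<Rightarrow> complex^4) \<Rightarrow> (real^3 \<Rightarrow> complex^4) \<Rightarrow> bool" where
  "dirac_eq m V z u f \<longleftrightarrow> H1s 0 u \<and> (\<exists>g. (\<forall>j. weak_deriv u j (g j)) \<and>
     (AE x in lborel.
        (\<Sum>j\<in>UNIV. alpha j *v ((- \<i>) *s g j x)) + (complex_of_real m) *s (beta *v u x)
        + V x *v u x - z *s u x = f x))"

text \<open>Free resolvent (H_m - z)^{-1} f for non-real z.\<close>
definition free_res :: "real \<Rightarrow> complex \<Rightarrow> (real^3 \<Rightarrow> complex^4) \<Rightarrow> real^3 \<Rightarrow> complex^4" where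
  "free_res m z f = (SOME u. dirac_eq m (\<lambda>x. 0) z u f)"

text \<open>u = R_m^{+}(lam) f (sg = 1) resp. R_m^{-}(lam) f (sg = -1): limit in H^{1,-s}
  of (H_m - lam - sg i delta)^{-1} f as delta tends to 0 from above.\<close>
definition lim_res :: "real \<Rightarrow> real \<Rightarrow> real \<Rightarrow> real
      \<Rightarrow> (real^3 \<Rightarrow> complex^4) \<Rightarrow> (real^3 \<Rightarrow> complex^4) \<Rightarrow> bool" where
  "lim_res m s sg lam f u \<longleftrightarrow> H1s (-s) u \<and>
     ((\<lambda>\<delta>. H1s_norm (-s) (\<lambda>x. free_res m (Complex lam (sg * \<delta>)) f x - u x)) \<longlongrightarrow> 0) (at_right 0)"

definition U_set :: "real \<Rightarrow> real set" where
  "U_set m = {lam. \<bar>lam\<bar> > m}"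

definition is_eigenvalue :: "real \<Rightarrow> (real^3 \<Rightarrow> complex^4^4) \<Rightarrow> real \<Rightarrow> bool" where
  "is_eigenvalue m V lam \<longleftrightarrow>
     (\<exists>u. dirac_eq m V (complex_of_real lam) u (\<lambda>x. 0) \<and> \<not> (AE x in lborel. u x = 0))"

definition Sigma_V :: "real \<Rightarrow> (real^3 \<Rightarrow> complex^4^4) \<Rightarrow> real \<Rightarrow> real \<Rightarrow> real set" where
  "Sigma_V m V s sg = {lam \<in> U_set m. \<exists>\<phi> u. L2s s \<phi> \<and> \<not> (AE x in lborel. \<phi> x = 0) \<and>
      lim_res m s sg lam \<phi> u \<and> (AE x in lborel. \<phi> x = - (V x *v u x))}"

definition finite_multiplicity :: "real \<Rightarrow> (real^3 \<Rightarrow> complex^4^4) \<Rightarrow> real \<Rightarrow> bool" where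
  "finite_multiplicity m V lam \<longleftrightarrow> (\<exists>N::nat. \<forall>k (us :: nat \<Rightarrow> real^3 \<Rightarrow> complex^4).
     (\<forall>i<k. dirac_eq m V (complex_of_real lam) (us i) (\<lambda>x. 0)) \<and>
     (\<forall>c :: nat \<Rightarrow> complex. (AE x in lborel. (\<Sum>i<k. c i *s us i x) = 0) \<longrightarrow> (\<forall>i<k. c i = 0))
     \<longrightarrow> k \<le> N)"

end

theory Submission
  imports Defs
begin

text \<open>
  Write \<open>H = \<alpha>\<cdot>D + m\<beta>\<close> and \<open>R(z) = (H - z)\<^sup>-\<^sup>1\<close>. The proof avoids the Fourier transform; derivatives are
  generators of translation groups on \<open>L\<^sup>2\<close>. If \<open>A\<close> generates dilations, then \<open>i[H, A] = \<alpha>\<cdot>D\<close>; together with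
  \<open>H\<beta> + \<beta>H = 2m\<close> this expresses \<open>R(z)\<^sup>2\<close> by terms linear in \<open>R(z)\<close>, with coefficients that stay bounded for
  \<open>z\<close> close to a point \<open>\<lambda>\<close> with \<open>\<bar>\<lambda>\<bar> > m\<close>.

  If \<open>\<phi> = -V R(\<lambda> \<plusminus> i0) \<phi>\<close>, then \<open>\<phi>\<close> lies in \<open>L\<^sup>2\<^sup>,\<^sup>1\<close>, and \<open>G(\<delta>) = \<delta> \<parallel>R(\<lambda> + i\<delta>) \<phi>\<parallel>\<^sup>2 = Im \<langle>\<phi>, R(\<lambda> + i\<delta>) \<phi>\<rangle>\<close>
  tends to \<open>0\<close> because \<open>V\<close> is Hermitian. The derivative of \<open>G\<close> is the real part of
  \<open>\<langle>\<phi>, R(\<lambda> + i\<delta>)\<^sup>2 \<phi>\<rangle>\<close>, so \<open>\<bar>G'\<bar> \<le> K ((G / \<delta>)\<^sup>1\<^sup>/\<^sup>2 + 1)\<close>, whence \<open>G = O(\<delta>)\<close>: the resolvent stays bounded in \<open>L\<^sup>2\<close> and its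
  limit is an eigenfunction. Conversely, for an eigenfunction \<open>u\<close> and \<open>\<phi> = -Vu\<close> one has
  \<open>R(\<lambda> \<plusminus> i\<delta>) \<phi> - u = \<plusminus>i\<delta> R(\<lambda> \<plusminus> i\<delta>) u\<close>, which tends to \<open>0\<close> since \<open>H\<close> has no eigenvalue at \<open>\<lambda>\<close>.

  With \<open>\<delta> = 0\<close> the same commutator identity gives \<open>\<parallel>u\<parallel> \<le> K \<parallel>(1 + \<bar>x\<bar>) V u\<parallel>\<close> for eigenfunctions, locally uniformly in
  \<open>\<lambda>\<close>. By compactness an orthonormal family of eigenfunctions with eigenvalues in a compact part of
  \<open>\<bar>\<lambda>\<bar> > m\<close> is then finite.
\<close>

section \<open>The Hilbert space of square-integrable spinor fields\<close>

text \<open>It is therefore kept on the right-hand side throughout: the estimates concern the free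
  equation (H - z) u = f, and only afterwards is f = -V u seen to lie in the weighted space they
  require. The dilation generator is also unbounded in x. Replacing x_k by R sin (x_k / R) keeps
  every vector inside L2, and because |R sin (x_k / R)| <= |x| the constants do not depend on R.

  The role of |\<lambda>| > m is algebraic: the commutator yields \<alpha>\<cdot>D and not H, and on
  solutions <v, \<alpha>\<cdot>D u> equals (z - m^2 / z) <v, u> up to terms containing a right-hand
  side. That coefficient vanishes only at the thresholds z = m and z = -m.

  The limiting resolvent is never constructed for general f. In one direction \<open>lim_res\<close>
  supplies the limit as a hypothesis; in the other the limit is the eigenfunction itself.\<close>

definition square_integrable :: "(real^3 \<Rightarrow> complex^4) \<Rightarrow> bool" where
  "square_integrable f \<longleftrightarrow> f \<in> borel_measurable lborel \<and> integrable lborel (\<lambda>x. (norm (f x))\<^sup>2)"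

lemma square_integrable_measurable: "square_integrable f \<Longrightarrow> f \<in> borel_measurable lborel"
  by (simp add: square_integrable_def)

lemma square_integrable_bound:
  assumes "square_integrable f" "g \<in> borel_measurable lborel"
    and "AE x in lborel. norm (g x) \<le> K * norm (f x)"
  shows "square_integrable g"
  unfolding square_integrable_def
proof
  have "integrable lborel (\<lambda>x. K\<^sup>2 * (norm (f x))\<^sup>2)"
    using assms(1) by (auto simp: square_integrable_def)
  then show "integrable lborel (\<lambda>x. (norm (g x))\<^sup>2)"
  proof (rule Bochner_Integration.integrable_bound)
    show "AE x in lborel. norm ((norm (g x))\<^sup>2) \<le> norm (K\<^sup>2 * (norm (f x))\<^sup>2)"
      using assms(3)
    proof eventually_elim
      case (elim x)
      then have "(norm (g x))\<^sup>2 \<le> (K * norm (f x))\<^sup>2" by (intro power_mono) auto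
      then show ?case by (simp add: power_mult_distrib)
    qed
  qed (use assms(2) in measurable)
qed (fact assms(2))

lemma square_integrable_inner:
  assumes "square_integrable f" "square_integrable g"
  shows "integrable lborel (\<lambda>x. f x \<bullet> g x)"
proof (rule Bochner_Integration.integrable_bound)
  show "integrable lborel (\<lambda>x. (norm (f x))\<^sup>2 + (norm (g x))\<^sup>2)"
    using assms by (auto simp: square_integrable_def)
  show "(\<lambda>x. f x \<bullet> g x) \<in> borel_measurable lborel"
    using assms[THEN square_integrable_measurable] by measurable
  have "norm (f x \<bullet> g x) \<le> norm ((norm (f x))\<^sup>2 + (norm (g x))\<^sup>2)" for x
  proof -
    have "norm (f x \<bullet> g x) \<le> norm (f x) * norm (g x)"
      using Cauchy_Schwarz_ineq2 by simp
    also have "\<dots> \<le> (norm (f x))\<^sup>2 + (norm (g x))\<^sup>2"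
      using sum_squares_bound[of "norm (f x)" "norm (g x)"] mult_nonneg_nonneg[OF norm_ge_zero norm_ge_zero, of "f x" "g x"]
      by linarith
    finally show ?thesis by simp
  qed
  then show "AE x in lborel. norm (f x \<bullet> g x) \<le> norm ((norm (f x))\<^sup>2 + (norm (g x))\<^sup>2)" by simp
qed

lemma square_integrable_zero [simp]: "square_integrable (\<lambda>x. 0)"
  by (simp add: square_integrable_def)

lemma square_integrable_scaleR: "square_integrable f \<Longrightarrow> square_integrable (\<lambda>x. c *\<^sub>R f x)"
  by (rule square_integrable_bound[where K = "\<bar>c\<bar>"]) (auto simp: square_integrable_def)

lemma square_integrable_add:
  assumes "square_integrable f" "square_integrable g"
  shows "square_integrable (\<lambda>x. f x + g x)"
proof -
  have "integrable lborel (\<lambda>x. f x \<bullet> f x + 2 * (f x \<bullet> g x) + g x \<bullet> g x)"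
    using assms by (intro Bochner_Integration.integrable_add integrable_mult_right square_integrable_inner)
  then show ?thesis using assms
    by (auto simp: square_integrable_def power2_norm_eq_inner inner_add inner_commute algebra_simps)
qed

lemma square_integrable_uminus: "square_integrable f \<Longrightarrow> square_integrable (\<lambda>x. - f x)"
  using square_integrable_scaleR[of f "-1"] by simp

lemma square_integrable_diff:
  "square_integrable f \<Longrightarrow> square_integrable g \<Longrightarrow> square_integrable (\<lambda>x. f x - g x)"
  using square_integrable_add[OF _ square_integrable_uminus, of f g] by simp

\<comment> \<open>The inner product is definite only up to null sets. As a quotient type,
  \<open>l2\<close> becomes an instance of \<open>real_inner\<close> and
  \<open>complete_space\<close>, so that limits, \<open>bounded_linear\<close> and vector-valued
  integrals apply to it directly; functions return through the representative
  \<open>fn\<close>.\<close>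
quotient_type l2 = "real^3 \<Rightarrow> complex^4" / partial:
  "\<lambda>f g. square_integrable f \<and> square_integrable g \<and> (AE x in lborel. f x = g x)"
proof (rule part_equivpI)
  show "\<exists>f. square_integrable f \<and> square_integrable f \<and> (AE x in lborel. f x = f x)"
    by (rule exI[of _ "\<lambda>x. 0"]) simp
  show "symp (\<lambda>f g. square_integrable f \<and> square_integrable g \<and> (AE x in lborel. f x = g x))"
    by (auto simp: symp_def elim: eventually_mono)
  show "transp (\<lambda>f g. square_integrable f \<and> square_integrable g \<and> (AE x in lborel. f x = g x))"
    by (auto simp: transp_def elim: eventually_elim2)
qed

instantiation l2 :: real_vector
begin

lift_definition zero_l2 :: l2 is "\<lambda>x. 0" by simp

lift_definition plus_l2 :: "l2 \<Rightarrow> l2 \<Rightarrow> l2" is "\<lambda>f g x. f x + g x"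
  by (auto intro: square_integrable_add elim: eventually_elim2)

lift_definition minus_l2 :: "l2 \<Rightarrow> l2 \<Rightarrow> l2" is "\<lambda>f g x. f x - g x"
  by (auto intro: square_integrable_diff elim: eventually_elim2)

lift_definition uminus_l2 :: "l2 \<Rightarrow> l2" is "\<lambda>f x. - f x"
  by (auto intro: square_integrable_uminus)

lift_definition scaleR_l2 :: "real \<Rightarrow> l2 \<Rightarrow> l2" is "\<lambda>c f x. c *\<^sub>R f x"
  by (auto intro: square_integrable_scaleR)

instance
proof
  fix u v w :: l2 and a b :: real
  show "u + v + w = u + (v + w)" by transfer (simp add: add.assoc square_integrable_add)
  show "u + v = v + u" by transfer (simp add: add.commute square_integrable_add)
  show "0 + u = u" by transfer simp
  show "- u + u = 0" by transfer simp
  show "u - v = u + - v" by transfer (simp add: square_integrable_diff)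
  show "a *\<^sub>R (u + v) = a *\<^sub>R u + a *\<^sub>R v"
    by transfer (simp add: scaleR_add_right square_integrable_add square_integrable_scaleR)
  show "(a + b) *\<^sub>R u = a *\<^sub>R u + b *\<^sub>R u"
    by transfer (simp add: scaleR_add_left square_integrable_add square_integrable_scaleR)
  show "a *\<^sub>R b *\<^sub>R u = (a * b) *\<^sub>R u" by transfer (simp add: square_integrable_scaleR)
  show "1 *\<^sub>R u = u" by transfer simp
qed

end

instantiation l2 :: real_inner
begin

lift_definition inner_l2 :: "l2 \<Rightarrow> l2 \<Rightarrow> real" is "\<lambda>f g. \<integral>x. f x \<bullet> g x \<partial>lborel"
proof -
  fix f f' g g' :: "real^3 \<Rightarrow> complex^4"
  assume *: "square_integrable f \<and> square_integrable f' \<and> (AE x in lborel. f x = f' x)"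
    "square_integrable g \<and> square_integrable g' \<and> (AE x in lborel. g x = g' x)"
  then have [measurable]: "f \<in> borel_measurable lborel" "g \<in> borel_measurable lborel"
    "f' \<in> borel_measurable lborel" "g' \<in> borel_measurable lborel"
    by (auto simp: square_integrable_def)
  show "(\<integral>x. f x \<bullet> g x \<partial>lborel) = (\<integral>x. f' x \<bullet> g' x \<partial>lborel)"
    using * by (intro integral_cong_AE) (auto elim: eventually_elim2)
qed

definition "norm_l2 (u::l2) = sqrt (inner u u)"
definition "sgn_l2 (u::l2) = u /\<^sub>R norm u"
definition "dist_l2 (u::l2) v = norm (u - v)"
definition "(uniformity :: (l2 \<times> l2) filter) = (INF e\<in>{0 <..}. principal {(x, y). dist x y < e})"
definition "open_l2 (S :: l2 set) \<longleftrightarrow> (\<forall>x\<in>S. \<forall>\<^sub>F (x', y) in uniformity. x' = x \<longrightarrow> y \<in> S)"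

instance
proof
  fix u v w :: l2 and c :: real
  show "inner u v = inner v u"
    by transfer (simp add: inner_commute)
  show "inner (u + v) w = inner u w + inner v w"
    by transfer (simp add: inner_add_left square_integrable_inner)
  show "inner (c *\<^sub>R u) v = c * inner u v"
    by transfer simp
  show "0 \<le> inner u u"
    by transfer (simp)
  show "inner u u = 0 \<longleftrightarrow> u = 0"
  proof transfer
    fix f :: "real^3 \<Rightarrow> complex^4"
    assume "square_integrable f \<and> square_integrable f \<and> (AE x in lborel. f x = f x)"
    then show "((\<integral>x. f x \<bullet> f x \<partial>lborel) = 0) =
        (square_integrable f \<and> square_integrable (\<lambda>x. 0) \<and> (AE x in lborel. f x = 0))"
      by (subst integral_nonneg_eq_0_iff_AE) (auto intro: square_integrable_inner)
  qed
qed (simp_all add: norm_l2_def sgn_l2_def dist_l2_def open_l2_def uniformity_l2_def)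

end

definition cls :: "(real^3 \<Rightarrow> complex^4) \<Rightarrow> l2" where "cls f = abs_l2 f"
definition fn :: "l2 \<Rightarrow> real^3 \<Rightarrow> complex^4" where "fn u = rep_l2 u"

lemma square_integrable_fn [simp]: "square_integrable (fn u)"
  using Quotient_rep_reflp[OF Quotient_l2] by (simp add: fn_def)

lemma fn_measurable [measurable]: "fn u \<in> borel_measurable lborel" "fn u \<in> borel_measurable borel"
  using square_integrable_measurable[OF square_integrable_fn, of u] by simp_all

lemma cls_fn [simp]: "cls (fn u) = u"
  using Quotient_abs_rep[OF Quotient_l2] by (simp add: fn_def cls_def)

lemma cls_eq_iff:
  "square_integrable f \<Longrightarrow> square_integrable g \<Longrightarrow> cls f = cls g \<longleftrightarrow> (AE x in lborel. f x = g x)"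
  using Quotient_rel[OF Quotient_l2, of f g] by (simp add: cls_def)

lemma fn_cls: "square_integrable f \<Longrightarrow> AE x in lborel. fn (cls f) x = f x"
  by (subst cls_eq_iff[symmetric]) auto

lemma l2_eq_iff: "u = v \<longleftrightarrow> (AE x in lborel. fn u x = fn v x)"
  by (subst cls_eq_iff[symmetric]) auto

lemma l2_cases: obtains f where "square_integrable f" "u = cls f"
  using square_integrable_fn cls_fn by metis

lemma cls_zero [simp]: "cls (\<lambda>x. 0) = 0"
  by (simp add: cls_def zero_l2.abs_eq)

lemma cls_add: "square_integrable f \<Longrightarrow> square_integrable g \<Longrightarrow> cls f + cls g = cls (\<lambda>x. f x + g x)"
  by (simp add: cls_def plus_l2.abs_eq)

lemma cls_diff: "square_integrable f \<Longrightarrow> square_integrable g \<Longrightarrow> cls f - cls g = cls (\<lambda>x. f x - g x)"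
  by (simp add: cls_def minus_l2.abs_eq)

lemma cls_uminus: "square_integrable f \<Longrightarrow> - cls f = cls (\<lambda>x. - f x)"
  by (simp add: cls_def uminus_l2.abs_eq)

lemma cls_scaleR: "square_integrable f \<Longrightarrow> c *\<^sub>R cls f = cls (\<lambda>x. c *\<^sub>R f x)"
  by (simp add: cls_def scaleR_l2.abs_eq)

lemma inner_cls: "square_integrable f \<Longrightarrow> square_integrable g \<Longrightarrow> cls f \<bullet> cls g = (\<integral>x. f x \<bullet> g x \<partial>lborel)"
  by (simp add: cls_def inner_l2.abs_eq)

lemma norm_cls_sq: "square_integrable f \<Longrightarrow> (norm (cls f))\<^sup>2 = (\<integral>x. (norm (f x))\<^sup>2 \<partial>lborel)"
  by (simp add: power2_norm_eq_inner inner_cls)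

lemma norm_fn_sq: "(norm u)\<^sup>2 = (\<integral>x. (norm (fn u x))\<^sup>2 \<partial>lborel)"
  using norm_cls_sq[of "fn u"] by simp

lemma integrable_fn_sq: "integrable lborel (\<lambda>x. (norm (fn u x))\<^sup>2)"
  using square_integrable_fn by (simp add: square_integrable_def del: square_integrable_fn)

lemma nn_integral_fn_sq: "(\<integral>\<^sup>+x. ennreal ((norm (fn u x))\<^sup>2) \<partial>lborel) = ennreal ((norm u)\<^sup>2)"
  unfolding norm_fn_sq by (rule nn_integral_eq_integral) (auto intro: integrable_fn_sq)

lemma fn_add: "AE x in lborel. fn (u + v) x = fn u x + fn v x"
  using fn_cls[OF square_integrable_add, of "fn u" "fn v"] cls_add[of "fn u" "fn v"] by simp

lemma fn_diff: "AE x in lborel. fn (u - v) x = fn u x - fn v x"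
  using fn_cls[OF square_integrable_diff, of "fn u" "fn v"] cls_diff[of "fn u" "fn v"] by simp

lemma fn_zero: "AE x in lborel. fn 0 x = 0"
  using fn_cls[OF square_integrable_zero] by simp

lemma norm_le_AE:
  assumes "K \<ge> 0" "AE x in lborel. norm (fn u x) \<le> K * norm (fn v x)"
  shows "norm u \<le> K * norm v"
proof -
  have "(\<integral>x. (norm (fn u x))\<^sup>2 \<partial>lborel) \<le> (\<integral>x. K\<^sup>2 * (norm (fn v x))\<^sup>2 \<partial>lborel)"
    using assms(2) by (intro integral_mono_AE integrable_mult_right integrable_fn_sq)
      (auto elim!: eventually_mono simp: power_mult_distrib[symmetric] intro!: power_mono)
  then have "(norm u)\<^sup>2 \<le> (K * norm v)\<^sup>2"
    by (simp add: norm_fn_sq power_mult_distrib)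
  then show ?thesis using assms(1) by (auto intro: power2_le_imp_le)
qed

text \<open>Riesz-Fischer. Along a fast subsequence the increments are summable almost everywhere,
  which gives a pointwise limit; Fatou's lemma turns the estimate for differences within the
  subsequence into one for the distance to that limit.\<close>

instance l2 :: complete_space
proof
  fix X :: "nat \<Rightarrow> l2"
  assume "Cauchy X"
  then have "\<exists>N. \<forall>m\<ge>N. \<forall>n\<ge>N. dist (X m) (X n) < (1/4)^k" for k :: nat
    by (intro metric_CauchyD) auto
  then obtain N where N: "\<And>k m n. m \<ge> N k \<Longrightarrow> n \<ge> N k \<Longrightarrow> dist (X m) (X n) < (1/4)^k"
    by metis
  \<comment> \<open>Summing the thresholds gives indices with \<open>r j \<ge> N k\<close> whenever
    \<open>k \<le> j\<close>, without arranging that \<open>N\<close> is monotone.\<close>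
  define r where "r k = (\<Sum>i\<le>k. N i)" for k
  have rN: "N k \<le> r j" if "k \<le> j" for k j
    unfolding r_def using that by (intro member_le_sum) auto
  define f where "f k = fn (X (r k))" for k
  have [measurable]: "f k \<in> borel_measurable borel" for k by (simp add: f_def fn_measurable)
  have close: "(\<integral>\<^sup>+x. ennreal ((norm (f j x - f k x))\<^sup>2) \<partial>lborel) \<le> ennreal ((1/16)^k)" if "k \<le> j" for j k
  proof -
    have "(\<integral>\<^sup>+x. ennreal ((norm (f j x - f k x))\<^sup>2) \<partial>lborel)
        = (\<integral>\<^sup>+x. ennreal ((norm (fn (X (r j) - X (r k)) x))\<^sup>2) \<partial>lborel)"
      using fn_diff[of "X (r j)" "X (r k)"] unfolding f_def
      by (intro nn_integral_cong_AE) (auto elim: eventually_mono)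
    also have "\<dots> = ennreal ((dist (X (r j)) (X (r k)))\<^sup>2)"
      by (simp add: nn_integral_fn_sq dist_norm)
    also have "\<dots> \<le> ennreal (((1/4)^k)\<^sup>2)"
      using N[of k "r j" "r k"] rN[of k j] rN[of k k] that
      by (intro ennreal_leI power_mono) auto
    also have "((1/4::real)^k)\<^sup>2 = (1/16)^k"
      by (simp add: power2_eq_square flip: power_mult_distrib)
    finally show ?thesis .
  qed
  \<comment> \<open>The squared increments have integral at most 16^(-k). Weighting them by 4^k
    keeps the sum finite and still leaves pointwise decay 2^(-k) for the increments
    themselves.\<close>
  have "(\<integral>\<^sup>+x. (\<Sum>k. ennreal (4^k * (norm (f (Suc k) x - f k x))\<^sup>2)) \<partial>lborel)
      = (\<Sum>k. \<integral>\<^sup>+x. ennreal (4^k) * ennreal ((norm (f (Suc k) x - f k x))\<^sup>2) \<partial>lborel)"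
    by (subst nn_integral_suminf) (auto simp: ennreal_mult)
  also have "\<dots> = (\<Sum>k. ennreal (4^k) * (\<integral>\<^sup>+x. ennreal ((norm (f (Suc k) x - f k x))\<^sup>2) \<partial>lborel))"
    by (simp add: nn_integral_cmult)
  also have "\<dots> \<le> (\<Sum>k. ennreal (4^k) * ennreal ((1/16)^k))"
    by (intro suminf_le mult_left_mono close) auto
  also have "\<dots> = (\<Sum>k. ennreal ((1/4)^k))"
    by (simp add: ennreal_mult[symmetric] power_mult_distrib[symmetric])
  also have "\<dots> < top"
    by (subst suminf_ennreal2) (auto intro: summable_geometric)
  finally have "AE x in lborel. (\<Sum>k. ennreal (4^k * (norm (f (Suc k) x - f k x))\<^sup>2)) \<noteq> \<infinity>"
    by (intro nn_integral_PInf_AE) (auto simp: less_top)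
  then have conv: "AE x in lborel. convergent (\<lambda>k. f k x)"
  proof eventually_elim
    case (elim x)
    then have "summable (\<lambda>k. 4^k * (norm (f (Suc k) x - f k x))\<^sup>2)"
      by (intro summable_suminf_not_top) auto
    then have "Bseq (\<lambda>k. 4^k * (norm (f (Suc k) x - f k x))\<^sup>2)"
      by (intro convergent_imp_Bseq) (auto dest: summable_LIMSEQ_zero simp: convergent_def)
    then obtain B where B: "B > 0" "\<And>k. norm (4^k * (norm (f (Suc k) x - f k x))\<^sup>2) \<le> B"
      unfolding Bseq_def by auto
    have le: "norm (f (Suc k) x - f k x) \<le> sqrt B * (1/2)^k" for k
    proof -
      have four: "(2::real)^k * 2^k = 4^k" by (simp add: power_mult_distrib[symmetric])
      have "(2^k * norm (f (Suc k) x - f k x))\<^sup>2 = 4^k * (norm (f (Suc k) x - f k x))\<^sup>2"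
        using four by (simp add: power_mult_distrib power2_eq_square)
      then have "(2^k * norm (f (Suc k) x - f k x))\<^sup>2 \<le> B"
        using B(2)[of k] by simp
      then have "2^k * norm (f (Suc k) x - f k x) \<le> sqrt B"
        by (rule real_le_rsqrt)
      then show ?thesis by (simp add: field_simps)
    qed
    have "summable (\<lambda>k. f (Suc k) x - f k x)"
      by (rule summable_comparison_test'[where N = 0 and g = "\<lambda>k. sqrt B * (1/2)^k"])
        (auto intro: summable_mult summable_geometric le)
    then have "convergent (\<lambda>n. \<Sum>k<n. f (Suc k) x - f k x)"
      by (simp add: summable_iff_convergent)
    then have "convergent (\<lambda>n. f n x - f 0 x)"
      unfolding sum_lessThan_telescope[of "\<lambda>k. f k x"] .
    from convergent_add[OF this convergent_const[of "f 0 x"]] show ?case by simp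
  qed
  define g where "g x = lim (\<lambda>k. f k x)" for x
  have [measurable]: "g \<in> borel_measurable borel" unfolding g_def by measurable
  have close_g: "(\<integral>\<^sup>+x. ennreal ((norm (g x - f k x))\<^sup>2) \<partial>lborel) \<le> ennreal ((1/16)^k)" for k
  proof -
    have "(\<integral>\<^sup>+x. ennreal ((norm (g x - f k x))\<^sup>2) \<partial>lborel)
        = (\<integral>\<^sup>+x. liminf (\<lambda>j. ennreal ((norm (f j x - f k x))\<^sup>2)) \<partial>lborel)"
    proof (rule nn_integral_cong_AE)
      show "AE x in lborel. ennreal ((norm (g x - f k x))\<^sup>2) = liminf (\<lambda>j. ennreal ((norm (f j x - f k x))\<^sup>2))"
        using conv
      proof eventually_elim
        case (elim x)
        then have "(\<lambda>j. f j x) \<longlonglongrightarrow> g x" by (simp add: convergent_LIMSEQ_iff g_def)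
        then have "(\<lambda>j. ennreal ((norm (f j x - f k x))\<^sup>2)) \<longlonglongrightarrow> ennreal ((norm (g x - f k x))\<^sup>2)"
          by (intro tendsto_intros) auto
        then show ?case by (rule lim_imp_Liminf[OF trivial_limit_sequentially, symmetric])
      qed
    qed
    also have "\<dots> \<le> liminf (\<lambda>j. \<integral>\<^sup>+x. ennreal ((norm (f j x - f k x))\<^sup>2) \<partial>lborel)"
      by (intro nn_integral_liminf) auto
    also have "\<dots> \<le> ennreal ((1/16)^k)"
      by (intro Liminf_le eventually_sequentiallyI[of k] close) auto
    finally show ?thesis .
  qed
  have "integrable lborel (\<lambda>x. (norm (g x - f k x))\<^sup>2)" for k
    using close_g[of k] by (intro integrableI_nonneg) (auto intro: le_less_trans)
  then have sq: "square_integrable (\<lambda>x. g x - f k x)" for k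
    by (simp add: square_integrable_def)
  have sqg: "square_integrable g"
    using square_integrable_add[OF sq[of 0], of "f 0"] by (simp add: f_def)
  have dg: "dist (X (r k)) (cls g) \<le> (1/4)^k" for k
  proof -
    have "ennreal ((norm (cls g - X (r k)))\<^sup>2) = (\<integral>\<^sup>+x. ennreal ((norm (g x - f k x))\<^sup>2) \<partial>lborel)"
    proof -
      have "cls g - X (r k) = cls (\<lambda>x. g x - f k x)"
        using cls_diff[OF sqg, of "f k"] by (simp add: f_def)
      then show ?thesis
        using nn_integral_eq_integral[of lborel "\<lambda>x. (norm (g x - f k x))\<^sup>2"] sq[of k]
        by (simp add: norm_cls_sq square_integrable_def)
    qed
    also have "\<dots> \<le> ennreal ((1/16)^k)" by (rule close_g)
    finally have "(norm (cls g - X (r k)))\<^sup>2 \<le> (1/16)^k"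
      by (simp add: ennreal_le_iff)
    also have "(1/16::real)^k = ((1/4)^k)\<^sup>2"
      by (simp add: power2_eq_square flip: power_mult_distrib)
    finally have "norm (cls g - X (r k)) \<le> (1/4)^k"
      by (rule power2_le_imp_le) simp
    then show ?thesis by (simp add: dist_norm norm_minus_commute)
  qed
  have "X \<longlonglongrightarrow> cls g"
  proof (rule metric_LIMSEQ_I)
    fix e :: real assume "e > 0"
    then obtain k where k: "(1/4)^k < e/2" using real_arch_pow_inv[of "e/2" "1/4"] by auto
    have "dist (X n) (cls g) < e" if "n \<ge> N k" for n
      using dist_triangle[of "X n" "cls g" "X (r k)"] N[of k n "r k"] rN[of k k] dg[of k] that k by simp
    then show "\<exists>no. \<forall>n\<ge>no. dist (X n) (cls g) < e" by blast
  qed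
  then show "convergent X" by (auto simp: convergent_def)
qed

instance l2 :: banach ..

text \<open>Projection theorem: a minimising sequence in \<open>S\<close> is Cauchy, and the error
  \<open>x - y\<close> at its limit is orthogonal to \<open>S\<close>, hence zero. The density of
  test fields and of ranges of H - z is derived from this.\<close>

lemma closure_eq_UNIV_if_orthogonal_trivial:
  fixes S :: "'a::{real_inner, complete_space} set"
  assumes S: "subspace S" and triv: "\<And>w. (\<And>v. v \<in> S \<Longrightarrow> w \<bullet> v = 0) \<Longrightarrow> w = 0"
  shows "closure S = UNIV"
proof -
  have ne: "S \<noteq> {}" using subspace_0[OF S] by auto
  have "x \<in> closure S" for x
  proof -
    define d where "d = infdist x S"
    have d: "d \<ge> 0" "\<And>s. s \<in> S \<Longrightarrow> d \<le> norm (x - s)"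
      unfolding d_def by (auto simp: infdist_nonneg dist_norm[symmetric] infdist_le)
    have "\<exists>s\<in>S. norm (x - s) < d + 1 / (real n + 1)" for n
    proof -
      have "Inf (dist x ` S) < d + 1 / (real n + 1)" using ne by (simp add: d_def infdist_def)
      then show ?thesis using cInf_lessD[of "dist x ` S"] ne by (auto simp: dist_norm)
    qed
    then obtain s where s: "\<And>n. s n \<in> S" "\<And>n. norm (x - s n) < d + 1 / (real n + 1)"
      by metis
    have lim: "(\<lambda>n. norm (x - s n)) \<longlonglongrightarrow> d"
    proof (rule tendsto_sandwich[of "\<lambda>n. d" _ _ "\<lambda>n. d + 1 / (real n + 1)"])
      show "(\<lambda>n. d + 1 / (real n + 1)) \<longlonglongrightarrow> d"
        using tendsto_add[OF tendsto_const LIMSEQ_inverse_real_of_nat, of d] by (simp add: inverse_eq_divide add.commute)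
    qed (use d s in \<open>auto intro!: always_eventually less_imp_le\<close>)
    \<comment> \<open>Parallelogram law; the midpoint of \<open>s n\<close> and \<open>s m\<close>
      lies in \<open>S\<close> and so has distance at least \<open>d\<close> from
      \<open>x\<close>.\<close>
    have par: "(norm (s n - s m))\<^sup>2 \<le> 2 * (norm (x - s n))\<^sup>2 + 2 * (norm (x - s m))\<^sup>2 - 4 * d\<^sup>2" for n m
    proof -
      have "(1/2) *\<^sub>R (s n + s m) \<in> S" using S s(1) by (simp add: subspace_add subspace_scale)
      from d(2)[OF this] have "d\<^sup>2 \<le> (norm (x - (1/2) *\<^sub>R (s n + s m)))\<^sup>2"
        using d(1) by (intro power_mono)
      moreover have "(norm (s n - s m))\<^sup>2 = 2 * (norm (x - s n))\<^sup>2 + 2 * (norm (x - s m))\<^sup>2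
          - 4 * (norm (x - (1/2) *\<^sub>R (s n + s m)))\<^sup>2"
        unfolding power2_norm_eq_inner
        by (simp add: inner_commute algebra_simps)
      ultimately show ?thesis by simp
    qed
    have "Cauchy s"
      unfolding Cauchy_def
    proof (intro allI impI)
      fix e :: real assume e: "e > 0"
      have "(\<lambda>n. (norm (x - s n))\<^sup>2) \<longlonglongrightarrow> d\<^sup>2" by (intro tendsto_intros lim)
      then have "\<forall>\<^sub>F n in sequentially. (norm (x - s n))\<^sup>2 < d\<^sup>2 + e\<^sup>2 / 4"
        using e by (intro order_tendstoD) auto
      then obtain N where N: "\<And>n. n \<ge> N \<Longrightarrow> (norm (x - s n))\<^sup>2 < d\<^sup>2 + e\<^sup>2 / 4"
        by (auto simp: eventually_sequentially)
      have "dist (s m) (s n) < e" if "m \<ge> N" "n \<ge> N" for m n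
      proof -
        have "(norm (s m - s n))\<^sup>2 < e\<^sup>2" using par[of m n] N[of m] N[of n] that by simp
        then show ?thesis using e by (simp add: dist_norm power2_less_imp_less)
      qed
      then show "\<exists>M. \<forall>m\<ge>M. \<forall>n\<ge>M. dist (s m) (s n) < e" by blast
    qed
    then obtain y where y: "s \<longlonglongrightarrow> y" using Cauchy_convergent_iff convergent_def by blast
    have yS: "y \<in> closure S" using y s(1) closure_sequential by blast
    have dy: "norm (x - y) = d"
      by (rule LIMSEQ_unique[OF _ lim]) (intro tendsto_intros y)
    have "(x - y) \<bullet> v = 0" if v: "v \<in> S" for v
    proof (cases "v = 0")
      case False
      \<comment> \<open>The coefficient of the projection of \<open>x - y\<close> to the line
        spanned by \<open>v\<close>; if it were nonzero, moving \<open>y\<close> along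
        \<open>v\<close> would push the distance below \<open>d\<close>.\<close>
      define t where "t = (x - y) \<bullet> v / (v \<bullet> v)"
      have "d \<le> norm (x - (y + t *\<^sub>R v))"
      proof (rule LIMSEQ_le_const)
        show "(\<lambda>n. norm (x - (s n + t *\<^sub>R v))) \<longlonglongrightarrow> norm (x - (y + t *\<^sub>R v))"
          by (intro tendsto_intros y)
        show "\<exists>N. \<forall>n\<ge>N. d \<le> norm (x - (s n + t *\<^sub>R v))"
          using d(2) S s(1) v by (auto intro!: subspace_add subspace_scale)
      qed
      then have "d\<^sup>2 \<le> (norm (x - (y + t *\<^sub>R v)))\<^sup>2" using d(1) by (intro power_mono)
      then have "(x - y) \<bullet> (x - y) \<le> (x - y - t *\<^sub>R v) \<bullet> (x - y - t *\<^sub>R v)"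
        by (simp flip: dy add: power2_norm_eq_inner diff_diff_eq)
      also have "\<dots> = (x - y) \<bullet> (x - y) - ((x - y) \<bullet> v)\<^sup>2 / (v \<bullet> v)"
      proof -
        have "(w - t *\<^sub>R v) \<bullet> (w - t *\<^sub>R v) = w \<bullet> w - 2 * t * (w \<bullet> v) + t * (t * (v \<bullet> v))" for w
          by (simp add: inner_diff_left inner_diff_right inner_commute)
        from this[of "x - y"] show ?thesis
          using False by (simp add: t_def power2_eq_square field_simps)
      qed
      finally have "((x - y) \<bullet> v)\<^sup>2 / (v \<bullet> v) \<le> 0" by simp
      moreover have "v \<bullet> v > 0" using False by simp
      ultimately show ?thesis by (simp add: divide_le_0_iff)
    qed simp
    then have "x - y = 0" by (rule triv)
    then show ?thesis using yS by simp
  qed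
  then show ?thesis by blast
qed

lemma Bessel_inequality:
  fixes S :: "'a::real_inner set"
  assumes "finite S" and orth: "pairwise orthogonal S" and one: "\<And>u. u \<in> S \<Longrightarrow> norm u = 1"
  shows "(\<Sum>u\<in>S. (x \<bullet> u)\<^sup>2) \<le> (norm x)\<^sup>2"
proof -
  define y where "y = (\<Sum>u\<in>S. (x \<bullet> u) *\<^sub>R u)"
  have yu: "y \<bullet> u = x \<bullet> u" if "u \<in> S" for u
  proof -
    have "y \<bullet> u = (\<Sum>v\<in>S. if v = u then x \<bullet> u else 0)"
      unfolding y_def inner_sum_left
    proof (rule sum.cong[OF refl])
      fix v assume "v \<in> S"
      then show "(x \<bullet> v) *\<^sub>R v \<bullet> u = (if v = u then x \<bullet> u else 0)"
        using orth one[OF that] that by (auto simp: pairwise_def orthogonal_def norm_eq_1)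
    qed
    then show ?thesis using assms(1) that by simp
  qed
  have "y \<bullet> y = (\<Sum>u\<in>S. (x \<bullet> u)\<^sup>2)"
    by (subst (2) y_def) (simp add: inner_sum_right yu power2_eq_square)
  moreover have "x \<bullet> y = (\<Sum>u\<in>S. (x \<bullet> u)\<^sup>2)"
    by (subst y_def) (simp add: inner_sum_right power2_eq_square)
  moreover have "0 \<le> (x - y) \<bullet> (x - y)" by simp
  ultimately show ?thesis
    by (simp add: power2_norm_eq_inner inner_diff inner_commute)
qed

section \<open>Multiplication operators and translations\<close>

definition adj4 :: "complex^4^4 \<Rightarrow> complex^4^4" where
  "adj4 A = (\<chi> i j. cnj (A $ j $ i))"

lemma norm_matrix_vector_le:
  fixes A :: "complex^'n^'m" and x :: "complex^'n"
  shows "norm (A *v x) \<le> norm A * norm x"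
proof -
  have row: "norm ((A *v x) $ i) \<le> norm (A $ i) * norm x" for i
  proof -
    have "norm ((A *v x) $ i) \<le> (\<Sum>j\<in>UNIV. norm (A $ i $ j) * norm (x $ j))"
      unfolding matrix_vector_mult_def by (simp add: norm_sum order_trans[OF norm_sum] norm_mult)
    also have "\<dots> = (\<Sum>j\<in>UNIV. \<bar>norm (A $ i $ j)\<bar> * \<bar>norm (x $ j)\<bar>)" by simp
    also have "\<dots> \<le> L2_set (\<lambda>j. norm (A $ i $ j)) UNIV * L2_set (\<lambda>j. norm (x $ j)) UNIV"
      by (rule L2_set_mult_ineq)
    finally show ?thesis by (simp add: norm_vec_def)
  qed
  have "norm (A *v x) \<le> L2_set (\<lambda>i. norm (A $ i) * norm x) UNIV"
    unfolding norm_vec_def[of "A *v x"] by (rule L2_set_mono) (auto intro: row)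
  also have "\<dots> = norm A * norm x"
    by (simp add: norm_vec_def[of A] L2_set_left_distrib)
  finally show ?thesis .
qed

lemma inner_matrix_vector: "(A *v x) \<bullet> y = x \<bullet> (adj4 A *v y)" for x y :: "complex^4"
proof -
  have *: "(a * b) \<bullet> c = b \<bullet> (cnj a * c)" for a b c :: complex
    by (simp add: inner_complex_def algebra_simps)
  have "(A *v x) \<bullet> y = (\<Sum>i\<in>UNIV. \<Sum>j\<in>UNIV. x $ j \<bullet> (cnj (A $ i $ j) * y $ i))"
    by (simp add: inner_vec_def matrix_vector_mult_def inner_sum_left *)
  also have "\<dots> = (\<Sum>j\<in>UNIV. \<Sum>i\<in>UNIV. x $ j \<bullet> (cnj (A $ i $ j) * y $ i))"
    by (rule sum.swap)
  also have "\<dots> = x \<bullet> (adj4 A *v y)"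
    by (simp add: inner_vec_def matrix_vector_mult_def inner_sum_right adj4_def)
  finally show ?thesis .
qed

lemma matrix_vector_measurable [measurable (raw)]:
  fixes W :: "'a \<Rightarrow> complex^4^4"
  assumes "W \<in> borel_measurable M" "f \<in> borel_measurable M"
  shows "(\<lambda>x. W x *v f x) \<in> borel_measurable M"
proof -
  have "continuous_on UNIV (\<lambda>p::(complex^4^4) \<times> (complex^4). fst p *v snd p)"
    unfolding matrix_vector_mult_def by (intro continuous_intros)
  from borel_measurable_continuous_onI[OF this] have *:
    "(\<lambda>p::(complex^4^4) \<times> (complex^4). fst p *v snd p) \<in> borel_measurable borel" .
  have "(\<lambda>x. (W x, f x)) \<in> borel_measurable M"
    using assms by measurable
  from measurable_compose[OF this *] show ?thesis by simp
qed

definition bounded_field :: "(real^3 \<Rightarrow> complex^4^4) \<Rightarrow> bool" where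
  "bounded_field W \<longleftrightarrow> W \<in> borel_measurable lborel \<and> (\<exists>K. \<forall>x. norm (W x) \<le> K)"

lemma square_integrable_Mul:
  assumes "bounded_field W" "square_integrable f"
  shows "square_integrable (\<lambda>x. W x *v f x)"
proof -
  obtain K where K: "\<And>x. norm (W x) \<le> K" using assms(1) by (auto simp: bounded_field_def)
  show ?thesis
  proof (rule square_integrable_bound[OF assms(2)])
    show "AE x in lborel. norm (W x *v f x) \<le> K * norm (f x)"
      by (intro AE_I2 order_trans[OF norm_matrix_vector_le] mult_right_mono K) auto
    show "(\<lambda>x. W x *v f x) \<in> borel_measurable lborel"
      using assms by (intro matrix_vector_measurable) (auto simp: bounded_field_def square_integrable_def)
  qed
qed

text \<open>The value 0 for unbounded fields makes \<open>Mul W\<close> a bounded linear operator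
  for every \<open>W\<close>, so that the linearity rules carry no side condition.\<close>

lift_definition Mul :: "(real^3 \<Rightarrow> complex^4^4) \<Rightarrow> l2 \<Rightarrow> l2" is
  "\<lambda>W f. if bounded_field W then (\<lambda>x. W x *v f x) else (\<lambda>x. 0)"
  by (auto intro: square_integrable_Mul elim: eventually_mono)

lemma Mul_cls: "bounded_field W \<Longrightarrow> square_integrable f \<Longrightarrow> Mul W (cls f) = cls (\<lambda>x. W x *v f x)"
  unfolding cls_def by (subst Mul.abs_eq) auto

lemma fn_Mul: "bounded_field W \<Longrightarrow> AE x in lborel. fn (Mul W u) x = W x *v fn u x"
  using Mul_cls[of W "fn u"] fn_cls[OF square_integrable_Mul, of W "fn u"] by simp

lemma Mul_add: "Mul W (u + v) = Mul W u + Mul W v"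
  by transfer (simp add: matrix_vector_right_distrib square_integrable_Mul square_integrable_add)

lemma Mul_diff: "Mul W (u - v) = Mul W u - Mul W v"
  by transfer (simp add: matrix_vector_mult_diff_distrib square_integrable_Mul square_integrable_diff)

lemma matrix_vector_scaleR: "A *v (c *\<^sub>R x) = c *\<^sub>R (A *v x)" for A :: "complex^4^4"
  by (simp add: matrix_vector_mult_def vec_eq_iff scaleR_sum_right)

lemma Mul_scaleR: "Mul W (c *\<^sub>R u) = c *\<^sub>R Mul W u"
  by transfer (simp add: matrix_vector_scaleR square_integrable_Mul square_integrable_scaleR)

text \<open>The bound is asked of the action of \<open>W x\<close> and not of the norm of the
  matrix: the norm of \<open>mat 1\<close> in \<open>complex^4^4\<close> is 2, and scalar
  multipliers would lose that factor.\<close>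

lemma norm_Mul_le:
  assumes "bounded_field W" "K \<ge> 0" "\<And>x v. norm (W x *v v) \<le> K * norm v"
  shows "norm (Mul W u) \<le> K * norm u"
  using fn_Mul[OF assms(1), of u] assms(2,3) by (intro norm_le_AE) (auto elim: eventually_mono)

lemma bounded_linear_Mul: "bounded_linear (Mul W)"
proof (cases "bounded_field W")
  case True
  then obtain K where K: "\<And>x. norm (W x) \<le> K" by (auto simp: bounded_field_def)
  have "norm (Mul W u) \<le> norm u * K" for u
  proof -
    have "norm (Mul W u) \<le> K * norm u"
      by (intro norm_Mul_le[OF True] order_trans[OF norm_matrix_vector_le] mult_right_mono K
          order_trans[OF norm_ge_zero K]) auto
    then show ?thesis by (simp add: mult.commute)
  qed
  then show ?thesis
    by (intro bounded_linear_intro[of _ K]) (auto simp: Mul_add Mul_scaleR)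
next
  case False
  then have "Mul W u = 0" for u by transfer simp
  then have "Mul W = (\<lambda>u. 0)" by blast
  then show ?thesis by (simp add: bounded_linear_zero)
qed

lemma Mul_zero [simp]: "Mul W 0 = 0"
  by (rule linear_0[OF bounded_linear.linear[OF bounded_linear_Mul]])

lemma Mul_uminus: "Mul W (- u) = - Mul W u"
  by (rule linear_neg[OF bounded_linear.linear[OF bounded_linear_Mul]])

lemma Mul_sum: "Mul W (\<Sum>i\<in>I. u i) = (\<Sum>i\<in>I. Mul W (u i))"
  by (rule linear_sum[OF bounded_linear.linear[OF bounded_linear_Mul]])

lemma bounded_field_const [simp]: "bounded_field (\<lambda>x. A)"
  by (auto simp: bounded_field_def)

lemma Mul_Mul:
  assumes "bounded_field W" "bounded_field W'" "bounded_field W''" "\<And>x. W x ** W' x = W'' x"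
  shows "Mul W (Mul W' u) = Mul W'' u"
proof -
  obtain f where f: "square_integrable f" "u = cls f" by (rule l2_cases)
  show ?thesis unfolding f(2)
    using assms f(1) by (simp add: Mul_cls square_integrable_Mul matrix_vector_mul_assoc)
qed

lemma inner_Mul:
  assumes "bounded_field W" "bounded_field W'" "\<And>x. adj4 (W x) = W' x"
  shows "Mul W u \<bullet> v = u \<bullet> Mul W' v"
proof -
  obtain f where f: "square_integrable f" "u = cls f" by (rule l2_cases)
  obtain g where g: "square_integrable g" "v = cls g" by (rule l2_cases)
  show ?thesis unfolding f(2) g(2)
    using assms f(1) g(1) by (simp add: Mul_cls square_integrable_Mul inner_cls inner_matrix_vector)
qed

text \<open>The type \<open>l2\<close> carries the real part of the Hermitian inner product; complex scalars act through the
  operators \<open>cs z\<close>, and imaginary parts are recovered as \<open>cs \<i> u \<bullet> v\<close>.\<close>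

definition cm :: "complex^4^4 \<Rightarrow> l2 \<Rightarrow> l2" where "cm A = Mul (\<lambda>x. A)"
definition cs :: "complex \<Rightarrow> l2 \<Rightarrow> l2" where "cs z = cm (mat z)"

lemma mat_vector: "mat z *v x = z *s x" for x :: "complex^4"
  by (simp add: matrix_vector_mult_def mat_def vec_eq_iff if_distrib if_distribR cong: if_cong)

lemma mat_mult_left: "mat z ** A = (\<chi> i j. z * A $ i $ j)" for A :: "complex^4^4"
  by (simp add: matrix_matrix_mult_def mat_def vec_eq_iff if_distrib if_distribR cong: if_cong)

lemma mat_mult_right: "A ** mat z = (\<chi> i j. z * A $ i $ j)" for A :: "complex^4^4"
  by (simp add: matrix_matrix_mult_def mat_def vec_eq_iff if_distrib if_distribR mult.commute cong: if_cong)

lemma mat_commute: "mat z ** A = A ** mat z" for A :: "complex^4^4"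
  by (simp add: mat_mult_left mat_mult_right)

lemma mat_mult: "mat z ** mat w = (mat (z * w) :: complex^4^4)"
  unfolding mat_mult_left by (simp add: mat_def vec_eq_iff)

lemma adj4_mat: "adj4 (mat z) = mat (cnj z)"
  by (auto simp: adj4_def mat_def vec_eq_iff)

lemma cm_cm: "cm A (cm B u) = cm (A ** B) u"
  unfolding cm_def by (rule Mul_Mul) auto

lemma cm_add: "cm A (u + v) = cm A u + cm A v" by (simp add: cm_def Mul_add)
lemma cm_diff: "cm A (u - v) = cm A u - cm A v" by (simp add: cm_def Mul_diff)
lemma cm_scaleR: "cm A (c *\<^sub>R u) = c *\<^sub>R cm A u" by (simp add: cm_def Mul_scaleR)
lemma cm_zero [simp]: "cm A 0 = 0" by (simp add: cm_def)
lemma cm_uminus: "cm A (- u) = - cm A u" by (simp add: cm_def Mul_uminus)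
lemma cm_sum: "cm A (\<Sum>i\<in>I. u i) = (\<Sum>i\<in>I. cm A (u i))" by (simp add: cm_def Mul_sum)
lemma bounded_linear_cm: "bounded_linear (cm A)" by (simp add: cm_def bounded_linear_Mul)

lemma inner_cm: "cm A u \<bullet> v = u \<bullet> cm (adj4 A) v"
  unfolding cm_def by (rule inner_Mul) auto

lemma cm_matrix_add: "cm (A + B) u = cm A u + cm B u"
proof -
  obtain f where f: "square_integrable f" "u = cls f" by (rule l2_cases)
  show ?thesis unfolding f(2) cm_def
    using f(1) by (simp add: Mul_cls cls_add square_integrable_Mul matrix_vector_mult_add_rdistrib)
qed

lemma Mul_cm_commute:
  assumes "bounded_field W" "\<And>x. W x ** A = A ** W x"
  shows "Mul W (cm A u) = cm A (Mul W u)"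
proof -
  obtain f where f: "square_integrable f" "u = cls f" by (rule l2_cases)
  show ?thesis unfolding f(2) cm_def
    using assms f(1) by (simp add: Mul_cls square_integrable_Mul matrix_vector_mul_assoc)
qed

lemma fn_cs: "AE x in lborel. fn (cs z u) x = z *s fn u x"
  using fn_Mul[of "\<lambda>x. mat z" u] by (simp add: cs_def cm_def mat_vector)

lemma cs_cls: "square_integrable f \<Longrightarrow> cs z (cls f) = cls (\<lambda>x. z *s f x)"
  by (simp add: cs_def cm_def Mul_cls mat_vector)

lemma cs_cs: "cs z (cs w u) = cs (z * w) u" by (simp add: cs_def cm_cm mat_mult)
lemma cs_add: "cs z (u + v) = cs z u + cs z v" by (simp add: cs_def cm_add)
lemma cs_diff: "cs z (u - v) = cs z u - cs z v" by (simp add: cs_def cm_diff)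
lemma cs_scaleR: "cs z (c *\<^sub>R u) = c *\<^sub>R cs z u" by (simp add: cs_def cm_scaleR)
lemma cs_zero [simp]: "cs z 0 = 0" by (simp add: cs_def)
lemma cs_sum: "cs z (\<Sum>i\<in>I. u i) = (\<Sum>i\<in>I. cs z (u i))" by (simp add: cs_def cm_sum)
lemma bounded_linear_cs: "bounded_linear (cs z)" by (simp add: cs_def bounded_linear_cm)
lemma cs_cm: "cs z (cm A u) = cm A (cs z u)" by (simp add: cs_def cm_cm mat_commute)
lemma inner_cs: "cs z u \<bullet> v = u \<bullet> cs (cnj z) v" by (simp add: cs_def inner_cm adj4_mat)

lemma cs_add_left: "cs (z + w) u = cs z u + cs w u"
proof -
  have "mat (z + w) = (mat z + mat w :: complex^4^4)" by (simp add: mat_def vec_eq_iff)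
  then show ?thesis by (simp add: cs_def cm_matrix_add)
qed

lemma cs_of_real: "cs (complex_of_real c) u = c *\<^sub>R u"
proof -
  obtain f where f: "square_integrable f" "u = cls f" by (rule l2_cases)
  have "complex_of_real c *s x = c *\<^sub>R x" for x :: "complex^4" by (simp add: vec_eq_iff) (simp add: scaleR_conv_of_real)
  then show ?thesis unfolding f(2)
    using f(1) by (simp add: cs_cls cls_scaleR)
qed

lemma cs_one [simp]: "cs 1 u = u"
  using cs_of_real[of 1 u] by simp

lemma cs_eq: "cs z u = Re z *\<^sub>R u + Im z *\<^sub>R cs \<i> u"
proof -
  have "cs z u = cs (of_real (Re z)) u + cs (of_real (Im z) * \<i>) u"
    by (subst complex_eq[of z]) (simp add: cs_add_left mult.commute)
  then show ?thesis by (simp add: cs_of_real flip: cs_cs)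
qed

lemma norm_cs: "norm (cs z u) = norm z * norm u"
proof -
  have "(norm (cs z u))\<^sup>2 = (norm z)\<^sup>2 * (norm u)\<^sup>2"
    unfolding power2_norm_eq_inner[of "cs z u"]
    by (subst inner_cs) (simp add: cs_cs mult.commute complex_norm_square[symmetric] cs_of_real power2_norm_eq_inner flip: of_real_power)
  then show ?thesis by (simp flip: power_mult_distrib)
qed

lemma inner_cs_i_self [simp]: "cs \<i> u \<bullet> u = 0"
proof -
  have "cs \<i> u \<bullet> u = u \<bullet> cs (- \<i>) u" by (simp add: inner_cs)
  also have "\<dots> = - (u \<bullet> cs \<i> u)"
    by (subst (1 2) cs_eq) simp
  finally show ?thesis by (simp add: inner_commute)
qed

section \<open>Translations as isometries of \<open>l2\<close>\<close>

lemma AE_lborel_translate: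
  fixes h :: "real^3"
  assumes "AE x in lborel. P x"
  shows "AE x in lborel. P (x + h)"
proof -
  from assms obtain N where N: "{x \<in> space lborel. \<not> P x} \<subseteq> N" "emeasure lborel N = 0" "N \<in> sets lborel"
    by (auto elim: AE_E)
  have "AE x in distr lborel borel ((+) h). x \<notin> N"
    using N by (subst lborel_distr_plus) (auto intro: AE_not_in simp: null_sets_def)
  then have "AE x in lborel. h + x \<notin> N"
    using N(3) by (subst (asm) AE_distr_iff) auto
  then show ?thesis using N(1) by (auto elim!: eventually_mono simp: add.commute)
qed

lemma lborel_integral_translate:
  fixes f :: "real^3 \<Rightarrow> 'b::{banach, second_countable_topology}"
  assumes [measurable]: "f \<in> borel_measurable borel"
  shows "(\<integral>x. f (x + h) \<partial>lborel) = (\<integral>x. f x \<partial>lborel)"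
proof -
  have "(\<integral>x. f x \<partial>lborel) = (\<integral>x. f x \<partial>distr lborel borel ((+) h))" by (simp only: lborel_distr_plus)
  also have "\<dots> = (\<integral>x. f (h + x) \<partial>lborel)" by (rule integral_distr) auto
  finally show ?thesis by (simp add: add.commute)
qed

lemma lborel_integrable_translate:
  fixes f :: "real^3 \<Rightarrow> 'b::{banach, second_countable_topology}"
  assumes [measurable]: "f \<in> borel_measurable borel"
  shows "integrable lborel (\<lambda>x. f (x + h)) \<longleftrightarrow> integrable lborel f"
proof -
  have "integrable lborel f \<longleftrightarrow> integrable (distr lborel borel ((+) h)) f" by (simp only: lborel_distr_plus)
  also have "\<dots> \<longleftrightarrow> integrable lborel (\<lambda>x. f (h + x))" by (rule integrable_distr_eq) auto
  finally show ?thesis by (simp add: add.commute)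
qed

lemma square_integrable_translate:
  "square_integrable f \<Longrightarrow> square_integrable (\<lambda>x. f (x + h))"
  using lborel_integrable_translate[of "\<lambda>x. (norm (f x))\<^sup>2" h]
  by (auto simp: square_integrable_def)

lift_definition tr :: "real^3 \<Rightarrow> l2 \<Rightarrow> l2" is "\<lambda>h f x. f (x + h)"
  by (auto intro: square_integrable_translate intro!: AE_lborel_translate[where P = "\<lambda>x. _ x = _ x"])

lemma tr_cls: "square_integrable f \<Longrightarrow> tr h (cls f) = cls (\<lambda>x. f (x + h))"
  unfolding cls_def by (subst tr.abs_eq) auto

lemma fn_tr: "AE x in lborel. fn (tr h u) x = fn u (x + h)"
  using tr_cls[of "fn u"] fn_cls[OF square_integrable_translate, of "fn u"] by simp

lemma tr_add: "tr h (u + v) = tr h u + tr h v"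
  by transfer (simp add: square_integrable_add square_integrable_translate)

lemma tr_diff: "tr h (u - v) = tr h u - tr h v"
  by transfer (simp add: square_integrable_diff square_integrable_translate)

lemma tr_scaleR: "tr h (c *\<^sub>R u) = c *\<^sub>R tr h u"
  by transfer (simp add: square_integrable_scaleR square_integrable_translate)

lemma tr_tr: "tr h (tr k u) = tr (h + k) u"
  by transfer (simp add: square_integrable_translate add.assoc)

lemma tr_0 [simp]: "tr 0 u = u"
  by transfer simp

lemma inner_tr: "tr h u \<bullet> tr h v = u \<bullet> v"
proof -
  obtain f where f: "square_integrable f" "u = cls f" by (rule l2_cases)
  obtain g where g: "square_integrable g" "v = cls g" by (rule l2_cases)
  have [measurable]: "f \<in> borel_measurable borel" "g \<in> borel_measurable borel"
    using f(1) g(1) by (auto simp: square_integrable_def)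
  show ?thesis unfolding f(2) g(2)
    using f(1) g(1) lborel_integral_translate[of "\<lambda>x. f x \<bullet> g x" h]
    by (simp add: tr_cls square_integrable_translate inner_cls)
qed

lemma inner_tr_left: "tr h u \<bullet> v = u \<bullet> tr (- h) v"
  using inner_tr[of h u "tr (- h) v"] by (simp add: tr_tr)

lemma norm_tr [simp]: "norm (tr h u) = norm u"
  by (simp add: norm_eq_sqrt_inner inner_tr)

lemma bounded_linear_tr: "bounded_linear (tr h)"
  by (rule bounded_linear_intro[of _ 1]) (auto simp: tr_add tr_scaleR)

lemma tr_zero [simp]: "tr h 0 = 0"
  by (rule linear_0[OF bounded_linear.linear[OF bounded_linear_tr]])

lemma bounded_field_translate: "bounded_field W \<Longrightarrow> bounded_field (\<lambda>x. W (x + h))"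
  by (auto simp: bounded_field_def)

lemma tr_Mul: "bounded_field W \<Longrightarrow> tr h (Mul W u) = Mul (\<lambda>x. W (x + h)) (tr h u)"
proof -
  assume W: "bounded_field W"
  obtain f where f: "square_integrable f" "u = cls f" by (rule l2_cases)
  show ?thesis unfolding f(2)
    using W f(1) by (simp add: tr_cls Mul_cls square_integrable_Mul square_integrable_translate bounded_field_translate)
qed

lemma tr_cm: "tr h (cm A u) = cm A (tr h u)"
  by (simp add: cm_def tr_Mul)

lemma tr_cs: "tr h (cs z u) = cs z (tr h u)"
  by (simp add: cs_def tr_cm)

section \<open>The anticommutation relations of the Dirac matrices\<close>

lemma vector_4:
  "(vector [a, b, c, d] :: 'a::zero^4) $ 1 = a"
  "(vector [a, b, c, d] :: 'a::zero^4) $ 2 = b"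
  "(vector [a, b, c, d] :: 'a::zero^4) $ 3 = c"
  "(vector [a, b, c, d] :: 'a::zero^4) $ 4 = d"
  by (simp_all add: vector_def)

lemma adj4_alpha [simp]: "adj4 (alpha j) = alpha j"
  by (auto simp: adj4_def alpha_def alpha1_def alpha2_def alpha3_def vec_eq_iff forall_4 vector_4)

lemma adj4_beta [simp]: "adj4 beta = beta"
  by (auto simp: adj4_def beta_def vec_eq_iff forall_4 vector_4)

lemma alpha_beta_anticommute: "alpha j ** beta + beta ** alpha j = 0"
  by (auto simp: alpha_def alpha1_def alpha2_def alpha3_def beta_def matrix_matrix_mult_def
      vec_eq_iff forall_4 sum_4 vector_4)

lemma alpha_sq: "alpha j ** alpha j = mat 1"
  by (auto simp: alpha_def alpha1_def alpha2_def alpha3_def matrix_matrix_mult_def mat_def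
      vec_eq_iff forall_4 sum_4 vector_4)

lemma beta_sq: "beta ** beta = mat 1"
  by (auto simp: beta_def matrix_matrix_mult_def mat_def vec_eq_iff forall_4 sum_4 vector_4)

lemma alpha_anticommute: "j \<noteq> k \<Longrightarrow> alpha j ** alpha k + alpha k ** alpha j = 0"
  by (auto simp: alpha_def alpha1_def alpha2_def alpha3_def matrix_matrix_mult_def
      vec_eq_iff forall_4 sum_4 vector_4 split: if_splits)
   (metis (full_types) exhaust_3)+

section \<open>Test functions\<close>

text \<open>The powers of \<open>inverse t\<close> are carried along because differentiation
  produces them: by \<open>flat_deriv\<close> derivatives stay in the span of the family, whose
  member \<open>flat 0\<close> is the usual exp (-1/t).\<close>

definition flat :: "nat \<Rightarrow> real \<Rightarrow> real" where
  "flat n t = (if t > 0 then exp (- inverse t) * inverse t ^ n else 0)"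

lemma flat_tendsto_0: "(flat n \<longlongrightarrow> 0) (at 0)"
proof (rule filterlim_split_at)
  have "eventually (\<lambda>t. 0 = flat n t) (at_left 0)"
    by (auto simp: eventually_at_left_field flat_def intro: exI[of _ "-1"])
  then show "(flat n \<longlongrightarrow> 0) (at_left 0)"
    by (rule Lim_transform_eventually[OF tendsto_const])
  have "((\<lambda>t. inverse t ^ n / exp (inverse t)) \<longlongrightarrow> 0) (at_right (0::real))"
    by (rule filterlim_compose[OF tendsto_power_div_exp_0 filterlim_inverse_at_top_right])
  moreover have "eventually (\<lambda>t. inverse t ^ n / exp (inverse t) = flat n t) (at_right 0)"
    by (auto simp: eventually_at_right_field flat_def exp_minus field_simps intro: exI[of _ 1])
  ultimately show "(flat n \<longlongrightarrow> 0) (at_right 0)"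
    by (rule Lim_transform_eventually)
qed

lemma flat_deriv: "(flat n has_real_derivative (flat (n + 2) t - real n * flat (n + 1) t)) (at t)"
proof -
  consider "t > 0" | "t < 0" | "t = 0" by linarith
  then show ?thesis
  proof cases
    case 1
    have "((\<lambda>t. exp (- inverse t) * inverse t ^ n) has_real_derivative
        (flat (n + 2) t - real n * flat (n + 1) t)) (at t)"
    proof -
      have i: "(inverse has_real_derivative - (inverse t)\<^sup>2) (at t)"
        using DERIV_inverse[of t UNIV] 1 by (simp add: power2_eq_square)
      have "((\<lambda>t. exp (- inverse t) * inverse t ^ n) has_real_derivative
          (exp (- inverse t) * - (- (inverse t)\<^sup>2)) * inverse t ^ n
          + (real n * (- (inverse t)\<^sup>2 * inverse t ^ (n - Suc 0))) * exp (- inverse t)) (at t)"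
        by (intro DERIV_mult DERIV_power i DERIV_fun_exp DERIV_minus)
      moreover have "(exp (- inverse t) * - (- (inverse t)\<^sup>2)) * inverse t ^ n
          + (real n * (- (inverse t)\<^sup>2 * inverse t ^ (n - Suc 0))) * exp (- inverse t)
          = flat (n + 2) t - real n * flat (n + 1) t"
        using 1 by (cases n) (simp_all add: flat_def power2_eq_square)
      ultimately show ?thesis by simp
    qed
    then show ?thesis
      by (rule has_field_derivative_transform_within_open[of _ _ _ "{0<..}"]) (use 1 in \<open>auto simp: flat_def\<close>)
  next
    case 2
    have "((\<lambda>t. 0) has_real_derivative (flat (n + 2) t - real n * flat (n + 1) t)) (at t)"
      using 2 by (simp add: flat_def)
    then show ?thesis
      by (rule has_field_derivative_transform_within_open[of _ _ _ "{..<0}"]) (use 2 in \<open>auto simp: flat_def\<close>)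
  next
    case 3
    \<comment> \<open>The difference quotient at 0 is \<open>flat (Suc n)\<close> itself.\<close>
    have "((\<lambda>t. (flat n t - flat n 0) / (t - 0)) \<longlongrightarrow> 0) (at 0)"
      by (rule Lim_transform_eventually[OF flat_tendsto_0[of "Suc n"]])
        (auto simp: eventually_at flat_def divide_inverse mult_ac intro: exI[of _ 1])
    then show ?thesis
      using 3 by (simp add: has_field_derivative_iff flat_def)
  qed
qed

lemma flat_nonneg: "flat n t \<ge> 0"
  by (simp add: flat_def)

lemma flat_0_le_1: "flat 0 t \<le> 1"
  by (simp add: flat_def)

text \<open>\<open>smooth3\<close> is coinductive, so smoothness is proved by exhibiting a class of
  functions closed under partial derivatives. This algebra is such a class and contains the box
  bumps.\<close>

inductive flat_algebra :: "(real^3 \<Rightarrow> complex) \<Rightarrow> bool" where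
  base: "flat_algebra (\<lambda>x. complex_of_real (flat n (a * x $ k + b)))"
| const: "flat_algebra (\<lambda>x. c)"
| add: "flat_algebra f \<Longrightarrow> flat_algebra g \<Longrightarrow> flat_algebra (\<lambda>x. f x + g x)"
| mult: "flat_algebra f \<Longrightarrow> flat_algebra g \<Longrightarrow> flat_algebra (\<lambda>x. f x * g x)"

lemma flat_algebra_derivative:
  assumes "flat_algebra f"
  shows "\<exists>D. (\<forall>j. flat_algebra (D j)) \<and>
    (\<forall>x. (f has_derivative (\<lambda>h. \<Sum>j\<in>UNIV. D j x * complex_of_real (h $ j))) (at x))"
  using assms
proof induction
  case (base n a k b)
  define D where "D j = (\<lambda>x::real^3. (if j = k then complex_of_real a else 0) *
     (complex_of_real (flat (n + 2) (a * x $ k + b)) + (- complex_of_real (real n)) * complex_of_real (flat (n + 1) (a * x $ k + b))))" for j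
  have "flat_algebra (D j)" for j
    unfolding D_def by (intro flat_algebra.intros)
  moreover have "((\<lambda>x. complex_of_real (flat n (a * x $ k + b))) has_derivative
      (\<lambda>h. \<Sum>j\<in>UNIV. D j x * complex_of_real (h $ j))) (at x)" for x :: "real^3"
  proof -
    have "((\<lambda>x::real^3. a * x $ k + b) has_derivative (\<lambda>h. a * h $ k)) (at x)"
      by (auto intro!: derivative_eq_intros bounded_linear.has_derivative[OF bounded_linear_vec_nth])
    from has_derivative_compose[OF this, of "flat n"] flat_deriv[of n "a * x $ k + b"]
    have "((\<lambda>x::real^3. flat n (a * x $ k + b)) has_derivative
        (\<lambda>h. (flat (n + 2) (a * x $ k + b) - real n * flat (n + 1) (a * x $ k + b)) * (a * h $ k))) (at x)"
      by (simp add: has_field_derivative_def)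
    from bounded_linear.has_derivative[OF bounded_linear_of_real this]
    have "((\<lambda>x::real^3. complex_of_real (flat n (a * x $ k + b))) has_derivative
        (\<lambda>h. complex_of_real ((flat (n + 2) (a * x $ k + b) - real n * flat (n + 1) (a * x $ k + b)) * (a * h $ k)))) (at x)" .
    moreover have "complex_of_real ((flat (n + 2) (a * x $ k + b) - real n * flat (n + 1) (a * x $ k + b)) * (a * h $ k))
        = (\<Sum>j\<in>UNIV. D j x * complex_of_real (h $ j))" for h
    proof -
      have "(\<Sum>j\<in>UNIV. D j x * complex_of_real (h $ j)) = (\<Sum>j\<in>UNIV. if j = k then D k x * complex_of_real (h $ k) else 0)"
        by (rule sum.cong) (auto simp: D_def)
      then show ?thesis by (simp add: D_def algebra_simps)
    qed
    ultimately show ?thesis by simp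
  qed
  ultimately show ?case by blast
next
  case (const c)
  show ?case
    by (rule exI[of _ "\<lambda>j x. 0"]) (auto intro: flat_algebra.intros)
next
  case (add f g)
  then obtain D D' where D: "\<forall>j. flat_algebra (D j)"
      "\<forall>x. (f has_derivative (\<lambda>h. \<Sum>j\<in>UNIV. D j x * complex_of_real (h $ j))) (at x)"
    and D': "\<forall>j. flat_algebra (D' j)"
      "\<forall>x. (g has_derivative (\<lambda>h. \<Sum>j\<in>UNIV. D' j x * complex_of_real (h $ j))) (at x)"
    by blast
  have "((\<lambda>x. f x + g x) has_derivative (\<lambda>h. \<Sum>j\<in>UNIV. (D j x + D' j x) * complex_of_real (h $ j))) (at x)" for x
    using has_derivative_add[OF D(2)[rule_format, of x] D'(2)[rule_format, of x]]
    by (simp add: sum.distrib distrib_right)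
  then show ?case using D(1) D'(1)
    by (intro exI[of _ "\<lambda>j x. D j x + D' j x"]) (auto intro: flat_algebra.intros)
next
  case (mult f g)
  then obtain D D' where D: "\<forall>j. flat_algebra (D j)"
      "\<forall>x. (f has_derivative (\<lambda>h. \<Sum>j\<in>UNIV. D j x * complex_of_real (h $ j))) (at x)"
    and D': "\<forall>j. flat_algebra (D' j)"
      "\<forall>x. (g has_derivative (\<lambda>h. \<Sum>j\<in>UNIV. D' j x * complex_of_real (h $ j))) (at x)"
    by blast
  have "((\<lambda>x. f x * g x) has_derivative (\<lambda>h. \<Sum>j\<in>UNIV. (f x * D' j x + D j x * g x) * complex_of_real (h $ j))) (at x)" for x
  proof -
    have "(\<lambda>h. \<Sum>j\<in>UNIV. (f x * D' j x + D j x * g x) * complex_of_real (h $ j))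
        = (\<lambda>h. f x * (\<Sum>j\<in>UNIV. D' j x * complex_of_real (h $ j)) + (\<Sum>j\<in>UNIV. D j x * complex_of_real (h $ j)) * g x)"
      unfolding sum_distrib_left sum_distrib_right sum.distrib[symmetric]
      by (intro ext sum.cong refl) (simp add: algebra_simps)
    then show ?thesis
      using has_derivative_mult[OF D(2)[rule_format, of x] D'(2)[rule_format, of x]] by simp
  qed
  then show ?case using D(1) D'(1) mult.hyps
    by (intro exI[of _ "\<lambda>j x. f x * D' j x + D j x * g x"] conjI allI flat_algebra.add flat_algebra.mult) auto
qed

lemma flat_algebra_smooth: "flat_algebra f \<Longrightarrow> smooth3 f"
proof (coinduction arbitrary: f)
  case smooth3
  from flat_algebra_derivative[OF this] obtain D where D: "\<And>j. flat_algebra (D j)"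
    "\<And>x. (f has_derivative (\<lambda>h. \<Sum>j\<in>UNIV. D j x * complex_of_real (h $ j))) (at x)"
    by blast
  have "pderiv3 f j = D j" for j
  proof
    fix x
    have "pderiv3 f j x = (\<Sum>i\<in>UNIV. D i x * complex_of_real (axis j 1 $ i))"
      unfolding pderiv3_def frechet_derivative_at[OF D(2), symmetric] ..
    also have "\<dots> = (\<Sum>i\<in>UNIV. if i = j then D j x else 0)"
      by (rule sum.cong) (auto simp: axis_def)
    finally show "pderiv3 f j x = D j x" by simp
  qed
  then show ?case using D by (auto simp: differentiable_def)
qed

lemma smooth3_differentiable: "smooth3 f \<Longrightarrow> f differentiable at x"
  by (erule smooth3.cases) simp

lemma smooth3_pderiv3: "smooth3 f \<Longrightarrow> smooth3 (pderiv3 f j)"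
  by (erule smooth3.cases) simp

text \<open>Since \<open>exp (-1 / (n t))\<close> tends to the indicator of \<open>t > 0\<close>, no normalised mollifier is needed to
  approximate the indicators of boxes.\<close>

definition box_bump :: "nat \<Rightarrow> real^3 \<Rightarrow> real^3 \<Rightarrow> real^3 \<Rightarrow> real" where
  "box_bump n a b x = (\<Prod>k\<in>UNIV. flat 0 (real (Suc n) * (x $ k - a $ k)) * flat 0 (real (Suc n) * (b $ k - x $ k)))"

lemma box_bump_range: "0 \<le> box_bump n a b x" "box_bump n a b x \<le> 1"
  unfolding box_bump_def
  by (auto intro!: prod_nonneg prod_le_1 mult_le_one simp: flat_nonneg flat_0_le_1)

lemma box_bump_outside: "x \<notin> box a b \<Longrightarrow> box_bump n a b x = 0"
proof -
  assume "x \<notin> box a b"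
  then obtain k where "x $ k \<le> a $ k \<or> b $ k \<le> x $ k" by (auto simp: mem_box_cart not_less)
  then have "flat 0 (real (Suc n) * (x $ k - a $ k)) * flat 0 (real (Suc n) * (b $ k - x $ k)) = 0"
    by (auto simp: flat_def zero_less_mult_iff)
  then show ?thesis unfolding box_bump_def by (intro prod_zero) auto
qed

lemma box_bump_tendsto: "(\<lambda>n. box_bump n a b x) \<longlonglongrightarrow> indicator (box a b) x"
proof (cases "x \<in> box a b")
  case True
  have flat_lim: "(\<lambda>n. flat 0 (real (Suc n) * t)) \<longlonglongrightarrow> 1" if "t > 0" for t
  proof -
    have "(\<lambda>n. exp (- (inverse (real (Suc n)) * inverse t))) \<longlonglongrightarrow> exp (- (0 * inverse t))"
      by (intro tendsto_intros LIMSEQ_inverse_real_of_nat)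
    then show ?thesis using that by (simp add: flat_def zero_less_mult_iff)
  qed
  have "(\<lambda>n. box_bump n a b x) \<longlonglongrightarrow> (\<Prod>k\<in>(UNIV::3 set). 1 * 1)"
    unfolding box_bump_def using True by (intro tendsto_prod tendsto_mult flat_lim) (auto simp: mem_box_cart)
  then show ?thesis using True by simp
qed (simp add: box_bump_outside)

lemma flat_algebra_prod:
  "finite A \<Longrightarrow> (\<And>k. k \<in> A \<Longrightarrow> flat_algebra (F k)) \<Longrightarrow> flat_algebra (\<lambda>x. \<Prod>k\<in>A. F k x)"
  by (induction A rule: finite_induct) (auto intro: flat_algebra.intros)

lemma test_fun_box_bump: "test_fun (\<lambda>x. complex_of_real (box_bump n a b x))"
proof -
  have "flat_algebra (\<lambda>x. complex_of_real (flat 0 (real (Suc n) * x $ k + (- real (Suc n) * a $ k))))"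
    "flat_algebra (\<lambda>x. complex_of_real (flat 0 ((- real (Suc n)) * x $ k + real (Suc n) * b $ k)))" for k
    by (rule flat_algebra.base)+
  then have "flat_algebra (\<lambda>x. complex_of_real (flat 0 (real (Suc n) * (x $ k - a $ k))))"
    "flat_algebra (\<lambda>x. complex_of_real (flat 0 (real (Suc n) * (b $ k - x $ k))))" for k
    by (simp_all add: algebra_simps)
  then have "flat_algebra (\<lambda>x. complex_of_real (box_bump n a b x))"
    unfolding box_bump_def of_real_prod of_real_mult
    by (intro flat_algebra_prod flat_algebra.mult) auto
  moreover have "bounded {x. complex_of_real (box_bump n a b x) \<noteq> 0}"
    by (rule bounded_subset[OF bounded_box[of a b]]) (auto intro: ccontr simp: box_bump_outside)
  ultimately show ?thesis
    by (simp add: test_fun_def flat_algebra_smooth compact_closure)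
qed

text \<open>Needed for \<open>c = \<i>\<close>: the inner product of \<open>l2\<close> sees real
  parts only, and testing with both \<phi> and i\<phi> recovers the complex identity.\<close>

lemma test_fun_scale: "test_fun \<phi> \<Longrightarrow> test_fun (\<lambda>x. c * \<phi> x)"
proof -
  assume "test_fun \<phi>"
  then have s: "smooth3 \<phi>" and b: "bounded {x. \<phi> x \<noteq> 0}"
    by (auto simp: test_fun_def compact_closure)
  have "smooth3 (\<lambda>x. c * \<phi> x)" using s
  proof (coinduction arbitrary: \<phi>)
    case smooth3
    then have d: "\<phi> differentiable at x" "smooth3 (pderiv3 \<phi> j)" for x j
      by (auto intro: smooth3_differentiable smooth3_pderiv3)
    have "((\<lambda>x. c * \<phi> x) has_derivative (\<lambda>h. c * frechet_derivative \<phi> (at x) h)) (at x)" for x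
      using d(1)[of x] by (intro has_derivative_mult_right) (simp add: frechet_derivative_works)
    note D = this
    have "(\<lambda>x. c * \<phi> x) differentiable at x" "pderiv3 (\<lambda>x. c * \<phi> x) j = (\<lambda>x. c * pderiv3 \<phi> j x)" for x j
      using D by (auto simp: differentiable_def pderiv3_def fun_eq_iff frechet_derivative_at[OF D, symmetric])
    then show ?case using d(2) by auto
  qed
  moreover have "bounded {x. c * \<phi> x \<noteq> 0}"
    by (rule bounded_subset[OF b]) auto
  ultimately show ?thesis by (simp add: test_fun_def compact_closure)
qed

lemma test_fun_translate: "test_fun \<phi> \<Longrightarrow> test_fun (\<lambda>x. \<phi> (x + h))"
  and pderiv3_translate: "test_fun \<phi> \<Longrightarrow> pderiv3 (\<lambda>x. \<phi> (x + h)) j x = pderiv3 \<phi> j (x + h)"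
proof -
  have *: "(\<lambda>x. \<phi> (x + h)) differentiable at x" "pderiv3 (\<lambda>x. \<phi> (x + h)) j = (\<lambda>x. pderiv3 \<phi> j (x + h))"
    if "smooth3 \<phi>" for \<phi> x j
  proof -
    have d: "\<phi> differentiable at x" for x using that by (rule smooth3_differentiable)
    have "((\<lambda>x. \<phi> (x + h)) has_derivative (\<lambda>k. frechet_derivative \<phi> (at (x + h)) k)) (at x)" for x
    proof -
      have "((\<lambda>x. x + h) has_derivative (\<lambda>k. k)) (at x)" by (auto intro!: derivative_eq_intros)
      moreover have "(\<phi> has_derivative (frechet_derivative \<phi> (at (x + h)))) (at (x + h))"
        using d by (simp add: frechet_derivative_works)
      ultimately show ?thesis by (rule has_derivative_compose)
    qed
    note D = this
    show "(\<lambda>x. \<phi> (x + h)) differentiable at x" "pderiv3 (\<lambda>x. \<phi> (x + h)) j = (\<lambda>x. pderiv3 \<phi> j (x + h))"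
      using D by (auto simp: differentiable_def pderiv3_def fun_eq_iff frechet_derivative_at[OF D, symmetric])
  qed
  assume "test_fun \<phi>"
  then have s: "smooth3 \<phi>" and b: "bounded {x. \<phi> x \<noteq> 0}"
    by (auto simp: test_fun_def compact_closure)
  show "pderiv3 (\<lambda>x. \<phi> (x + h)) j x = pderiv3 \<phi> j (x + h)"
    by (simp add: *[OF s])
  have "smooth3 (\<lambda>x. \<phi> (x + h))" using s
  proof (coinduction arbitrary: \<phi>)
    case smooth3
    then have "smooth3 (pderiv3 \<phi> j)" for j by (rule smooth3_pderiv3)
    then show ?case using *[OF smooth3] by auto
  qed
  moreover have "bounded {x. \<phi> (x + h) \<noteq> 0}"
  proof -
    have "{x. \<phi> (x + h) \<noteq> 0} = (\<lambda>x. - h + x) ` {x. \<phi> x \<noteq> 0}"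
      by (auto simp: image_iff intro!: exI[of _ "_ + h"])
    then show ?thesis using bounded_translation[OF b, of "- h"] by simp
  qed
  ultimately show "test_fun (\<lambda>x. \<phi> (x + h))" by (simp add: test_fun_def compact_closure)
qed

lemma test_fun_pderiv3:
  assumes "test_fun \<phi>"
  shows "test_fun (pderiv3 \<phi> j)"
proof -
  have s: "smooth3 \<phi>" and K: "compact (closure {x. \<phi> x \<noteq> 0})" using assms by (auto simp: test_fun_def)
  have "pderiv3 \<phi> j x = 0" if "x \<notin> closure {x. \<phi> x \<noteq> 0}" for x
  proof -
    have "(\<phi> has_derivative (\<lambda>h. 0)) (at x)"
    proof (rule has_derivative_transform_within_open[of "\<lambda>x. 0"])
      show "open (- closure {x. \<phi> x \<noteq> 0})" by (rule open_Compl[OF closed_closure])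
      show "0 = \<phi> y" if "y \<in> - closure {x. \<phi> x \<noteq> 0}" for y
      proof (rule ccontr)
        assume "0 \<noteq> \<phi> y"
        then have "y \<in> {x. \<phi> x \<noteq> 0}" by simp
        then show False using that closure_subset[of "{x. \<phi> x \<noteq> 0}"] by blast
      qed
      show "x \<in> - closure {x. \<phi> x \<noteq> 0}" using that by blast
    qed (rule has_derivative_const)
    then have "frechet_derivative \<phi> (at x) = (\<lambda>h. 0)" by (rule frechet_derivative_at[symmetric])
    then show ?thesis by (simp add: pderiv3_def)
  qed
  then have "{x. pderiv3 \<phi> j x \<noteq> 0} \<subseteq> closure {x. \<phi> x \<noteq> 0}" by auto
  then have "bounded {x. pderiv3 \<phi> j x \<noteq> 0}"
    by (rule bounded_subset[OF compact_imp_bounded[OF K]])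
  moreover have "smooth3 (pderiv3 \<phi> j)" using s by (rule smooth3_pderiv3)
  ultimately show ?thesis by (simp add: test_fun_def compact_closure)
qed

lemma test_fun_continuous: "test_fun \<phi> \<Longrightarrow> continuous_on UNIV \<phi>"
  by (auto simp: test_fun_def continuous_on_eq_continuous_at
      intro!: differentiable_imp_continuous_within smooth3_differentiable)

lemma test_fun_bounded:
  assumes "test_fun \<phi>" obtains B where "\<And>x. norm (\<phi> x) \<le> B"
proof -
  have "compact (\<phi> ` closure {x. \<phi> x \<noteq> 0})"
    using assms by (intro compact_continuous_image continuous_on_subset[OF test_fun_continuous[OF assms]])
      (auto simp: test_fun_def)
  then have "bounded (\<phi> ` closure {x. \<phi> x \<noteq> 0})" by (rule compact_imp_bounded)
  then obtain B where B: "\<And>x. x \<in> closure {x. \<phi> x \<noteq> 0} \<Longrightarrow> norm (\<phi> x) \<le> B"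
    unfolding bounded_iff by blast
  have "norm (\<phi> x) \<le> max B 0" for x
  proof (cases "\<phi> x = 0")
    case False
    then have "x \<in> closure {x. \<phi> x \<noteq> 0}" using closure_subset[of "{x. \<phi> x \<noteq> 0}"] by blast
    from B[OF this] show ?thesis by simp
  qed simp
  then show ?thesis by (rule that)
qed

lemma test_fun_measurable [measurable_dest]: "test_fun \<phi> \<Longrightarrow> \<phi> \<in> borel_measurable borel"
  by (rule borel_measurable_continuous_onI) (rule test_fun_continuous)

text \<open>The bumps converge boundedly to indicators of boxes, so the integral of \<open>g\<close>
  over every box vanishes. Boxes generate the Borel sets and are stable under intersection, so
  Dynkin's argument extends this to the Borel subsets of a box.\<close>

lemma AE_zero_if_test_orthogonal:
  fixes g :: "real^3 \<Rightarrow> complex"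
  assumes int: "\<And>K. compact K \<Longrightarrow> set_integrable lborel K g"
    and orth: "\<And>\<phi>. test_fun \<phi> \<Longrightarrow> (\<integral>x. g x * \<phi> x \<partial>lborel) = 0"
  shows "AE x in lborel. g x = 0"
proof -
  have box_int: "set_integrable lborel (box a b) g" for a b
    by (rule set_integrable_subset[OF int[OF compact_cbox[of a b]]]) (auto simp: box_subset_cbox)
  have box_zero: "(LINT x:box a b|lborel. g x) = 0" for a b
  proof -
    have "(\<lambda>n. \<integral>x. indicator (box a b) x *\<^sub>R g x * complex_of_real (box_bump n a b x) \<partial>lborel) \<longlonglongrightarrow>
        (\<integral>x. indicator (box a b) x *\<^sub>R g x * indicator (box a b) x \<partial>lborel)"
    proof (rule integral_dominated_convergence[where w = "\<lambda>x. norm (indicator (box a b) x *\<^sub>R g x)"])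
      have [measurable]: "(\<lambda>x. indicator (box a b) x *\<^sub>R g x) \<in> borel_measurable lborel"
        using box_int[of a b] by (auto simp: set_integrable_def)
      show "(\<lambda>x. indicator (box a b) x *\<^sub>R g x * complex_of_real (box_bump n a b x)) \<in> borel_measurable lborel" for n
        using test_fun_measurable[OF test_fun_box_bump[of n a b]] by measurable
      show "(\<lambda>x. indicator (box a b) x *\<^sub>R g x * indicator (box a b) x) \<in> borel_measurable lborel"
        by measurable
      show "integrable lborel (\<lambda>x. norm (indicator (box a b) x *\<^sub>R g x))"
        using box_int[of a b] unfolding set_integrable_def by (rule integrable_norm)
      show "AE x in lborel. (\<lambda>n. indicator (box a b) x *\<^sub>R g x * complex_of_real (box_bump n a b x))
          \<longlonglongrightarrow> indicator (box a b) x *\<^sub>R g x * indicator (box a b) x"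
      proof (intro AE_I2 tendsto_intros)
        fix x :: "real^3"
        have "(\<lambda>n. complex_of_real (box_bump n a b x)) \<longlonglongrightarrow> complex_of_real (indicator (box a b) x)"
          by (intro tendsto_intros box_bump_tendsto)
        then show "(\<lambda>n. complex_of_real (box_bump n a b x)) \<longlonglongrightarrow> indicator (box a b) x"
          by (auto simp: indicator_def split: if_splits)
      qed
      show "AE x in lborel. norm (indicator (box a b) x *\<^sub>R g x * complex_of_real (box_bump n a b x))
          \<le> norm (indicator (box a b) x *\<^sub>R g x)" for n
        using box_bump_range[of n a b] by (intro AE_I2) (auto simp: norm_mult intro!: mult_left_mono mult_left_le)
    qed
    moreover have "(\<integral>x. indicator (box a b) x *\<^sub>R g x * complex_of_real (box_bump n a b x) \<partial>lborel) = 0" for n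
    proof -
      have "indicator (box a b) x *\<^sub>R g x * complex_of_real (box_bump n a b x) = g x * complex_of_real (box_bump n a b x)" for x
        by (cases "x \<in> box a b") (auto simp: box_bump_outside)
      then show ?thesis using orth[OF test_fun_box_bump] by simp
    qed
    ultimately have "(\<integral>x. indicator (box a b) x *\<^sub>R g x * indicator (box a b) x \<partial>lborel) = 0"
      using LIMSEQ_unique[OF _ tendsto_const] by fastforce
    moreover have "indicator (box a b) x *\<^sub>R g x * indicator (box a b) x = indicator (box a b) x *\<^sub>R g x" for x
      by (auto simp: indicator_def)
    ultimately show ?thesis by (simp only: set_lebesgue_integral_def)
  qed
  have on_box: "AE x in lborel. indicator (box a b) x *\<^sub>R g x = 0" for a b :: "real^3"
  proof (rule sigma_finite_measure.density_zero[OF sigma_finite_lborel])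
    let ?G = "\<lambda>x. indicator (box a b) x *\<^sub>R g x"
    show G: "integrable lborel ?G" using box_int[of a b] by (simp add: set_integrable_def)
    have GA: "set_integrable lborel A ?G" if "A \<in> sets borel" for A
      using integrable_mult_indicator[OF _ G, of A] that by (simp add: set_integrable_def)
    fix A :: "(real^3) set" assume A: "A \<in> sets lborel"
    have "Int_stable (range (\<lambda>(a, b). box a b :: (real^3) set))"
      by (auto simp: Int_stable_def box_Int_box)
    moreover have "range (\<lambda>(a, b). box a b :: (real^3) set) \<subseteq> Pow UNIV" by auto
    moreover have "A \<in> sigma_sets UNIV (range (\<lambda>(a, b). box a b))"
      using A unfolding sets_lborel borel_eq_box by simp
    ultimately show "(LINT x:A|lborel. ?G x) = 0"
    proof (induction rule: sigma_sets_induct_disjoint)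
      case (basic A)
      then obtain c d where "A = box c d" by auto
      then have "A \<inter> box a b \<in> range (\<lambda>(a, b). box a b)" by (auto simp: box_Int_box)
      then obtain c d where cd: "A \<inter> box a b = box c d" by auto
      have "indicator A x *\<^sub>R ?G x = indicator (box c d) x *\<^sub>R g x" for x
        unfolding cd[symmetric] by (auto simp: indicator_def)
      then show ?case using box_zero[of c d] by (simp only: set_lebesgue_integral_def)
    next
      case empty
      then show ?case by (simp add: set_lebesgue_integral_def)
    next
      case (compl A)
      then have [measurable]: "A \<in> sets borel" by (simp add: borel_eq_box)
      have "indicator (UNIV - A) x *\<^sub>R ?G x = ?G x - indicator A x *\<^sub>R ?G x" for x
        by (auto simp: indicator_def)
      then have "(LINT x:(UNIV - A)|lborel. ?G x) = (\<integral>x. ?G x \<partial>lborel) - (LINT x:A|lborel. ?G x)"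
        unfolding set_lebesgue_integral_def
        using G GA[of A] unfolding set_integrable_def
        by (simp only:) (rule Bochner_Integration.integral_diff, auto)
      then show ?case using compl box_zero[of a b] by (simp only: set_lebesgue_integral_def) simp
    next
      case (union A)
      then have "A i \<in> sets borel" for i by (auto simp: borel_eq_box)
      then have "(LINT x:(\<Union>i. A i)|lborel. ?G x) = (\<Sum>i. (LINT x:(A i)|lborel. ?G x))"
        using union(1) by (intro lebesgue_integral_countable_add GA) (auto simp: disjoint_family_on_def)
      then show ?case using union by simp
    qed
  qed
  have "AE x in lborel. \<forall>N::nat. indicator (box (\<chi> k. - real N) (\<chi> k. real N)) x *\<^sub>R g x = 0"
    by (subst AE_all_countable) (intro allI on_box)
  then show ?thesis
  proof eventually_elim
    case (elim x)
    obtain N :: nat where N: "norm x < real N" using reals_Archimedean2 by blast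
    have "x \<in> box (\<chi> k. - real N) (\<chi> k. real N)"
      using N component_le_norm_cart[of x] by (auto simp: mem_box_cart abs_le_iff) (smt (verit) component_le_norm_cart)+
    then show ?case using elim[rule_format, of N] by simp
  qed
qed

text \<open>The conjugate turns the real inner product with \<open>tv k \<phi>\<close> into the real
  part of the bilinear pairing of the k-th component with \<phi>, which is the form in which
  \<open>weak_deriv\<close> is stated.\<close>

definition tv :: "4 \<Rightarrow> (real^3 \<Rightarrow> complex) \<Rightarrow> real^3 \<Rightarrow> complex^4" where
  "tv k \<phi> x = axis k (cnj (\<phi> x))"

lemma norm_tv: "norm (tv k \<phi> x) = norm (\<phi> x)"
  by (simp add: tv_def norm_vec_def L2_set_def axis_def if_distrib[of norm] if_distrib[of "\<lambda>a. a\<^sup>2"] cong: if_cong)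

lemma inner_tv: "v \<bullet> tv k \<phi> x = Re (v $ k * \<phi> x)"
proof -
  have "v \<bullet> tv k \<phi> x = (v $ k) \<bullet> cnj (\<phi> x)" unfolding tv_def by (rule inner_axis)
  then show ?thesis by (simp add: inner_complex_def)
qed

lemma tv_measurable: "\<phi> \<in> borel_measurable M \<Longrightarrow> tv k \<phi> \<in> borel_measurable M"
proof -
  assume \<phi>: "\<phi> \<in> borel_measurable M"
  have "continuous_on UNIV (\<lambda>z. axis k (cnj z) :: complex^4)"
    unfolding axis_def
  proof (intro continuous_on_vec_lambda)
    show "continuous_on UNIV (\<lambda>z. if i = k then cnj z else 0)" for i
      by (cases "i = k") (auto intro: continuous_intros)
  qed
  from measurable_compose[OF \<phi> borel_measurable_continuous_onI[OF this]]
  show ?thesis by (simp add: tv_def[abs_def])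
qed

lemma square_integrable_bounded_support:
  assumes "f \<in> borel_measurable borel" "bounded S" "\<And>x. x \<notin> S \<Longrightarrow> f x = 0" "\<And>x. norm (f x) \<le> B"
  shows "square_integrable f"
    and "S \<subseteq> cball 0 r \<Longrightarrow> (\<integral>x. (norm (f x))\<^sup>2 \<partial>lborel) \<le> B\<^sup>2 * measure lborel (cball (0::real^3) r)"
proof -
  have le: "(norm (f x))\<^sup>2 \<le> B\<^sup>2 * indicator (cball 0 r) x" if "S \<subseteq> cball 0 r" for r x
    using that assms(3)[of x] assms(4)[of x]
    by (cases "x \<in> cball 0 r") (auto simp: indicator_def subset_iff intro!: power_mono)
  have ir: "integrable lborel (\<lambda>x. B\<^sup>2 * indicator (cball (0::real^3) r) x)" for r
    by (intro integrable_mult_right integrable_real_indicator) (auto simp: emeasure_bounded_finite[unfolded infinity_ennreal_def])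
  have int: "integrable lborel (\<lambda>x. (norm (f x))\<^sup>2)" if "S \<subseteq> cball 0 r" for r
    using assms(1) le[OF that] by (intro Bochner_Integration.integrable_bound[OF ir[of r]]) auto
  obtain r' where "S \<subseteq> cball 0 r'" using assms(2) by (auto simp: bounded_iff subset_iff)
  from int[OF this] show "square_integrable f" using assms(1) by (simp add: square_integrable_def)
  assume S: "S \<subseteq> cball 0 r"
  have "(\<integral>x. (norm (f x))\<^sup>2 \<partial>lborel) \<le> (\<integral>x. B\<^sup>2 * indicator (cball (0::real^3) r) x \<partial>lborel)"
    by (rule integral_mono_AE[OF int[OF S] ir AE_I2]) (rule le[OF S])
  then show "(\<integral>x. (norm (f x))\<^sup>2 \<partial>lborel) \<le> B\<^sup>2 * measure lborel (cball (0::real^3) r)" by simp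
qed

lemma square_integrable_tv:
  assumes "test_fun \<phi>" shows "square_integrable (tv k \<phi>)"
proof -
  obtain B where "\<And>x. norm (\<phi> x) \<le> B" using test_fun_bounded[OF assms] by blast
  moreover have "bounded {x. \<phi> x \<noteq> 0}" using assms by (simp add: test_fun_def compact_closure)
  ultimately show ?thesis
    using test_fun_measurable[OF assms]
    by (intro square_integrable_bounded_support[where S = "{x. \<phi> x \<noteq> 0}" and B = B])
      (auto simp: norm_tv intro: tv_measurable, auto simp: tv_def axis_def vec_eq_iff)
qed

lemma integrable_square_integrable_test:
  assumes "square_integrable f" "test_fun \<phi>"
  shows "integrable lborel (\<lambda>x. f x $ k * \<phi> x)"
proof -
  have [measurable]: "f \<in> borel_measurable borel" "\<phi> \<in> borel_measurable borel"
    using assms test_fun_measurable by (auto simp: square_integrable_def)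
  have [measurable]: "(\<lambda>x. f x $ k) \<in> borel_measurable borel"
    by (rule borel_measurable_continuous_on[where f = "\<lambda>v. v $ k", OF continuous_on_component])
       (auto intro: continuous_intros)
  have i: "integrable lborel (\<lambda>x. (norm (f x))\<^sup>2 + (norm (tv k \<phi> x))\<^sup>2)"
    using assms(1) square_integrable_tv[OF assms(2), of k] by (auto simp: square_integrable_def)
  show ?thesis
  proof (rule Bochner_Integration.integrable_bound[OF i])
    show "AE x in lborel. norm (f x $ k * \<phi> x) \<le> norm ((norm (f x))\<^sup>2 + (norm (tv k \<phi> x))\<^sup>2)"
    proof (rule AE_I2)
      fix x
      have "norm (f x $ k * \<phi> x) \<le> norm (f x) * norm (\<phi> x)"
        by (simp add: norm_mult mult_right_mono Finite_Cartesian_Product.norm_nth_le)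
      also have "\<dots> \<le> (norm (f x))\<^sup>2 + (norm (\<phi> x))\<^sup>2"
        using sum_squares_bound[of "norm (f x)" "norm (\<phi> x)"] mult_nonneg_nonneg[OF norm_ge_zero norm_ge_zero, of "f x" "\<phi> x"]
        by linarith
      finally show "norm (f x $ k * \<phi> x) \<le> norm ((norm (f x))\<^sup>2 + (norm (tv k \<phi> x))\<^sup>2)"
        by (simp add: norm_tv)
    qed
  qed measurable
qed

lemma inner_cls_tv:
  assumes "square_integrable f" "test_fun \<phi>"
  shows "cls f \<bullet> cls (tv k \<phi>) = Re (\<integral>x. f x $ k * \<phi> x \<partial>lborel)"
  unfolding inner_cls[OF assms(1) square_integrable_tv[OF assms(2)]] inner_tv
  by (rule integral_Re[OF integrable_square_integrable_test[OF assms]])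

lemma set_integrable_square_integrable:
  assumes "square_integrable f" "emeasure lborel K < \<infinity>" "K \<in> sets borel"
  shows "set_integrable lborel K (\<lambda>x. f x $ k)"
proof -
  have [measurable]: "f \<in> borel_measurable borel" "K \<in> sets borel"
    using assms by (auto simp: square_integrable_def)
  have [measurable]: "(\<lambda>x. f x $ k) \<in> borel_measurable borel"
    by (rule borel_measurable_continuous_on[where f = "\<lambda>v. v $ k", OF continuous_on_component])
       (auto intro: continuous_intros)
  have i: "integrable lborel (\<lambda>x. (norm (f x))\<^sup>2 + indicator K x)"
    using assms by (auto simp: square_integrable_def)
  show ?thesis unfolding set_integrable_def
  proof (rule Bochner_Integration.integrable_bound[OF i])
    show "AE x in lborel. norm (indicator K x *\<^sub>R f x $ k) \<le> norm ((norm (f x))\<^sup>2 + indicator K x :: real)"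
    proof (rule AE_I2)
      fix x
      have "norm (f x $ k) \<le> norm (f x)" by (rule Finite_Cartesian_Product.norm_nth_le)
      also have "\<dots> \<le> (norm (f x))\<^sup>2 + 1"
      proof -
        have "2 * norm (f x) \<le> (norm (f x))\<^sup>2 + 1" using sum_squares_bound[of "norm (f x)" 1] by simp
        then show ?thesis using norm_ge_zero[of "f x"] by linarith
      qed
      finally show "norm (indicator K x *\<^sub>R f x $ k) \<le> norm ((norm (f x))\<^sup>2 + indicator K x :: real)"
        by (auto simp: indicator_def)
    qed
  qed measurable
qed

lemma loc_int_square_integrable: "square_integrable f \<Longrightarrow> loc_int f"
  unfolding loc_int_def
  by (intro allI impI set_integrable_square_integrable) (auto intro: borel_compact emeasure_bounded_finite compact_imp_bounded simp flip: infinity_ennreal_def)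

lemma test_orthogonal_trivial:
  assumes "\<And>k \<phi>. test_fun \<phi> \<Longrightarrow> w \<bullet> cls (tv k \<phi>) = 0"
  shows "w = 0"
proof -
  have "AE x in lborel. fn w x $ k = 0" for k
  proof (rule AE_zero_if_test_orthogonal)
    show "set_integrable lborel K (\<lambda>x. fn w x $ k)" if "compact K" for K
      using loc_int_square_integrable[of "fn w"] that by (simp add: loc_int_def)
    fix \<phi> assume \<phi>: "test_fun \<phi>"
    have "Re (\<integral>x. fn w x $ k * \<phi> x \<partial>lborel) = 0"
      using assms[OF \<phi>] inner_cls_tv[of "fn w" \<phi> k] \<phi> by simp
    moreover have "Re (\<integral>x. fn w x $ k * (\<i> * \<phi> x) \<partial>lborel) = 0"
      using assms[OF test_fun_scale[OF \<phi>]] inner_cls_tv[of "fn w" "\<lambda>x. \<i> * \<phi> x" k] test_fun_scale[OF \<phi>] by simp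
    moreover have "(\<integral>x. fn w x $ k * (\<i> * \<phi> x) \<partial>lborel) = \<i> * (\<integral>x. fn w x $ k * \<phi> x \<partial>lborel)"
      by (simp flip: integral_mult_right_zero add: mult_ac)
    ultimately show "(\<integral>x. fn w x $ k * \<phi> x \<partial>lborel) = 0" by (simp add: complex_eq_iff)
  qed
  then have "AE x in lborel. \<forall>k. fn w x $ k = 0" by (intro eventually_all_finite)
  then show ?thesis
    using fn_zero by (subst l2_eq_iff) (auto elim!: eventually_elim2 simp: vec_eq_iff)
qed

section \<open>Weak derivatives as generators of translations\<close>

text \<open>The strong L2 derivative of the translation group at 0. For square-integrable functions
  it agrees with the weak derivative (\<open>has_pd_iff_weak_deriv\<close>), and every bounded
  operator that commutes with translations preserves it at once.\<close>

definition has_pd :: "3 \<Rightarrow> l2 \<Rightarrow> l2 \<Rightarrow> bool" where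
  "has_pd j u g \<longleftrightarrow> ((\<lambda>t. (tr (axis j t) u - u) /\<^sub>R t) \<longlongrightarrow> g) (at 0)"

lemma axis_plus: "axis j s + axis j t = (axis j (s + t) :: real^3)"
  by (simp add: axis_def vec_eq_iff)

lemma axis_minus: "- axis j t = (axis j (- t) :: real^3)"
  by (simp add: axis_def vec_eq_iff)

lemma tr_axis_tr_axis: "tr (axis j s) (tr (axis j t) u) = tr (axis j (s + t)) u"
  by (simp add: tr_tr axis_plus)

lemma axis_zero [simp]: "axis j 0 = (0 :: real^3)"
  by (simp add: axis_def vec_eq_iff)

lemma has_pd_unique: "has_pd j u g \<Longrightarrow> has_pd j u g' \<Longrightarrow> g = g'"
  unfolding has_pd_def by (rule tendsto_unique[OF trivial_limit_at])

lemma has_pd_commuting: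
  assumes "has_pd j u g" "bounded_linear T" "\<And>t w. tr (axis j t) (T w) = T (tr (axis j t) w)"
  shows "has_pd j (T u) (T g)"
proof -
  interpret T: bounded_linear T by fact
  have "((\<lambda>t. T ((tr (axis j t) u - u) /\<^sub>R t)) \<longlongrightarrow> T g) (at 0)"
    using assms(1) unfolding has_pd_def by (rule T.tendsto)
  then show ?thesis by (simp add: has_pd_def assms(3) T.scaleR T.diff)
qed

lemma has_pd_tr: "has_pd j u g \<Longrightarrow> has_pd j (tr h u) (tr h g)"
  by (rule has_pd_commuting[OF _ bounded_linear_tr]) (auto simp: tr_tr add.commute)

lemma has_pd_cm: "has_pd j u g \<Longrightarrow> has_pd j (cm A u) (cm A g)"
  by (rule has_pd_commuting[OF _ bounded_linear_cm]) (auto simp: tr_cm)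

lemma has_pd_cs: "has_pd j u g \<Longrightarrow> has_pd j (cs z u) (cs z g)"
  unfolding cs_def by (rule has_pd_cm)

lemma has_pd_scaleR: "has_pd j u g \<Longrightarrow> has_pd j (c *\<^sub>R u) (c *\<^sub>R g)"
  by (rule has_pd_commuting[OF _ bounded_linear_scaleR_right]) (auto simp: tr_scaleR)

lemma has_pd_add: "has_pd j u g \<Longrightarrow> has_pd j v k \<Longrightarrow> has_pd j (u + v) (g + k)"
  unfolding has_pd_def by (drule (1) tendsto_add) (simp add: tr_add algebra_simps)

lemma has_pd_zero: "has_pd j 0 0"
  by (simp add: has_pd_def)

lemma has_pd_diff: "has_pd j u g \<Longrightarrow> has_pd j v k \<Longrightarrow> has_pd j (u - v) (g - k)"
  using has_pd_add[OF _ has_pd_scaleR[of j v k "-1"], of u g] by simp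

lemma has_pd_backward:
  assumes "has_pd j u g"
  shows "((\<lambda>t. (tr (axis j (- t)) u - u) /\<^sub>R t) \<longlongrightarrow> - g) (at 0)"
proof -
  have "filterlim uminus (at (0::real)) (at 0)"
    by (auto simp: filterlim_at eventually_at_filter intro!: tendsto_eq_intros)
  with assms have "((\<lambda>t. (tr (axis j (- t)) u - u) /\<^sub>R (- t)) \<longlongrightarrow> g) (at 0)"
    unfolding has_pd_def by (rule filterlim_compose)
  from tendsto_minus[OF this] show ?thesis by simp
qed

lemma has_pd_skew:
  assumes "has_pd j u g" "has_pd j v k"
  shows "g \<bullet> v = - (u \<bullet> k)"
proof -
  have "((\<lambda>t. ((tr (axis j t) u - u) /\<^sub>R t) \<bullet> v) \<longlongrightarrow> g \<bullet> v) (at 0)"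
    using assms(1) unfolding has_pd_def by (intro tendsto_inner tendsto_const)
  moreover have "((tr (axis j t) u - u) /\<^sub>R t) \<bullet> v = u \<bullet> ((tr (axis j (- t)) v - v) /\<^sub>R t)" for t
    by (simp add: inner_diff_left inner_diff_right inner_tr_left axis_minus)
  moreover have "((\<lambda>t. u \<bullet> ((tr (axis j (- t)) v - v) /\<^sub>R t)) \<longlongrightarrow> u \<bullet> (- k)) (at 0)"
    by (intro tendsto_inner tendsto_const has_pd_backward assms(2))
  ultimately have "g \<bullet> v = u \<bullet> (- k)"
    by (simp only:) (rule tendsto_unique[OF trivial_limit_at])
  then show ?thesis by simp
qed

text \<open>Formally two integrations by parts, but second derivatives need not exist. For
  difference quotients the identity is exact because translations commute; then the step tends to
  0.\<close>

lemma has_pd_swap: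
  assumes "has_pd j u uj" "has_pd k u uk" "has_pd j v vj" "has_pd k v vk"
  shows "uj \<bullet> vk = uk \<bullet> vj"
proof -
  have "((\<lambda>t. ((tr (axis j t) u - u) /\<^sub>R t) \<bullet> ((tr (axis k t) v - v) /\<^sub>R t)) \<longlongrightarrow> uj \<bullet> vk) (at 0)"
    using assms(1,4) unfolding has_pd_def by (intro tendsto_inner)
  moreover have "((\<lambda>t. ((tr (axis k (- t)) u - u) /\<^sub>R t) \<bullet> ((tr (axis j (- t)) v - v) /\<^sub>R t)) \<longlongrightarrow> (- uk) \<bullet> (- vj)) (at 0)"
    by (intro tendsto_inner has_pd_backward assms(2,3))
  moreover have "((tr (axis j t) u - u) /\<^sub>R t) \<bullet> ((tr (axis k t) v - v) /\<^sub>R t) =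
      ((tr (axis k (- t)) u - u) /\<^sub>R t) \<bullet> ((tr (axis j (- t)) v - v) /\<^sub>R t)" for t
  proof -
    have "tr (axis j t) u \<bullet> tr (axis k t) v = tr (axis k (- t)) u \<bullet> tr (axis j (- t)) v"
      by (simp add: inner_tr_left tr_tr axis_minus) (simp add: add.commute)
    moreover have "tr (axis j t) u \<bullet> v = u \<bullet> tr (axis j (- t)) v" "u \<bullet> tr (axis k t) v = tr (axis k (- t)) u \<bullet> v"
      by (simp_all add: inner_tr_left axis_minus)
    ultimately show ?thesis by (simp add: inner_diff_left inner_diff_right algebra_simps)
  qed
  ultimately have "uj \<bullet> vk = (- uk) \<bullet> (- vj)"
    by (simp only:) (rule tendsto_unique[OF trivial_limit_at])
  then show ?thesis by simp
qed

lemma has_pd_vector_derivative: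
  assumes "has_pd j u g"
  shows "((\<lambda>t. tr (axis j t) u) has_vector_derivative tr (axis j t) g) (at t)"
proof -
  have "has_pd j (tr (axis j t) u) (tr (axis j t) g)" by (rule has_pd_tr[OF assms])
  then have "((\<lambda>h. norm ((tr (axis j (t + h)) u - tr (axis j t) u) /\<^sub>R h - tr (axis j t) g)) \<longlongrightarrow> 0) (at 0)"
    unfolding has_pd_def by (subst tendsto_norm_zero_iff, subst (asm) LIM_zero_iff[symmetric])
      (simp add: tr_axis_tr_axis add.commute)
  moreover have "eventually (\<lambda>h. norm ((tr (axis j (t + h)) u - tr (axis j t) u) /\<^sub>R h - tr (axis j t) g)
      = norm (tr (axis j (t + h)) u - tr (axis j t) u - h *\<^sub>R tr (axis j t) g) / norm h) (at 0)"
  proof (rule eventually_at_filter[THEN iffD2, OF always_eventually], safe)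
    fix h :: real assume "h \<noteq> 0"
    then have "(tr (axis j (t + h)) u - tr (axis j t) u) /\<^sub>R h - tr (axis j t) g
       = (tr (axis j (t + h)) u - tr (axis j t) u - h *\<^sub>R tr (axis j t) g) /\<^sub>R h"
      by (simp add: scaleR_diff_right)
    then show "norm ((tr (axis j (t + h)) u - tr (axis j t) u) /\<^sub>R h - tr (axis j t) g)
      = norm (tr (axis j (t + h)) u - tr (axis j t) u - h *\<^sub>R tr (axis j t) g) / norm h"
      by (simp add: divide_inverse mult.commute)
  qed
  ultimately have "((\<lambda>h. norm (tr (axis j (t + h)) u - tr (axis j t) u - h *\<^sub>R tr (axis j t) g) / norm h) \<longlongrightarrow> 0) (at 0)"
    by (rule Lim_transform_eventually)
  then show ?thesis
    by (simp add: has_vector_derivative_def has_derivative_at bounded_linear_scaleR_left)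
qed

lemma has_pd_norm_le:
  assumes "has_pd j u g"
  shows "norm (tr (axis j t) u - u) \<le> \<bar>t\<bar> * norm g"
proof -
  have "norm (tr (axis j t) u - tr (axis j 0) u) \<le> norm g * norm (t - 0)"
  proof (rule differentiable_bound[where S = UNIV and f' = "\<lambda>t h. h *\<^sub>R tr (axis j t) g"])
    show "((\<lambda>t. tr (axis j t) u) has_derivative (\<lambda>h. h *\<^sub>R tr (axis j s) g)) (at s within UNIV)" for s
      using has_pd_vector_derivative[OF assms, of s] by (simp add: has_vector_derivative_def)
    show "onorm (\<lambda>h. h *\<^sub>R tr (axis j s) g) \<le> norm g" for s
      by (rule onorm_le) simp
  qed auto
  then show ?thesis by (simp add: mult.commute)
qed

lemma test_fun_uniformly_continuous:
  assumes "test_fun \<phi>" "e > 0"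
  obtains d where "d > 0" "\<And>x y. dist x y < d \<Longrightarrow> norm (\<phi> x - \<phi> y) < e"
proof -
  have "bounded {x. \<phi> x \<noteq> 0}" using assms(1) by (simp add: test_fun_def compact_closure)
  then obtain r where r: "\<And>x. \<phi> x \<noteq> 0 \<Longrightarrow> norm x \<le> r" by (auto simp: bounded_iff)
  have "uniformly_continuous_on (cball 0 (r + 1)) \<phi>"
    using test_fun_continuous[OF assms(1)] by (intro compact_uniformly_continuous) (auto intro: continuous_on_subset)
  then obtain d where d: "d > 0" "\<And>x y. x \<in> cball 0 (r + 1) \<Longrightarrow> y \<in> cball 0 (r + 1) \<Longrightarrow> dist y x < d \<Longrightarrow> dist (\<phi> y) (\<phi> x) < e"
    using assms(2) unfolding uniformly_continuous_on_def by blast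
  show ?thesis
  proof (rule that[of "min d 1"])
    fix x y :: "real^3" assume xy: "dist x y < min d 1"
    show "norm (\<phi> x - \<phi> y) < e"
    proof (cases "\<phi> x = 0 \<and> \<phi> y = 0")
      case True
      then show ?thesis using assms(2) by simp
    next
      case False
      then have "norm x \<le> r \<or> norm y \<le> r" using r by blast
      moreover have "norm x \<le> norm y + 1" "norm y \<le> norm x + 1"
        using xy norm_triangle_ineq3[of x y] by (auto simp: dist_norm)
      ultimately show ?thesis
        using d(2)[of y x] xy by (auto simp: dist_norm)
    qed
  qed (use d in auto)
qed

lemma test_fun_directional_derivative:
  assumes "test_fun \<phi>"
  shows "((\<lambda>t. \<phi> (x + axis j t)) has_vector_derivative pderiv3 \<phi> j (x + axis j t)) (at t within S)"
proof -
  have ax: "(\<lambda>t. x + axis j t) = (\<lambda>t. x + t *\<^sub>R axis j 1)" by (simp add: axis_def vec_eq_iff fun_eq_iff)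
  have "(\<phi> has_derivative (frechet_derivative \<phi> (at (x + axis j t)))) (at (x + axis j t))"
    using assms by (intro frechet_derivative_works[THEN iffD1] smooth3_differentiable) (simp add: test_fun_def)
  moreover have "((\<lambda>t. x + axis j t) has_derivative (\<lambda>h. h *\<^sub>R axis j 1)) (at t within S)"
    unfolding ax by (auto intro!: derivative_eq_intros)
  ultimately have *: "((\<lambda>t. \<phi> (x + axis j t)) has_derivative
      (\<lambda>h. frechet_derivative \<phi> (at (x + axis j t)) (h *\<^sub>R axis j 1))) (at t within S)"
    by (rule has_derivative_compose[rotated])
  have "linear (frechet_derivative \<phi> (at (x + axis j t)))"
    using assms by (intro linear_frechet_derivative smooth3_differentiable) (simp add: test_fun_def)
  then show ?thesis using * by (simp add: has_vector_derivative_def pderiv3_def linear_scale)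
qed

lemma tr_cls_tv: "test_fun \<phi> \<Longrightarrow> tr h (cls (tv k \<phi>)) = cls (tv k (\<lambda>x. \<phi> (x + h)))"
  by (simp add: tr_cls square_integrable_tv) (simp add: tv_def[abs_def])

text \<open>The difference quotient minus the derivative is uniformly small, since the derivative is
  uniformly continuous, and it vanishes outside a fixed ball; hence it is small in L2.\<close>

lemma has_pd_test:
  assumes \<phi>: "test_fun \<phi>"
  shows "has_pd j (cls (tv k \<phi>)) (cls (tv k (pderiv3 \<phi> j)))"
proof -
  let ?\<psi> = "pderiv3 \<phi> j"
  have \<psi>: "test_fun ?\<psi>" by (rule test_fun_pderiv3[OF \<phi>])
  have "bounded {x. \<phi> x \<noteq> 0}" "bounded {x. ?\<psi> x \<noteq> 0}" using \<phi> \<psi> by (simp_all add: test_fun_def compact_closure)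
  then have "bounded ({x. \<phi> x \<noteq> 0} \<union> {x. ?\<psi> x \<noteq> 0})" by simp
  then obtain r where r: "\<And>x. \<phi> x \<noteq> 0 \<Longrightarrow> norm x \<le> r" "\<And>x. ?\<psi> x \<noteq> 0 \<Longrightarrow> norm x \<le> r"
    unfolding bounded_iff by blast
  define M where "M = sqrt (measure lborel (cball (0::real^3) (r + 1)))"
  have M: "M \<ge> 0" by (simp add: M_def)
  have bound: "norm ((tr (axis j t) (cls (tv k \<phi>)) - cls (tv k \<phi>)) /\<^sub>R t - cls (tv k ?\<psi>)) \<le> e * M"
    if t: "t \<noteq> 0" "\<bar>t\<bar> < d" "\<bar>t\<bar> < 1" and "e \<ge> 0" and d: "\<And>x y. dist x y < d \<Longrightarrow> norm (?\<psi> x - ?\<psi> y) < e" for t d e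
  proof -
    let ?q = "\<lambda>x. (\<phi> (x + axis j t) - \<phi> x) /\<^sub>R t - ?\<psi> x"
    have q_le: "norm (?q x) \<le> e" for x
    proof -
      have "norm (\<phi> (x + axis j t) - \<phi> (x + axis j 0) - (t - 0) *\<^sub>R ?\<psi> (x + axis j 0)) \<le> norm (t - 0) * e"
      proof (rule vector_differentiable_bound_linearization[where S = "closed_segment 0 t" and ?x0.0 = 0])
        show "norm (?\<psi> (x + axis j s) - ?\<psi> (x + axis j 0)) \<le> e" if "s \<in> closed_segment 0 t" for s
        proof -
          have "\<bar>s\<bar> \<le> \<bar>t\<bar>" using that by (auto simp: closed_segment_eq_real_ivl split: if_splits)
          moreover have "norm (axis j s :: real^3) = \<bar>s\<bar>"
            by (simp add: norm_vec_def L2_set_def axis_def if_distrib[of norm] if_distrib[of "\<lambda>a. a\<^sup>2"] cong: if_cong)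
          ultimately show ?thesis using d[of "x + axis j s" x] t by (auto simp: dist_norm intro: less_imp_le)
        qed
      qed (use test_fun_directional_derivative[OF \<phi>] in auto)
      moreover have "?q x = (\<phi> (x + axis j t) - \<phi> (x + axis j 0) - (t - 0) *\<^sub>R ?\<psi> (x + axis j 0)) /\<^sub>R t"
        using t(1) by (simp add: scaleR_diff_right)
      from arg_cong[OF this, of norm] have "norm (?q x) = norm (\<phi> (x + axis j t) - \<phi> (x + axis j 0) - (t - 0) *\<^sub>R ?\<psi> (x + axis j 0)) / \<bar>t\<bar>"
        by (simp only: norm_scaleR) (simp add: divide_inverse mult.commute)
      ultimately show ?thesis using t(1) by (simp add: divide_le_eq mult.commute)
    qed
    have eq: "(tr (axis j t) (cls (tv k \<phi>)) - cls (tv k \<phi>)) /\<^sub>R t - cls (tv k ?\<psi>) = cls (tv k ?q)"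
    proof -
      have "tv k ?q = (\<lambda>x. (tv k (\<lambda>x. \<phi> (x + axis j t)) x - tv k \<phi> x) /\<^sub>R t - tv k ?\<psi> x)"
        by (simp add: tv_def axis_def vec_eq_iff fun_eq_iff)
      then show ?thesis
        using \<phi> \<psi> test_fun_translate[OF \<phi>, of "axis j t"]
        by (simp add: tr_cls_tv square_integrable_tv cls_diff cls_scaleR square_integrable_diff square_integrable_scaleR)
    qed
    have meas: "tv k ?q \<in> borel_measurable borel"
      using test_fun_measurable[OF \<phi>] test_fun_measurable[OF \<psi>]
        test_fun_measurable[OF test_fun_translate[OF \<phi>, of "axis j t"]] by (intro tv_measurable) measurable
    have out: "tv k ?q x = 0" if "x \<notin> cball 0 (r + 1)" for x
    proof -
      have "norm (axis j t :: real^3) = \<bar>t\<bar>"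
        by (simp add: norm_vec_def L2_set_def axis_def if_distrib[of norm] if_distrib[of "\<lambda>a. a\<^sup>2"] cong: if_cong)
      then have "norm x \<le> norm (x + axis j t) + 1"
        using norm_triangle_ineq4[of "x + axis j t" "axis j t"] t(3) by simp
      then have "\<not> norm x \<le> r" "\<not> norm (x + axis j t) \<le> r" using that by auto
      then have "\<phi> x = 0" "\<phi> (x + axis j t) = 0" "?\<psi> x = 0" using r by blast+
      then show ?thesis by (simp add: tv_def axis_def vec_eq_iff)
    qed
    have tq: "norm (tv k ?q x) \<le> e" for x using q_le[of x] by (simp add: norm_tv)
    have si: "square_integrable (tv k ?q)"
      by (rule square_integrable_bounded_support(1)[where S = "cball 0 (r + 1)" and B = e]) (use meas out tq in auto)
    have "(norm (cls (tv k ?q)))\<^sup>2 \<le> e\<^sup>2 * measure lborel (cball (0::real^3) (r + 1))"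
      unfolding norm_cls_sq[OF si]
      by (rule square_integrable_bounded_support(2)[where S = "cball 0 (r + 1)" and B = e]) (use meas out tq in auto)
    also have "\<dots> = (e * M)\<^sup>2" by (simp add: M_def power_mult_distrib)
    finally have "norm (cls (tv k ?q)) \<le> e * M"
      by (rule power2_le_imp_le) (use M \<open>e \<ge> 0\<close> in auto)
    then show ?thesis by (simp add: eq)
  qed
  show ?thesis unfolding has_pd_def
  proof (rule LIM_I)
    fix \<epsilon> :: real assume \<epsilon>: "\<epsilon> > 0"
    define e where "e = \<epsilon> / (2 * (M + 1))"
    have e: "e > 0" "e * M < \<epsilon>" using \<epsilon> M by (auto simp: e_def field_simps intro!: add_nonneg_pos)
    obtain d where d: "d > 0" "\<And>x y. dist x y < d \<Longrightarrow> norm (?\<psi> x - ?\<psi> y) < e"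
      using test_fun_uniformly_continuous[OF \<psi> e(1)] by blast
    show "\<exists>s>0. \<forall>t. t \<noteq> 0 \<and> norm (t - 0) < s \<longrightarrow>
        norm ((tr (axis j t) (cls (tv k \<phi>)) - cls (tv k \<phi>)) /\<^sub>R t - cls (tv k ?\<psi>)) < \<epsilon>"
    proof (intro exI[of _ "min d 1"] conjI allI impI)
      fix t :: real assume "t \<noteq> 0 \<and> norm (t - 0) < min d 1"
      then show "norm ((tr (axis j t) (cls (tv k \<phi>)) - cls (tv k \<phi>)) /\<^sub>R t - cls (tv k ?\<psi>)) < \<epsilon>"
        using bound[of t d e] d(2) e by auto
    qed (use d in auto)
  qed
qed

lemma closure_UNIV_if_contains_test:
  assumes "subspace S" "\<And>k \<phi>. test_fun \<phi> \<Longrightarrow> cls (tv k \<phi>) \<in> S"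
  shows "closure S = (UNIV :: l2 set)"
  by (rule closure_eq_UNIV_if_orthogonal_trivial[OF assms(1)]) (auto intro: test_orthogonal_trivial assms(2))

text \<open>The vectors with this property form a subspace containing the test fields, by
  \<open>has_pd_norm_le\<close>. That subspace is dense, and since translations are isometric the
  property passes to its closure.\<close>

lemma tr_axis_tendsto: "((\<lambda>t. tr (axis j t) u) \<longlongrightarrow> u) (at 0)"
proof -
  let ?S = "{u. ((\<lambda>t. tr (axis j t) u) \<longlongrightarrow> u) (at 0)}"
  have "subspace ?S"
    by (rule subspaceI) (auto simp: tr_add tr_scaleR intro: tendsto_intros)
  moreover have "cls (tv k \<phi>) \<in> ?S" if "test_fun \<phi>" for k \<phi>
  proof -
    let ?u = "cls (tv k \<phi>)" and ?g = "cls (tv k (pderiv3 \<phi> j))"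
    have "((\<lambda>t. \<bar>t\<bar> * norm ?g) \<longlongrightarrow> 0) (at 0)" by (auto intro!: tendsto_eq_intros)
    then have "((\<lambda>t. tr (axis j t) ?u - ?u) \<longlongrightarrow> 0) (at 0)"
      by (rule Lim_null_comparison[rotated]) (auto intro!: always_eventually has_pd_norm_le has_pd_test that)
    then show ?thesis by (simp add: LIM_zero_iff)
  qed
  ultimately have cl: "closure ?S = UNIV" by (rule closure_UNIV_if_contains_test)
  show ?thesis
  proof (rule LIM_I)
    fix e :: real assume e: "e > 0"
    have "u \<in> closure ?S" using cl by simp
    then obtain v where v: "v \<in> ?S" "dist v u < e/3"
      using e unfolding closure_approachable by (metis zero_less_divide_iff zero_less_numeral)
    then obtain d where d: "d > 0" "\<And>t. t \<noteq> 0 \<Longrightarrow> norm (t - 0) < d \<Longrightarrow> norm (tr (axis j t) v - v) < e/3"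
      using LIM_D[of "\<lambda>t. tr (axis j t) v" v 0 "e/3"] e by auto
    have "norm (tr (axis j t) u - u) < e" if "t \<noteq> 0" "norm (t - 0) < d" for t
    proof -
      have "tr (axis j t) u - u = tr (axis j t) (u - v) + (tr (axis j t) v - v) + (v - u)"
        by (simp add: tr_diff)
      also have "norm \<dots> \<le> norm (tr (axis j t) (u - v)) + norm (tr (axis j t) v - v) + norm (v - u)"
        by (intro order_trans[OF norm_triangle_ineq] add_mono norm_triangle_ineq) auto
      finally show ?thesis using d(2)[OF that] v(2) by (simp add: dist_norm norm_minus_commute)
    qed
    then show "\<exists>s>0. \<forall>t. t \<noteq> 0 \<and> norm (t - 0) < s \<longrightarrow> norm (tr (axis j t) u - u) < e"
      using d(1) by blast
  qed
qed

lemma continuous_on_tr_axis: "continuous_on A (\<lambda>t. tr (axis j t) u)"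
proof (rule continuous_at_imp_continuous_on, safe)
  fix s
  have "((\<lambda>h. tr (axis j h) (tr (axis j s) u)) \<longlongrightarrow> tr (axis j s) u) (at 0)"
    by (rule tr_axis_tendsto)
  then have "((\<lambda>h. tr (axis j (s + h)) u) \<longlongrightarrow> tr (axis j s) u) (at 0)"
    by (simp add: tr_axis_tr_axis add.commute)
  then show "isCont (\<lambda>t. tr (axis j t) u) s" by (simp add: isCont_iff)
qed

text \<open>A weak derivative is a strong one. For \<phi> in the dense set, the inner product of
  \<open>tr (axis j t) u\<close> with \<phi> is differentiable in t, with derivative the inner
  product of \<open>tr (axis j t) g\<close> with \<phi>; the quantifier over t is what allows this
  away from 0. Strong continuity at \<open>g\<close> bounds the linearisation error by |t| e/2 times
  the norm of \<phi>, a closed condition that extends to all \<phi>.\<close>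

lemma has_pd_weakI:
  assumes D: "closure {\<phi>. \<exists>\<psi>. has_pd j \<phi> \<psi> \<and> (\<forall>t. g \<bullet> tr (axis j t) \<phi> = - (u \<bullet> tr (axis j t) \<psi>))} = UNIV"
    (is "closure ?D = UNIV")
  shows "has_pd j u g"
  unfolding has_pd_def
proof (rule LIM_I)
  fix e :: real assume e: "e > 0"
  then obtain d where d: "d > 0" "\<And>t. t \<noteq> 0 \<Longrightarrow> norm (t - 0) < d \<Longrightarrow> norm (tr (axis j t) g - g) < e/2"
    using LIM_D[OF tr_axis_tendsto[of j g], of "e/2"] by auto
  have small: "norm (tr (axis j t) g - g) \<le> e/2" if "\<bar>t\<bar> < d" for t
    using d(2)[of t] that e by (cases "t = 0") auto
  have main: "\<bar>(tr (axis j t) u - u - t *\<^sub>R g) \<bullet> \<phi>\<bar> \<le> \<bar>t\<bar> * (e/2) * norm \<phi>" if t: "\<bar>t\<bar> < d" for t \<phi>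
  proof -
    let ?C = "{\<phi>. \<bar>(tr (axis j t) u - u - t *\<^sub>R g) \<bullet> \<phi>\<bar> \<le> \<bar>t\<bar> * (e/2) * norm \<phi>}"
    have "?D \<subseteq> ?C"
    proof safe
      fix \<phi> \<psi> assume \<phi>: "has_pd j \<phi> \<psi>" "\<forall>t. g \<bullet> tr (axis j t) \<phi> = - (u \<bullet> tr (axis j t) \<psi>)"
      have der: "((\<lambda>t. tr (axis j t) u \<bullet> \<phi>) has_vector_derivative tr (axis j s) g \<bullet> \<phi>) (at s within S)" for s S
      proof -
        have "((\<lambda>t. tr (axis j t) \<phi>) has_derivative (\<lambda>h. h *\<^sub>R tr (axis j (- s)) \<psi>)) (at (- s))"
          using has_pd_vector_derivative[OF \<phi>(1)] by (simp add: has_vector_derivative_def)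
        moreover have "((\<lambda>t. - t) has_derivative (\<lambda>h. - h)) (at s within S)"
          by (auto intro!: derivative_eq_intros)
        ultimately have "((\<lambda>t. tr (axis j (- t)) \<phi>) has_derivative (\<lambda>h. (- h) *\<^sub>R tr (axis j (- s)) \<psi>)) (at s within S)"
          by (rule has_derivative_compose[rotated])
        from has_derivative_inner_right[OF this, of u]
        have "((\<lambda>t. u \<bullet> tr (axis j (- t)) \<phi>) has_derivative (\<lambda>h. h * (g \<bullet> tr (axis j (- s)) \<phi>))) (at s within S)"
          using \<phi>(2) by simp
        then show ?thesis
          by (simp add: has_vector_derivative_def inner_tr_left axis_minus)
      qed
      have "norm (tr (axis j t) u \<bullet> \<phi> - tr (axis j 0) u \<bullet> \<phi> - (t - 0) *\<^sub>R (tr (axis j 0) g \<bullet> \<phi>))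
          \<le> norm (t - 0) * (e/2 * norm \<phi>)"
      proof (rule vector_differentiable_bound_linearization[where S = "closed_segment 0 t" and ?x0.0 = 0])
        show "norm (tr (axis j s) g \<bullet> \<phi> - tr (axis j 0) g \<bullet> \<phi>) \<le> e/2 * norm \<phi>" if "s \<in> closed_segment 0 t" for s
        proof -
          have s: "\<bar>s\<bar> < d" using that t by (auto simp: closed_segment_eq_real_ivl split: if_splits)
          have "norm (tr (axis j s) g \<bullet> \<phi> - tr (axis j 0) g \<bullet> \<phi>) = \<bar>(tr (axis j s) g - g) \<bullet> \<phi>\<bar>"
            by (simp add: inner_diff_left)
          also have "\<dots> \<le> norm (tr (axis j s) g - g) * norm \<phi>" by (rule Cauchy_Schwarz_ineq2)
          also have "\<dots> \<le> e/2 * norm \<phi>" by (intro mult_right_mono small[OF s]) auto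
          finally show ?thesis .
        qed
      qed (use der in auto)
      then show "\<bar>(tr (axis j t) u - u - t *\<^sub>R g) \<bullet> \<phi>\<bar> \<le> \<bar>t\<bar> * (e/2) * norm \<phi>"
        by (simp add: inner_diff_left)
    qed
    moreover have "closed ?C" by (intro closed_Collect_le continuous_intros)
    ultimately have "closure ?D \<subseteq> ?C" by (rule closure_minimal)
    then show ?thesis using D by blast
  qed
  have "norm ((tr (axis j t) u - u) /\<^sub>R t - g) < e" if "t \<noteq> 0" "norm (t - 0) < d" for t
  proof -
    let ?w = "tr (axis j t) u - u - t *\<^sub>R g"
    \<comment> \<open>The linearisation error is tested against itself.\<close>
    have "norm ?w * norm ?w \<le> \<bar>t\<bar> * (e/2) * norm ?w"
      using main[of t ?w] that by (simp add: power2_norm_eq_inner[symmetric] power2_eq_square)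
    then have w: "norm ?w \<le> \<bar>t\<bar> * (e/2)"
      using e by (cases "?w = 0") (auto simp: mult_le_cancel_right)
    have "(tr (axis j t) u - u) /\<^sub>R t - g = ?w /\<^sub>R t" using that by (simp add: scaleR_diff_right)
    then have "norm ((tr (axis j t) u - u) /\<^sub>R t - g) = norm ?w / \<bar>t\<bar>"
      by (simp only: norm_scaleR) (simp add: divide_inverse mult.commute)
    also have "\<dots> \<le> e/2" using w that by (simp add: divide_le_eq mult.commute)
    finally show ?thesis using e by simp
  qed
  then show "\<exists>s>0. \<forall>t. t \<noteq> 0 \<and> norm (t - 0) < s \<longrightarrow> norm ((tr (axis j t) u - u) /\<^sub>R t - g) < e"
    using d(1) by blast
qed

text \<open>Translates of test functions are test functions, so the condition at t = 0 already
  contains the one for all t.\<close>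

lemma has_pd_weak_testI:
  assumes "\<And>k \<phi>. test_fun \<phi> \<Longrightarrow> g \<bullet> cls (tv k \<phi>) = - (u \<bullet> cls (tv k (pderiv3 \<phi> j)))"
  shows "has_pd j u g"
proof (rule has_pd_weakI, rule closure_UNIV_if_contains_test)
  let ?D = "{\<phi>. \<exists>\<psi>. has_pd j \<phi> \<psi> \<and> (\<forall>t. g \<bullet> tr (axis j t) \<phi> = - (u \<bullet> tr (axis j t) \<psi>))}"
  show "subspace ?D"
  proof (rule subspaceI)
    show "0 \<in> ?D" by (auto intro: exI[of _ 0] has_pd_zero)
    show "x + y \<in> ?D" if "x \<in> ?D" "y \<in> ?D" for x y
      using that by (force intro: has_pd_add simp: tr_add inner_add_right)
    show "c *\<^sub>R x \<in> ?D" if "x \<in> ?D" for c x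
      using that by (force intro: has_pd_scaleR simp: tr_scaleR)
  qed
  show "cls (tv k \<phi>) \<in> ?D" if "test_fun \<phi>" for k \<phi>
  proof -
    have "g \<bullet> tr (axis j t) (cls (tv k \<phi>)) = - (u \<bullet> tr (axis j t) (cls (tv k (pderiv3 \<phi> j))))" for t
    proof -
      have "pderiv3 (\<lambda>x. \<phi> (x + axis j t)) j = (\<lambda>x. pderiv3 \<phi> j (x + axis j t))"
        using pderiv3_translate[OF that] by blast
      then show ?thesis
        using assms[OF test_fun_translate[OF that, of "axis j t"], of k] that
        by (simp add: tr_cls_tv test_fun_pderiv3)
    qed
    then show ?thesis using has_pd_test[OF that, of j k] by blast
  qed
qed

text \<open>In the weak form only inner products occur, and these pass to the limit.\<close>

lemma has_pd_closed:
  assumes "\<And>n. has_pd j (U n) (G n)" "U \<longlonglongrightarrow> u" "G \<longlonglongrightarrow> g"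
  shows "has_pd j u g"
proof (rule has_pd_weak_testI)
  fix k \<phi> assume \<phi>: "test_fun \<phi>"
  have "(\<lambda>n. G n \<bullet> cls (tv k \<phi>)) \<longlonglongrightarrow> g \<bullet> cls (tv k \<phi>)"
    by (intro tendsto_intros assms)
  moreover have "(\<lambda>n. - (U n \<bullet> cls (tv k (pderiv3 \<phi> j)))) \<longlonglongrightarrow> - (u \<bullet> cls (tv k (pderiv3 \<phi> j)))"
    by (intro tendsto_intros assms)
  moreover have "G n \<bullet> cls (tv k \<phi>) = - (U n \<bullet> cls (tv k (pderiv3 \<phi> j)))" for n
    by (rule has_pd_skew[OF assms(1) has_pd_test[OF \<phi>]])
  ultimately show "g \<bullet> cls (tv k \<phi>) = - (u \<bullet> cls (tv k (pderiv3 \<phi> j)))"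
    by (simp only:) (rule LIMSEQ_unique)
qed

lemma pderiv3_scale: "test_fun \<phi> \<Longrightarrow> pderiv3 (\<lambda>x. c * \<phi> x) j = (\<lambda>x. c * pderiv3 \<phi> j x)"
proof
  fix x
  assume "test_fun \<phi>"
  then have "(\<phi> has_derivative frechet_derivative \<phi> (at x)) (at x)"
    by (intro frechet_derivative_works[THEN iffD1] smooth3_differentiable) (simp add: test_fun_def)
  from frechet_derivative_at[OF has_derivative_mult_right[OF this, of c]]
  show "pderiv3 (\<lambda>x. c * \<phi> x) j x = c * pderiv3 \<phi> j x"
    unfolding pderiv3_def by metis
qed

text \<open>The bridge to the definitions of the theorem. Real parts come from
  \<open>has_pd_skew\<close> in one direction and enter \<open>has_pd_weak_testI\<close> in the
  other; imaginary parts come from the test function i\<phi>.\<close>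

lemma has_pd_iff_weak_deriv:
  assumes u: "square_integrable u" and g: "square_integrable g"
  shows "has_pd j (cls u) (cls g) \<longleftrightarrow> weak_deriv u j g"
proof
  assume "weak_deriv u j g"
  then show "has_pd j (cls u) (cls g)"
    by (intro has_pd_weak_testI)
      (simp add: inner_cls_tv u g test_fun_pderiv3 weak_deriv_def)
next
  assume pd: "has_pd j (cls u) (cls g)"
  have re: "Re (\<integral>x. g x $ k * \<phi> x \<partial>lborel) = - Re (\<integral>x. u x $ k * pderiv3 \<phi> j x \<partial>lborel)"
    if "test_fun \<phi>" for k \<phi>
    using has_pd_skew[OF pd has_pd_test[OF that, of j k]] that
    by (simp add: inner_cls_tv u g test_fun_pderiv3)
  have "(\<integral>x. u x $ k * pderiv3 \<phi> j x \<partial>lborel) = - (\<integral>x. g x $ k * \<phi> x \<partial>lborel)"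
    if \<phi>: "test_fun \<phi>" for k \<phi>
  proof -
    have "(\<integral>x. g x $ k * (\<i> * \<phi> x) \<partial>lborel) = \<i> * (\<integral>x. g x $ k * \<phi> x \<partial>lborel)"
      "(\<integral>x. u x $ k * (\<i> * pderiv3 \<phi> j x) \<partial>lborel) = \<i> * (\<integral>x. u x $ k * pderiv3 \<phi> j x \<partial>lborel)"
      by (simp_all flip: integral_mult_right_zero add: mult_ac)
    then show ?thesis
      using re[OF \<phi>, of k] re[OF test_fun_scale[OF \<phi>, of \<i>], of k] pderiv3_scale[OF \<phi>, of \<i> j]
      by (simp add: complex_eq_iff)
  qed
  then show "weak_deriv u j g"
    by (simp add: weak_deriv_def loc_int_square_integrable u g)
qed

lemma loc_int_test_integrable:
  assumes "loc_int g" "test_fun \<phi>"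
  shows "integrable lborel (\<lambda>x. g x $ k * \<phi> x)"
proof -
  let ?K = "closure {x. \<phi> x \<noteq> 0}"
  obtain B where B: "\<And>x. norm (\<phi> x) \<le> B" using test_fun_bounded[OF assms(2)] by blast
  have "set_integrable lborel ?K (\<lambda>x. g x $ k)"
    using assms by (simp add: loc_int_def test_fun_def)
  then have i: "integrable lborel (\<lambda>x. indicator ?K x *\<^sub>R g x $ k)" by (simp add: set_integrable_def)
  have [measurable]: "\<phi> \<in> borel_measurable borel" by (rule test_fun_measurable[OF assms(2)])
  have "integrable lborel (\<lambda>x. (indicator ?K x *\<^sub>R g x $ k) * \<phi> x)"
  proof (rule Bochner_Integration.integrable_bound[OF integrable_mult_right[OF integrable_norm[OF i], of B]])
    show "AE x in lborel. norm (indicator ?K x *\<^sub>R g x $ k * \<phi> x) \<le> norm (B * norm (indicator ?K x *\<^sub>R g x $ k))"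
    proof (rule AE_I2)
      fix x
      have "norm (indicator ?K x *\<^sub>R g x $ k) * norm (\<phi> x) \<le> norm (indicator ?K x *\<^sub>R g x $ k) * \<bar>B\<bar>"
        using B[of x] by (intro mult_left_mono) auto
      then show "norm (indicator ?K x *\<^sub>R g x $ k * \<phi> x) \<le> norm (B * norm (indicator ?K x *\<^sub>R g x $ k))"
        by (simp add: norm_mult abs_mult mult_ac)
    qed
    show "(\<lambda>x. indicator ?K x *\<^sub>R g x $ k * \<phi> x) \<in> borel_measurable lborel"
      using borel_measurable_integrable[OF i] by measurable
  qed
  moreover have "(indicator ?K x *\<^sub>R g x $ k) * \<phi> x = g x $ k * \<phi> x" for x
    using closure_subset[of "{x. \<phi> x \<noteq> 0}"] by (cases "\<phi> x = 0") (auto simp: indicator_def)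
  ultimately show ?thesis by (simp only:)
qed

lemma weak_deriv_unique:
  assumes "weak_deriv u j g" "weak_deriv u j h"
  shows "AE x in lborel. g x = h x"
proof -
  have "AE x in lborel. g x $ k - h x $ k = 0" for k
  proof (rule AE_zero_if_test_orthogonal)
    show "set_integrable lborel K (\<lambda>x. g x $ k - h x $ k)" if "compact K" for K
      using assms that by (intro set_integral_diff) (auto simp: weak_deriv_def loc_int_def)
    show "(\<integral>x. (g x $ k - h x $ k) * \<phi> x \<partial>lborel) = 0" if "test_fun \<phi>" for \<phi>
    proof -
      have "(\<integral>x. g x $ k * \<phi> x \<partial>lborel) = (\<integral>x. h x $ k * \<phi> x \<partial>lborel)"
        using assms that by (simp add: weak_deriv_def)
      moreover have "integrable lborel (\<lambda>x. g x $ k * \<phi> x)" "integrable lborel (\<lambda>x. h x $ k * \<phi> x)"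
        using assms that by (auto intro: loc_int_test_integrable simp: weak_deriv_def)
      ultimately show ?thesis by (simp add: left_diff_distrib)
    qed
  qed
  then have "AE x in lborel. \<forall>k. g x $ k - h x $ k = 0" by (intro eventually_all_finite)
  then show ?thesis by (auto elim!: eventually_mono simp: vec_eq_iff)
qed

section \<open>The free Dirac operator and its resolvent\<close>

text \<open>The Sobolev space H^1, the common domain of \<alpha>\<cdot>D and H.\<close>

definition W1 :: "l2 \<Rightarrow> bool" where "W1 u \<longleftrightarrow> (\<forall>j. \<exists>g. has_pd j u g)"
definition pd :: "3 \<Rightarrow> l2 \<Rightarrow> l2" where "pd j u = (THE g. has_pd j u g)"

lemma pd_eq: "has_pd j u g \<Longrightarrow> pd j u = g"
  unfolding pd_def by (blast intro: has_pd_unique)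

lemma W1_has_pd: "W1 u \<Longrightarrow> has_pd j u (pd j u)"
  using pd_eq unfolding W1_def by metis

lemma W1I: "(\<And>j. has_pd j u (g j)) \<Longrightarrow> W1 u"
  by (auto simp: W1_def)

lemma W1_add: "W1 u \<Longrightarrow> W1 v \<Longrightarrow> W1 (u + v)"
  and pd_add: "W1 u \<Longrightarrow> W1 v \<Longrightarrow> pd j (u + v) = pd j u + pd j v"
  by (auto intro: W1I[OF has_pd_add[OF W1_has_pd W1_has_pd]] pd_eq[OF has_pd_add[OF W1_has_pd W1_has_pd]])

lemma W1_diff: "W1 u \<Longrightarrow> W1 v \<Longrightarrow> W1 (u - v)"
  and pd_diff: "W1 u \<Longrightarrow> W1 v \<Longrightarrow> pd j (u - v) = pd j u - pd j v"
  by (auto intro: W1I[OF has_pd_diff[OF W1_has_pd W1_has_pd]] pd_eq[OF has_pd_diff[OF W1_has_pd W1_has_pd]])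

lemma W1_scaleR: "W1 u \<Longrightarrow> W1 (c *\<^sub>R u)"
  and pd_scaleR: "W1 u \<Longrightarrow> pd j (c *\<^sub>R u) = c *\<^sub>R pd j u"
  by (auto intro: W1I[OF has_pd_scaleR[OF W1_has_pd]] pd_eq[OF has_pd_scaleR[OF W1_has_pd]])

lemma W1_cm: "W1 u \<Longrightarrow> W1 (cm A u)"
  and pd_cm: "W1 u \<Longrightarrow> pd j (cm A u) = cm A (pd j u)"
  by (auto intro: W1I[OF has_pd_cm[OF W1_has_pd]] pd_eq[OF has_pd_cm[OF W1_has_pd]])

lemma W1_cs: "W1 u \<Longrightarrow> W1 (cs z u)"
  and pd_cs: "W1 u \<Longrightarrow> pd j (cs z u) = cs z (pd j u)"
  by (auto intro: W1I[OF has_pd_cs[OF W1_has_pd]] pd_eq[OF has_pd_cs[OF W1_has_pd]])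

lemma W1_tr: "W1 u \<Longrightarrow> W1 (tr h u)"
  and pd_tr: "W1 u \<Longrightarrow> pd j (tr h u) = tr h (pd j u)"
  by (auto intro: W1I[OF has_pd_tr[OF W1_has_pd]] pd_eq[OF has_pd_tr[OF W1_has_pd]])

lemma W1_zero: "W1 0"
  by (rule W1I[OF has_pd_zero])

lemma W1_test: "test_fun \<phi> \<Longrightarrow> W1 (cls (tv k \<phi>))"
  by (rule W1I[OF has_pd_test])

lemma adj4_mult: "adj4 (A ** B) = adj4 B ** adj4 A"
  by (simp add: adj4_def matrix_matrix_mult_def vec_eq_iff mult.commute)

lemma cm_matrix_uminus: "A + B = 0 \<Longrightarrow> cm A u = - cm B u"
proof -
  assume "A + B = 0"
  then have "cm A u + cm B u = cm 0 u" by (simp flip: cm_matrix_add)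
  also have "\<dots> = 0"
    using cm_matrix_add[of 0 0 u] by simp
  finally show ?thesis by (simp add: eq_neg_iff_add_eq_0)
qed

lemma cs_minus_left: "cs (- z) u = - cs z u"
proof -
  have "cs (- z) u = cs (complex_of_real (-1)) (cs z u)" by (simp add: cs_cs)
  then show ?thesis by (simp only: cs_of_real) simp
qed

definition aD :: "l2 \<Rightarrow> l2" where
  "aD u = (\<Sum>j\<in>UNIV. cm (alpha j) (cs (- \<i>) (pd j u)))"

definition Hm :: "real \<Rightarrow> l2 \<Rightarrow> l2" where
  "Hm m u = aD u + m *\<^sub>R cm beta u"

lemma aD_add: "W1 u \<Longrightarrow> W1 v \<Longrightarrow> aD (u + v) = aD u + aD v"
  by (simp add: aD_def pd_add cs_add cm_add sum.distrib)

lemma aD_diff: "W1 u \<Longrightarrow> W1 v \<Longrightarrow> aD (u - v) = aD u - aD v"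
  by (simp add: aD_def pd_diff cs_diff cm_diff sum_subtractf)

lemma aD_scaleR: "W1 u \<Longrightarrow> aD (c *\<^sub>R u) = c *\<^sub>R aD u"
  by (simp add: aD_def pd_scaleR cs_scaleR cm_scaleR scaleR_sum_right)

lemma aD_cs: "W1 u \<Longrightarrow> aD (cs z u) = cs z (aD u)"
  by (simp add: aD_def pd_cs cs_sum cs_cm cs_cs mult.commute)

lemma aD_tr: "W1 u \<Longrightarrow> aD (tr h u) = tr h (aD u)"
  by (simp add: aD_def pd_tr tr_cs tr_cm linear_sum[OF bounded_linear.linear[OF bounded_linear_tr]])

lemma aD_beta: "W1 u \<Longrightarrow> aD (cm beta u) = - cm beta (aD u)"
  by (simp add: aD_def pd_cm cm_sum cs_cm cm_cm cm_matrix_uminus[OF alpha_beta_anticommute] sum_negf)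

lemma aD_symmetric:
  assumes "W1 u" "W1 v"
  shows "aD u \<bullet> v = u \<bullet> aD v"
proof -
  have "cm (alpha j) (cs (- \<i>) (pd j u)) \<bullet> v = u \<bullet> cm (alpha j) (cs (- \<i>) (pd j v))" for j
  proof -
    have "cm (alpha j) (cs (- \<i>) (pd j u)) \<bullet> v = pd j u \<bullet> cs \<i> (cm (alpha j) v)"
      by (simp add: inner_cm inner_cs)
    also have "\<dots> = - (u \<bullet> cs \<i> (cm (alpha j) (pd j v)))"
      by (intro has_pd_skew[of j] has_pd_cs has_pd_cm W1_has_pd assms)
    also have "\<dots> = u \<bullet> cm (alpha j) (cs (- \<i>) (pd j v))"
      by (simp add: cs_cm cs_minus_left cm_uminus)
    finally show ?thesis .
  qed
  then show ?thesis by (simp add: aD_def inner_sum_left inner_sum_right)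
qed

text \<open>This is the square of \<alpha>\<cdot>D being minus the Laplacian, read as a quadratic
  form. Each off-diagonal term equals its own negative: \<open>has_pd_swap\<close> exchanges the
  derivatives and the matrices anticommute. Consequently \<alpha>\<cdot>D controls every first
  derivative.\<close>

lemma norm_aD_sq:
  assumes "W1 u"
  shows "(norm (aD u))\<^sup>2 = (\<Sum>j\<in>UNIV. (norm (pd j u))\<^sup>2)"
proof -
  define q where "q j k = cm (alpha j) (cs (- \<i>) (pd j u)) \<bullet> cm (alpha k) (cs (- \<i>) (pd k u))" for j k
  have q: "q j k = pd j u \<bullet> cm (alpha j ** alpha k) (pd k u)" for j k
    by (simp add: q_def inner_cm inner_cs cs_cm[symmetric] cs_cs cm_cm)
  have diag: "q j j = (norm (pd j u))\<^sup>2" for j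
    using cs_one[of "pd j u"] unfolding q alpha_sq by (simp add: cs_def power2_norm_eq_inner)
  have off: "q j k = 0" if "j \<noteq> k" for j k
  proof -
    let ?C = "alpha j ** alpha k"
    have "pd j u \<bullet> cm ?C (pd k u) = pd k u \<bullet> cm ?C (pd j u)"
      using assms by (intro has_pd_swap[of j u _ k _ "cm ?C u"] has_pd_cm W1_has_pd)
    also have "\<dots> = pd j u \<bullet> cm (alpha k ** alpha j) (pd k u)"
      by (subst inner_commute) (simp add: inner_cm adj4_mult)
    also have "\<dots> = - (pd j u \<bullet> cm ?C (pd k u))"
      using cm_matrix_uminus[OF alpha_anticommute[OF that[symmetric]]] by simp
    finally show ?thesis by (simp add: q)
  qed
  have "(norm (aD u))\<^sup>2 = (\<Sum>j\<in>UNIV. \<Sum>k\<in>UNIV. q j k)"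
    by (simp add: power2_norm_eq_inner aD_def inner_sum_left inner_sum_right q_def) (rule sum.swap)
  also have "\<dots> = (\<Sum>j\<in>UNIV. \<Sum>k\<in>UNIV. if k = j then (norm (pd j u))\<^sup>2 else 0)"
    by (intro sum.cong refl) (auto simp: diag off)
  finally show ?thesis by simp
qed

lemma norm_pd_le: "W1 u \<Longrightarrow> norm (pd j u) \<le> norm (aD u)"
proof -
  assume "W1 u"
  then have "(norm (pd j u))\<^sup>2 \<le> (norm (aD u))\<^sup>2"
    unfolding norm_aD_sq[OF \<open>W1 u\<close>] by (intro member_le_sum) auto
  then show ?thesis by (rule power2_le_imp_le) simp
qed

text \<open>Applied to differences, \<open>norm_pd_le\<close> makes each sequence of partial
  derivatives Cauchy, so closedness is inherited from \<open>has_pd_closed\<close>.\<close>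

lemma aD_closed:
  assumes "\<And>n. W1 (U n)" "U \<longlonglongrightarrow> u" "(\<lambda>n. aD (U n)) \<longlonglongrightarrow> f"
  shows "W1 u" "aD u = f"
proof -
  have "\<exists>g. (\<lambda>n. pd j (U n)) \<longlonglongrightarrow> g" for j
  proof -
    have "Cauchy (\<lambda>n. aD (U n))" using assms(3) by (rule LIMSEQ_imp_Cauchy)
    moreover have "dist (pd j (U m)) (pd j (U n)) \<le> dist (aD (U m)) (aD (U n))" for m n
      using norm_pd_le[OF W1_diff[OF assms(1,1)], of j m n]
      by (simp add: dist_norm pd_diff aD_diff assms(1))
    ultimately have "Cauchy (\<lambda>n. pd j (U n))"
      unfolding Cauchy_def by (meson le_less_trans)
    then show ?thesis by (simp add: Cauchy_convergent_iff convergent_def)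
  qed
  then obtain g where g: "\<And>j. (\<lambda>n. pd j (U n)) \<longlonglongrightarrow> g j" by metis
  have pdu: "has_pd j u (g j)" for j
    by (rule has_pd_closed[OF W1_has_pd[OF assms(1)] assms(2) g])
  then show "W1 u" by (rule W1I)
  have "(\<lambda>n. aD (U n)) \<longlonglongrightarrow> (\<Sum>j\<in>UNIV. cm (alpha j) (cs (- \<i>) (g j)))"
    unfolding aD_def
    by (intro tendsto_sum bounded_linear.tendsto[OF bounded_linear_cm] bounded_linear.tendsto[OF bounded_linear_cs] g)
  then show "aD u = f"
    using assms(3) LIMSEQ_unique by (simp add: aD_def pd_eq[OF pdu]) blast
qed

lemma Hm_diff: "W1 u \<Longrightarrow> W1 v \<Longrightarrow> Hm m (u - v) = Hm m u - Hm m v"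
  by (simp add: Hm_def aD_diff cm_diff algebra_simps)

lemma Hm_add: "W1 u \<Longrightarrow> W1 v \<Longrightarrow> Hm m (u + v) = Hm m u + Hm m v"
  by (simp add: Hm_def aD_add cm_add algebra_simps)

lemma Hm_scaleR: "W1 u \<Longrightarrow> Hm m (c *\<^sub>R u) = c *\<^sub>R Hm m u"
  by (simp add: Hm_def aD_scaleR cm_scaleR algebra_simps)

lemma Hm_cs: "W1 u \<Longrightarrow> Hm m (cs z u) = cs z (Hm m u)"
  by (simp add: Hm_def aD_cs cs_add cs_scaleR cs_cm)

lemma Hm_tr: "W1 u \<Longrightarrow> Hm m (tr h u) = tr h (Hm m u)"
  by (simp add: Hm_def aD_tr tr_add tr_scaleR tr_cm)

lemma Hm_symmetric: "W1 u \<Longrightarrow> W1 v \<Longrightarrow> Hm m u \<bullet> v = u \<bullet> Hm m v"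
  by (simp add: Hm_def inner_add_left inner_add_right aD_symmetric inner_cm)

lemma Hm_beta: "W1 u \<Longrightarrow> Hm m (cm beta u) = - cm beta (Hm m u) + (2 * m) *\<^sub>R u"
proof -
  assume "W1 u"
  have "cm beta (cm beta u) = u" using cs_one[of u] by (simp add: cm_cm beta_sq cs_def)
  moreover have "(2 * m) *\<^sub>R u = m *\<^sub>R u + m *\<^sub>R u" by (simp flip: scaleR_add_left)
  ultimately show ?thesis using \<open>W1 u\<close>
    by (simp add: Hm_def aD_beta cm_add cm_scaleR)
qed

lemma Hm_cs_i_self: "W1 u \<Longrightarrow> Hm m u \<bullet> cs \<i> u = 0"
proof -
  assume u: "W1 u"
  have "Hm m u \<bullet> cs \<i> u = u \<bullet> cs \<i> (Hm m u)"
    by (simp add: Hm_symmetric[OF u W1_cs[OF u]] Hm_cs[OF u])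
  also have "\<dots> = cs (- \<i>) u \<bullet> Hm m u" by (simp add: inner_cs)
  also have "\<dots> = - (Hm m u \<bullet> cs \<i> u)" by (simp add: cs_minus_left inner_commute)
  finally show ?thesis by simp
qed

text \<open>The imaginary part of <(H - z) u, u>. It gives the bound 1 / |Im z| for the resolvent,
  and for (H - z) u = f it is the identity on which the function \<open>G\<close> in
  \<open>res_bounded\<close> rests.\<close>

lemma Hm_shift_inner_cs_i:
  assumes "W1 u"
  shows "cs \<i> (Hm m u - cs z u) \<bullet> u = Im z * (norm u)\<^sup>2"
proof -
  have "cs \<i> u \<bullet> cs \<i> u = (norm u)\<^sup>2"
    using norm_cs[of \<i> u] by (simp flip: power2_norm_eq_inner)
  moreover have "cs z u \<bullet> cs \<i> u = Im z * (cs \<i> u \<bullet> cs \<i> u)"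
    by (subst cs_eq) (simp add: inner_add_left inner_commute[of u])
  ultimately have "(Hm m u - cs z u) \<bullet> cs \<i> u = - (Im z * (norm u)\<^sup>2)"
    using Hm_cs_i_self[OF assms] by (simp add: inner_diff_left)
  then show ?thesis by (simp add: inner_cs cs_minus_left)
qed

lemma Hm_shift_lower_bound:
  assumes "W1 u"
  shows "\<bar>Im z\<bar> * norm u \<le> norm (Hm m u - cs z u)"
proof -
  have "\<bar>Im z\<bar> * (norm u)\<^sup>2 = \<bar>cs \<i> (Hm m u - cs z u) \<bullet> u\<bar>"
    by (simp add: Hm_shift_inner_cs_i[OF assms] abs_mult)
  also have "\<dots> \<le> norm (cs \<i> (Hm m u - cs z u)) * norm u" by (rule Cauchy_Schwarz_ineq2)
  finally have "\<bar>Im z\<bar> * norm u * norm u \<le> norm (Hm m u - cs z u) * norm u"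
    by (simp add: norm_cs power2_eq_square)
  then show ?thesis by (cases "u = 0") auto
qed

section \<open>Averages along the axes: a regularisation that commutes with H\<close>

definition av :: "3 \<Rightarrow> real \<Rightarrow> l2 \<Rightarrow> l2" where
  "av j h u = (1 / (2 * h)) *\<^sub>R integral {-h..h} (\<lambda>s. tr (axis j s) u)"

lemma tr_axis_integrable: "(\<lambda>s. tr (axis j s) u) integrable_on {a..b}"
  by (intro integrable_continuous_interval continuous_on_tr_axis)

lemma av_commuting:
  assumes "bounded_linear T" "\<And>t w. tr (axis j t) (T w) = T (tr (axis j t) w)"
  shows "av j h (T u) = T (av j h u)"
proof -
  interpret T: bounded_linear T by fact
  show ?thesis
    using integral_linear[OF tr_axis_integrable[of j u "-h" h] assms(1)]
    by (simp add: av_def assms(2) o_def T.scaleR)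
qed

lemma norm_av_le: "h > 0 \<Longrightarrow> norm (av j h u) \<le> norm u"
proof -
  assume h: "h > 0"
  have "norm (integral {-h..h} (\<lambda>s. tr (axis j s) u)) \<le> norm u * (h - (-h))"
    using h by (intro integral_bound continuous_on_tr_axis) auto
  then show ?thesis using h by (simp add: av_def field_simps)
qed

lemma bounded_linear_av: "h > 0 \<Longrightarrow> bounded_linear (av j h)"
proof (rule bounded_linear_intro[of _ 1])
  show "av j h (x + y) = av j h x + av j h y" for x y
    by (simp add: av_def tr_add integral_add[OF tr_axis_integrable tr_axis_integrable] scaleR_add_right)
  show "av j h (r *\<^sub>R x) = r *\<^sub>R av j h x" for r x
    by (rule av_commuting) (auto simp: tr_scaleR intro: bounded_linear_scaleR_right)
qed (simp add: norm_av_le)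

lemma inner_av: "av j h u \<bullet> v = u \<bullet> av j h v"
proof -
  have "integral {-h..h} (\<lambda>s. tr (axis j s) u) \<bullet> v = integral {-h..h} (\<lambda>s. tr (axis j s) u \<bullet> v)"
    using integral_linear[OF tr_axis_integrable[of j u "-h" h] bounded_linear_inner_left[of v]] by (simp add: o_def)
  also have "\<dots> = integral {-h..h} (\<lambda>s. u \<bullet> tr (axis j (- s)) v)"
    by (simp add: inner_tr_left axis_minus)
  also have "\<dots> = integral {-h..h} (\<lambda>s. u \<bullet> tr (axis j s) v)"
    using Henstock_Kurzweil_Integration.integral_reflect_real[of h "-h" "\<lambda>s. u \<bullet> tr (axis j s) v"] by simp
  also have "\<dots> = u \<bullet> integral {-h..h} (\<lambda>s. tr (axis j s) v)"
    using integral_linear[OF tr_axis_integrable[of j v "-h" h] bounded_linear_inner_right[of u]] by (simp add: o_def)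
  finally show ?thesis by (simp add: av_def)
qed

text \<open>One average gains one derivative. The fundamental theorem of calculus is applied to
  translates of the test field, where a derivative exists; the average is self-adjoint because its
  interval is symmetric, which transfers the result to \<open>u\<close>.\<close>

lemma has_pd_av:
  assumes "h > 0"
  shows "has_pd j (av j h u) ((1 / (2 * h)) *\<^sub>R (tr (axis j h) u - tr (axis j (- h)) u))"
proof (rule has_pd_weak_testI)
  fix k \<phi> assume \<phi>: "test_fun \<phi>"
  let ?p = "cls (tv k \<phi>)" and ?q = "cls (tv k (pderiv3 \<phi> j))"
  have "((\<lambda>s. tr (axis j s) ?q) has_integral (tr (axis j h) ?p - tr (axis j (- h)) ?p)) {-h..h}"
    using assms has_pd_vector_derivative[OF has_pd_test[OF \<phi>]]
    by (intro fundamental_theorem_of_calculus) (auto intro: has_vector_derivative_at_within)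
  then have "av j h ?q = (1 / (2 * h)) *\<^sub>R (tr (axis j h) ?p - tr (axis j (- h)) ?p)"
    by (simp add: av_def integral_unique)
  then show "(1 / (2 * h)) *\<^sub>R (tr (axis j h) u - tr (axis j (- h)) u) \<bullet> ?p = - (av j h u \<bullet> ?q)"
    by (simp add: inner_av inner_diff_left inner_diff_right inner_tr_left axis_minus right_diff_distrib)
qed

lemma has_pd_av_other: "h > 0 \<Longrightarrow> has_pd j u g \<Longrightarrow> has_pd j (av k h u) (av k h g)"
  by (rule has_pd_commuting[OF _ bounded_linear_av])
    (auto intro!: av_commuting[symmetric] bounded_linear_tr simp: tr_tr add.commute)

lemma av_eq_zero:
  assumes "\<And>h. h > 0 \<Longrightarrow> av j h u = 0"
  shows "u = 0"
proof -
  have "norm u \<le> e" if e: "e > 0" for e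
  proof -
    obtain d where d: "d > 0" "\<And>t. t \<noteq> 0 \<Longrightarrow> norm (t - 0) < d \<Longrightarrow> norm (tr (axis j t) u - u) < e"
      using LIM_D[OF tr_axis_tendsto[of j u] e] by auto
    define h where "h = d / 2"
    have h: "h > 0" using d by (simp add: h_def)
    have "integral {-h..h} (\<lambda>s. tr (axis j s) u - u) = integral {-h..h} (\<lambda>s. tr (axis j s) u) - integral {-h..h} (\<lambda>s. u)"
      by (rule Henstock_Kurzweil_Integration.integral_diff[OF tr_axis_integrable]) auto
    then have "integral {-h..h} (\<lambda>s. tr (axis j s) u - u) = - (2 * h) *\<^sub>R u"
      using assms[OF h] h by (simp add: av_def)
    moreover have "norm (integral {-h..h} (\<lambda>s. tr (axis j s) u - u)) \<le> e * (h - (-h))"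
    proof (rule integral_bound)
      show "norm (tr (axis j s) u - u) \<le> e" if "s \<in> {-h..h}" for s
      proof -
        have "\<bar>s\<bar> < d" using that d(1) by (auto simp: h_def)
        then show ?thesis using d(2)[of s] e by (cases "s = 0") auto
      qed
    qed (use h in \<open>auto intro!: continuous_intros continuous_on_tr_axis\<close>)
    ultimately show ?thesis using h by (simp add: field_simps)
  qed
  then have "norm u \<le> 0" by (metis dense_ge)
  then show ?thesis by simp
qed

text \<open>One average per coordinate, so that all three first derivatives exist. The lengths are
  independent, which lets \<open>smooth_av_eq_zero\<close> remove the averages one at a
  time.\<close>

definition smooth_av :: "real \<Rightarrow> real \<Rightarrow> real \<Rightarrow> l2 \<Rightarrow> l2" where
  "smooth_av a b c u = av 1 a (av 2 b (av 3 c u))"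

lemma smooth_av_W1:
  assumes "a > 0" "b > 0" "c > 0"
  shows "W1 (smooth_av a b c u)"
proof -
  have "\<exists>g. has_pd j (smooth_av a b c u) g" for j
    using exhaust_3[of j] has_pd_av[OF assms(1), of 1 "av 2 b (av 3 c u)"]
      has_pd_av_other[OF assms(1) has_pd_av[OF assms(2), of 2 "av 3 c u"], of 1]
      has_pd_av_other[OF assms(1) has_pd_av_other[OF assms(2) has_pd_av[OF assms(3), of 3 u]], of 1 2]
    unfolding smooth_av_def by metis
  then show ?thesis by (simp add: W1_def)
qed

lemma smooth_av_commuting:
  assumes "bounded_linear T" "\<And>t w. tr t (T w) = T (tr t w)"
  shows "smooth_av a b c (T u) = T (smooth_av a b c u)"
  by (simp add: smooth_av_def av_commuting[OF assms(1)] assms(2))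

lemma bounded_linear_smooth_av:
  assumes "a > 0" "b > 0" "c > 0"
  shows "bounded_linear (smooth_av a b c)"
  using bounded_linear_compose[OF bounded_linear_av[OF assms(1), of 1]
      bounded_linear_compose[OF bounded_linear_av[OF assms(2), of 2] bounded_linear_av[OF assms(3), of 3]]]
  by (simp add: smooth_av_def[abs_def])

lemma av_av_commute: "b > 0 \<Longrightarrow> av j a (av k b u) = av k b (av j a u)"
  by (rule av_commuting[OF bounded_linear_av])
    (auto intro!: av_commuting[symmetric] bounded_linear_tr simp: tr_tr add.commute)

lemma inner_smooth_av:
  assumes "a > 0" "b > 0" "c > 0"
  shows "smooth_av a b c u \<bullet> v = u \<bullet> smooth_av a b c v"
proof -
  have "smooth_av a b c u \<bullet> v = u \<bullet> av 3 c (av 2 b (av 1 a v))"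
    by (simp add: smooth_av_def inner_av)
  also have "av 3 c (av 2 b (av 1 a v)) = av 1 a (av 2 b (av 3 c v))"
    using assms by (simp add: av_av_commute[of a 3] av_av_commute[of a 2] av_av_commute[of b 3])
  finally show ?thesis by (simp add: smooth_av_def)
qed

lemma Hm_smooth_av:
  assumes "a > 0" "b > 0" "c > 0" and u: "W1 u"
  shows "Hm m (smooth_av a b c u) = smooth_av a b c (Hm m u)"
proof -
  let ?P = "smooth_av a b c"
  interpret P: bounded_linear ?P by (rule bounded_linear_smooth_av[OF assms(1-3)])
  have "tr h (?P w) = ?P (tr h w)" for h w
    by (rule smooth_av_commuting[symmetric]) (auto intro: bounded_linear_tr simp: tr_tr add.commute)
  then have "has_pd j (?P u) (?P (pd j u))" for j
    using W1_has_pd[OF u] by (intro has_pd_commuting[OF _ P.bounded_linear])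
  then have "pd j (?P u) = ?P (pd j u)" for j by (rule pd_eq)
  moreover have cm: "?P (cm A w) = cm A (?P w)" for A w
    by (rule smooth_av_commuting) (auto intro: bounded_linear_cm simp: tr_cm)
  moreover have "?P (cs z w) = cs z (?P w)" for z w
    unfolding cs_def by (rule cm)
  ultimately show ?thesis
    by (simp add: Hm_def aD_def P.add P.sum P.scaleR)
qed

lemma smooth_av_eq_zero:
  assumes "\<And>a b c. a > 0 \<Longrightarrow> b > 0 \<Longrightarrow> c > 0 \<Longrightarrow> smooth_av a b c u = 0"
  shows "u = 0"
  by (intro av_eq_zero[of 3 u] av_eq_zero[of 2 "av 3 _ u"] av_eq_zero[of 1 "av 2 _ (av 3 _ u)"])
    (simp add: assms[unfolded smooth_av_def])

text \<open>A vector orthogonal to the range solves the adjoint equation only weakly. Its averages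
  lie in the domain and solve it strongly, since \<open>smooth_av\<close> is self-adjoint and
  commutes with H; so they vanish by \<open>inj\<close>, and with them the vector. The lemma serves
  non-real z in \<open>resolvent_exists\<close> and real z in
  \<open>res_tendsto_eigenfunction\<close>.\<close>

lemma dense_range:
  assumes inj: "\<And>v. W1 v \<Longrightarrow> Hm m v = cs (cnj z) v \<Longrightarrow> v = 0"
  shows "closure {Hm m v - cs z v | v. W1 v} = UNIV"
proof (rule closure_eq_UNIV_if_orthogonal_trivial)
  show "subspace {Hm m v - cs z v | v. W1 v}"
  proof (rule subspaceI)
    show "0 \<in> {Hm m v - cs z v | v. W1 v}"
      using W1_zero Hm_scaleR[OF W1_zero, of m 0] by (force intro: exI[of _ 0])
    show "x + y \<in> {Hm m v - cs z v | v. W1 v}"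
      if xy: "x \<in> {Hm m v - cs z v | v. W1 v}" "y \<in> {Hm m v - cs z v | v. W1 v}" for x y
    proof -
      obtain v w where "W1 v" "x = Hm m v - cs z v" "W1 w" "y = Hm m w - cs z w" using xy by blast
      then have "x + y = Hm m (v + w) - cs z (v + w)" "W1 (v + w)"
        by (simp_all add: Hm_add cs_add W1_add)
      then show ?thesis by blast
    qed
    show "c *\<^sub>R x \<in> {Hm m v - cs z v | v. W1 v}" if x: "x \<in> {Hm m v - cs z v | v. W1 v}" for c x
    proof -
      obtain v where "W1 v" "x = Hm m v - cs z v" using x by blast
      then have "c *\<^sub>R x = Hm m (c *\<^sub>R v) - cs z (c *\<^sub>R v)" "W1 (c *\<^sub>R v)"
        by (simp_all add: Hm_scaleR cs_scaleR W1_scaleR scaleR_diff_right)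
      then show ?thesis by blast
    qed
  qed
  fix w assume w: "\<And>f. f \<in> {Hm m v - cs z v | v. W1 v} \<Longrightarrow> w \<bullet> f = 0"
  show "w = 0"
  proof (rule smooth_av_eq_zero)
    fix a b c :: real assume abc: "a > 0" "b > 0" "c > 0"
    let ?P = "smooth_av a b c"
    interpret P: bounded_linear ?P by (rule bounded_linear_smooth_av[OF abc])
    have Pw: "W1 (?P w)" by (rule smooth_av_W1[OF abc])
    have "(Hm m (?P w) - cs (cnj z) (?P w)) \<bullet> u = 0" if u: "W1 u" for u
    proof -
      have "(Hm m (?P w) - cs (cnj z) (?P w)) \<bullet> u = ?P w \<bullet> (Hm m u - cs z u)"
        by (simp add: inner_diff_left inner_diff_right Hm_symmetric[OF Pw u] inner_cs)
      also have "\<dots> = w \<bullet> ?P (Hm m u - cs z u)"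
        by (rule inner_smooth_av[OF abc])
      also have "?P (Hm m u - cs z u) = Hm m (?P u) - cs z (?P u)"
      proof -
        have "?P (cs z u) = cs z (?P u)"
          by (rule smooth_av_commuting) (auto intro: bounded_linear_cs simp: tr_cs)
        then show ?thesis by (simp add: P.diff Hm_smooth_av[OF abc u])
      qed
      also have "w \<bullet> \<dots> = 0" using smooth_av_W1[OF abc] by (intro w) blast
      finally show ?thesis .
    qed
    then have "Hm m (?P w) - cs (cnj z) (?P w) = 0"
      by (intro test_orthogonal_trivial) (auto intro: W1_test)
    then show "?P w = 0" by (intro inj[OF Pw]) simp
  qed
qed

text \<open>The range is dense, the lower bound makes preimages of a convergent sequence Cauchy, and
  \<alpha>\<cdot>D is closed. To use the last point, the bounded terms with z and m are moved to the
  right-hand side.\<close>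

lemma resolvent_exists:
  assumes z: "Im z \<noteq> 0"
  shows "\<exists>u. W1 u \<and> Hm m u - cs z u = f"
proof -
  have "closure {Hm m v - cs z v | v. W1 v} = UNIV"
  proof (rule dense_range)
    fix v assume "W1 v" "Hm m v = cs (cnj z) v"
    then show "v = 0" using Hm_shift_lower_bound[of v "cnj z" m] z by (simp add: mult_le_0_iff)
  qed
  then have "f \<in> closure {Hm m v - cs z v | v. W1 v}" by simp
  then obtain F where F: "\<And>n. F n \<in> {Hm m v - cs z v | v. W1 v}" "F \<longlonglongrightarrow> f"
    unfolding closure_sequential by blast
  then obtain U where U: "\<And>n. W1 (U n)" "\<And>n. F n = Hm m (U n) - cs z (U n)"
    by simp metis
  have CF: "Cauchy F" using F(2) by (rule LIMSEQ_imp_Cauchy)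
  have "Cauchy U"
    unfolding Cauchy_def
  proof (intro allI impI)
    fix e :: real assume e: "e > 0"
    then obtain M where M: "\<And>k l. k \<ge> M \<Longrightarrow> l \<ge> M \<Longrightarrow> dist (F k) (F l) < \<bar>Im z\<bar> * e"
      using metric_CauchyD[OF CF, of "\<bar>Im z\<bar> * e"] z by auto
    have "dist (U k) (U l) < e" if "k \<ge> M" "l \<ge> M" for k l
    proof -
      have "\<bar>Im z\<bar> * norm (U k - U l) \<le> norm (Hm m (U k - U l) - cs z (U k - U l))"
        by (rule Hm_shift_lower_bound[OF W1_diff[OF U(1) U(1)]])
      also have "Hm m (U k - U l) - cs z (U k - U l) = F k - F l"
        by (simp add: U Hm_diff cs_diff)
      also have "norm (F k - F l) < \<bar>Im z\<bar> * e" using M[OF that] by (simp add: dist_norm)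
      finally show ?thesis using z by (simp add: dist_norm)
    qed
    then show "\<exists>M. \<forall>k\<ge>M. \<forall>l\<ge>M. dist (U k) (U l) < e" by blast
  qed
  then obtain u where u: "U \<longlonglongrightarrow> u" by (auto simp: Cauchy_convergent_iff convergent_def)
  have aDU: "aD (U n) = F n + cs z (U n) - m *\<^sub>R cm beta (U n)" for n
    by (simp add: U(2) Hm_def)
  have lim: "(\<lambda>n. aD (U n)) \<longlonglongrightarrow> f + cs z u - m *\<^sub>R cm beta u"
    unfolding aDU
    by (intro tendsto_intros F(2) bounded_linear.tendsto[OF bounded_linear_cs u]
        bounded_linear.tendsto[OF bounded_linear_cm u])
  show ?thesis
    using aD_closed[OF U(1) u lim] by (intro exI[of _ u]) (simp add: Hm_def)
qed

lemma resolvent_unique: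
  assumes "Im z \<noteq> 0" "W1 u" "W1 v" "Hm m u - cs z u = Hm m v - cs z v"
  shows "u = v"
proof -
  have "Hm m (u - v) - cs z (u - v) = (Hm m u - cs z u) - (Hm m v - cs z v)"
    using assms(2,3) by (simp add: Hm_diff cs_diff)
  also have "\<dots> = 0" using assms(4) by simp
  finally have "Hm m (u - v) - cs z (u - v) = 0" .
  then show ?thesis
    using Hm_shift_lower_bound[OF W1_diff[OF assms(2,3)], of z m] assms(1) by (simp add: mult_le_0_iff)
qed

definition res :: "real \<Rightarrow> complex \<Rightarrow> l2 \<Rightarrow> l2" where
  "res m z f = (THE u. W1 u \<and> Hm m u - cs z u = f)"

lemma res:
  assumes "Im z \<noteq> 0"
  shows "W1 (res m z f)" "Hm m (res m z f) - cs z (res m z f) = f"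
proof -
  have "\<exists>!u. W1 u \<and> Hm m u - cs z u = f"
    using resolvent_exists[OF assms] resolvent_unique[OF assms] by metis
  from theI'[OF this] show "W1 (res m z f)" "Hm m (res m z f) - cs z (res m z f) = f"
    by (simp_all add: res_def)
qed

lemma res_eqI: "Im z \<noteq> 0 \<Longrightarrow> W1 u \<Longrightarrow> Hm m u - cs z u = f \<Longrightarrow> u = res m z f"
  using res resolvent_unique by metis

section \<open>The virial estimate\<close>

definition bfun :: "(real^3 \<Rightarrow> real) \<Rightarrow> bool" where
  "bfun a \<longleftrightarrow> a \<in> borel_measurable borel \<and> (\<exists>K. \<forall>x. \<bar>a x\<bar> \<le> K)"

definition ms :: "(real^3 \<Rightarrow> real) \<Rightarrow> l2 \<Rightarrow> l2" where
  "ms a = Mul (\<lambda>x. a x *\<^sub>R mat 1)"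

lemma scaled_mat: "c *\<^sub>R mat 1 = (mat (complex_of_real c) :: complex^4^4)"
  by (simp add: vec_eq_iff mat_def) (simp add: scaleR_conv_of_real)

lemma scaled_mat_vector: "(c *\<^sub>R mat 1 :: complex^4^4) *v x = c *\<^sub>R x"
  unfolding scaled_mat mat_vector by (simp add: vec_eq_iff) (simp add: scaleR_conv_of_real)

lemma bounded_field_scalar: "bfun a \<Longrightarrow> bounded_field (\<lambda>x. a x *\<^sub>R mat 1)"
proof -
  assume "bfun a"
  then obtain K where K: "a \<in> borel_measurable borel" "\<And>x. \<bar>a x\<bar> \<le> K" by (auto simp: bfun_def)
  have "norm (a x *\<^sub>R mat 1 :: complex^4^4) \<le> K * norm (mat 1 :: complex^4^4)" for x
    using K(2)[of x] by (simp add: mult_right_mono)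
  then show ?thesis using K(1) by (auto simp: bounded_field_def)
qed

lemma ms_cls: "bfun a \<Longrightarrow> square_integrable f \<Longrightarrow> ms a (cls f) = cls (\<lambda>x. a x *\<^sub>R f x)"
  by (simp add: ms_def Mul_cls bounded_field_scalar scaled_mat_vector)

lemma square_integrable_ms: "bfun a \<Longrightarrow> square_integrable f \<Longrightarrow> square_integrable (\<lambda>x. a x *\<^sub>R f x)"
  using square_integrable_Mul[OF bounded_field_scalar] by (simp add: scaled_mat_vector)

lemma fn_ms: "bfun a \<Longrightarrow> AE x in lborel. fn (ms a u) x = a x *\<^sub>R fn u x"
  using fn_Mul[OF bounded_field_scalar, of a u] by (simp add: ms_def scaled_mat_vector)

lemma bounded_linear_ms: "bounded_linear (ms a)"
  by (simp add: ms_def bounded_linear_Mul)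

lemma ms_add: "ms a (u + v) = ms a u + ms a v" by (simp add: ms_def Mul_add)
lemma ms_diff: "ms a (u - v) = ms a u - ms a v" by (simp add: ms_def Mul_diff)
lemma ms_scaleR: "ms a (c *\<^sub>R u) = c *\<^sub>R ms a u" by (simp add: ms_def Mul_scaleR)
lemma ms_sum: "ms a (\<Sum>i\<in>I. u i) = (\<Sum>i\<in>I. ms a (u i))" by (simp add: ms_def Mul_sum)

lemma norm_ms_le:
  assumes "bfun a" "K \<ge> 0" "\<And>x. \<bar>a x\<bar> \<le> K"
  shows "norm (ms a u) \<le> K * norm u"
  unfolding ms_def
  by (rule norm_Mul_le[OF bounded_field_scalar]) (use assms in \<open>auto simp: scaled_mat_vector intro: mult_right_mono\<close>)

lemma adj4_scaled_mat: "adj4 (c *\<^sub>R mat 1) = c *\<^sub>R mat 1"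
  by (auto simp: adj4_def mat_def vec_eq_iff)

lemma inner_ms: "bfun a \<Longrightarrow> ms a u \<bullet> v = u \<bullet> ms a v"
  unfolding ms_def by (rule inner_Mul) (auto simp: bounded_field_scalar adj4_scaled_mat)

lemma ms_cm: "bfun a \<Longrightarrow> ms a (cm A u) = cm A (ms a u)"
  unfolding ms_def
proof (rule Mul_cm_commute[OF bounded_field_scalar])
  show "(a x *\<^sub>R mat 1) ** A = A ** (a x *\<^sub>R mat 1)" for x
    unfolding scaled_mat by (rule mat_commute)
qed

lemma ms_cs: "bfun a \<Longrightarrow> ms a (cs z u) = cs z (ms a u)"
  unfolding cs_def by (rule ms_cm)

lemma bfun_translate: "bfun a \<Longrightarrow> bfun (\<lambda>x. a (x + h))"
  by (auto simp: bfun_def)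

lemma tr_ms: "bfun a \<Longrightarrow> tr h (ms a u) = ms (\<lambda>x. a (x + h)) (tr h u)"
  unfolding ms_def by (rule tr_Mul[OF bounded_field_scalar])

lemma bfun_diff: "bfun a \<Longrightarrow> bfun b \<Longrightarrow> bfun (\<lambda>x. a x - b x)"
proof -
  assume "bfun a" "bfun b"
  then obtain K L where KL: "a \<in> borel_measurable borel" "b \<in> borel_measurable borel" "\<And>x. \<bar>a x\<bar> \<le> K" "\<And>x. \<bar>b x\<bar> \<le> L"
    by (auto simp: bfun_def)
  have "\<bar>a x - b x\<bar> \<le> K + L" for x using KL(3,4)[of x] by linarith
  then show ?thesis using KL(1,2) by (auto simp: bfun_def)
qed

lemma ms_field_diff: "bfun a \<Longrightarrow> bfun b \<Longrightarrow> ms a u - ms b u = ms (\<lambda>x. a x - b x) u"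
proof -
  assume ab: "bfun a" "bfun b"
  obtain f where f: "square_integrable f" "u = cls f" by (rule l2_cases)
  show ?thesis unfolding f(2)
    using ab f(1) by (simp add: ms_cls cls_diff square_integrable_ms bfun_diff scaleR_diff_left)
qed

lemma bfun_scale: "bfun a \<Longrightarrow> bfun (\<lambda>x. c * a x)"
proof -
  assume "bfun a"
  then obtain K where K: "a \<in> borel_measurable borel" "\<And>x. \<bar>a x\<bar> \<le> K" by (auto simp: bfun_def)
  have "\<bar>c * a x\<bar> \<le> \<bar>c\<bar> * K" for x using K(2)[of x] by (simp add: abs_mult mult_left_mono)
  then show ?thesis using K(1) by (auto simp: bfun_def)
qed

lemma ms_field_scale: "bfun a \<Longrightarrow> c *\<^sub>R ms a u = ms (\<lambda>x. c * a x) u"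
proof -
  assume a: "bfun a"
  obtain f where f: "square_integrable f" "u = cls f" by (rule l2_cases)
  show ?thesis unfolding f(2)
    using a f(1) by (simp add: ms_cls cls_scaleR square_integrable_ms bfun_scale)
qed

text \<open>A bounded stand-in for the coordinate x_k, which is recovered as R tends to infinity. It
  is at most |x| in absolute value for every R, depends on x_k alone, and has the derivative
  \<open>cn\<close>, bounded by 1. A bound for (1 + |x|) f therefore controls its product with f
  uniformly in R.\<close>

definition sn :: "3 \<Rightarrow> real \<Rightarrow> real^3 \<Rightarrow> real" where "sn k R x = R * sin (x $ k / R)"
definition cn :: "3 \<Rightarrow> real \<Rightarrow> real^3 \<Rightarrow> real" where "cn k R x = cos (x $ k / R)"

lemma bfun_sn: "R > 0 \<Longrightarrow> bfun (sn k R)"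
  unfolding bfun_def
proof (intro conjI exI allI)
  show "sn k R \<in> borel_measurable borel"
    unfolding sn_def[abs_def] divide_inverse by (intro borel_measurable_continuous_onI continuous_intros)
  show "\<bar>sn k R x\<bar> \<le> R" if "R > 0" for x
    using that by (simp add: sn_def abs_mult mult_left_le)
qed

lemma abs_sn_le: "R > 0 \<Longrightarrow> \<bar>sn k R x\<bar> \<le> norm x"
proof -
  assume R: "R > 0"
  have "\<bar>sn k R x\<bar> = R * \<bar>sin (x $ k / R)\<bar>" using R by (simp add: sn_def abs_mult)
  also have "\<dots> \<le> R * \<bar>x $ k / R\<bar>" using R abs_sin_x_le_abs_x[of "x $ k / R"] by (intro mult_left_mono) auto
  also have "\<dots> = \<bar>x $ k\<bar>" using R by simp
  also have "\<dots> \<le> norm x" by (rule component_le_norm_cart)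
  finally show ?thesis .
qed

lemma bfun_cn: "bfun (cn k R)"
  unfolding bfun_def
proof (intro conjI exI allI)
  show "cn k R \<in> borel_measurable borel"
    unfolding cn_def[abs_def] divide_inverse by (intro borel_measurable_continuous_onI continuous_intros)
  show "\<bar>cn k R x\<bar> \<le> 1" for x by (simp add: cn_def)
qed

lemma sin_lipschitz: "\<bar>sin x - sin y\<bar> \<le> \<bar>x - y\<bar>" for x y :: real
proof -
  have "norm (sin x - sin y) \<le> 1 * norm (x - y)"
    by (rule field_differentiable_bound[where S = UNIV and f' = cos]) (auto intro: DERIV_sin)
  then show ?thesis by simp
qed

lemma cos_lipschitz: "\<bar>cos x - cos y\<bar> \<le> \<bar>x - y\<bar>" for x y :: real
proof -
  have "norm (cos x - cos y) \<le> 1 * norm (x - y)"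
    by (rule field_differentiable_bound[where S = UNIV and f' = "\<lambda>x. - sin x"]) (auto intro: DERIV_cos)
  then show ?thesis by simp
qed

lemma sin_linearization: "\<bar>sin (a + t) - sin a - t * cos a\<bar> \<le> t\<^sup>2" for a t :: real
proof -
  have "norm (sin (a + t) - sin a - (a + t - a) *\<^sub>R cos a) \<le> norm (a + t - a) * \<bar>t\<bar>"
  proof (rule vector_differentiable_bound_linearization[where S = "closed_segment a (a + t)" and f' = cos])
    show "(sin has_vector_derivative cos x) (at x within closed_segment a (a + t))" for x
      by (simp add: DERIV_sin has_real_derivative_iff_has_vector_derivative[symmetric] has_field_derivative_at_within)
    show "norm (cos x - cos a) \<le> \<bar>t\<bar>" if "x \<in> closed_segment a (a + t)" for x
      using cos_lipschitz[of x a] that by (auto simp: closed_segment_eq_real_ivl split: if_splits)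
  qed auto
  then show ?thesis by (simp add: power2_eq_square)
qed

text \<open>Leibniz rule for difference quotients: the translated multiplier acts on the quotient of
  \<open>u\<close>, and the quotient of the multiplier acts on \<open>u\<close>. Both multipliers
  converge uniformly, with errors |t| and |t| / R.\<close>

lemma has_pd_sn:
  assumes R: "R > 0" and u: "has_pd k u g"
  shows "has_pd k (ms (sn k R) u) (ms (sn k R) g + ms (cn k R) u)"
proof -
  define q where "q t = (tr (axis k t) u - u) /\<^sub>R t" for t
  define st where "st t x = sn k R (x + axis k t)" for t x
  have st: "bfun (st t)" for t unfolding st_def by (rule bfun_translate[OF bfun_sn[OF R]])
  have st_R: "\<bar>st t x\<bar> \<le> R" for t x using R by (simp add: st_def sn_def abs_mult mult_left_le)
  have st_eq: "st t x = R * sin (x $ k / R + t / R)" for t x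
    by (simp add: st_def sn_def axis_def add_divide_distrib)
  have st_diff: "\<bar>st t x - sn k R x\<bar> \<le> \<bar>t\<bar>" for t x
  proof -
    have "\<bar>st t x - sn k R x\<bar> = R * \<bar>sin (x $ k / R + t / R) - sin (x $ k / R)\<bar>"
      using R by (simp add: st_eq sn_def abs_mult flip: right_diff_distrib)
    also have "\<dots> \<le> R * \<bar>t / R\<bar>"
      using R sin_lipschitz[of "x $ k / R + t / R" "x $ k / R"] by (intro mult_left_mono) auto
    finally show ?thesis using R by simp
  qed
  have st_lin: "\<bar>inverse t * (st t x - sn k R x) - cn k R x\<bar> \<le> \<bar>t\<bar> / R" if "t \<noteq> 0" for t x
  proof -
    have "inverse t * (st t x - sn k R x) - cn k R x
        = inverse t * (R * (sin (x $ k / R + t / R) - sin (x $ k / R) - t / R * cos (x $ k / R)))"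
      using that R by (simp add: st_eq sn_def cn_def field_simps)
    then have "\<bar>inverse t * (st t x - sn k R x) - cn k R x\<bar>
        = inverse \<bar>t\<bar> * (R * \<bar>sin (x $ k / R + t / R) - sin (x $ k / R) - t / R * cos (x $ k / R)\<bar>)"
      using R by (simp only: abs_mult abs_inverse)
    also have "\<dots> \<le> inverse \<bar>t\<bar> * (R * (t / R)\<^sup>2)"
      using R by (intro mult_left_mono sin_linearization) auto
    also have "\<dots> = \<bar>t\<bar> / R"
      using that R by (simp add: field_simps power2_eq_square)
    finally show ?thesis .
  qed
  have q: "(q \<longlongrightarrow> g) (at 0)" using u by (simp add: has_pd_def q_def[abs_def])
  have "((\<lambda>t. R * norm (q t - g) + \<bar>t\<bar> * norm g) \<longlongrightarrow> R * 0 + \<bar>0\<bar> * norm g) (at 0)"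
    by (intro tendsto_add tendsto_mult tendsto_const tendsto_norm_zero LIM_zero q tendsto_rabs tendsto_ident_at)
  then have "((\<lambda>t. R * norm (q t - g) + \<bar>t\<bar> * norm g) \<longlongrightarrow> 0) (at 0)" by simp
  moreover have "norm (ms (st t) (q t) - ms (sn k R) g) \<le> R * norm (q t - g) + \<bar>t\<bar> * norm g" for t
  proof -
    have "ms (st t) (q t) - ms (sn k R) g = ms (st t) (q t - g) + ms (\<lambda>x. st t x - sn k R x) g"
      by (simp add: ms_diff flip: ms_field_diff[OF st bfun_sn[OF R]])
    also have "norm \<dots> \<le> norm (ms (st t) (q t - g)) + norm (ms (\<lambda>x. st t x - sn k R x) g)"
      by (rule norm_triangle_ineq)
    also have "\<dots> \<le> R * norm (q t - g) + \<bar>t\<bar> * norm g"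
    proof (rule add_mono)
      show "norm (ms (st t) (q t - g)) \<le> R * norm (q t - g)"
        by (rule norm_ms_le[OF st]) (use R st_R in auto)
      show "norm (ms (\<lambda>x. st t x - sn k R x) g) \<le> \<bar>t\<bar> * norm g"
        by (rule norm_ms_le[OF bfun_diff[OF st bfun_sn[OF R]]]) (use st_diff in auto)
    qed
    finally show ?thesis .
  qed
  ultimately have "((\<lambda>t. ms (st t) (q t) - ms (sn k R) g) \<longlongrightarrow> 0) (at 0)"
    by (intro Lim_null_comparison[OF always_eventually, of "\<lambda>t. ms (st t) (q t) - ms (sn k R) g"] allI)
  then have 1: "((\<lambda>t. ms (st t) (q t)) \<longlongrightarrow> ms (sn k R) g) (at 0)" by (simp add: LIM_zero_iff)
  have "((\<lambda>t. \<bar>t\<bar> / R * norm u) \<longlongrightarrow> 0) (at 0)"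
    using R by (auto intro!: tendsto_eq_intros)
  moreover have "eventually (\<lambda>t. norm (ms (\<lambda>x. inverse t * (st t x - sn k R x)) u - ms (cn k R) u) \<le> \<bar>t\<bar> / R * norm u) (at 0)"
    unfolding eventually_at_filter
  proof (intro always_eventually allI impI)
    fix t :: real assume t: "t \<noteq> 0"
    have b: "bfun (\<lambda>x. inverse t * (st t x - sn k R x))"
      by (rule bfun_scale[OF bfun_diff[OF st bfun_sn[OF R]]])
    show "norm (ms (\<lambda>x. inverse t * (st t x - sn k R x)) u - ms (cn k R) u) \<le> \<bar>t\<bar> / R * norm u"
      unfolding ms_field_diff[OF b bfun_cn]
      by (rule norm_ms_le[OF bfun_diff[OF b bfun_cn]]) (use R st_lin[OF t] in auto)
  qed
  ultimately have "((\<lambda>t. ms (\<lambda>x. inverse t * (st t x - sn k R x)) u - ms (cn k R) u) \<longlongrightarrow> 0) (at 0)"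
    by (rule Lim_null_comparison[rotated])
  then have 2: "((\<lambda>t. ms (\<lambda>x. inverse t * (st t x - sn k R x)) u) \<longlongrightarrow> ms (cn k R) u) (at 0)"
    by (simp add: LIM_zero_iff)
  have "(tr (axis k t) (ms (sn k R) u) - ms (sn k R) u) /\<^sub>R t
      = ms (st t) (q t) + ms (\<lambda>x. inverse t * (st t x - sn k R x)) u" for t
  proof -
    have "tr (axis k t) (ms (sn k R) u) = ms (st t) (tr (axis k t) u)"
      by (simp add: tr_ms[OF bfun_sn[OF R]] st_def[abs_def])
    moreover have "ms (\<lambda>x. inverse t * (st t x - sn k R x)) u = inverse t *\<^sub>R (ms (st t) u - ms (sn k R) u)"
      unfolding ms_field_diff[OF st bfun_sn[OF R]]
      by (rule ms_field_scale[OF bfun_diff[OF st bfun_sn[OF R]], symmetric])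
    ultimately show ?thesis
      by (simp add: q_def ms_scaleR ms_diff scaleR_diff_right)
  qed
  then show ?thesis unfolding has_pd_def using tendsto_add[OF 1 2] by simp
qed

lemma has_pd_sn_other:
  assumes "R > 0" "has_pd j u g" "j \<noteq> k"
  shows "has_pd j (ms (sn k R) u) (ms (sn k R) g)"
proof (rule has_pd_commuting[OF assms(2) bounded_linear_ms])
  have "(\<lambda>x. sn k R (x + axis j t)) = sn k R" for t
    using assms(3) by (simp add: sn_def[abs_def] axis_def)
  then show "tr (axis j t) (ms (sn k R) w) = ms (sn k R) (tr (axis j t) w)" for t w
    by (simp add: tr_ms[OF bfun_sn[OF assms(1)]])
qed

lemma Hm_sn:
  assumes R: "R > 0" and u: "W1 u"
  shows "W1 (ms (sn k R) u)"
    and "Hm m (ms (sn k R) u) = ms (sn k R) (Hm m u) + cm (alpha k) (cs (- \<i>) (ms (cn k R) u))"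
proof -
  define G where "G j = ms (sn k R) (pd j u) + (if j = k then ms (cn k R) u else 0)" for j
  have pdG: "has_pd j (ms (sn k R) u) (G j)" for j
    using has_pd_sn[OF R W1_has_pd[OF u], of k] has_pd_sn_other[OF R W1_has_pd[OF u], of j k]
    by (auto simp: G_def)
  then show "W1 (ms (sn k R) u)" by (rule W1I)
  have "cm (alpha j) (cs (- \<i>) (G j)) = ms (sn k R) (cm (alpha j) (cs (- \<i>) (pd j u)))
      + (if j = k then cm (alpha k) (cs (- \<i>) (ms (cn k R) u)) else 0)" for j
    by (auto simp: G_def cs_add cm_add ms_cm[OF bfun_sn[OF R]] ms_cs[OF bfun_sn[OF R]])
  then have "aD (ms (sn k R) u) = ms (sn k R) (aD u) + cm (alpha k) (cs (- \<i>) (ms (cn k R) u))"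
    by (simp add: aD_def pd_eq[OF pdG] sum.distrib ms_sum)
  then show "Hm m (ms (sn k R) u) = ms (sn k R) (Hm m u) + cm (alpha k) (cs (- \<i>) (ms (cn k R) u))"
    by (simp add: Hm_def ms_add ms_scaleR ms_cm[OF bfun_sn[OF R]])
qed

text \<open>This is the commutator with the bounded vector field \<open>R sin (x\<^sub>k / R) \<partial>\<^sub>k\<close>, with \<open>\<partial>\<^sub>k\<close> replaced by
  difference quotients because \<open>\<partial>\<^sub>k u\<close> need not lie in the domain of \<open>H\<close>.\<close>

lemma virial_identity:
  assumes R: "R > 0" and u: "W1 u" "Hm m u - cs z u = f" and v: "W1 v" "Hm m v - cs (cnj z) v = g"
  shows "v \<bullet> cm (alpha k) (cs (- \<i>) (ms (cn k R) (pd k u)))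
    = g \<bullet> ms (sn k R) (pd k u) + (ms (sn k R) (pd k v) + ms (cn k R) v) \<bullet> f"
proof -
  let ?s = "ms (sn k R)" and ?c = "ms (cn k R)"
  define q where "q w t = (tr (axis k t) w - w) /\<^sub>R t" for w t
  have q: "(q u \<longlongrightarrow> pd k u) (at 0)" using W1_has_pd[OF u(1), of k] by (simp add: has_pd_def q_def[abs_def])
  have 1: "((\<lambda>t. g \<bullet> ?s (q u t)) \<longlongrightarrow> g \<bullet> ?s (pd k u)) (at 0)"
    by (intro tendsto_inner tendsto_const bounded_linear.tendsto[OF bounded_linear_ms] q)
  have 2: "((\<lambda>t. ((tr (axis k (- t)) (?s v) - ?s v) /\<^sub>R t) \<bullet> f) \<longlongrightarrow> - (?s (pd k v) + ?c v) \<bullet> f) (at 0)"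
    by (intro tendsto_inner tendsto_const has_pd_backward has_pd_sn R W1_has_pd v)
  have 3: "((\<lambda>t. v \<bullet> cm (alpha k) (cs (- \<i>) (?c (q u t)))) \<longlongrightarrow> v \<bullet> cm (alpha k) (cs (- \<i>) (?c (pd k u)))) (at 0)"
    by (intro tendsto_inner tendsto_const bounded_linear.tendsto[OF bounded_linear_cm]
        bounded_linear.tendsto[OF bounded_linear_cs] bounded_linear.tendsto[OF bounded_linear_ms] q)
  \<comment> \<open>Exact before the limit: \<open>q u t\<close> lies in the domain, so H can be
    moved off \<open>v\<close> across the multiplier at the cost of the commutator term with
    \<open>cn\<close>. The quotient is then shifted from \<open>f\<close>, which need not be
    differentiable, to \<open>?s v\<close>.\<close>
  have eq: "g \<bullet> ?s (q u t) = ((tr (axis k (- t)) (?s v) - ?s v) /\<^sub>R t) \<bullet> f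
      + v \<bullet> cm (alpha k) (cs (- \<i>) (?c (q u t)))" for t
  proof -
    have w: "W1 (q u t)" unfolding q_def by (intro W1_scaleR W1_diff W1_tr u)
    have Hw: "Hm m (q u t) - cs z (q u t) = q f t"
      unfolding q_def u(2)[symmetric]
      by (simp add: Hm_scaleR Hm_diff Hm_tr W1_scaleR W1_diff W1_tr u(1) cs_scaleR cs_diff tr_diff tr_cs algebra_simps)
    have "g \<bullet> ?s (q u t) = v \<bullet> (Hm m (?s (q u t)) - cs z (?s (q u t)))"
      using Hm_symmetric[OF v(1) Hm_sn(1)[OF R w], of m k]
      by (simp add: v(2)[symmetric] inner_diff_left inner_diff_right inner_cs)
    also have "Hm m (?s (q u t)) - cs z (?s (q u t)) = ?s (q f t) + cm (alpha k) (cs (- \<i>) (?c (q u t)))"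
      by (simp add: Hm_sn(2)[OF R w] Hw[symmetric] ms_diff ms_cs[OF bfun_sn[OF R]])
    also have "v \<bullet> \<dots> = v \<bullet> ?s (q f t) + v \<bullet> cm (alpha k) (cs (- \<i>) (?c (q u t)))"
      by (rule inner_add_right)
    also have "v \<bullet> ?s (q f t) = ?s v \<bullet> q f t" by (simp add: inner_ms[OF bfun_sn[OF R]])
    also have "\<dots> = ((tr (axis k (- t)) (?s v) - ?s v) /\<^sub>R t) \<bullet> f"
      by (simp add: q_def inner_diff_left inner_diff_right inner_tr_left axis_minus)
    finally show ?thesis .
  qed
  have "g \<bullet> ?s (pd k u) = - (?s (pd k v) + ?c v) \<bullet> f + v \<bullet> cm (alpha k) (cs (- \<i>) (?c (pd k u)))"
    by (rule tendsto_unique[OF trivial_limit_at 1]) (simp add: eq tendsto_add[OF 2 3, simplified])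
  then show ?thesis by (simp add: inner_add_left inner_diff_left)
qed

lemma inner_cn_tendsto: "(\<lambda>n. x \<bullet> ms (cn k (real (Suc n))) y) \<longlonglongrightarrow> x \<bullet> y"
proof -
  obtain f where f: "square_integrable f" "x = cls f" by (rule l2_cases)
  obtain g where g: "square_integrable g" "y = cls g" by (rule l2_cases)
  have [measurable]: "f \<in> borel_measurable borel" "g \<in> borel_measurable borel"
    using f g by (auto simp: square_integrable_def)
  have [measurable]: "cn k R \<in> borel_measurable borel" for R using bfun_cn by (simp add: bfun_def)
  have "(\<lambda>n. \<integral>x. f x \<bullet> (cn k (real (Suc n)) x *\<^sub>R g x) \<partial>lborel) \<longlonglongrightarrow> (\<integral>x. f x \<bullet> g x \<partial>lborel)"
  proof (rule integral_dominated_convergence[where w = "\<lambda>x. \<bar>f x \<bullet> g x\<bar>"])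
    show "integrable lborel (\<lambda>x. \<bar>f x \<bullet> g x\<bar>)" by (intro integrable_abs square_integrable_inner f g)
    show "AE x in lborel. (\<lambda>n. f x \<bullet> (cn k (real (Suc n)) x *\<^sub>R g x)) \<longlonglongrightarrow> f x \<bullet> g x"
    proof (rule AE_I2)
      fix x :: "real^3"
      have "(\<lambda>n. cos (x $ k * inverse (real (Suc n)))) \<longlonglongrightarrow> cos (x $ k * 0)"
        by (intro tendsto_intros LIMSEQ_inverse_real_of_nat)
      then have "(\<lambda>n. cn k (real (Suc n)) x) \<longlonglongrightarrow> 1" by (simp add: cn_def divide_inverse)
      from tendsto_inner[OF tendsto_const tendsto_scaleR[OF this tendsto_const]]
      show "(\<lambda>n. f x \<bullet> (cn k (real (Suc n)) x *\<^sub>R g x)) \<longlonglongrightarrow> f x \<bullet> g x" by fastforce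
    qed
    show "AE x in lborel. norm (f x \<bullet> (cn k (real (Suc n)) x *\<^sub>R g x)) \<le> \<bar>f x \<bullet> g x\<bar>" for n
      by (intro AE_I2) (auto simp: cn_def abs_mult intro: mult_left_le_one_le)
  qed measurable
  then show ?thesis
    using f g by (simp add: ms_cls[OF bfun_cn] inner_cls square_integrable_ms[OF bfun_cn])
qed

text \<open>The identity is used as R tends to infinity. Only \<open>cn\<close> needs a limit, and a
  weak one suffices; the terms with \<open>sn\<close> are bounded through \<open>F\<close> and
  \<open>G\<close> uniformly in R. The factor 3 counts the coordinates.\<close>

lemma virial_bound:
  assumes u: "W1 u" "Hm m u - cs z u = f" and v: "W1 v" "Hm m v - cs (cnj z) v = g"
    and F: "\<And>k R. R > 0 \<Longrightarrow> norm (ms (sn k R) f) \<le> F" "norm f \<le> F"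
    and G: "\<And>k R. R > 0 \<Longrightarrow> norm (ms (sn k R) g) \<le> G"
  shows "\<bar>v \<bullet> aD u\<bar> \<le> 3 * (G * norm (aD u) + F * norm (aD v) + F * norm v)"
proof -
  have F0: "F \<ge> 0" "G \<ge> 0" using order_trans[OF norm_ge_zero F(2)] order_trans[OF norm_ge_zero G[of 1]] by auto
  have k: "\<bar>v \<bullet> cm (alpha k) (cs (- \<i>) (pd k u))\<bar> \<le> G * norm (aD u) + F * norm (aD v) + F * norm v" for k
  proof (rule LIMSEQ_le_const2)
    let ?A = "\<lambda>w. cm (alpha k) (cs (- \<i>) w)"
    have adj: "v \<bullet> ?A w = cs \<i> (cm (alpha k) v) \<bullet> w" for w by (simp add: inner_cs inner_cm)
    show "(\<lambda>n. \<bar>v \<bullet> ?A (ms (cn k (real (Suc n))) (pd k u))\<bar>) \<longlonglongrightarrow> \<bar>v \<bullet> ?A (pd k u)\<bar>"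
      unfolding adj by (intro tendsto_rabs inner_cn_tendsto)
    have "\<bar>v \<bullet> ?A (ms (cn k R) (pd k u))\<bar> \<le> G * norm (aD u) + F * norm (aD v) + F * norm v" if R: "R > 0" for R
    proof -
      have "v \<bullet> ?A (ms (cn k R) (pd k u)) = ms (sn k R) g \<bullet> pd k u + pd k v \<bullet> ms (sn k R) f + ms (cn k R) v \<bullet> f"
        by (subst virial_identity[OF R u v]) (simp add: inner_add_left inner_ms[OF bfun_sn[OF R]])
      also have "\<bar>\<dots>\<bar> \<le> \<bar>ms (sn k R) g \<bullet> pd k u\<bar> + \<bar>pd k v \<bullet> ms (sn k R) f\<bar> + \<bar>ms (cn k R) v \<bullet> f\<bar>"
        by linarith
      also have "\<dots> \<le> norm (ms (sn k R) g) * norm (pd k u) + norm (pd k v) * norm (ms (sn k R) f) + norm (ms (cn k R) v) * norm f"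
        by (intro add_mono Cauchy_Schwarz_ineq2)
      also have "\<dots> \<le> G * norm (aD u) + norm (aD v) * F + (1 * norm v) * F"
        using F0 R by (intro add_mono mult_mono F G norm_pd_le u v norm_ms_le bfun_cn) (auto simp: cn_def)
      finally show ?thesis by (simp add: mult.commute)
    qed
    then show "\<exists>N. \<forall>n\<ge>N. \<bar>v \<bullet> ?A (ms (cn k (real (Suc n))) (pd k u))\<bar> \<le> G * norm (aD u) + F * norm (aD v) + F * norm v"
      by (intro exI[of _ 0]) (auto simp del: of_nat_Suc)
  qed
  have "\<bar>v \<bullet> aD u\<bar> \<le> (\<Sum>k\<in>(UNIV::3 set). \<bar>v \<bullet> cm (alpha k) (cs (- \<i>) (pd k u))\<bar>)"
    unfolding aD_def inner_sum_right by (rule sum_abs)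
  also have "\<dots> \<le> (\<Sum>k\<in>(UNIV::3 set). G * norm (aD u) + F * norm (aD v) + F * norm v)"
    by (intro sum_mono k)
  finally show ?thesis by simp
qed

lemma norm_cm_beta [simp]: "norm (cm beta u) = norm u"
proof -
  have "cm beta u \<bullet> cm beta u = u \<bullet> u"
    using cs_one[of u] by (simp add: inner_cm cm_cm beta_sq cs_def)
  then show ?thesis by (simp add: norm_eq_sqrt_inner)
qed

text \<open>The factor 2 absorbs the mass term by means of m \<le> |z|.\<close>

lemma norm_aD_le:
  assumes "Hm m u - cs z u = f" "0 \<le> m" "m \<le> norm z"
  shows "norm (aD u) \<le> norm f + 2 * norm z * norm u"
proof -
  have "aD u = f + cs z u - m *\<^sub>R cm beta u" by (simp add: assms(1)[symmetric] Hm_def)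
  also have "norm \<dots> \<le> norm f + norm (cs z u) + norm (m *\<^sub>R cm beta u)"
    by (intro order_trans[OF norm_triangle_ineq4] add_mono norm_triangle_ineq order_refl)
  also have "\<dots> \<le> norm f + norm z * norm u + norm z * norm u"
    using assms(2) mult_right_mono[OF assms(3), of "norm u"] by (simp add: norm_cs mult.commute)
  finally show ?thesis by (simp add: algebra_simps)
qed

text \<open>The part of \<open>\<alpha>\<cdot>D = H - m\<beta>\<close> commuting with \<open>H\<close> is \<open>H - m\<^sup>2 H\<^sup>-\<^sup>1\<close>; the remaining
  part of \<open>\<beta>\<close> is removed by means of the anticommutator \<open>H\<beta> + \<beta>H = 2m\<close>.\<close>

lemma inner_via_aD:
  assumes z: "z \<noteq> 0" "z\<^sup>2 - (complex_of_real m)\<^sup>2 \<noteq> 0"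
    and u: "W1 u" "Hm m u - cs z u = f" and v: "W1 v" "Hm m v - cs (cnj z) v = g"
  defines "\<kappa> \<equiv> z / (z\<^sup>2 - (complex_of_real m)\<^sup>2)" and "\<mu> \<equiv> 1 / (z\<^sup>2 - (complex_of_real m)\<^sup>2)"
  shows "v \<bullet> u = v \<bullet> aD (cs \<kappa> u) - v \<bullet> cs \<kappa> f
    - (m / 2) * (g \<bullet> cm beta (cs \<mu> u) + v \<bullet> cm beta (cs \<mu> f))"
proof -
  define y where "y = cs \<mu> u"
  have y: "W1 y" unfolding y_def by (rule W1_cs[OF u(1)])
  have \<kappa>: "\<kappa> = z * \<mu>" by (simp add: \<kappa>_def \<mu>_def)
  have zy: "cs z y = cs \<kappa> u" by (simp add: y_def cs_cs \<kappa>)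
  have Hy: "Hm m y = cs z y + cs \<mu> f"
    by (simp add: y_def Hm_cs[OF u(1)] u(2)[symmetric] cs_diff cs_cs mult.commute)
  have Hu: "Hm m (cs \<kappa> u) = cs z (cs \<kappa> u) + cs \<kappa> f"
    by (simp add: Hm_cs[OF u(1)] u(2)[symmetric] cs_diff cs_cs mult.commute)
  \<comment> \<open>H\<beta> + \<beta>H = 2m is paired with \<open>v\<close> and \<open>y\<close>:
    the term <v, \<beta> z y> becomes m <v, y> up to terms containing \<open>f\<close> or
    \<open>g\<close>.\<close>
  have "g \<bullet> cm beta y = v \<bullet> (Hm m (cm beta y) - cs z (cm beta y))"
    using Hm_symmetric[OF v(1) W1_cm[OF y], of m beta]
    by (simp add: v(2)[symmetric] inner_diff_left inner_diff_right inner_cs)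
  also have "Hm m (cm beta y) - cs z (cm beta y) = (2 * m) *\<^sub>R y - cm beta (cs \<mu> f) - 2 *\<^sub>R cm beta (cs z y)"
    by (simp add: Hm_beta[OF y] Hy cm_add cs_cm scaleR_2)
  finally have b: "2 * (v \<bullet> cm beta (cs \<kappa> u)) = 2 * m * (v \<bullet> y) - v \<bullet> cm beta (cs \<mu> f) - g \<bullet> cm beta y"
    by (simp add: inner_diff_right zy)
  have "aD (cs \<kappa> u) = cs z (cs \<kappa> u) + cs \<kappa> f - m *\<^sub>R cm beta (cs \<kappa> u)"
    using Hu by (simp add: Hm_def eq_diff_eq)
  then have a: "v \<bullet> aD (cs \<kappa> u) = v \<bullet> cs z (cs \<kappa> u) + v \<bullet> cs \<kappa> f - m * (v \<bullet> cm beta (cs \<kappa> u))"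
    by (simp add: inner_diff_right inner_add_right)
  \<comment> \<open>The two coefficients are chosen such that 1 = z \<kappa> - m^2 \<mu>.\<close>
  have "u = cs ((z\<^sup>2 - (complex_of_real m)\<^sup>2) * \<mu>) u" using z(2) by (simp add: \<mu>_def)
  also have "(z\<^sup>2 - (complex_of_real m)\<^sup>2) * \<mu> = z * \<kappa> + complex_of_real (- m\<^sup>2) * \<mu>"
    by (simp add: \<kappa> power2_eq_square algebra_simps)
  also have "cs (z * \<kappa> + complex_of_real (- m\<^sup>2) * \<mu>) u = cs z (cs \<kappa> u) + (- m\<^sup>2) *\<^sub>R y"
    unfolding cs_add_left y_def cs_cs[symmetric] cs_of_real ..
  finally have c: "v \<bullet> u = v \<bullet> cs z (cs \<kappa> u) - m\<^sup>2 * (v \<bullet> y)"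
    by (metis (no_types, lifting) add_uminus_conv_diff inner_add_right inner_scaleR_right mult_minus_left)
  have b': "v \<bullet> cm beta (cs \<kappa> u) = m * (v \<bullet> y) - (g \<bullet> cm beta y + v \<bullet> cm beta (cs \<mu> f)) / 2"
    using b by (simp add: field_simps)
  have "m * (v \<bullet> cm beta (cs \<kappa> u)) = m\<^sup>2 * (v \<bullet> y) - (m / 2) * (g \<bullet> cm beta y + v \<bullet> cm beta (cs \<mu> f))"
    unfolding b' by (simp add: power2_eq_square right_diff_distrib)
  then show ?thesis using a c unfolding y_def by linarith
qed

text \<open>With u = R(z) f and v the same for the conjugate of z, the inner product is the real
  part of <f, R(z)^2 f>. It is quadratic in the resolvent, while the bound is only linear in the
  norms of u and v, and the factor (Re z)^2 - m^2 does not degenerate as Im z tends to 0.\<close>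

lemma key_bound:
  assumes m: "0 \<le> m" "m\<^sup>2 < (Re z)\<^sup>2"
    and u: "W1 u" "Hm m u - cs z u = f" and v: "W1 v" "Hm m v - cs (cnj z) v = f"
    and F: "\<And>k R. R > 0 \<Longrightarrow> norm (ms (sn k R) f) \<le> F" "norm f \<le> F"
  shows "((Re z)\<^sup>2 - m\<^sup>2) * \<bar>v \<bullet> u\<bar> \<le> norm z * F * (6 * F + (6 * norm z + 5) * (norm u + norm v))"
proof -
  define w where "w = z\<^sup>2 - (complex_of_real m)\<^sup>2"
  define \<kappa> where "\<kappa> = z / w"
  define \<mu> where "\<mu> = 1 / w"
  define W where "W = norm w"
  define N where "N = norm u + norm v"
  have F0: "F \<ge> 0" using order_trans[OF norm_ge_zero F(2)] .
  have mz: "m < \<bar>Re z\<bar>" using power2_less_imp_less[of m "\<bar>Re z\<bar>"] m by simp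
  then have mz': "m \<le> norm z" using abs_Re_le_cmod[of z] by linarith
  have z0: "z \<noteq> 0" using mz m by auto
  \<comment> \<open>Factor z^2 - m^2 = (z - m)(z + m) and compare each factor with its real
    part.\<close>
  have Wge: "(Re z)\<^sup>2 - m\<^sup>2 \<le> W"
  proof -
    have "(Re z)\<^sup>2 - m\<^sup>2 = \<bar>Re (z - of_real m)\<bar> * \<bar>Re (z + of_real m)\<bar>"
    proof -
      have "\<bar>Re (z - of_real m)\<bar> * \<bar>Re (z + of_real m)\<bar> = \<bar>(Re z)\<^sup>2 - m\<^sup>2\<bar>"
        by (simp add: power2_eq_square algebra_simps flip: abs_mult)
      then show ?thesis using m(2) by simp
    qed
    also have "\<dots> \<le> norm (z - of_real m) * norm (z + of_real m)"
      by (intro mult_mono abs_Re_le_cmod) auto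
    also have "\<dots> = W" unfolding W_def w_def
      by (simp add: norm_mult[symmetric] power2_eq_square algebra_simps)
    finally show ?thesis .
  qed
  then have W0: "W > 0" using m(2) by simp
  then have w0: "w \<noteq> 0" by (auto simp: W_def)
  have nk: "norm \<kappa> = norm z / W" and nm: "norm \<mu> = 1 / W"
    by (simp_all add: \<kappa>_def \<mu>_def W_def norm_divide)
  have id: "v \<bullet> u = v \<bullet> aD (cs \<kappa> u) - v \<bullet> cs \<kappa> f
      - (m / 2) * (f \<bullet> cm beta (cs \<mu> u) + v \<bullet> cm beta (cs \<mu> f))"
    using inner_via_aD[OF z0 _ u v] w0 by (simp add: w_def \<kappa>_def \<mu>_def)
  have aDu: "norm (aD u) \<le> F + 2 * norm z * norm u" and aDv: "norm (aD v) \<le> F + 2 * norm z * norm v"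
    using norm_aD_le[OF u(2) m(1) mz'] norm_aD_le[OF v(2) m(1)] mz' F(2) by auto
  have 1: "\<bar>v \<bullet> aD (cs \<kappa> u)\<bar> \<le> norm \<kappa> * F * (6 * F + 6 * norm z * N + 3 * norm v)"
  proof -
    have "\<bar>v \<bullet> aD (cs \<kappa> u)\<bar> \<le> 3 * (F * norm (aD (cs \<kappa> u)) + (norm \<kappa> * F) * norm (aD v) + (norm \<kappa> * F) * norm v)"
    proof (rule virial_bound[OF W1_cs[OF u(1)] _ v])
      show "Hm m (cs \<kappa> u) - cs z (cs \<kappa> u) = cs \<kappa> f"
        by (simp add: Hm_cs[OF u(1)] u(2)[symmetric] cs_diff cs_cs mult.commute)
      show "norm (ms (sn k R) (cs \<kappa> f)) \<le> norm \<kappa> * F" if "R > 0" for k R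
        using F(1)[OF that, of k] by (simp add: ms_cs[OF bfun_sn[OF that]] norm_cs mult_left_mono)
      show "norm (cs \<kappa> f) \<le> norm \<kappa> * F" using F(2) by (simp add: norm_cs mult_left_mono)
      show "norm (ms (sn k R) f) \<le> F" if "R > 0" for k R by (rule F(1)[OF that])
    qed
    also have "\<dots> = norm \<kappa> * F * (3 * (norm (aD u) + norm (aD v) + norm v))"
      by (simp add: aD_cs[OF u(1)] norm_cs algebra_simps)
    also have "\<dots> \<le> norm \<kappa> * F * (6 * F + 6 * norm z * N + 3 * norm v)"
      using aDu aDv F0 by (intro mult_left_mono) (auto simp: N_def algebra_simps)
    finally show ?thesis .
  qed
  have 2: "\<bar>v \<bullet> cs \<kappa> f\<bar> \<le> norm \<kappa> * F * norm v"
  proof -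
    have "\<bar>v \<bullet> cs \<kappa> f\<bar> \<le> norm v * norm (cs \<kappa> f)" by (rule Cauchy_Schwarz_ineq2)
    also have "\<dots> \<le> norm v * (norm \<kappa> * F)" using F(2) by (intro mult_left_mono) (auto simp: norm_cs mult_left_mono)
    finally show ?thesis by (simp add: mult_ac)
  qed
  have 3: "\<bar>(m / 2) * (f \<bullet> cm beta (cs \<mu> u) + v \<bullet> cm beta (cs \<mu> f))\<bar> \<le> norm \<kappa> * F * N"
  proof -
    have "\<bar>f \<bullet> cm beta (cs \<mu> u)\<bar> \<le> norm f * norm (cm beta (cs \<mu> u))"
      "\<bar>v \<bullet> cm beta (cs \<mu> f)\<bar> \<le> norm v * norm (cm beta (cs \<mu> f))"
      by (rule Cauchy_Schwarz_ineq2)+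
    then have "\<bar>f \<bullet> cm beta (cs \<mu> u) + v \<bullet> cm beta (cs \<mu> f)\<bar> \<le> norm f * (norm \<mu> * norm u) + norm v * (norm \<mu> * norm f)"
      by (simp add: norm_cs)
    also have "\<dots> = norm \<mu> * norm f * N" by (simp add: N_def algebra_simps)
    also have "\<dots> \<le> norm \<mu> * F * N" using F(2) by (intro mult_right_mono mult_left_mono) (auto simp: N_def)
    finally have "\<bar>(m / 2) * (f \<bullet> cm beta (cs \<mu> u) + v \<bullet> cm beta (cs \<mu> f))\<bar> \<le> (m / 2) * (norm \<mu> * F * N)"
      using m(1) by (simp add: abs_mult mult_left_mono)
    also have "\<dots> \<le> norm z * (norm \<mu> * F * N)"
      using mz' m(1) F0 by (intro mult_right_mono) (auto simp: N_def)
    finally show ?thesis using W0 by (simp add: nk nm field_simps)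
  qed
  have "\<bar>v \<bullet> u\<bar> \<le> norm \<kappa> * F * (6 * F + 6 * norm z * N + 3 * norm v) + norm \<kappa> * F * norm v + norm \<kappa> * F * N"
    using 1 2 3 id by linarith
  also have "\<dots> = norm \<kappa> * F * (6 * F + 6 * norm z * N + 4 * norm v + N)"
    by (simp add: algebra_simps)
  \<comment> \<open>The constant 5 is 3 + 1 + 1, from the virial term, the term with \<kappa> f and
    the terms with \<beta>.\<close>
  also have "\<dots> \<le> norm \<kappa> * F * (6 * F + (6 * norm z + 5) * N)"
    using F0 by (intro mult_left_mono) (auto simp: N_def algebra_simps)
  finally have "W * \<bar>v \<bullet> u\<bar> \<le> norm z * F * (6 * F + (6 * norm z + 5) * N)"
    using W0 by (simp add: nk field_simps)
  moreover have "((Re z)\<^sup>2 - m\<^sup>2) * \<bar>v \<bullet> u\<bar> \<le> W * \<bar>v \<bullet> u\<bar>"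
    using Wge by (intro mult_right_mono) auto
  ultimately show ?thesis unfolding N_def by linarith
qed

text \<open>The key bound with right-hand side 0 and \<open>F = 0\<close>.\<close>

lemma Hm_kernel_trivial:
  assumes "0 \<le> m" "m\<^sup>2 < lam\<^sup>2" "W1 u" "Hm m u = cs (complex_of_real lam) u"
  shows "u = 0"
proof -
  have "(lam\<^sup>2 - m\<^sup>2) * \<bar>u \<bullet> u\<bar> \<le> 0"
  proof -
    have 0: "Hm m u - cs (complex_of_real lam) u = 0" using assms(4) by simp
    have "((Re (complex_of_real lam))\<^sup>2 - m\<^sup>2) * \<bar>u \<bullet> u\<bar> \<le> norm (complex_of_real lam) * 0
        * (6 * 0 + (6 * norm (complex_of_real lam) + 5) * (norm u + norm u))"
    proof (rule key_bound[OF assms(1) _ assms(3) 0 assms(3)])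
      show "m\<^sup>2 < (Re (complex_of_real lam))\<^sup>2" using assms(2) by simp
      show "Hm m u - cs (cnj (complex_of_real lam)) u = 0" using 0 by simp
    qed (simp_all add: linear_0[OF bounded_linear.linear[OF bounded_linear_ms]])
    then show ?thesis by simp
  qed
  then have "u \<bullet> u \<le> 0" using assms(2) by (simp add: mult_le_0_iff)
  then have "u \<bullet> u = 0" using inner_ge_zero[of u] by linarith
  then show ?thesis by simp
qed

lemma Hm_shift_adjoint:
  assumes "W1 u" "W1 v"
  shows "(Hm m v - cs (cnj z) v) \<bullet> u = v \<bullet> (Hm m u - cs z u)"
  using Hm_symmetric[OF assms(2,1)] by (simp add: inner_diff_left inner_diff_right inner_cs)

text \<open>The resolvent at the conjugate of z is the adjoint of R(z), so Im <f, R(z) f> changes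
  sign under conjugation. By \<open>Hm_shift_inner_cs_i\<close> it is Im z times a squared norm, up
  to a sign common to both points.\<close>

lemma norm_res_cnj:
  assumes "Im z \<noteq> 0"
  shows "norm (res m (cnj z) f) = norm (res m z f)"
proof -
  define u v where uv_def: "u = res m z f" "v = res m (cnj z) f"
  have z': "Im (cnj z) \<noteq> 0" using assms by simp
  note u = res[OF assms, of m f, folded uv_def] and v = res[OF z', of m f, folded uv_def]
  have "Im (cnj z) * (norm v)\<^sup>2 = cs \<i> f \<bullet> v"
    using Hm_shift_inner_cs_i[OF v(1), of m "cnj z"] v(2) by simp
  also have "\<dots> = (Hm m (cs \<i> u) - cs z (cs \<i> u)) \<bullet> v"
    by (simp add: u(2)[symmetric] Hm_cs[OF u(1)] cs_diff cs_cs mult.commute)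
  also have "\<dots> = cs \<i> u \<bullet> f"
    using Hm_shift_adjoint[OF v(1) W1_cs[OF u(1), of \<i>], of m "cnj z"] v(2) by simp
  also have "\<dots> = - (cs \<i> f \<bullet> u)"
    by (subst inner_cs) (simp add: cs_minus_left inner_commute[of u])
  also have "cs \<i> f \<bullet> u = Im z * (norm u)\<^sup>2"
    using Hm_shift_inner_cs_i[OF u(1), of m z] u(2) by simp
  finally have "(norm v)\<^sup>2 = (norm u)\<^sup>2" using assms by simp
  then show ?thesis by (simp add: uv_def)
qed

text \<open>A differential inequality in the style of Mourre: \<open>G \<delta> = \<delta> \<parallel>R(\<lambda> + i\<delta>) f\<parallel>\<^sup>2\<close> satisfies
  \<open>\<bar>G'\<bar> \<le> K (\<parallel>R(\<lambda> + i\<delta>) f\<parallel> + 1)\<close> by the key bound, so \<open>G \<rightarrow> 0\<close> forces \<open>G \<delta> = O(\<delta>)\<close>.\<close>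

lemma res_bounded:
  assumes m: "0 \<le> m" "m\<^sup>2 < lam\<^sup>2"
    and F: "\<And>k R. R > 0 \<Longrightarrow> norm (ms (sn k R) f) \<le> F" "norm f \<le> F"
    and lim: "((\<lambda>\<delta>. cs \<i> f \<bullet> res m (Complex lam \<delta>) f) \<longlongrightarrow> 0) (at_right 0)"
  shows "\<exists>L. \<forall>\<delta>. 0 < \<delta> \<and> \<delta> \<le> 1 \<longrightarrow> norm (res m (Complex lam \<delta>) f) \<le> L \<and> norm (res m (Complex lam (- \<delta>)) f) \<le> L"
proof -
  define u where "u \<delta> = res m (Complex lam \<delta>) f" for \<delta>
  have u: "W1 (u \<delta>)" "Hm m (u \<delta>) - cs (Complex lam \<delta>) (u \<delta>) = f" if "\<delta> \<noteq> 0" for \<delta>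
    using res[of "Complex lam \<delta>" m f] that by (simp_all add: u_def)
  have cnj: "cnj (Complex lam \<delta>) = Complex lam (- \<delta>)" for \<delta> by (simp add: complex_eq_iff)
  have norm_minus: "norm (u (- \<delta>)) = norm (u \<delta>)" if "\<delta> \<noteq> 0" for \<delta>
    using norm_res_cnj[of "Complex lam \<delta>" m f] that by (simp add: u_def cnj)
  define G where "G \<delta> = cs \<i> f \<bullet> u \<delta>" for \<delta>
  have G: "G \<delta> = \<delta> * (norm (u \<delta>))\<^sup>2" if "\<delta> \<noteq> 0" for \<delta>
    using Hm_shift_inner_cs_i[OF u(1)[OF that], of m "Complex lam \<delta>"] u(2)[OF that] by (simp add: G_def)
  \<comment> \<open>The first resolvent identity, written as an equation for the difference.\<close>
  have step: "Hm m (u \<delta>' - u \<delta>) - cs (Complex lam \<delta>) (u \<delta>' - u \<delta>) = (\<delta>' - \<delta>) *\<^sub>R cs \<i> (u \<delta>')"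
    if "\<delta> \<noteq> 0" "\<delta>' \<noteq> 0" for \<delta> \<delta>'
  proof -
    have "cs (Complex lam \<delta>') (u \<delta>') = cs (Complex lam \<delta>) (u \<delta>') + (\<delta>' - \<delta>) *\<^sub>R cs \<i> (u \<delta>')"
      by (subst (1 2) cs_eq) (simp add: algebra_simps)
    then show ?thesis
      using u[OF that(1)] u[OF that(2)] by (simp add: Hm_diff cs_diff algebra_simps)
  qed
  \<comment> \<open>An exact increment, obtained by expressing \<open>f\<close> through the solution
    at the conjugate point. Once \<open>u\<close> is known to be continuous, the derivative of
    \<open>G\<close> can be read off.\<close>
  have Gdiff: "G \<delta>' - G \<delta> = (\<delta>' - \<delta>) * (u (- \<delta>) \<bullet> u \<delta>')" if "\<delta> \<noteq> 0" "\<delta>' \<noteq> 0" for \<delta> \<delta>'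
  proof -
    have m\<delta>: "- \<delta> \<noteq> 0" using that by simp
    have "G \<delta>' - G \<delta> = cs \<i> f \<bullet> (u \<delta>' - u \<delta>)" by (simp add: G_def inner_diff_right)
    also have "cs \<i> f = Hm m (cs \<i> (u (- \<delta>))) - cs (cnj (Complex lam \<delta>)) (cs \<i> (u (- \<delta>)))"
      unfolding u(2)[OF m\<delta>, symmetric] by (simp add: Hm_cs[OF u(1)[OF m\<delta>]] cs_diff cs_cs mult.commute cnj)
    also have "\<dots> \<bullet> (u \<delta>' - u \<delta>) = cs \<i> (u (- \<delta>)) \<bullet> ((\<delta>' - \<delta>) *\<^sub>R cs \<i> (u \<delta>'))"
      unfolding step[OF that, symmetric]
      by (rule Hm_shift_adjoint) (intro W1_diff W1_cs u that m\<delta>)+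
    also have "\<dots> = (\<delta>' - \<delta>) * (u (- \<delta>) \<bullet> u \<delta>')"
      by (simp add: inner_cs cs_cs)
    finally show ?thesis .
  qed
  \<comment> \<open>Resolvent identity and lower bound; for y > \<delta>/2 the norm of
    \<open>u y\<close> stays below \<open>norm f / (\<delta> / 2)\<close>.\<close>
  have cont: "(u \<longlongrightarrow> u \<delta>) (at \<delta>)" if \<delta>: "\<delta> > 0" for \<delta>
  proof -
    have "((\<lambda>y. \<bar>y - \<delta>\<bar> * (norm f / (\<delta> / 2)) / \<delta>) \<longlongrightarrow> \<bar>\<delta> - \<delta>\<bar> * (norm f / (\<delta> / 2)) / \<delta>) (at \<delta>)"
      using \<delta> by (intro tendsto_intros) auto
    then have "((\<lambda>y. \<bar>y - \<delta>\<bar> * (norm f / (\<delta> / 2)) / \<delta>) \<longlongrightarrow> 0) (at \<delta>)" by simp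
    moreover have "eventually (\<lambda>y. norm (u y - u \<delta>) \<le> \<bar>y - \<delta>\<bar> * (norm f / (\<delta> / 2)) / \<delta>) (at \<delta>)"
    proof -
      have "eventually (\<lambda>y. y > \<delta> / 2) (at \<delta>)"
        using \<delta> by (intro order_tendstoD(1)[OF tendsto_ident_at]) simp
      then show ?thesis
      proof eventually_elim
        case (elim y)
        then have y: "y > 0" using \<delta> by simp
        have "y * norm (u y) \<le> norm f"
          using Hm_shift_lower_bound[OF u(1), of y "Complex lam y" m] u(2)[of y] y by simp
        then have "\<delta> / 2 * norm (u y) \<le> norm f"
          using elim mult_right_mono[of "\<delta> / 2" y "norm (u y)"] by simp
        then have uy: "norm (u y) \<le> norm f / (\<delta> / 2)" using \<delta> by (simp add: field_simps)
        have "\<delta> * norm (u y - u \<delta>) \<le> norm ((y - \<delta>) *\<^sub>R cs \<i> (u y))"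
          using Hm_shift_lower_bound[OF W1_diff[OF u(1) u(1)], of y \<delta> "Complex lam \<delta>" m] step[of \<delta> y] \<delta> y by simp
        also have "\<dots> = \<bar>y - \<delta>\<bar> * norm (u y)" by (simp add: norm_cs)
        also have "\<dots> \<le> \<bar>y - \<delta>\<bar> * (norm f / (\<delta> / 2))" by (intro mult_left_mono uy) auto
        finally show ?case using \<delta> by (simp only: pos_le_divide_eq mult.commute)
      qed
    qed
    ultimately have "((\<lambda>y. u y - u \<delta>) \<longlongrightarrow> 0) (at \<delta>)" by (rule Lim_null_comparison[rotated])
    then show ?thesis by (simp add: LIM_zero_iff)
  qed
  have G': "(G has_real_derivative (u (- \<delta>) \<bullet> u \<delta>)) (at \<delta>)" if \<delta>: "\<delta> > 0" for \<delta>
    unfolding has_field_derivative_iff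
  proof (rule Lim_transform_eventually)
    show "((\<lambda>y. u (- \<delta>) \<bullet> u y) \<longlongrightarrow> u (- \<delta>) \<bullet> u \<delta>) (at \<delta>)"
      by (intro tendsto_intros cont \<delta>)
    have "eventually (\<lambda>y. y > 0) (at \<delta>)" by (intro order_tendstoD(1)[OF tendsto_ident_at] \<delta>)
    moreover have "eventually (\<lambda>y. y \<noteq> \<delta>) (at \<delta>)" by (simp add: eventually_at_filter)
    ultimately show "eventually (\<lambda>y. u (- \<delta>) \<bullet> u y = (G y - G \<delta>) / (y - \<delta>)) (at \<delta>)"
      by eventually_elim (use \<delta> in \<open>simp add: Gdiff\<close>)
  qed
  define Z where "Z = \<bar>lam\<bar> + 1"
  \<comment> \<open>Read off from \<open>key_bound\<close>: \<open>Z\<close> bounds the modulus of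
    z, the solutions at \<delta> and -\<delta> have equal norms, whence the factor 2, and
    \<open>norm (u \<delta>) + 1\<close> absorbs the term without solutions.\<close>
  define K where "K = Z * F / (lam\<^sup>2 - m\<^sup>2) * (6 * F + 2 * (6 * Z + 5))"
  have F0: "F \<ge> 0" using order_trans[OF norm_ge_zero F(2)] .
  have D0: "lam\<^sup>2 - m\<^sup>2 > 0" using m by simp
  have Z0: "Z \<ge> 1" by (simp add: Z_def)
  have K0: "K \<ge> 0" unfolding K_def using F0 D0 Z0 by (intro mult_nonneg_nonneg divide_nonneg_nonneg) auto
  have G'_bound: "\<bar>u (- \<delta>) \<bullet> u \<delta>\<bar> \<le> K * (norm (u \<delta>) + 1)" if \<delta>: "0 < \<delta>" "\<delta> \<le> 1" for \<delta>
  proof -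
    let ?z = "Complex lam \<delta>"
    have z: "norm ?z \<le> Z" using cmod_le[of ?z] \<delta> by (simp add: Z_def)
    have \<delta>0: "\<delta> \<noteq> 0" "- \<delta> \<noteq> 0" using \<delta> by auto
    have "((Re ?z)\<^sup>2 - m\<^sup>2) * \<bar>u (- \<delta>) \<bullet> u \<delta>\<bar> \<le> norm ?z * F * (6 * F + (6 * norm ?z + 5) * (norm (u \<delta>) + norm (u (- \<delta>))))"
      using m u[OF \<delta>0(1)] u[OF \<delta>0(2)] F by (intro key_bound) (auto simp: cnj)
    also have "\<dots> \<le> Z * F * (6 * F + (6 * Z + 5) * (norm (u \<delta>) + norm (u (- \<delta>))))"
      using z F0 Z0 by (intro mult_mono add_mono order_refl) (auto intro!: add_nonneg_nonneg mult_nonneg_nonneg)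
    also have "\<dots> \<le> Z * F * ((6 * F + 2 * (6 * Z + 5)) * (norm (u \<delta>) + 1))"
    proof (rule mult_left_mono)
      have "0 \<le> 6 * F * norm (u \<delta>)" using F0 by simp
      then show "6 * F + (6 * Z + 5) * (norm (u \<delta>) + norm (u (- \<delta>))) \<le> (6 * F + 2 * (6 * Z + 5)) * (norm (u \<delta>) + 1)"
        using Z0 by (simp add: norm_minus[OF \<delta>0(1)] algebra_simps)
    qed (use F0 Z0 in auto)
    finally show ?thesis using D0 by (simp add: K_def field_simps)
  qed
  \<comment> \<open>In \<open>h\<close> below, adding \<delta> to \<open>G\<close> keeps the
    argument of the root positive. With \<rho> the root of
    \<open>(norm (u \<delta>))\<^sup>2 + 1\<close> one has
    \<open>sqrt (G \<delta> + \<delta>) = sqrt \<delta> * \<rho>\<close>, while the derivative of G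
    + \<delta> is at most (2K + 1) \<rho>; so this \<open>L\<close> makes \<open>h\<close>
    nonincreasing.\<close>
  define L where "L = 2 * K + 1"
  define h where "h \<delta> = sqrt (G \<delta> + \<delta>) - L * sqrt \<delta>" for \<delta>
  have E: "G \<delta> + \<delta> = \<delta> * ((norm (u \<delta>))\<^sup>2 + 1)" if "\<delta> > 0" for \<delta>
    using G[of \<delta>] that by (simp add: algebra_simps)
  have Epos: "G \<delta> + \<delta> > 0" if "\<delta> > 0" for \<delta>
    unfolding E[OF that] using that by (intro mult_pos_pos add_nonneg_pos) auto
  have mono: "h b \<le> h a" if ab: "0 < a" "a \<le> b" "b \<le> 1" for a b
  proof (rule DERIV_nonpos_imp_nonincreasing[OF ab(2)])
    fix \<delta> assume "a \<le> \<delta>" "\<delta> \<le> b"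
    then have \<delta>: "0 < \<delta>" "\<delta> \<le> 1" using ab by auto
    define \<rho> where "\<rho> = sqrt ((norm (u \<delta>))\<^sup>2 + 1)"
    have \<rho>: "\<rho> \<ge> 1" "\<rho> \<ge> norm (u \<delta>)"
      unfolding \<rho>_def by (auto intro: real_le_rsqrt)
    have sE: "sqrt (G \<delta> + \<delta>) = sqrt \<delta> * \<rho>" by (simp add: E[OF \<delta>(1)] \<rho>_def real_sqrt_mult)
    have der: "(h has_real_derivative (inverse (sqrt (G \<delta> + \<delta>)) / 2 * (u (- \<delta>) \<bullet> u \<delta> + 1) - L * (inverse (sqrt \<delta>) / 2))) (at \<delta>)"
    proof -
      have "((\<lambda>\<delta>. G \<delta> + \<delta>) has_real_derivative (u (- \<delta>) \<bullet> u \<delta> + 1)) (at \<delta>)"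
        by (intro DERIV_add G' DERIV_ident \<delta>)
      from DERIV_diff[OF DERIV_chain2[OF DERIV_real_sqrt[OF Epos[OF \<delta>(1)]] this] DERIV_cmult[OF DERIV_real_sqrt[OF \<delta>(1)]]]
      show ?thesis unfolding h_def[abs_def] .
    qed
    have "u (- \<delta>) \<bullet> u \<delta> + 1 \<le> K * (\<rho> + \<rho>) + \<rho>"
      using G'_bound[OF \<delta>] \<rho> K0 mult_left_mono[of "norm (u \<delta>) + 1" "\<rho> + \<rho>" K] by linarith
    then have "inverse (sqrt \<delta> * \<rho>) / 2 * (u (- \<delta>) \<bullet> u \<delta> + 1) \<le> inverse (sqrt \<delta> * \<rho>) / 2 * (L * \<rho>)"
      using \<delta> \<rho> by (intro mult_left_mono) (auto simp: L_def algebra_simps)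
    also have "\<dots> = L * (inverse (sqrt \<delta>) / 2)" using \<rho> by simp
    finally have "inverse (sqrt (G \<delta> + \<delta>)) / 2 * (u (- \<delta>) \<bullet> u \<delta> + 1) - L * (inverse (sqrt \<delta>) / 2) \<le> 0"
      by (simp add: sE)
    then show "\<exists>y. (h has_real_derivative y) (at \<delta>) \<and> y \<le> 0" using der by blast
  qed
  have h_lim: "(h \<longlongrightarrow> 0) (at_right 0)"
  proof -
    have "(G \<longlongrightarrow> 0) (at_right 0)" using lim by (simp add: G_def[abs_def] u_def)
    then have "(h \<longlongrightarrow> sqrt (0 + 0) - L * sqrt 0) (at_right 0)"
      unfolding h_def[abs_def] by (intro tendsto_intros)
    then show ?thesis by simp
  qed
  \<comment> \<open>A nonincreasing function that tends to 0 at 0 from the right is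
    nonpositive.\<close>
  have hb: "h b \<le> 0" if b: "0 < b" "b \<le> 1" for b
  proof (rule tendsto_lowerbound[OF h_lim])
    show "eventually (\<lambda>a. h b \<le> h a) (at_right 0)"
      unfolding eventually_at_right_field using mono b by (intro exI[of _ b]) auto
  qed simp
  have bound: "norm (u \<delta>) \<le> L" if \<delta>: "0 < \<delta>" "\<delta> \<le> 1" for \<delta>
  proof -
    have "sqrt \<delta> * sqrt ((norm (u \<delta>))\<^sup>2 + 1) \<le> sqrt \<delta> * L"
      using hb[OF \<delta>] by (simp add: h_def E[OF \<delta>(1)] real_sqrt_mult mult.commute)
    then have "sqrt ((norm (u \<delta>))\<^sup>2 + 1) \<le> L" using \<delta> by simp
    moreover have "norm (u \<delta>) \<le> sqrt ((norm (u \<delta>))\<^sup>2 + 1)" by (auto intro: real_le_rsqrt)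
    ultimately show ?thesis by simp
  qed
  show ?thesis
  proof (intro exI allI impI)
    fix \<delta> :: real assume "0 < \<delta> \<and> \<delta> \<le> 1"
    then show "norm (res m (Complex lam \<delta>) f) \<le> L \<and> norm (res m (Complex lam (- \<delta>)) f) \<le> L"
      using bound[of \<delta>] norm_minus[of \<delta>] by (simp add: u_def)
  qed
qed

section \<open>Eigenfunctions and limits of the resolvent\<close>

lemma weight_zero [simp]: "weight 0 x = 1"
proof -
  have "1 + (norm x)\<^sup>2 \<noteq> 0" by (metis add_pos_nonneg less_irrefl zero_le_power2 zero_less_one)
  then show ?thesis by (simp add: weight_def)
qed

lemma weight_pos: "weight s x > 0"
proof -
  have "1 + (norm x)\<^sup>2 > 0" by (simp add: add_pos_nonneg)
  then show ?thesis unfolding weight_def by simp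
qed

lemma weight_neg_le_1: "s \<ge> 0 \<Longrightarrow> weight (- s) x \<le> 1"
proof -
  assume "s \<ge> 0"
  then have "1 \<le> (1 + (norm x)\<^sup>2) powr s" by (intro ge_one_powr_ge_zero) auto
  then show ?thesis unfolding weight_def powr_minus_divide by (simp add: divide_le_eq_1)
qed

lemma weight_measurable [measurable]: "weight s \<in> borel_measurable borel"
  unfolding weight_def[abs_def] by measurable

lemma L2s_zero_iff: "L2s 0 u \<longleftrightarrow> square_integrable u"
  by (simp add: L2s_def square_integrable_def)

text \<open>Local integrability provides measurability only after restriction to compact sets;
  cutting off at growing balls recovers it globally as a pointwise limit.\<close>

lemma loc_int_measurable:
  assumes "loc_int g"
  shows "g \<in> borel_measurable borel"
proof -
  have comp: "(\<lambda>x. g x $ k) \<in> borel_measurable borel" for k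
  proof (rule borel_measurable_LIMSEQ_metric)
    show "(\<lambda>x. indicator (cball 0 (real n)) x *\<^sub>R g x $ k) \<in> borel_measurable borel" for n
    proof -
      have "set_integrable lborel (cball 0 (real n)) (\<lambda>x. g x $ k)"
        using assms by (simp add: loc_int_def)
      from borel_measurable_integrable[OF this[unfolded set_integrable_def]] show ?thesis by simp
    qed
    show "(\<lambda>n. indicator (cball 0 (real n)) x *\<^sub>R g x $ k) \<longlonglongrightarrow> g x $ k" for x
    proof (rule tendsto_eventually)
      obtain N :: nat where "norm x \<le> real N" using real_arch_simple by blast
      then show "\<forall>\<^sub>F n in sequentially. indicator (cball 0 (real n)) x *\<^sub>R g x $ k = g x $ k"
        by (intro eventually_sequentiallyI[of N]) (auto simp: indicator_def)
    qed
  qed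
  have "(\<lambda>x. \<Sum>k\<in>UNIV. tv k (\<lambda>x. cnj (g x $ k)) x) \<in> borel_measurable borel"
    by (intro borel_measurable_sum tv_measurable measurable_compose[OF comp] borel_measurable_continuous_onI
        continuous_intros)
  moreover have "(\<Sum>k\<in>UNIV. tv k (\<lambda>x. cnj (g x $ k)) x) = g x" for x
    by (simp add: vec_eq_iff tv_def axis_def if_distrib if_distribR cong: if_cong)
  ultimately show ?thesis by simp
qed

lemma weak_deriv_pd: "square_integrable u \<Longrightarrow> W1 (cls u) \<Longrightarrow> weak_deriv u j (fn (pd j (cls u)))"
  using W1_has_pd[of "cls u" j] has_pd_iff_weak_deriv[of u "fn (pd j (cls u))" j] by simp

lemma H1s_zero_iff: "H1s 0 u \<longleftrightarrow> square_integrable u \<and> W1 (cls u)"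
proof
  assume "H1s 0 u"
  then obtain g where u: "square_integrable u" and g: "\<And>j. weak_deriv u j (g j)" "\<And>j. square_integrable (g j)"
    by (auto simp: H1s_def L2s_zero_iff)
  then have "has_pd j (cls u) (cls (g j))" for j by (simp add: has_pd_iff_weak_deriv)
  then show "square_integrable u \<and> W1 (cls u)" using u by (auto intro: W1I[of _ "\<lambda>j. cls (g j)"])
next
  assume u: "square_integrable u \<and> W1 (cls u)"
  then have "weak_deriv u j (fn (pd j (cls u)))" for j by (intro weak_deriv_pd) auto
  then show "H1s 0 u" using u unfolding H1s_def L2s_zero_iff
    by (intro conjI exI[of _ "\<lambda>j. fn (pd j (cls u))"]) auto
qed

lemma fn_sum: "finite I \<Longrightarrow> AE x in lborel. fn (\<Sum>i\<in>I. u i) x = (\<Sum>i\<in>I. fn (u i) x)"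
proof (induction I rule: finite_induct)
  case empty
  then show ?case using fn_zero by simp
next
  case (insert i I)
  show ?case using insert(3) fn_add[of "u i" "\<Sum>i\<in>I. u i"]
  proof eventually_elim
    case (elim x)
    then show ?case using insert(1,2) by simp
  qed
qed

lemma fn_cm: "AE x in lborel. fn (cm A u) x = A *v fn u x"
  using fn_Mul[of "\<lambda>x. A" u] by (simp add: cm_def)

lemma fn_Hm:
  "AE x in lborel. fn (Hm m u) x = (\<Sum>j\<in>UNIV. alpha j *v ((- \<i>) *s fn (pd j u) x)) + complex_of_real m *s (beta *v fn u x)"
proof -
  have "AE x in lborel. \<forall>j. fn (cm (alpha j) (cs (- \<i>) (pd j u))) x = alpha j *v ((- \<i>) *s fn (pd j u) x)"
  proof (intro eventually_all_finite)
    fix j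
    show "AE x in lborel. fn (cm (alpha j) (cs (- \<i>) (pd j u))) x = alpha j *v ((- \<i>) *s fn (pd j u) x)"
      using fn_cm[of "alpha j" "cs (- \<i>) (pd j u)"] fn_cs[of "- \<i>" "pd j u"]
      by eventually_elim simp
  qed
  moreover have "AE x in lborel. fn (aD u) x = (\<Sum>j\<in>UNIV. fn (cm (alpha j) (cs (- \<i>) (pd j u))) x)"
    unfolding aD_def by (rule fn_sum) simp
  moreover have "AE x in lborel. fn (Hm m u) x = fn (aD u) x + fn (cs (complex_of_real m) (cm beta u)) x"
    unfolding Hm_def cs_of_real by (rule fn_add)
  ultimately show ?thesis
    using fn_cs[of "complex_of_real m" "cm beta u"] fn_cm[of beta u]
    by eventually_elim simp
qed

text \<open>Weak derivatives are unique almost everywhere, so the functions \<open>g\<close>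
  quantified in \<open>dirac_eq\<close> may be replaced by representatives of
  \<open>pd\<close>.\<close>

lemma dirac_eq_iff:
  assumes V: "bounded_field V"
  shows "dirac_eq m V z u f \<longleftrightarrow> square_integrable u \<and> W1 (cls u) \<and>
    (AE x in lborel. fn (Hm m (cls u) + Mul V (cls u) - cs z (cls u)) x = f x)"
proof -
  have main: "(AE x in lborel. (\<Sum>j\<in>UNIV. alpha j *v ((- \<i>) *s g j x)) + complex_of_real m *s (beta *v u x)
        + V x *v u x - z *s u x = f x) \<longleftrightarrow>
      (AE x in lborel. fn (Hm m (cls u) + Mul V (cls u) - cs z (cls u)) x = f x)"
    if u: "square_integrable u" "W1 (cls u)" and g: "\<And>j. weak_deriv u j (g j)" for g
  proof -
    have "AE x in lborel. \<forall>j. g j x = fn (pd j (cls u)) x"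
      by (intro eventually_all_finite weak_deriv_unique[OF g] weak_deriv_pd u)
    then have "AE x in lborel. (\<Sum>j\<in>UNIV. alpha j *v ((- \<i>) *s g j x)) + complex_of_real m *s (beta *v u x)
        + V x *v u x - z *s u x = fn (Hm m (cls u) + Mul V (cls u) - cs z (cls u)) x"
      using fn_Hm[of m "cls u"] fn_Mul[OF V, of "cls u"] fn_cs[of z "cls u"] fn_cls[OF u(1)]
        fn_add[of "Hm m (cls u)" "Mul V (cls u)"] fn_diff[of "Hm m (cls u) + Mul V (cls u)" "cs z (cls u)"]
      by eventually_elim simp
    then show ?thesis by (intro eventually_subst) (auto elim: eventually_mono)
  qed
  show ?thesis
  proof
    assume "dirac_eq m V z u f"
    then obtain g where u: "square_integrable u" "W1 (cls u)" and g: "\<And>j. weak_deriv u j (g j)"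
      and eq: "AE x in lborel. (\<Sum>j\<in>UNIV. alpha j *v ((- \<i>) *s g j x)) + complex_of_real m *s (beta *v u x)
        + V x *v u x - z *s u x = f x"
      unfolding dirac_eq_def H1s_zero_iff by blast
    show "square_integrable u \<and> W1 (cls u) \<and>
        (AE x in lborel. fn (Hm m (cls u) + Mul V (cls u) - cs z (cls u)) x = f x)"
      using u main[OF u g] eq by blast
  next
    assume *: "square_integrable u \<and> W1 (cls u) \<and>
        (AE x in lborel. fn (Hm m (cls u) + Mul V (cls u) - cs z (cls u)) x = f x)"
    then have "weak_deriv u j (fn (pd j (cls u)))" for j by (intro weak_deriv_pd) auto
    then show "dirac_eq m V z u f"
      unfolding dirac_eq_def H1s_zero_iff using * main[of "\<lambda>j. fn (pd j (cls u))"]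
      by (intro conjI exI[of _ "\<lambda>j. fn (pd j (cls u))"]) auto
  qed
qed

lemma dirac_eq_l2_iff:
  assumes "bounded_field V" "square_integrable f"
  shows "dirac_eq m V z u f \<longleftrightarrow> square_integrable u \<and> W1 (cls u) \<and>
    Hm m (cls u) + Mul V (cls u) - cs z (cls u) = cls f"
proof -
  have "(AE x in lborel. fn w x = f x) \<longleftrightarrow> w = cls f" for w
    using cls_eq_iff[of "fn w" f] assms(2) by simp
  then show ?thesis by (simp add: dirac_eq_iff[OF assms(1)])
qed

lemma Mul_zero_field: "Mul (\<lambda>x. 0) u = 0"
  using cm_matrix_uminus[of 0 0 u] by (simp add: cm_def equation_minus_iff eq_neg_iff_add_eq_0 flip: scaleR_2)

text \<open>The choice operator may return any representative, but uniqueness of the resolvent fixes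
  its class.\<close>

lemma free_res:
  assumes "Im z \<noteq> 0" "square_integrable f"
  shows "square_integrable (free_res m z f)" "cls (free_res m z f) = res m z (cls f)"
proof -
  have iff: "dirac_eq m (\<lambda>x. 0) z u f \<longleftrightarrow> square_integrable u \<and> W1 (cls u) \<and> Hm m (cls u) - cs z (cls u) = cls f" for u
    using dirac_eq_l2_iff[of "\<lambda>x. 0" f m z u] assms(2) by (simp add: Mul_zero_field)
  have "dirac_eq m (\<lambda>x. 0) z (fn (res m z (cls f))) f"
    using res[OF assms(1), of m "cls f"] by (simp add: iff)
  then have "dirac_eq m (\<lambda>x. 0) z (free_res m z f) f"
    unfolding free_res_def by (rule someI[of "\<lambda>u. dirac_eq m (\<lambda>x. 0) z u f"])
  then show "square_integrable (free_res m z f)" "cls (free_res m z f) = res m z (cls f)"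
    using res_eqI[OF assms(1), of "cls (free_res m z f)" m "cls f"] by (auto simp: iff)
qed

lemma weighted_norm_le:
  assumes "square_integrable f" "s \<ge> 0"
  shows "integrable lborel (\<lambda>x. weight (- s) x * (norm (f x))\<^sup>2)"
    and "(\<integral>x. weight (- s) x * (norm (f x))\<^sup>2 \<partial>lborel) \<le> (norm (cls f))\<^sup>2"
proof -
  have [measurable]: "f \<in> borel_measurable borel" and i: "integrable lborel (\<lambda>x. (norm (f x))\<^sup>2)"
    using assms(1) by (auto simp: square_integrable_def)
  have le: "weight (- s) x * (norm (f x))\<^sup>2 \<le> (norm (f x))\<^sup>2" for x
    using mult_right_mono[OF weight_neg_le_1[OF assms(2), of x], of "(norm (f x))\<^sup>2"] by simp
  show int: "integrable lborel (\<lambda>x. weight (- s) x * (norm (f x))\<^sup>2)"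
    using le weight_pos[of "- s"]
    by (intro Bochner_Integration.integrable_bound[OF i]) (auto simp: abs_mult abs_of_pos)
  show "(\<integral>x. weight (- s) x * (norm (f x))\<^sup>2 \<partial>lborel) \<le> (norm (cls f))\<^sup>2"
    unfolding norm_cls_sq[OF assms(1)] by (intro integral_mono_AE int i AE_I2 le)
qed

lemma wd_eq: "weak_deriv u j g \<Longrightarrow> AE x in lborel. wd u j x = g x"
  and wd_weak_deriv: "weak_deriv u j g \<Longrightarrow> weak_deriv u j (wd u j)"
proof -
  show *: "weak_deriv u j g \<Longrightarrow> weak_deriv u j (wd u j)" unfolding wd_def by (rule someI[of "weak_deriv u j"])
  show "weak_deriv u j g \<Longrightarrow> AE x in lborel. wd u j x = g x" by (rule weak_deriv_unique[OF *])
qed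

lemma weighted_wd_integral:
  assumes "weak_deriv u j g"
  shows "(\<integral>x. weight s x * (norm (wd u j x))\<^sup>2 \<partial>lborel) = (\<integral>x. weight s x * (norm (g x))\<^sup>2 \<partial>lborel)"
proof (rule integral_cong_AE)
  have [measurable]: "g \<in> borel_measurable borel" "wd u j \<in> borel_measurable borel"
    using assms wd_weak_deriv[OF assms] by (auto simp: weak_deriv_def intro: loc_int_measurable)
  show "(\<lambda>x. weight s x * (norm (wd u j x))\<^sup>2) \<in> borel_measurable lborel"
    "(\<lambda>x. weight s x * (norm (g x))\<^sup>2) \<in> borel_measurable lborel" by measurable
  show "AE x in lborel. weight s x * (norm (wd u j x))\<^sup>2 = weight s x * (norm (g x))\<^sup>2"
    using wd_eq[OF assms] by eventually_elim simp
qed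

text \<open>Weights with negative exponent are at most 1, and \<open>norm_aD_sq\<close> collects the
  three derivatives.\<close>

lemma H1s_norm_le:
  assumes u: "square_integrable u" "W1 (cls u)" and s: "s \<ge> 0"
  shows "H1s_norm (- s) u \<le> norm (cls u) + norm (aD (cls u))"
proof -
  have "(\<integral>x. weight (- s) x * (norm (wd u j x))\<^sup>2 \<partial>lborel) \<le> (norm (pd j (cls u)))\<^sup>2" for j
    using weighted_norm_le(2)[of "fn (pd j (cls u))" s] s
    by (simp add: weighted_wd_integral[OF weak_deriv_pd[OF u]])
  then have "H1s_norm (- s) u \<le> sqrt ((norm (cls u))\<^sup>2 + (\<Sum>j\<in>UNIV. (norm (pd j (cls u)))\<^sup>2))"
    unfolding H1s_norm_def using weighted_norm_le(2)[OF u(1) s]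
    by (intro real_sqrt_le_mono add_mono sum_mono) auto
  also have "\<dots> \<le> norm (cls u) + norm (aD (cls u))"
    unfolding norm_aD_sq[OF u(2), symmetric] by (rule sqrt_sum_squares_le_sum) auto
  finally show ?thesis .
qed

lemma H1s_zero_imp: "H1s 0 u \<Longrightarrow> s \<ge> 0 \<Longrightarrow> H1s (- s) u"
proof -
  assume "H1s 0 u" and s: "s \<ge> 0"
  then obtain g where g: "\<And>j. weak_deriv u j (g j)" "\<And>j. square_integrable (g j)" "square_integrable u"
    unfolding H1s_def L2s_zero_iff by blast
  have "L2s (- s) f" if "square_integrable f" for f
    using weighted_norm_le(1)[OF that s] that by (simp add: L2s_def square_integrable_def)
  then show ?thesis unfolding H1s_def using g by blast
qed

text \<open>The operators \<delta> R(z) are bounded by 1, and on vectors (H - \<lambda>) v they are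
  of order \<delta>. Such vectors are dense by \<open>dense_range\<close>, since the kernel of H -
  \<lambda> is trivial; hence \<delta> R(z) tends strongly to 0. The equation then transfers the
  convergence to \<alpha>\<cdot>D.\<close>

lemma res_tendsto_eigenfunction:
  assumes m: "0 \<le> m" "m\<^sup>2 < lam\<^sup>2" and sg: "sg = 1 \<or> sg = -1"
    and u: "W1 u" "Hm m u - cs (complex_of_real lam) u = f"
  defines "w \<equiv> \<lambda>\<delta>. res m (Complex lam (sg * \<delta>)) f - u"
  shows "((\<lambda>\<delta>. norm (w \<delta>) + norm (aD (w \<delta>))) \<longlongrightarrow> 0) (at_right 0)"
proof -
  let ?z = "\<lambda>\<delta>. Complex lam (sg * \<delta>)"
  have z: "cs (?z \<delta>) x = cs (complex_of_real lam) x + (sg * \<delta>) *\<^sub>R cs \<i> x" for \<delta> x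
    by (subst (1 2) cs_eq) simp
  have w: "W1 (w \<delta>)" "Hm m (w \<delta>) - cs (?z \<delta>) (w \<delta>) = (sg * \<delta>) *\<^sub>R cs \<i> u" if "\<delta> > 0" for \<delta>
  proof -
    have i: "Im (?z \<delta>) \<noteq> 0" using that sg by auto
    define r where "r = res m (?z \<delta>) f"
    have r: "W1 r" "Hm m r - cs (?z \<delta>) r = f" using res[OF i, of m f] by (simp_all add: r_def)
    show "W1 (w \<delta>)" unfolding w_def by (rule W1_diff[OF r(1)[unfolded r_def] u(1)])
    have "Hm m (r - u) - cs (?z \<delta>) (r - u) = (Hm m r - cs (?z \<delta>) r) - (Hm m u - cs (?z \<delta>) u)"
      using r(1) u(1) by (simp add: Hm_diff cs_diff)
    also have "\<dots> = (sg * \<delta>) *\<^sub>R cs \<i> u"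
    proof -
      have "Hm m u - cs (?z \<delta>) u = f - (sg * \<delta>) *\<^sub>R cs \<i> u"
        unfolding z u(2)[symmetric] by simp
      then show ?thesis unfolding r(2) by simp
    qed
    finally show "Hm m (w \<delta>) - cs (?z \<delta>) (w \<delta>) = (sg * \<delta>) *\<^sub>R cs \<i> u" by (simp add: w_def r_def)
  qed
  have lim_w: "((\<lambda>\<delta>. norm (w \<delta>)) \<longlongrightarrow> 0) (at_right 0)"
  proof (rule tendstoI)
    fix e :: real assume e: "e > 0"
    have "closure {Hm m v - cs (complex_of_real lam) v | v. W1 v} = UNIV"
      using Hm_kernel_trivial[OF m] by (intro dense_range) auto
    then have "cs \<i> u \<in> closure {Hm m v - cs (complex_of_real lam) v | v. W1 v}" by simp
    then obtain y where "y \<in> {Hm m v - cs (complex_of_real lam) v | v. W1 v}" "dist y (cs \<i> u) < e / 2"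
      using e unfolding closure_approachable by (meson half_gt_zero)
    then obtain v where v: "W1 v" "norm (cs \<i> u - (Hm m v - cs (complex_of_real lam) v)) < e / 2"
      by (auto simp: dist_norm norm_minus_commute)
    \<comment> \<open>Here (H - \<lambda>) v approximates i u, and \<open>?c *\<^sub>R v\<close> is
      subtracted from \<open>w \<delta>\<close>. One term \<delta> norm v comes from replacing z by
      \<lambda>, the other from restoring what was subtracted.\<close>
    have bound: "norm (w \<delta>) \<le> e / 2 + 2 * \<delta> * norm v" if \<delta>: "\<delta> > 0" for \<delta>
    proof -
      let ?c = "sg * \<delta>"
      have c: "\<bar>?c\<bar> = \<delta>" using sg \<delta> by auto
      have "Hm m (w \<delta> - ?c *\<^sub>R v) - cs (?z \<delta>) (w \<delta> - ?c *\<^sub>R v)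
          = ?c *\<^sub>R (cs \<i> u - (Hm m v - cs (?z \<delta>) v))"
        using w[OF \<delta>] v(1) by (simp add: Hm_diff Hm_scaleR W1_scaleR cs_diff cs_scaleR algebra_simps)
      also have "\<dots> = ?c *\<^sub>R ((cs \<i> u - (Hm m v - cs (complex_of_real lam) v)) + ?c *\<^sub>R cs \<i> v)"
        unfolding z by (simp add: algebra_simps)
      finally have eq: "Hm m (w \<delta> - ?c *\<^sub>R v) - cs (?z \<delta>) (w \<delta> - ?c *\<^sub>R v) = \<dots>" .
      have "\<delta> * norm (w \<delta> - ?c *\<^sub>R v) \<le> \<delta> * norm ((cs \<i> u - (Hm m v - cs (complex_of_real lam) v)) + ?c *\<^sub>R cs \<i> v)"
        using Hm_shift_lower_bound[of "w \<delta> - ?c *\<^sub>R v" "?z \<delta>" m] w(1)[OF \<delta>] v(1) c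
        unfolding eq norm_scaleR by (simp add: W1_diff W1_scaleR)
      then have "norm (w \<delta> - ?c *\<^sub>R v) \<le> norm ((cs \<i> u - (Hm m v - cs (complex_of_real lam) v)) + ?c *\<^sub>R cs \<i> v)"
        using \<delta> by simp
      also have "\<dots> \<le> e / 2 + \<delta> * norm v"
        using v(2) c by (intro order_trans[OF norm_triangle_ineq] add_mono) (auto simp: norm_cs)
      finally have "norm (w \<delta> - ?c *\<^sub>R v) \<le> e / 2 + \<delta> * norm v" .
      moreover have "norm (w \<delta>) \<le> norm (w \<delta> - ?c *\<^sub>R v) + \<delta> * norm v"
        using norm_triangle_sub[of "w \<delta>" "?c *\<^sub>R v"] c by (simp add: add.commute)
      ultimately show ?thesis by simp
    qed
    have "((\<lambda>\<delta>. e / 2 + 2 * \<delta> * norm v) \<longlongrightarrow> e / 2 + 2 * 0 * norm v) (at_right 0)"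
      by (intro tendsto_intros)
    then have "eventually (\<lambda>\<delta>. e / 2 + 2 * \<delta> * norm v < e) (at_right 0)"
      by (rule order_tendstoD(2)) (use e in auto)
    moreover have "eventually (\<lambda>\<delta>. \<delta> > 0) (at_right (0::real))" by (simp add: eventually_at_filter)
    ultimately show "eventually (\<lambda>\<delta>. dist (norm (w \<delta>)) 0 < e) (at_right 0)"
      by eventually_elim (use bound in \<open>auto intro: le_less_trans\<close>)
  qed
  have "((\<lambda>\<delta>. \<delta> * norm u + 2 * (\<bar>lam\<bar> + \<delta>) * norm (w \<delta>)) \<longlongrightarrow> 0 * norm u + 2 * (\<bar>lam\<bar> + 0) * 0) (at_right 0)"
    by (intro tendsto_intros lim_w)
  then have lim2: "((\<lambda>\<delta>. \<delta> * norm u + 2 * (\<bar>lam\<bar> + \<delta>) * norm (w \<delta>)) \<longlongrightarrow> 0) (at_right 0)" by simp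
  have "((\<lambda>\<delta>. norm (aD (w \<delta>))) \<longlongrightarrow> 0) (at_right 0)"
  proof (rule tendsto_sandwich[OF _ _ tendsto_const lim2])
    have "eventually (\<lambda>\<delta>. \<delta> > 0) (at_right (0::real))" by (simp add: eventually_at_filter)
    then show "eventually (\<lambda>\<delta>. norm (aD (w \<delta>)) \<le> \<delta> * norm u + 2 * (\<bar>lam\<bar> + \<delta>) * norm (w \<delta>)) (at_right 0)"
    proof eventually_elim
      case (elim \<delta>)
      have c: "\<bar>sg * \<delta>\<bar> = \<delta>" using sg elim by auto
      have "m < \<bar>lam\<bar>" using power2_less_imp_less[of m "\<bar>lam\<bar>"] m by simp
      then have mz: "m \<le> norm (?z \<delta>)" using abs_Re_le_cmod[of "?z \<delta>"] by simp
      have zn: "norm (?z \<delta>) \<le> \<bar>lam\<bar> + \<delta>" using cmod_le[of "?z \<delta>"] c by simp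
      have "norm (aD (w \<delta>)) \<le> norm ((sg * \<delta>) *\<^sub>R cs \<i> u) + 2 * norm (?z \<delta>) * norm (w \<delta>)"
        by (rule norm_aD_le[OF w(2)[OF elim] m(1) mz])
      also have "\<dots> \<le> \<delta> * norm u + 2 * (\<bar>lam\<bar> + \<delta>) * norm (w \<delta>)"
        using c zn unfolding norm_scaleR norm_cs by (intro add_mono mult_right_mono mult_left_mono) auto
      finally show ?case .
    qed
  qed simp
  from tendsto_add[OF lim_w this] show ?thesis by simp
qed

section \<open>Weighted spaces and the decay of the potential\<close>

lemma weight_half_sq: "(weight (t / 2) x)\<^sup>2 = weight t x"
proof -
  have "1 + (norm x)\<^sup>2 > 0" by (simp add: add_pos_nonneg)
  then show ?thesis by (simp add: weight_def power2_eq_square flip: powr_add)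
qed

lemma weight_mult_minus: "weight t x * weight (- t) x = 1"
proof -
  have "1 + (norm x)\<^sup>2 > 0" by (simp add: add_pos_nonneg)
  then show ?thesis by (simp add: weight_def flip: powr_add)
qed

lemma weighted_square_integrable:
  assumes "L2s t h"
  shows "square_integrable (\<lambda>x. weight (t / 2) x *\<^sub>R h x)"
    and "(norm (cls (\<lambda>x. weight (t / 2) x *\<^sub>R h x)))\<^sup>2 = (\<integral>x. weight t x * (norm (h x))\<^sup>2 \<partial>lborel)"
proof -
  have eq: "(norm (weight (t / 2) x *\<^sub>R h x))\<^sup>2 = weight t x * (norm (h x))\<^sup>2" for x
    by (simp add: power_mult_distrib weight_half_sq)
  show si: "square_integrable (\<lambda>x. weight (t / 2) x *\<^sub>R h x)"
    unfolding square_integrable_def eq using assms by (auto simp: L2s_def)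
  show "(norm (cls (\<lambda>x. weight (t / 2) x *\<^sub>R h x)))\<^sup>2 = (\<integral>x. weight t x * (norm (h x))\<^sup>2 \<partial>lborel)"
    unfolding norm_cls_sq[OF si] eq ..
qed

lemma weighted_integral_nonneg: "0 \<le> (\<integral>x. weight t x * (norm (h x))\<^sup>2 \<partial>lborel)"
  by (rule Bochner_Integration.integral_nonneg) (simp add: less_imp_le[OF weight_pos])

lemma H1s_norm_nonneg: "0 \<le> H1s_norm t u"
  unfolding H1s_norm_def
  by (intro real_sqrt_ge_zero add_nonneg_nonneg sum_nonneg weighted_integral_nonneg)

lemma L2s_iff_square_integrable:
  "L2s t h \<longleftrightarrow> square_integrable (\<lambda>x. weight (t / 2) x *\<^sub>R h x)"
proof
  assume si: "square_integrable (\<lambda>x. weight (t / 2) x *\<^sub>R h x)"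
  then have [measurable]: "(\<lambda>x. weight (t / 2) x *\<^sub>R h x) \<in> borel_measurable borel"
    by (simp add: square_integrable_def)
  have "(\<lambda>x. weight (- (t / 2)) x *\<^sub>R (weight (t / 2) x *\<^sub>R h x)) \<in> borel_measurable borel" by measurable
  moreover have "weight (- (t / 2)) x *\<^sub>R (weight (t / 2) x *\<^sub>R h x) = h x" for x
    using weight_mult_minus[of "t / 2" x] by (simp add: mult.commute)
  ultimately have "h \<in> borel_measurable borel" by simp
  moreover have "(norm (weight (t / 2) x *\<^sub>R h x))\<^sup>2 = weight t x * (norm (h x))\<^sup>2" for x
    by (simp add: power_mult_distrib weight_half_sq)
  ultimately show "L2s t h" using si by (simp add: L2s_def square_integrable_def)
qed (rule weighted_square_integrable)

lemma L2s_diff: "L2s t f \<Longrightarrow> L2s t g \<Longrightarrow> L2s t (\<lambda>x. f x - g x)"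
  unfolding L2s_iff_square_integrable using square_integrable_diff by (simp add: scaleR_diff_right)

lemma square_integrable_imp_L2s: "square_integrable f \<Longrightarrow> s \<ge> 0 \<Longrightarrow> L2s (- s) f"
  using weighted_norm_le(1)[of f s] by (simp add: L2s_def square_integrable_def)

lemma weak_deriv_diff:
  assumes "weak_deriv u j g" "weak_deriv v j h"
  shows "weak_deriv (\<lambda>x. u x - v x) j (\<lambda>x. g x - h x)"
proof -
  have loc: "loc_int u" "loc_int v" "loc_int g" "loc_int h" using assms by (auto simp: weak_deriv_def)
  have ld: "loc_int (\<lambda>x. a x - b x)" if "loc_int a" "loc_int b" for a b
    unfolding loc_int_def
  proof (intro allI impI)
    fix K :: "(real^3) set" and k assume "compact K"
    then have "set_integrable lborel K (\<lambda>x. a x $ k)" "set_integrable lborel K (\<lambda>x. b x $ k)"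
      using that by (auto simp: loc_int_def)
    then show "set_integrable lborel K (\<lambda>x. (a x - b x) $ k)" by (simp add: set_integral_diff)
  qed
  have "(\<integral>x. (u x - v x) $ k * pderiv3 \<phi> j x \<partial>lborel) = - (\<integral>x. (g x - h x) $ k * \<phi> x \<partial>lborel)"
    if \<phi>: "test_fun \<phi>" for \<phi> k
  proof -
    note i = loc_int_test_integrable[where k = k]
    have "(\<integral>x. (u x - v x) $ k * pderiv3 \<phi> j x \<partial>lborel)
        = (\<integral>x. u x $ k * pderiv3 \<phi> j x \<partial>lborel) - (\<integral>x. v x $ k * pderiv3 \<phi> j x \<partial>lborel)"
      using i[OF loc(1) test_fun_pderiv3[OF \<phi>]] i[OF loc(2) test_fun_pderiv3[OF \<phi>]]
      by (simp add: left_diff_distrib)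
    also have "\<dots> = - ((\<integral>x. g x $ k * \<phi> x \<partial>lborel) - (\<integral>x. h x $ k * \<phi> x \<partial>lborel))"
      using assms \<phi> by (simp add: weak_deriv_def)
    also have "(\<integral>x. g x $ k * \<phi> x \<partial>lborel) - (\<integral>x. h x $ k * \<phi> x \<partial>lborel) = (\<integral>x. (g x - h x) $ k * \<phi> x \<partial>lborel)"
      using i[OF loc(3) \<phi>] i[OF loc(4) \<phi>] by (simp add: left_diff_distrib)
    finally show ?thesis .
  qed
  then show ?thesis using ld loc by (simp add: weak_deriv_def)
qed

lemma norm_ms_sn_le:
  assumes f: "square_integrable f" and g: "square_integrable (\<lambda>x. (1 + norm x) *\<^sub>R f x)"
  shows "R > 0 \<Longrightarrow> norm (ms (sn k R) (cls f)) \<le> norm (cls (\<lambda>x. (1 + norm x) *\<^sub>R f x))"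
    and "norm (cls f) \<le> norm (cls (\<lambda>x. (1 + norm x) *\<^sub>R f x))"
proof -
  show "norm (ms (sn k R) (cls f)) \<le> norm (cls (\<lambda>x. (1 + norm x) *\<^sub>R f x))" if R: "R > 0"
  proof -
    have "AE x in lborel. norm (fn (ms (sn k R) (cls f)) x) \<le> 1 * norm (fn (cls (\<lambda>x. (1 + norm x) *\<^sub>R f x)) x)"
      using fn_ms[OF bfun_sn[OF R], of k "cls f"] fn_cls[OF f] fn_cls[OF g]
    proof eventually_elim
      case (elim x)
      have "\<bar>sn k R x\<bar> * norm (f x) \<le> (1 + norm x) * norm (f x)"
        using abs_sn_le[OF R, of k x] by (intro mult_right_mono) auto
      then show ?case using elim by simp
    qed
    from norm_le_AE[OF _ this] show ?thesis by simp
  qed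
  have "AE x in lborel. norm (fn (cls f) x) \<le> 1 * norm (fn (cls (\<lambda>x. (1 + norm x) *\<^sub>R f x)) x)"
    using fn_cls[OF f] fn_cls[OF g]
  proof eventually_elim
    case (elim x)
    have "1 * norm (f x) \<le> (1 + norm x) * norm (f x)" by (intro mult_right_mono) auto
    then show ?case using elim by simp
  qed
  from norm_le_AE[OF _ this] show "norm (cls f) \<le> norm (cls (\<lambda>x. (1 + norm x) *\<^sub>R f x))" by simp
qed

lemma weight_le_powr: "a \<ge> 0 \<Longrightarrow> weight a x \<le> (1 + norm x) powr (2 * a)"
proof -
  assume a: "a \<ge> 0"
  have "weight a x \<le> ((1 + norm x)\<^sup>2) powr a"
    unfolding weight_def using a by (intro powr_mono2) (auto simp: power2_sum add_pos_nonneg)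
  also have "(1 + norm x)\<^sup>2 = (1 + norm x) powr 2"
    using powr_realpow[of "1 + norm x" 2] by (simp add: add_pos_nonneg)
  finally show ?thesis by (simp only: powr_powr)
qed

text \<open>With \<open>p = 1\<close> and \<open>b = s\<close> this says that \<open>V\<close> maps \<open>L\<^sup>2\<^sup>,\<^sup>-\<^sup>s\<close> into \<open>L\<^sup>2\<^sup>,\<^sup>1\<close>, as the virial estimate requires.\<close>

lemma potential_bound:
  assumes "C > 0" "\<forall>x. norm (V x) \<le> C * (1 + norm x) powr (-(2 + eps))"
    and ab: "a \<ge> 0" "b \<ge> 0" "p \<ge> 0" "a + b + p \<le> 2 + eps"
  shows "weight (a / 2) x * (1 + norm x) powr p * norm (V x *v v) \<le> C * weight (- (b / 2)) x * norm (v :: complex^4)"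
proof -
  have r: "1 + norm x > 0" "1 + norm x \<ge> 1" by (auto simp: add_pos_nonneg)
  have "norm (V x *v v) \<le> norm (V x) * norm v" by (rule norm_matrix_vector_le)
  also have "\<dots> \<le> C * (1 + norm x) powr (-(2 + eps)) * norm v"
    using assms(2) by (intro mult_right_mono) auto
  finally have Vv: "norm (V x *v v) \<le> C * (1 + norm x) powr (-(2 + eps)) * norm v" .
  have wa: "weight (a / 2) x \<le> (1 + norm x) powr a" and wb: "weight (b / 2) x \<le> (1 + norm x) powr b"
    using weight_le_powr[of "a / 2" x] weight_le_powr[of "b / 2" x] ab by auto
  have "weight (a / 2) x * (1 + norm x) powr p * ((1 + norm x) powr (-(2 + eps)) * weight (b / 2) x) \<le> 1"
  proof -
    have "weight (a / 2) x * (1 + norm x) powr p * ((1 + norm x) powr (-(2 + eps)) * weight (b / 2) x)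
        \<le> (1 + norm x) powr a * (1 + norm x) powr p * ((1 + norm x) powr (-(2 + eps)) * (1 + norm x) powr b)"
      using wa wb less_imp_le[OF weight_pos] by (intro mult_mono mult_nonneg_nonneg) auto
    also have "\<dots> = (1 + norm x) powr (a + p + (-(2 + eps) + b))"
      by (simp only: powr_add)
    also have "\<dots> \<le> (1 + norm x) powr 0" using ab r by (intro powr_mono) auto
    finally show ?thesis using r by simp
  qed
  then have key: "weight (a / 2) x * (1 + norm x) powr p * (1 + norm x) powr (-(2 + eps)) \<le> weight (- (b / 2)) x"
    using mult_right_mono[of "weight (a / 2) x * (1 + norm x) powr p * ((1 + norm x) powr (-(2 + eps)) * weight (b / 2) x)" 1 "weight (- (b / 2)) x"]
      weight_pos[of "- (b / 2)" x] weight_mult_minus[of "b / 2" x] by (simp add: mult.assoc)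
  have "weight (a / 2) x * (1 + norm x) powr p * norm (V x *v v)
      \<le> weight (a / 2) x * (1 + norm x) powr p * (C * (1 + norm x) powr (-(2 + eps)) * norm v)"
    using weight_pos[of "a / 2" x] by (intro mult_left_mono Vv) (auto intro: less_imp_le)
  also have "\<dots> = C * (weight (a / 2) x * (1 + norm x) powr p * (1 + norm x) powr (-(2 + eps))) * norm v"
    by (simp only: mult_ac)
  also have "\<dots> \<le> C * weight (- (b / 2)) x * norm v"
    using key assms(1) by (intro mult_right_mono mult_left_mono) auto
  finally show ?thesis .
qed

lemma bounded_field_potential:
  fixes V :: "real^3 \<Rightarrow> complex^4^4"
  assumes "C > 0" "eps > 0" "V \<in> borel_measurable lborel" "\<forall>x. norm (V x) \<le> C * (1 + norm x) powr (-(2 + eps))"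
  shows "bounded_field V"
proof -
  have "norm (V x) \<le> C" for x
  proof -
    have "(1 + norm x) powr (-(2 + eps)) \<le> (1 + norm x) powr 0" using assms(2) by (intro powr_mono) auto
    also have "\<dots> = 1" by (simp add: add_pos_nonneg less_imp_neq[symmetric])
    finally have "C * (1 + norm x) powr (-(2 + eps)) \<le> C" using assms(1) by simp
    then show ?thesis using assms(4) order_trans by blast
  qed
  then show ?thesis using assms(3) by (auto simp: bounded_field_def)
qed

lemma eigenvalue_in_Sigma:
  fixes m C eps s sg lam :: real and V :: "real^3 \<Rightarrow> complex^4^4"
  assumes m: "m > 0" and C: "C > 0" and eps: "eps > 0"
    and Vm: "V \<in> borel_measurable lborel"
    and Vb: "\<forall>x. norm (V x) \<le> C * (1 + norm x) powr (-(2 + eps))"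
    and s: "1/2 < s" "s < (1 + eps) / 2"
    and sg: "sg = 1 \<or> sg = -1" and lam: "lam \<in> U_set m" and ev: "is_eigenvalue m V lam"
  shows "lam \<in> Sigma_V m V s sg"
proof -
  note V = bounded_field_potential[OF C eps Vm Vb]
  have "m < \<bar>lam\<bar>" using lam by (simp add: U_set_def)
  then have m': "0 \<le> m" "m\<^sup>2 < lam\<^sup>2" using m power_strict_mono[of m "\<bar>lam\<bar>" 2] by auto
  obtain u where u: "dirac_eq m V (complex_of_real lam) u (\<lambda>x. 0)" "\<not> (AE x in lborel. u x = 0)"
    using ev by (auto simp: is_eigenvalue_def)
  have si: "square_integrable u" and W: "W1 (cls u)"
    and eq: "Hm m (cls u) + Mul V (cls u) - cs (complex_of_real lam) (cls u) = 0"
    using u(1) by (simp_all add: dirac_eq_l2_iff[OF V])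
  define \<phi> where "\<phi> x = - (V x *v u x)" for x
  have si\<phi>: "square_integrable \<phi>" unfolding \<phi>_def[abs_def] by (intro square_integrable_uminus square_integrable_Mul V si)
  have "cls \<phi> = - Mul V (cls u)"
    unfolding \<phi>_def[abs_def] by (simp add: Mul_cls[OF V si] cls_uminus square_integrable_Mul[OF V si])
  moreover have "Hm m (cls u) - cs (complex_of_real lam) (cls u)
      = (Hm m (cls u) + Mul V (cls u) - cs (complex_of_real lam) (cls u)) - Mul V (cls u)" by simp
  ultimately have H: "Hm m (cls u) - cs (complex_of_real lam) (cls u) = cls \<phi>" unfolding eq by simp
  have L2: "L2s s \<phi>"
    unfolding L2s_iff_square_integrable
  proof (rule square_integrable_bound[OF si])
    show "(\<lambda>x. weight (s / 2) x *\<^sub>R \<phi> x) \<in> borel_measurable lborel"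
      using si\<phi> by (auto simp: square_integrable_def)
    show "AE x in lborel. norm (weight (s / 2) x *\<^sub>R \<phi> x) \<le> C * norm (u x)"
    proof (rule AE_I2)
      fix x
      \<comment> \<open>Here a = s and b = p = 0, which needs s <= 2 + eps: an unweighted
        \<open>u\<close> suffices for \<phi> to acquire the weight.\<close>
      have "weight (s / 2) x * (1 + norm x) powr 0 * norm (V x *v u x) \<le> C * weight (- (0 / 2)) x * norm (u x)"
        using s eps by (intro potential_bound[OF C Vb]) auto
      moreover have "1 + norm x \<noteq> 0" by (metis add_pos_nonneg less_irrefl norm_ge_zero zero_less_one)
      ultimately show "norm (weight (s / 2) x *\<^sub>R \<phi> x) \<le> C * norm (u x)"
        using weight_pos[of "s / 2" x] by (simp add: \<phi>_def abs_of_pos)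
    qed
  qed
  \<comment> \<open>If V u vanished, \<open>u\<close> would be an eigenfunction of the free
    operator.\<close>
  have nz: "\<not> (AE x in lborel. \<phi> x = 0)"
  proof
    assume "AE x in lborel. \<phi> x = 0"
    then have "cls \<phi> = 0" using cls_eq_iff[OF si\<phi> square_integrable_zero] by simp
    then have "cls u = 0" using Hm_kernel_trivial[OF m' W] H by simp
    then have "AE x in lborel. u x = 0" using cls_eq_iff[OF si square_integrable_zero] by simp
    then show False using u(2) by simp
  qed
  have "lim_res m s sg lam \<phi> u"
    unfolding lim_res_def
  proof
    show "H1s (- s) u" using s si W by (intro H1s_zero_imp) (auto simp: H1s_zero_iff)
    let ?w = "\<lambda>\<delta> x. free_res m (Complex lam (sg * \<delta>)) \<phi> x - u x"
    have lim: "((\<lambda>\<delta>. norm (res m (Complex lam (sg * \<delta>)) (cls \<phi>) - cls u) + norm (aD (res m (Complex lam (sg * \<delta>)) (cls \<phi>) - cls u))) \<longlongrightarrow> 0) (at_right 0)"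
      by (rule res_tendsto_eigenfunction[OF m' sg W H])
    show "((\<lambda>\<delta>. H1s_norm (- s) (?w \<delta>)) \<longlongrightarrow> 0) (at_right 0)"
    proof (rule tendsto_sandwich[OF _ _ tendsto_const lim])
      show "eventually (\<lambda>\<delta>. 0 \<le> H1s_norm (- s) (?w \<delta>)) (at_right 0)"
        by (intro always_eventually allI H1s_norm_nonneg)
      have "eventually (\<lambda>\<delta>. \<delta> > 0) (at_right (0::real))" by (simp add: eventually_at_filter)
      then show "eventually (\<lambda>\<delta>. H1s_norm (- s) (?w \<delta>) \<le> norm (res m (Complex lam (sg * \<delta>)) (cls \<phi>) - cls u)
          + norm (aD (res m (Complex lam (sg * \<delta>)) (cls \<phi>) - cls u))) (at_right 0)"
      proof eventually_elim
        case (elim \<delta>)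
        have z: "Im (Complex lam (sg * \<delta>)) \<noteq> 0" using elim sg by auto
        note fr = free_res[OF z si\<phi>, of m]
        have c: "cls (?w \<delta>) = res m (Complex lam (sg * \<delta>)) (cls \<phi>) - cls u"
          by (simp add: cls_diff[OF fr(1) si, symmetric] fr(2))
        have "square_integrable (?w \<delta>)" by (rule square_integrable_diff[OF fr(1) si])
        moreover have "W1 (cls (?w \<delta>))" unfolding c by (rule W1_diff[OF res(1)[OF z] W])
        ultimately show ?case using H1s_norm_le[of "?w \<delta>" s] s by (simp add: c)
      qed
    qed
  qed
  moreover have "AE x in lborel. \<phi> x = - (V x *v u x)" by (simp add: \<phi>_def)
  ultimately show ?thesis
    unfolding Sigma_V_def using lam L2 nz by blast
qed

text \<open>On a ball the weight is bounded below, so there the limit inherits the uniform L2 bound,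
  with a constant that does not depend on the radius. Fatou's lemma then removes the ball.\<close>

lemma square_integrable_of_weighted_limit:
  assumes h: "L2s (- s) h" and s: "s \<ge> 0"
    and lim: "((\<lambda>\<delta>. \<integral>x. weight (- s) x * (norm (fn (a \<delta>) x - h x))\<^sup>2 \<partial>lborel) \<longlongrightarrow> 0) (at_right (0::real))"
    and bd: "eventually (\<lambda>\<delta>. norm (a \<delta>) \<le> L) (at_right 0)"
  shows "square_integrable h"
proof -
  have [measurable]: "h \<in> borel_measurable borel" using h by (simp add: L2s_def)
  have [measurable]: "cball (0::real^3) R \<in> sets borel" for R by simp
  have ball: "(\<integral>\<^sup>+x. ennreal (indicator (cball 0 R) x * (norm (h x))\<^sup>2) \<partial>lborel) \<le> ennreal (2 * L\<^sup>2 + 1)" if R: "R \<ge> 0" for R :: real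
  proof -
    \<comment> \<open>1 / B is the least value of the weight on the ball. Choosing \<delta> with
      weighted error below 1 / (2 B) makes the contribution of the error at most 1, whatever the
      radius.\<close>
    define B where "B = (1 + R\<^sup>2) powr s"
    have B: "B > 0" unfolding B_def by (simp add: add_pos_nonneg less_imp_neq[symmetric])
    have "eventually (\<lambda>\<delta>. (\<integral>x. weight (- s) x * (norm (fn (a \<delta>) x - h x))\<^sup>2 \<partial>lborel) < 1 / (2 * B)) (at_right 0)"
      using lim B by (intro order_tendstoD(2)) auto
    from eventually_happens'[OF trivial_limit_at_right_real eventually_conj[OF this bd]]
    obtain \<delta> where \<delta>: "(\<integral>x. weight (- s) x * (norm (fn (a \<delta>) x - h x))\<^sup>2 \<partial>lborel) < 1 / (2 * B)" "norm (a \<delta>) \<le> L"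
      by blast
    let ?D = "\<lambda>x. weight (- s) x * (norm (fn (a \<delta>) x - h x))\<^sup>2"
    have iD: "integrable lborel ?D"
      using L2s_diff[OF square_integrable_imp_L2s[OF square_integrable_fn s] h] by (simp add: L2s_def)
    have i: "integrable lborel (\<lambda>x. 2 * B * ?D x + 2 * (norm (fn (a \<delta>) x))\<^sup>2)"
      by (intro Bochner_Integration.integrable_add integrable_mult_right iD integrable_fn_sq)
    have "indicator (cball 0 R) x * (norm (h x))\<^sup>2 \<le> 2 * B * ?D x + 2 * (norm (fn (a \<delta>) x))\<^sup>2" for x
    proof (cases "x \<in> cball 0 R")
      case True
      have "(norm (h x))\<^sup>2 \<le> (norm (fn (a \<delta>) x - h x) + norm (fn (a \<delta>) x))\<^sup>2"
        using norm_triangle_ineq2[of "h x" "fn (a \<delta>) x"] by (intro power_mono) (auto simp: norm_minus_commute)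
      also have "\<dots> \<le> 2 * (norm (fn (a \<delta>) x - h x))\<^sup>2 + 2 * (norm (fn (a \<delta>) x))\<^sup>2"
        using sum_squares_bound[of "norm (fn (a \<delta>) x - h x)" "norm (fn (a \<delta>) x)"] by (simp add: power2_sum)
      also have "(norm (fn (a \<delta>) x - h x))\<^sup>2 \<le> B * ?D x"
      proof -
        have "weight s x \<le> B" unfolding weight_def B_def using True s R
          by (intro powr_mono2 add_left_mono power_mono) auto
        then have "1 \<le> B * weight (- s) x"
          using weight_mult_minus[of s x] mult_right_mono[of "weight s x" B "weight (- s) x"] weight_pos[of "- s" x] by simp
        then have "1 * (norm (fn (a \<delta>) x - h x))\<^sup>2 \<le> B * weight (- s) x * (norm (fn (a \<delta>) x - h x))\<^sup>2"
          by (intro mult_right_mono) auto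
        then show ?thesis by (simp add: mult.assoc)
      qed
      finally show ?thesis using True by simp
    next
      case False
      then show ?thesis using B weight_pos[of "- s" x] by (simp add: add_nonneg_nonneg)
    qed
    then have "(\<integral>\<^sup>+x. ennreal (indicator (cball 0 R) x * (norm (h x))\<^sup>2) \<partial>lborel)
        \<le> (\<integral>\<^sup>+x. ennreal (2 * B * ?D x + 2 * (norm (fn (a \<delta>) x))\<^sup>2) \<partial>lborel)"
      by (intro nn_integral_mono ennreal_leI)
    also have "\<dots> = ennreal (\<integral>x. 2 * B * ?D x + 2 * (norm (fn (a \<delta>) x))\<^sup>2 \<partial>lborel)"
      using B less_imp_le[OF weight_pos] by (intro nn_integral_eq_integral i AE_I2 add_nonneg_nonneg mult_nonneg_nonneg) auto
    also have "(\<integral>x. 2 * B * ?D x + 2 * (norm (fn (a \<delta>) x))\<^sup>2 \<partial>lborel) = 2 * B * (\<integral>x. ?D x \<partial>lborel) + 2 * (norm (a \<delta>))\<^sup>2"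
      unfolding norm_fn_sq by (subst Bochner_Integration.integral_add) (auto intro!: integrable_mult_right iD integrable_fn_sq)
    also have "ennreal (2 * B * (\<integral>x. ?D x \<partial>lborel) + 2 * (norm (a \<delta>))\<^sup>2) \<le> ennreal (2 * L\<^sup>2 + 1)"
    proof (rule ennreal_leI)
      have "2 * B * (\<integral>x. ?D x \<partial>lborel) \<le> 1" using \<delta>(1) B by (simp add: field_simps)
      moreover have "(norm (a \<delta>))\<^sup>2 \<le> L\<^sup>2" using \<delta>(2) by (intro power_mono) auto
      ultimately show "2 * B * (\<integral>x. ?D x \<partial>lborel) + 2 * (norm (a \<delta>))\<^sup>2 \<le> 2 * L\<^sup>2 + 1" by linarith
    qed
    finally show ?thesis .
  qed
  have "(\<integral>\<^sup>+x. ennreal ((norm (h x))\<^sup>2) \<partial>lborel)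
      = (\<integral>\<^sup>+x. liminf (\<lambda>n. ennreal (indicator (cball 0 (real n)) x * (norm (h x))\<^sup>2)) \<partial>lborel)"
  proof (rule nn_integral_cong)
    fix x
    have "(\<lambda>n. ennreal (indicator (cball 0 (real n)) x * (norm (h x))\<^sup>2)) \<longlonglongrightarrow> ennreal ((norm (h x))\<^sup>2)"
    proof (rule tendsto_eventually)
      obtain N :: nat where "norm x \<le> real N" using real_arch_simple by blast
      then show "\<forall>\<^sub>F n in sequentially. ennreal (indicator (cball 0 (real n)) x * (norm (h x))\<^sup>2) = ennreal ((norm (h x))\<^sup>2)"
        by (intro eventually_sequentiallyI[of N]) (auto simp: indicator_def)
    qed
    then show "ennreal ((norm (h x))\<^sup>2) = liminf (\<lambda>n. ennreal (indicator (cball 0 (real n)) x * (norm (h x))\<^sup>2))"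
      by (rule lim_imp_Liminf[OF trivial_limit_sequentially, symmetric])
  qed
  also have "\<dots> \<le> liminf (\<lambda>n. \<integral>\<^sup>+x. ennreal (indicator (cball 0 (real n)) x * (norm (h x))\<^sup>2) \<partial>lborel)"
    by (intro nn_integral_liminf) measurable
  also have "\<dots> \<le> ennreal (2 * L\<^sup>2 + 1)"
    by (intro Liminf_le always_eventually allI ball) auto
  finally have "(\<integral>\<^sup>+x. ennreal ((norm (h x))\<^sup>2) \<partial>lborel) < \<infinity>" by (auto intro: le_less_trans)
  then show ?thesis by (auto simp: square_integrable_def intro!: integrableI_nonneg)
qed

text \<open>Im <f, R(z) f> is governed by Im z times a squared norm that conjugation preserves.
  Hence \<open>res_bounded\<close>, whose hypothesis concerns the limit from above, also serves the
  limit from below.\<close>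

lemma inner_cs_i_res_sg:
  assumes "sg = 1 \<or> sg = -1" "\<delta> > 0"
  shows "\<bar>cs \<i> f \<bullet> res m (Complex lam \<delta>) f\<bar> = \<bar>cs \<i> f \<bullet> res m (Complex lam (sg * \<delta>)) f\<bar>"
proof -
  have *: "cs \<i> f \<bullet> res m z f = Im z * (norm (res m z f))\<^sup>2" if "Im z \<noteq> 0" for z
    using Hm_shift_inner_cs_i[OF res(1)[OF that, of m f], of m z] res(2)[OF that, of m f] by simp
  have "cnj (Complex lam \<delta>) = Complex lam (- \<delta>)" by (simp add: complex_eq_iff)
  then have "norm (res m (Complex lam (- \<delta>)) f) = norm (res m (Complex lam \<delta>) f)"
    using norm_res_cnj[of "Complex lam \<delta>" m f] assms(2) by simp
  then show ?thesis using *[of "Complex lam \<delta>"] *[of "Complex lam (- \<delta>)"] assms by (auto simp: abs_mult)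
qed

lemma hermitian4_adj4: "hermitian4 A \<Longrightarrow> adj4 A = A"
proof -
  assume h: "hermitian4 A"
  have "adj4 A $ i $ j = A $ i $ j" for i j
  proof -
    have "adj4 A $ i $ j = cnj (A $ j $ i)" by (simp add: adj4_def)
    also have "\<dots> = A $ i $ j" using h[unfolded hermitian4_def, rule_format, of i j] by (rule sym)
    finally show ?thesis .
  qed
  then show ?thesis by (simp only: vec_eq_iff) simp
qed

lemma hermitian4_inner_zero: "hermitian4 A \<Longrightarrow> (\<i> *s (A *v x)) \<bullet> x = 0"
proof -
  assume "hermitian4 A"
  note A = hermitian4_adj4[OF this]
  have "(\<i> *s (A *v x)) \<bullet> x = x \<bullet> (adj4 (mat \<i> ** A) *v x)"
    unfolding mat_vector[symmetric] matrix_vector_mul_assoc by (rule inner_matrix_vector)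
  also have "adj4 (mat \<i> ** A) = mat (- \<i>) ** A"
    unfolding adj4_mult A adj4_mat complex_cnj_i by (rule mat_commute[symmetric])
  also have "(mat (- \<i>) ** A) *v x = (- \<i>) *s (A *v x)"
    unfolding matrix_vector_mul_assoc[symmetric] by (rule mat_vector)
  also have "(- \<i>) *s (A *v x) = - (\<i> *s (A *v x))" by simp
  finally have "(\<i> *s (A *v x)) \<bullet> x = - (x \<bullet> (\<i> *s (A *v x)))" by (simp only: inner_minus_right)
  then show ?thesis using inner_commute[of x "\<i> *s (A *v x)"] by linarith
qed

lemma norm_cm_alpha [simp]: "norm (cm (alpha j) u) = norm u"
proof -
  have "cm (alpha j) u \<bullet> cm (alpha j) u = u \<bullet> u"
    using cs_one[of u] by (simp add: inner_cm cm_cm alpha_sq cs_def)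
  then show ?thesis by (simp add: norm_eq_sqrt_inner)
qed

text \<open>Convergence to \<open>u\<close> is known only in weighted norms. Once
  \<open>res_bounded\<close> has bounded the resolvents in L2, this places first \<open>u\<close>
  and then its weak derivatives in L2; the equation itself is again verified in the weighted
  norm.\<close>

lemma Sigma_in_eigenvalue:
  fixes m C eps s sg lam :: real and V :: "real^3 \<Rightarrow> complex^4^4"
  assumes m: "m > 0" and C: "C > 0" and eps: "eps > 0"
    and Vm: "V \<in> borel_measurable lborel" and herm: "\<forall>x. hermitian4 (V x)"
    and Vb: "\<forall>x. norm (V x) \<le> C * (1 + norm x) powr (-(2 + eps))"
    and s: "1/2 < s" "s < (1 + eps) / 2"
    and sg: "sg = 1 \<or> sg = -1" and S: "lam \<in> Sigma_V m V s sg"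
  shows "is_eigenvalue m V lam"
proof -
  note V = bounded_field_potential[OF C eps Vm Vb]
  obtain \<phi> u where lam: "lam \<in> U_set m" and \<phi>: "L2s s \<phi>" "\<not> (AE x in lborel. \<phi> x = 0)"
    and lr: "lim_res m s sg lam \<phi> u" and \<phi>V: "AE x in lborel. \<phi> x = - (V x *v u x)"
    using S by (auto simp: Sigma_V_def)
  have "m < \<bar>lam\<bar>" using lam by (simp add: U_set_def)
  then have m': "0 \<le> m" "m\<^sup>2 < lam\<^sup>2" "m < \<bar>lam\<bar>" using m power_strict_mono[of m "\<bar>lam\<bar>" 2] by auto
  have s0: "s \<ge> 0" using s by simp
  obtain g where u: "L2s (- s) u" and g: "\<And>j. weak_deriv u j (g j)" "\<And>j. L2s (- s) (g j)"
    and lim: "((\<lambda>\<delta>. H1s_norm (- s) (\<lambda>x. free_res m (Complex lam (sg * \<delta>)) \<phi> x - u x)) \<longlongrightarrow> 0) (at_right 0)"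
    using lr unfolding lim_res_def H1s_def by blast
  have [measurable]: "\<phi> \<in> borel_measurable borel" "u \<in> borel_measurable borel" using \<phi>(1) u by (auto simp: L2s_def)
  have si_wu: "square_integrable (\<lambda>x. weight (- s / 2) x *\<^sub>R u x)"
    using u unfolding L2s_iff_square_integrable .
  have si1: "square_integrable (\<lambda>x. (1 + norm x) *\<^sub>R \<phi> x)"
  proof (rule square_integrable_bound[OF si_wu])
    show "AE x in lborel. norm ((1 + norm x) *\<^sub>R \<phi> x) \<le> C * norm (weight (- s / 2) x *\<^sub>R u x)"
      using \<phi>V
    proof eventually_elim
      case (elim x)
      have p: "1 + norm x > 0" by (simp add: add_pos_nonneg)
      have "weight (0 / 2) x * (1 + norm x) powr 1 * norm (V x *v u x) \<le> C * weight (- (s / 2)) x * norm (u x)"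
        using s eps by (intro potential_bound[OF C Vb]) auto
      then show ?case using elim p weight_pos[of "- (s / 2)" x] by (simp add: abs_of_pos)
    qed
  qed measurable
  have si\<phi>: "square_integrable \<phi>"
  proof (rule square_integrable_bound[OF si1])
    show "AE x in lborel. norm (\<phi> x) \<le> 1 * norm ((1 + norm x) *\<^sub>R \<phi> x)"
    proof (rule AE_I2)
      fix x
      have "1 * norm (\<phi> x) \<le> (1 + norm x) * norm (\<phi> x)" by (intro mult_right_mono) auto
      then show "norm (\<phi> x) \<le> 1 * norm ((1 + norm x) *\<^sub>R \<phi> x)" by simp
    qed
  qed measurable
  define f where "f = cls \<phi>"
  define r where "r \<delta> = res m (Complex lam (sg * \<delta>)) f" for \<delta>
  define D where "D \<delta> = (\<lambda>x. free_res m (Complex lam (sg * \<delta>)) \<phi> x - u x)" for \<delta>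
  define N where "N \<delta> = H1s_norm (- s) (D \<delta>)" for \<delta>
  have N: "(N \<longlongrightarrow> 0) (at_right 0)" using lim by (simp add: N_def[abs_def] D_def)
  have pos: "eventually (\<lambda>\<delta>. \<delta> > 0) (at_right (0::real))" by (simp add: eventually_at_filter)
  have z: "Im (Complex lam (sg * \<delta>)) \<noteq> 0" if "\<delta> > 0" for \<delta> using that sg by auto
  have r: "W1 (r \<delta>)" "Hm m (r \<delta>) - cs (Complex lam (sg * \<delta>)) (r \<delta>) = f" if "\<delta> > 0" for \<delta>
    using res[OF z[OF that], of m f] by (simp_all add: r_def)
  have fr: "square_integrable (free_res m (Complex lam (sg * \<delta>)) \<phi>)"
      "cls (free_res m (Complex lam (sg * \<delta>)) \<phi>) = r \<delta>" if "\<delta> > 0" for \<delta>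
    using free_res[OF z[OF that] si\<phi>, of m] by (simp_all add: r_def f_def)
  have DL: "L2s (- s) (D \<delta>)" if "\<delta> > 0" for \<delta>
    unfolding D_def by (intro L2s_diff square_integrable_imp_L2s fr that s0 u)
  have wdD: "weak_deriv (D \<delta>) j (\<lambda>x. fn (pd j (r \<delta>)) x - g j x)" if "\<delta> > 0" for \<delta> j
  proof -
    have "weak_deriv (free_res m (Complex lam (sg * \<delta>)) \<phi>) j (fn (pd j (r \<delta>)))"
      using weak_deriv_pd[OF fr(1)[OF that], of j] fr(2)[OF that] r(1)[OF that] by simp
    from weak_deriv_diff[OF this g(1)] show ?thesis by (simp add: D_def)
  qed
  have Nsq: "(N \<delta>)\<^sup>2 = (\<integral>x. weight (- s) x * (norm (D \<delta> x))\<^sup>2 \<partial>lborel)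
      + (\<Sum>j\<in>UNIV. \<integral>x. weight (- s) x * (norm (wd (D \<delta>) j x))\<^sup>2 \<partial>lborel)" for \<delta>
    unfolding N_def H1s_norm_def by (intro real_sqrt_pow2 add_nonneg_nonneg sum_nonneg weighted_integral_nonneg)
  have N0: "N \<delta> \<ge> 0" for \<delta> unfolding N_def by (rule H1s_norm_nonneg)
  have I0: "(\<integral>x. weight (- s) x * (norm (D \<delta> x))\<^sup>2 \<partial>lborel) \<le> (N \<delta>)\<^sup>2" for \<delta>
    unfolding Nsq by (simp add: sum_nonneg weighted_integral_nonneg)
  have Ij: "(\<integral>x. weight (- s) x * (norm (wd (D \<delta>) j x))\<^sup>2 \<partial>lborel) \<le> (N \<delta>)\<^sup>2" for \<delta> j
  proof -
    have "(\<integral>x. weight (- s) x * (norm (wd (D \<delta>) j x))\<^sup>2 \<partial>lborel)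
        \<le> (\<Sum>j\<in>UNIV. \<integral>x. weight (- s) x * (norm (wd (D \<delta>) j x))\<^sup>2 \<partial>lborel)"
      by (intro member_le_sum weighted_integral_nonneg) auto
    then show ?thesis unfolding Nsq using weighted_integral_nonneg[of "- s" "D \<delta>"] by linarith
  qed
  have Nsq_lim: "((\<lambda>\<delta>. (N \<delta>)\<^sup>2) \<longlongrightarrow> 0) (at_right 0)" using tendsto_power[OF N, of 2] by simp
  \<comment> \<open>As \<open>V\<close> is Hermitian, \<open>\<langle>i\<phi>, u\<rangle> = 0\<close> pointwise, so only the remainder \<open>R(\<lambda> \<plusminus> i\<delta>)\<phi> - u\<close> contributes.\<close>
  define A where "A = norm (cls (\<lambda>x. weight (s / 2) x *\<^sub>R \<phi> x))"
  have G_le: "\<bar>cs \<i> f \<bullet> r \<delta>\<bar> \<le> A * N \<delta>" if \<delta>: "\<delta> > 0" for \<delta>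
  proof -
    let ?a = "\<lambda>x. weight (s / 2) x *\<^sub>R \<phi> x" and ?b = "\<lambda>x. weight (- s / 2) x *\<^sub>R D \<delta> x"
    have a: "square_integrable ?a" using \<phi>(1) unfolding L2s_iff_square_integrable .
    have ia: "square_integrable (\<lambda>x. \<i> *s ?a x)" using square_integrable_Mul[OF bounded_field_const a, of "mat \<i>"] by (simp add: mat_vector)
    have b: "square_integrable ?b" using DL[OF \<delta>] unfolding L2s_iff_square_integrable .
    have i\<phi>: "square_integrable (\<lambda>x. \<i> *s \<phi> x)" using square_integrable_Mul[OF bounded_field_const si\<phi>, of "mat \<i>"] by (simp add: mat_vector)
    have "cs \<i> f \<bullet> r \<delta> = (\<integral>x. (\<i> *s \<phi> x) \<bullet> free_res m (Complex lam (sg * \<delta>)) \<phi> x \<partial>lborel)"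
      unfolding f_def cs_cls[OF si\<phi>] fr(2)[OF \<delta>, symmetric] by (rule inner_cls[OF i\<phi> fr(1)[OF \<delta>]])
    also have "\<dots> = (\<integral>x. (\<i> *s ?a x) \<bullet> ?b x \<partial>lborel)"
    proof (rule integral_cong_AE)
      have [measurable]: "(\<lambda>x. \<i> *s \<phi> x) \<in> borel_measurable borel" "(\<lambda>x. \<i> *s ?a x) \<in> borel_measurable borel"
        "?b \<in> borel_measurable borel" "free_res m (Complex lam (sg * \<delta>)) \<phi> \<in> borel_measurable borel"
        using i\<phi> ia b fr(1)[OF \<delta>] by (auto simp: square_integrable_def)
      show "(\<lambda>x. (\<i> *s \<phi> x) \<bullet> free_res m (Complex lam (sg * \<delta>)) \<phi> x) \<in> borel_measurable lborel"
        "(\<lambda>x. (\<i> *s ?a x) \<bullet> ?b x) \<in> borel_measurable lborel" by measurable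
      show "AE x in lborel. (\<i> *s \<phi> x) \<bullet> free_res m (Complex lam (sg * \<delta>)) \<phi> x = (\<i> *s ?a x) \<bullet> ?b x"
        using \<phi>V
      proof eventually_elim
        case (elim x)
        have "(\<i> *s \<phi> x) \<bullet> u x = - ((\<i> *s (V x *v u x)) \<bullet> u x)" using elim by simp
        then have zero: "(\<i> *s \<phi> x) \<bullet> u x = 0" using hermitian4_inner_zero herm by simp
        have "\<i> *s ?a x = weight (s / 2) x *\<^sub>R (\<i> *s \<phi> x)" by (simp add: vec_eq_iff)
        then have "(\<i> *s ?a x) \<bullet> ?b x = (weight (s / 2) x * weight (- (s / 2)) x) * ((\<i> *s \<phi> x) \<bullet> D \<delta> x)" by simp
        also have "\<dots> = (\<i> *s \<phi> x) \<bullet> free_res m (Complex lam (sg * \<delta>)) \<phi> x"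
          by (simp add: weight_mult_minus D_def inner_diff_right zero)
        finally show ?case ..
      qed
    qed
    also have "\<dots> = cs \<i> (cls ?a) \<bullet> cls ?b" unfolding cs_cls[OF a] by (rule inner_cls[OF ia b, symmetric])
    finally have "\<bar>cs \<i> f \<bullet> r \<delta>\<bar> \<le> norm (cs \<i> (cls ?a)) * norm (cls ?b)"
      using Cauchy_Schwarz_ineq2 by simp
    moreover have "norm (cls ?b) \<le> N \<delta>"
    proof (rule power2_le_imp_le[OF _ N0])
      show "(norm (cls ?b))\<^sup>2 \<le> (N \<delta>)\<^sup>2"
        using weighted_square_integrable(2)[OF DL[OF \<delta>]] I0[of \<delta>] by simp
    qed
    ultimately show ?thesis
      using mult_left_mono[of "norm (cls ?b)" "N \<delta>" A] by (simp add: norm_cs A_def)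
  qed
  have "((\<lambda>\<delta>. cs \<i> f \<bullet> res m (Complex lam \<delta>) f) \<longlongrightarrow> 0) (at_right 0)"
  proof (rule Lim_null_comparison)
    show "eventually (\<lambda>\<delta>. norm (cs \<i> f \<bullet> res m (Complex lam \<delta>) f) \<le> A * N \<delta>) (at_right 0)"
      using pos
    proof eventually_elim
      case (elim \<delta>)
      show ?case using G_le[OF elim] inner_cs_i_res_sg[OF sg elim, of f m lam] by (simp add: r_def)
    qed
    show "((\<lambda>\<delta>. A * N \<delta>) \<longlongrightarrow> 0) (at_right 0)" using tendsto_mult[OF tendsto_const N, of A] by simp
  qed
  then have "\<exists>L. \<forall>\<delta>. 0 < \<delta> \<and> \<delta> \<le> 1 \<longrightarrow> norm (res m (Complex lam \<delta>) f) \<le> L \<and> norm (res m (Complex lam (- \<delta>)) f) \<le> L"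
    using norm_ms_sn_le[OF si\<phi> si1]
    by (intro res_bounded[OF m'(1,2), of f "norm (cls (\<lambda>x. (1 + norm x) *\<^sub>R \<phi> x))"]) (simp_all add: f_def)
  then obtain L where L: "\<And>\<delta>. 0 < \<delta> \<Longrightarrow> \<delta> \<le> 1 \<Longrightarrow> norm (res m (Complex lam \<delta>) f) \<le> L \<and> norm (res m (Complex lam (- \<delta>)) f) \<le> L"
    by blast
  have rL: "norm (r \<delta>) \<le> L" if "0 < \<delta>" "\<delta> \<le> 1" for \<delta> using L[OF that] sg by (auto simp: r_def)
  have unit: "eventually (\<lambda>\<delta>. 0 < \<delta> \<and> \<delta> \<le> 1) (at_right (0::real))"
    unfolding eventually_at_right_field by (auto intro: exI[of _ 1])
  define L' where "L' = norm f + 2 * (\<bar>lam\<bar> + 1) * L"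
  have pdL: "norm (pd j (r \<delta>)) \<le> L'" if \<delta>: "0 < \<delta>" "\<delta> \<le> 1" for j \<delta>
  proof -
    let ?z = "Complex lam (sg * \<delta>)"
    have z1: "norm ?z \<le> \<bar>lam\<bar> + 1" using cmod_le[of ?z] \<delta> sg by auto
    have "norm (pd j (r \<delta>)) \<le> norm (aD (r \<delta>))" by (rule norm_pd_le[OF r(1)[OF \<delta>(1)]])
    also have "\<dots> \<le> norm f + 2 * norm ?z * norm (r \<delta>)"
      using abs_Re_le_cmod[of ?z] m' by (intro norm_aD_le[OF r(2)[OF \<delta>(1)]]) auto
    also have "\<dots> \<le> L'" unfolding L'_def using z1 rL[OF \<delta>]
      by (intro add_left_mono mult_mono) auto
    finally show ?thesis .
  qed
  have siu: "square_integrable u"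
  proof (rule square_integrable_of_weighted_limit[OF u s0])
    show "((\<lambda>\<delta>. \<integral>x. weight (- s) x * (norm (fn (r \<delta>) x - u x))\<^sup>2 \<partial>lborel) \<longlongrightarrow> 0) (at_right 0)"
    proof (rule tendsto_sandwich[OF _ _ tendsto_const Nsq_lim])
      show "eventually (\<lambda>\<delta>. (\<integral>x. weight (- s) x * (norm (fn (r \<delta>) x - u x))\<^sup>2 \<partial>lborel) \<le> (N \<delta>)\<^sup>2) (at_right 0)"
        using pos
      proof eventually_elim
        case (elim \<delta>)
        have "(\<integral>x. weight (- s) x * (norm (fn (r \<delta>) x - u x))\<^sup>2 \<partial>lborel) = (\<integral>x. weight (- s) x * (norm (D \<delta> x))\<^sup>2 \<partial>lborel)"
        proof (rule integral_cong_AE)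
          have [measurable]: "D \<delta> \<in> borel_measurable borel" using DL[OF elim] by (simp add: L2s_def)
          show "(\<lambda>x. weight (- s) x * (norm (fn (r \<delta>) x - u x))\<^sup>2) \<in> borel_measurable lborel"
            "(\<lambda>x. weight (- s) x * (norm (D \<delta> x))\<^sup>2) \<in> borel_measurable lborel" by measurable
          show "AE x in lborel. weight (- s) x * (norm (fn (r \<delta>) x - u x))\<^sup>2 = weight (- s) x * (norm (D \<delta> x))\<^sup>2"
            using fn_cls[OF fr(1)[OF elim]] unfolding fr(2)[OF elim] D_def by eventually_elim simp
        qed
        then show ?case using I0[of \<delta>] by simp
      qed
    qed (intro always_eventually allI weighted_integral_nonneg)
    show "eventually (\<lambda>\<delta>. norm (r \<delta>) \<le> L) (at_right 0)" using unit by eventually_elim (use rL in auto)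
  qed
  have sig: "square_integrable (g j)" for j
  proof (rule square_integrable_of_weighted_limit[OF g(2) s0])
    show "((\<lambda>\<delta>. \<integral>x. weight (- s) x * (norm (fn (pd j (r \<delta>)) x - g j x))\<^sup>2 \<partial>lborel) \<longlongrightarrow> 0) (at_right 0)"
    proof (rule tendsto_sandwich[OF _ _ tendsto_const Nsq_lim])
      show "eventually (\<lambda>\<delta>. (\<integral>x. weight (- s) x * (norm (fn (pd j (r \<delta>)) x - g j x))\<^sup>2 \<partial>lborel) \<le> (N \<delta>)\<^sup>2) (at_right 0)"
        using pos
      proof eventually_elim
        case (elim \<delta>)
        show ?case using Ij[of \<delta> j] weighted_wd_integral[OF wdD[OF elim], of "- s" j] by simp
      qed
    qed (intro always_eventually allI weighted_integral_nonneg)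
    show "eventually (\<lambda>\<delta>. norm (pd j (r \<delta>)) \<le> L') (at_right 0)" using unit by eventually_elim (use pdL in auto)
  qed
  define U where "U = cls u"
  have "has_pd j U (cls (g j))" for j
    unfolding U_def using g(1) by (simp add: has_pd_iff_weak_deriv siu sig)
  then have WU: "W1 U" by (rule W1I)
  \<comment> \<open>The defect of the free equation. It does not depend on \<delta>, while its
    weighted norm is bounded by a quantity that tends to 0 with \<delta>.\<close>
  define e where "e = Hm m U - cs (complex_of_real lam) U - f"
  define wt where "wt x = weight (- s / 2) x" for x :: "real^3"
  have wt: "bfun wt"
  proof -
    have "\<bar>wt x\<bar> \<le> 1" for x using weight_neg_le_1[of "s / 2" x] weight_pos[of "- (s / 2)" x] s0 by (simp add: wt_def abs_of_pos)
    moreover have "wt \<in> borel_measurable borel" unfolding wt_def[abs_def] by measurable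
    ultimately show ?thesis by (auto simp: bfun_def)
  qed
  have ms_norm: "(norm (ms wt w))\<^sup>2 = (\<integral>x. weight (- s) x * (norm (fn w x))\<^sup>2 \<partial>lborel)" for w
    using weighted_square_integrable(2)[OF square_integrable_imp_L2s[OF square_integrable_fn s0], of w]
      ms_cls[OF wt square_integrable_fn, of w] by (simp add: wt_def)
  have ms_le1: "norm (ms wt w) \<le> norm w" for w
    using norm_ms_le[OF wt, of 1 w] weight_neg_le_1[of "s / 2"] weight_pos[of "- (s / 2)"] s0 by (simp add: wt_def abs_of_pos)
  have e_le: "norm (ms wt e) \<le> (3 + m + \<bar>lam\<bar>) * N \<delta> + \<delta> * (L + norm U + norm U)" if \<delta>: "0 < \<delta>" "\<delta> \<le> 1" for \<delta>
  proof -
    define d where "d = r \<delta> - U"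
    have Wd: "W1 d" unfolding d_def by (rule W1_diff[OF r(1)[OF \<delta>(1)] WU])
    have siD: "square_integrable (D \<delta>)" unfolding D_def by (rule square_integrable_diff[OF fr(1)[OF \<delta>(1)] siu])
    have clsD: "cls (D \<delta>) = d" unfolding D_def d_def U_def
      by (simp add: cls_diff[OF fr(1)[OF \<delta>(1)] siu, symmetric] fr(2)[OF \<delta>(1)])
    have d_N: "norm (ms wt d) \<le> N \<delta>"
    proof (rule power2_le_imp_le[OF _ N0])
      have "(norm (ms wt d))\<^sup>2 = (\<integral>x. weight (- s) x * (norm (D \<delta> x))\<^sup>2 \<partial>lborel)"
        using weighted_square_integrable(2)[OF DL[OF \<delta>(1)]] ms_cls[OF wt siD] by (simp add: clsD wt_def)
      then show "(norm (ms wt d))\<^sup>2 \<le> (N \<delta>)\<^sup>2" using I0[of \<delta>] by simp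
    qed
    have pd_N: "norm (ms wt (pd j d)) \<le> N \<delta>" for j
    proof (rule power2_le_imp_le[OF _ N0])
      have "weak_deriv (D \<delta>) j (fn (pd j d))" using weak_deriv_pd[OF siD, of j] Wd by (simp add: clsD)
      then show "(norm (ms wt (pd j d)))\<^sup>2 \<le> (N \<delta>)\<^sup>2"
        using Ij[of \<delta> j] by (simp add: ms_norm weighted_wd_integral)
    qed
    have zc: "cs (Complex lam (sg * \<delta>)) x = cs (complex_of_real lam) x + (sg * \<delta>) *\<^sub>R cs \<i> x" for x
      by (subst (1 2) cs_eq) simp
    have "e = cs (complex_of_real lam) d - Hm m d + (sg * \<delta>) *\<^sub>R cs \<i> (r \<delta>)"
    proof -
      have "Hm m d = Hm m (r \<delta>) - Hm m U" unfolding d_def by (rule Hm_diff[OF r(1)[OF \<delta>(1)] WU])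
      then show ?thesis unfolding e_def r(2)[OF \<delta>(1), symmetric] zc by (simp add: d_def cs_diff algebra_simps)
    qed
    then have "ms wt e = ms wt (cs (complex_of_real lam) d) - ms wt (Hm m d) + (sg * \<delta>) *\<^sub>R ms wt (cs \<i> (r \<delta>))"
      by (simp add: ms_add ms_diff ms_scaleR)
    moreover have "norm (a - b + c) \<le> norm a + norm b + norm c" for a b c :: l2
      by (intro order_trans[OF norm_triangle_ineq] add_mono norm_triangle_ineq4 order_refl)
    ultimately have "norm (ms wt e) \<le> norm (ms wt (cs (complex_of_real lam) d)) + norm (ms wt (Hm m d)) + norm ((sg * \<delta>) *\<^sub>R ms wt (cs \<i> (r \<delta>)))"
      by (simp only:)
    moreover have "norm (ms wt (cs (complex_of_real lam) d)) \<le> \<bar>lam\<bar> * N \<delta>"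
      using d_N by (simp add: ms_cs[OF wt] norm_cs mult_left_mono)
    \<comment> \<open>The weight commutes with the matrices, and these are isometric: one N \<delta>
      for each of the three derivatives and m N \<delta> for the mass term.\<close>
    moreover have "norm (ms wt (Hm m d)) \<le> 3 * N \<delta> + m * N \<delta>"
    proof -
      have "ms wt (Hm m d) = (\<Sum>j\<in>UNIV. cm (alpha j) (cs (- \<i>) (ms wt (pd j d)))) + m *\<^sub>R cm beta (ms wt d)"
        by (simp add: Hm_def aD_def ms_add ms_sum ms_scaleR ms_cm[OF wt] ms_cs[OF wt])
      also have "norm \<dots> \<le> (\<Sum>j\<in>(UNIV::3 set). N \<delta>) + m * N \<delta>"
      proof (intro order_trans[OF norm_triangle_ineq] add_mono order_trans[OF norm_sum] sum_mono)
        show "norm (cm (alpha j) (cs (- \<i>) (ms wt (pd j d)))) \<le> N \<delta>" for j using pd_N[of j] by (simp add: norm_cs)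
        show "norm (m *\<^sub>R cm beta (ms wt d)) \<le> m * N \<delta>" using d_N m by (simp add: mult_left_mono)
      qed
      finally show ?thesis by simp
    qed
    moreover have "norm ((sg * \<delta>) *\<^sub>R ms wt (cs \<i> (r \<delta>))) \<le> \<delta> * L"
    proof -
      have "norm (ms wt (cs \<i> (r \<delta>))) \<le> L" using ms_le1[of "cs \<i> (r \<delta>)"] rL[OF \<delta>] by (simp add: norm_cs)
      moreover have "\<bar>sg * \<delta>\<bar> = \<delta>" using sg \<delta> by auto
      ultimately show ?thesis using \<delta> by (simp add: mult_left_mono)
    qed
    moreover have "0 \<le> \<delta> * (norm U + norm U)" using \<delta> by simp
    ultimately show ?thesis by (simp add: algebra_simps)
  qed
  have "norm (ms wt e) \<le> 0"
  proof (rule tendsto_lowerbound)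
    have "((\<lambda>\<delta>. (3 + m + \<bar>lam\<bar>) * N \<delta> + \<delta> * (L + norm U + norm U)) \<longlongrightarrow> (3 + m + \<bar>lam\<bar>) * 0 + 0 * (L + norm U + norm U)) (at_right 0)"
      by (intro tendsto_intros N)
    then show "((\<lambda>\<delta>. (3 + m + \<bar>lam\<bar>) * N \<delta> + \<delta> * (L + norm U + norm U)) \<longlongrightarrow> 0) (at_right 0)" by simp
    show "eventually (\<lambda>\<delta>. norm (ms wt e) \<le> (3 + m + \<bar>lam\<bar>) * N \<delta> + \<delta> * (L + norm U + norm U)) (at_right 0)"
      using unit by eventually_elim (use e_le in auto)
  qed simp
  then have "ms wt e = 0" by simp
  then have "AE x in lborel. wt x *\<^sub>R fn e x = 0"
    using fn_ms[OF wt, of e] fn_zero by (auto elim: eventually_elim2)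
  then have "AE x in lborel. fn e x = fn 0 x"
    using fn_zero
  proof eventually_elim
    case (elim x)
    then show ?case using weight_pos[of "- s / 2" x] by (simp add: wt_def)
  qed
  then have e0: "e = 0" by (simp add: l2_eq_iff)
  have fV: "f = - Mul V U"
  proof -
    have "square_integrable (\<lambda>x. - (V x *v u x))" by (intro square_integrable_uminus square_integrable_Mul V siu)
    then have "f = cls (\<lambda>x. - (V x *v u x))" unfolding f_def using cls_eq_iff[OF si\<phi>] \<phi>V by simp
    then show ?thesis unfolding U_def by (simp add: Mul_cls[OF V siu] cls_uminus square_integrable_Mul[OF V siu])
  qed
  have "dirac_eq m V (complex_of_real lam) u (\<lambda>x. 0)"
    unfolding dirac_eq_l2_iff[OF V square_integrable_zero]
    using siu WU e0 by (simp add: e_def fV U_def algebra_simps)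
  moreover have "\<not> (AE x in lborel. u x = 0)"
  proof
    assume "AE x in lborel. u x = 0"
    then have "AE x in lborel. \<phi> x = 0" using \<phi>V by eventually_elim simp
    then show False using \<phi>(2) by simp
  qed
  ultimately show ?thesis by (auto simp: is_eigenvalue_def)
qed

section \<open>Compactness and the counting of eigenvalues\<close>

lemma ball_in_borel [measurable]: "ball (0::real^3) h \<in> sets borel"
  by simp

text \<open>A translation by \<open>y\<close> is composed of three along the axes, each of length at
  most |y|, and \<open>norm_pd_le\<close> bounds the three derivatives.\<close>

lemma norm_tr_diff_le:
  assumes "W1 u"
  shows "norm (tr y u - u) \<le> 3 * norm y * norm (aD u)"
proof -
  have ax: "norm (tr (axis j (y $ j)) u - u) \<le> norm y * norm (aD u)" for j
    by (rule order_trans[OF has_pd_norm_le[OF W1_has_pd[OF assms]]])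
      (intro mult_mono norm_pd_le[OF assms] component_le_norm_cart norm_ge_zero)
  have y: "y = axis 1 (y $ 1) + axis 2 (y $ 2) + axis 3 (y $ 3)"
    by (simp add: vec_eq_iff forall_3 axis_def)
  have "tr y u - u = tr (axis 1 (y $ 1) + axis 2 (y $ 2)) (tr (axis 3 (y $ 3)) u - u)
      + tr (axis 1 (y $ 1)) (tr (axis 2 (y $ 2)) u - u) + (tr (axis 1 (y $ 1)) u - u)"
    by (subst y) (simp add: tr_diff tr_tr add.assoc)
  also have "norm \<dots> \<le> norm (tr (axis 3 (y $ 3)) u - u) + norm (tr (axis 2 (y $ 2)) u - u) + norm (tr (axis 1 (y $ 1)) u - u)"
    by (intro order_trans[OF norm_triangle_ineq] add_mono) auto
  also have "\<dots> \<le> 3 * norm y * norm (aD u)" using ax[of 1] ax[of 2] ax[of 3] by simp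
  finally show ?thesis .
qed

text \<open>Cauchy-Schwarz, pairing \<open>w\<close> with the constant vector given by its own
  integral, cut off to \<open>Q\<close>.\<close>

lemma norm_integral_sq_le:
  assumes w: "square_integrable w" and Q: "bounded Q" "Q \<in> sets borel" and out: "\<And>y. y \<notin> Q \<Longrightarrow> w y = 0"
    and int: "integrable lborel w"
  shows "(norm (\<integral>y. w y \<partial>lborel))\<^sup>2 \<le> measure lborel Q * (\<integral>y. (norm (w y))\<^sup>2 \<partial>lborel)"
proof -
  define v where "v = (\<integral>y. w y \<partial>lborel)"
  let ?q = "\<lambda>y. indicator Q y *\<^sub>R v"
  have fin: "emeasure lborel Q < \<infinity>" using emeasure_bounded_finite[OF Q(1)] by simp
  have q: "square_integrable ?q"
    by (rule square_integrable_bounded_support(1)[of _ Q "norm v"]) (use Q in \<open>auto simp: indicator_def\<close>)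
  have "(norm (indicator Q y *\<^sub>R v))\<^sup>2 = indicator Q y * (norm v)\<^sup>2" for y by (auto simp: indicator_def)
  then have nq: "(norm (cls ?q))\<^sup>2 = measure lborel Q * (norm v)\<^sup>2"
    using fin Q(2) by (simp add: norm_cls_sq[OF q])
  have "v \<bullet> v = (\<integral>y. w y \<bullet> v \<partial>lborel)" by (subst (1) v_def) (rule integral_inner_left[OF int, symmetric])
  also have "\<dots> = (\<integral>y. w y \<bullet> ?q y \<partial>lborel)"
    by (intro Bochner_Integration.integral_cong refl) (use out in \<open>auto simp: indicator_def\<close>)
  also have "\<dots> = cls w \<bullet> cls ?q" by (rule inner_cls[OF w q, symmetric])
  finally have "(norm v)\<^sup>2 \<le> norm (cls w) * norm (cls ?q)"
    using norm_cauchy_schwarz[of "cls w" "cls ?q"] by (simp add: power2_norm_eq_inner)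
  then have "((norm v)\<^sup>2)\<^sup>2 \<le> (norm (cls w) * norm (cls ?q))\<^sup>2" by (intro power_mono) auto
  also have "\<dots> = (measure lborel Q * (norm (cls w))\<^sup>2) * (norm v)\<^sup>2"
    by (simp only: power_mult_distrib nq) (simp only: mult_ac)
  finally have "(norm v)\<^sup>2 * (norm v)\<^sup>2 \<le> (measure lborel Q * (norm (cls w))\<^sup>2) * (norm v)\<^sup>2"
    by (simp add: power2_eq_square[of "(norm v)\<^sup>2"])
  then have "(norm v)\<^sup>2 \<le> measure lborel Q * (norm (cls w))\<^sup>2"
  proof (cases "v = 0")
    case False
    then have "(norm v)\<^sup>2 > 0" by simp
    with \<open>(norm v)\<^sup>2 * (norm v)\<^sup>2 \<le> (measure lborel Q * (norm (cls w))\<^sup>2) * (norm v)\<^sup>2\<close>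
    show ?thesis by (rule mult_right_le_imp_le)
  qed simp
  then show ?thesis by (simp add: v_def norm_cls_sq[OF w])
qed

text \<open>A function of x and not a class in \<open>l2\<close>, because Bessel's inequality will
  be applied at each point x.\<close>

definition ball_av :: "real \<Rightarrow> l2 \<Rightarrow> real^3 \<Rightarrow> complex^4" where
  "ball_av h u x = (\<integral>y. indicator (ball 0 h) y *\<^sub>R fn u (x + y) \<partial>lborel) /\<^sub>R measure lborel (ball (0::real^3) h)"

lemma ball_av_measurable [measurable]: "ball_av h u \<in> borel_measurable borel"
proof -
  have "(\<lambda>x. \<integral>y. indicator (ball 0 h) y *\<^sub>R fn u (x + y) \<partial>lborel) \<in> borel_measurable borel"
    by (rule lborel.borel_measurable_lebesgue_integral) measurable
  then show ?thesis unfolding ball_av_def[abs_def] by measurable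
qed

lemma ball_integrable:
  assumes "square_integrable f"
  shows "square_integrable (\<lambda>y. indicator (ball (0::real^3) h) y *\<^sub>R f y)"
    and "integrable lborel (\<lambda>y. indicator (ball (0::real^3) h) y *\<^sub>R f y)"
proof -
  have [measurable]: "f \<in> borel_measurable borel" using assms by (simp add: square_integrable_def)
  show "square_integrable (\<lambda>y. indicator (ball (0::real^3) h) y *\<^sub>R f y)"
    by (rule square_integrable_bound[OF assms, where K = 1]) (auto simp: indicator_def)
  have fin: "emeasure lborel (ball (0::real^3) h) < \<infinity>" using emeasure_bounded_finite[OF bounded_ball] by simp
  have i: "integrable lborel (\<lambda>x. (norm (f x))\<^sup>2 + indicator (ball 0 h) x)"
    using assms fin by (auto simp: square_integrable_def)
  show "integrable lborel (\<lambda>y. indicator (ball (0::real^3) h) y *\<^sub>R f y)"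
  proof (rule Bochner_Integration.integrable_bound[OF i])
    show "AE y in lborel. norm (indicator (ball 0 h) y *\<^sub>R f y) \<le> norm ((norm (f y))\<^sup>2 + indicator (ball 0 h) y :: real)"
    proof (rule AE_I2)
      fix y
      have "2 * norm (f y) \<le> (norm (f y))\<^sup>2 + 1" using sum_squares_bound[of "norm (f y)" 1] by simp
      then have "norm (f y) \<le> (norm (f y))\<^sup>2 + 1" using norm_ge_zero[of "f y"] by linarith
      then show "norm (indicator (ball 0 h) y *\<^sub>R f y) \<le> norm ((norm (f y))\<^sup>2 + indicator (ball 0 h) y :: real)"
        by (auto simp: indicator_def)
    qed
  qed measurable
qed

text \<open>Cauchy-Schwarz on the ball bounds the squared error at x by the mean of |u(x) - u(x +
  y)|^2 over y. After exchanging the integrals, each y contributes the squared norm of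
  \<open>tr y u - u\<close>.\<close>

lemma ball_av_close:
  assumes h: "h > 0" and u: "W1 u"
  shows "(\<integral>\<^sup>+x. ennreal ((norm (fn u x - ball_av h u x))\<^sup>2) \<partial>lborel) \<le> ennreal ((3 * h * norm (aD u))\<^sup>2)"
proof -
  let ?Q = "ball (0::real^3) h"
  define q where "q = measure lborel ?Q"
  have q: "q > 0" unfolding q_def by (rule content_ball_pos[OF h])
  have emq: "emeasure lborel ?Q = ennreal q"
    unfolding q_def using emeasure_bounded_finite[OF bounded_ball[of "0::real^3" h]] by (intro emeasure_eq_ennreal_measure) auto
  have pt: "ennreal ((norm (fn u x - ball_av h u x))\<^sup>2)
      \<le> ennreal (1 / q) * (\<integral>\<^sup>+y. ennreal ((norm (indicator ?Q y *\<^sub>R (fn u x - fn u (x + y))))\<^sup>2) \<partial>lborel)" for x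
  proof -
    let ?w = "\<lambda>y. indicator ?Q y *\<^sub>R (fn u x - fn u (x + y))"
    have t: "square_integrable (\<lambda>y. fn u (x + y))"
      using square_integrable_translate[OF square_integrable_fn, of u x] by (simp add: add.commute)
    have c: "square_integrable (\<lambda>y. indicator ?Q y *\<^sub>R fn u x)"
      by (rule square_integrable_bounded_support(1)[of _ ?Q "norm (fn u x)"]) (auto simp: indicator_def)
    have ci: "integrable lborel (\<lambda>y. indicator ?Q y *\<^sub>R fn u x)"
    proof -
      have "indicator ?Q y *\<^sub>R (indicator ?Q y *\<^sub>R fn u x) = indicator ?Q y *\<^sub>R fn u x" for y
        by (auto simp: indicator_def)
      then show ?thesis using ball_integrable(2)[OF c, of h] by (simp only:)
    qed
    have w: "square_integrable ?w"
      using square_integrable_diff[OF c ball_integrable(1)[OF t, of h]] by (simp add: scaleR_diff_right)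
    have wi: "integrable lborel ?w"
      using Bochner_Integration.integrable_diff[OF ci ball_integrable(2)[OF t, of h]] by (simp add: scaleR_diff_right)
    have "(\<integral>y. ?w y \<partial>lborel) = q *\<^sub>R fn u x - (\<integral>y. indicator ?Q y *\<^sub>R fn u (x + y) \<partial>lborel)"
    proof -
      have "(\<integral>y. indicator ?Q y *\<^sub>R fn u x \<partial>lborel) = q *\<^sub>R fn u x"
        using emq by (simp add: q_def)
      then show ?thesis
        using Bochner_Integration.integral_diff[OF ci ball_integrable(2)[OF t, of h]] by (simp add: scaleR_diff_right)
    qed
    then have eq: "fn u x - ball_av h u x = (\<integral>y. ?w y \<partial>lborel) /\<^sub>R q"
      using q by (simp add: ball_av_def q_def[symmetric] scaleR_diff_right)
    have "(norm (fn u x - ball_av h u x))\<^sup>2 = (norm (\<integral>y. ?w y \<partial>lborel))\<^sup>2 / q\<^sup>2"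
      unfolding eq using q by (simp add: power_mult_distrib divide_inverse mult.commute power_inverse)
    also have "\<dots> \<le> (q * (\<integral>y. (norm (?w y))\<^sup>2 \<partial>lborel)) / q\<^sup>2"
      unfolding q_def
      by (intro divide_right_mono norm_integral_sq_le[OF w bounded_ball _ _ wi]) (auto simp: indicator_def)
    also have "\<dots> = 1 / q * (\<integral>y. (norm (?w y))\<^sup>2 \<partial>lborel)" using q by (simp add: power2_eq_square)
    finally have "ennreal ((norm (fn u x - ball_av h u x))\<^sup>2) \<le> ennreal (1 / q * (\<integral>y. (norm (?w y))\<^sup>2 \<partial>lborel))"
      by (rule ennreal_leI)
    also have "\<dots> = ennreal (1 / q) * ennreal (\<integral>y. (norm (?w y))\<^sup>2 \<partial>lborel)"
      using q by (intro ennreal_mult) (auto intro: Bochner_Integration.integral_nonneg)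
    also have "ennreal (\<integral>y. (norm (?w y))\<^sup>2 \<partial>lborel) = (\<integral>\<^sup>+y. ennreal ((norm (?w y))\<^sup>2) \<partial>lborel)"
      using w by (intro nn_integral_eq_integral[symmetric]) (auto simp: square_integrable_def)
    finally show ?thesis .
  qed
  have inner_le: "(\<integral>\<^sup>+x. ennreal ((norm (indicator ?Q y *\<^sub>R (fn u x - fn u (x + y))))\<^sup>2) \<partial>lborel)
      \<le> indicator ?Q y * ennreal ((3 * h * norm (aD u))\<^sup>2)" for y
  proof (cases "y \<in> ?Q")
    case True
    have "(\<integral>\<^sup>+x. ennreal ((norm (fn u x - fn u (x + y)))\<^sup>2) \<partial>lborel) = (\<integral>\<^sup>+x. ennreal ((norm (fn (tr y u - u) x))\<^sup>2) \<partial>lborel)"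
    proof (rule nn_integral_cong_AE)
      show "AE x in lborel. ennreal ((norm (fn u x - fn u (x + y)))\<^sup>2) = ennreal ((norm (fn (tr y u - u) x))\<^sup>2)"
        using fn_diff[of "tr y u" u] fn_tr[of y u] by eventually_elim (simp add: norm_minus_commute)
    qed
    also have "\<dots> = ennreal ((norm (tr y u - u))\<^sup>2)" by (rule nn_integral_fn_sq)
    also have "\<dots> \<le> ennreal ((3 * h * norm (aD u))\<^sup>2)"
    proof (intro ennreal_leI power_mono)
      have "norm (tr y u - u) \<le> 3 * norm y * norm (aD u)" by (rule norm_tr_diff_le[OF u])
      also have "\<dots> \<le> 3 * h * norm (aD u)" using True by (intro mult_right_mono) auto
      finally show "norm (tr y u - u) \<le> 3 * h * norm (aD u)" .
    qed simp
    finally show ?thesis using True by simp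
  qed simp
  have "(\<integral>\<^sup>+x. ennreal ((norm (fn u x - ball_av h u x))\<^sup>2) \<partial>lborel)
      \<le> (\<integral>\<^sup>+x. ennreal (1 / q) * (\<integral>\<^sup>+y. ennreal ((norm (indicator ?Q y *\<^sub>R (fn u x - fn u (x + y))))\<^sup>2) \<partial>lborel) \<partial>lborel)"
    by (intro nn_integral_mono pt)
  also have "\<dots> = ennreal (1 / q) * (\<integral>\<^sup>+x. (\<integral>\<^sup>+y. ennreal ((norm (indicator ?Q y *\<^sub>R (fn u x - fn u (x + y))))\<^sup>2) \<partial>lborel) \<partial>lborel)"
    by (rule nn_integral_cmult) measurable
  also have "(\<integral>\<^sup>+x. (\<integral>\<^sup>+y. ennreal ((norm (indicator ?Q y *\<^sub>R (fn u x - fn u (x + y))))\<^sup>2) \<partial>lborel) \<partial>lborel)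
      = (\<integral>\<^sup>+y. (\<integral>\<^sup>+x. ennreal ((norm (indicator ?Q y *\<^sub>R (fn u x - fn u (x + y))))\<^sup>2) \<partial>lborel) \<partial>lborel)"
    by (rule lborel_pair.Fubini') measurable
  also have "ennreal (1 / q) * \<dots> \<le> ennreal (1 / q) * (\<integral>\<^sup>+y. indicator ?Q y * ennreal ((3 * h * norm (aD u))\<^sup>2) \<partial>lborel)"
    by (intro mult_left_mono nn_integral_mono inner_le) auto
  also have "(\<integral>\<^sup>+y. indicator ?Q y * ennreal ((3 * h * norm (aD u))\<^sup>2) \<partial>lborel) = ennreal q * ennreal ((3 * h * norm (aD u))\<^sup>2)"
    using emq by (simp add: nn_integral_multc)
  also have "ennreal (1 / q) * (ennreal q * ennreal ((3 * h * norm (aD u))\<^sup>2)) = ennreal ((3 * h * norm (aD u))\<^sup>2)"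
    using q by (simp add: ennreal_mult[symmetric] flip: mult.assoc)
  finally show ?thesis .
qed

text \<open>Each real component of \<open>ball_av h u x\<close> is the inner product of
  \<open>u\<close> with a translated, normalised indicator of the ball, whose squared norm is 1 / q
  with q the volume. Bessel's inequality bounds the sum over \<open>S\<close> by that number,
  however large \<open>S\<close> is; \<open>DIM(complex^4)\<close> counts the real
  components.\<close>

lemma ball_av_Bessel:
  assumes S: "finite S" "pairwise orthogonal S" "\<And>u. u \<in> S \<Longrightarrow> norm u = 1" and h: "h > 0"
  shows "(\<Sum>u\<in>S. (norm (ball_av h u x))\<^sup>2) \<le> DIM(complex^4) / measure lborel (ball (0::real^3) h)"
proof -
  let ?Q = "ball (0::real^3) h"
  define q where "q = measure lborel ?Q"
  have q: "q > 0" unfolding q_def by (rule content_ball_pos[OF h])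
  define \<kappa> where "\<kappa> b = cls (\<lambda>y. indicator ?Q y *\<^sub>R (b :: complex^4))" for b
  have si: "square_integrable (\<lambda>y. indicator ?Q y *\<^sub>R (b :: complex^4))" for b
    by (rule square_integrable_bounded_support(1)[of _ ?Q "norm b"]) (auto simp: indicator_def)
  have n\<kappa>: "(norm (\<kappa> b))\<^sup>2 = q" if "b \<in> Basis" for b
  proof -
    have "(norm (indicator ?Q y *\<^sub>R b))\<^sup>2 = indicator ?Q y" for y using that by (auto simp: indicator_def)
    then show ?thesis using emeasure_bounded_finite[OF bounded_ball[of "0::real^3" h]]
      by (simp add: \<kappa>_def norm_cls_sq[OF si] q_def)
  qed
  have comp: "ball_av h u x \<bullet> b = (tr (- x) (\<kappa> b) \<bullet> u) / q" for u b
  proof -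
    have t: "square_integrable (\<lambda>y. fn u (x + y))" "cls (\<lambda>y. fn u (x + y)) = tr x u"
      using square_integrable_translate[OF square_integrable_fn, of u x] tr_cls[OF square_integrable_fn, of x u]
      by (simp_all add: add.commute)
    have "ball_av h u x \<bullet> b = (\<integral>y. (indicator ?Q y *\<^sub>R fn u (x + y)) \<bullet> b \<partial>lborel) / q"
      unfolding ball_av_def q_def[symmetric]
      by (simp add: integral_inner_left[OF ball_integrable(2)[OF t(1), of h], symmetric] divide_inverse)
    also have "(\<integral>y. (indicator ?Q y *\<^sub>R fn u (x + y)) \<bullet> b \<partial>lborel) = (\<integral>y. fn u (x + y) \<bullet> (indicator ?Q y *\<^sub>R b) \<partial>lborel)"
      by simp
    also have "\<dots> = tr x u \<bullet> \<kappa> b" unfolding \<kappa>_def t(2)[symmetric] by (rule inner_cls[OF t(1) si, symmetric])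
    also have "\<dots> = tr (- x) (\<kappa> b) \<bullet> u" unfolding inner_tr_left[of x u] by (rule inner_commute)
    finally show ?thesis .
  qed
  have "(\<Sum>u\<in>S. (norm (ball_av h u x))\<^sup>2) = (\<Sum>u\<in>S. \<Sum>b\<in>Basis. (tr (- x) (\<kappa> b) \<bullet> u)\<^sup>2 / q\<^sup>2)"
  proof (rule sum.cong[OF refl])
    fix u
    have "(norm (ball_av h u x))\<^sup>2 = (\<Sum>b\<in>Basis. (ball_av h u x \<bullet> b)\<^sup>2)"
      unfolding power2_norm_eq_inner euclidean_inner[of "ball_av h u x" "ball_av h u x"] by (simp add: power2_eq_square)
    then show "(norm (ball_av h u x))\<^sup>2 = (\<Sum>b\<in>Basis. (tr (- x) (\<kappa> b) \<bullet> u)\<^sup>2 / q\<^sup>2)"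
      by (simp add: comp power_divide)
  qed
  also have "\<dots> = (\<Sum>b\<in>Basis. (\<Sum>u\<in>S. (tr (- x) (\<kappa> b) \<bullet> u)\<^sup>2) / q\<^sup>2)"
    by (subst sum.swap) (simp add: sum_divide_distrib)
  also have "\<dots> \<le> (\<Sum>b\<in>(Basis :: (complex^4) set). q / q\<^sup>2)"
  proof (intro sum_mono divide_right_mono)
    fix b :: "complex^4" assume "b \<in> Basis"
    then show "(\<Sum>u\<in>S. (tr (- x) (\<kappa> b) \<bullet> u)\<^sup>2) \<le> q"
      using Bessel_inequality[OF S, of "tr (- x) (\<kappa> b)"] n\<kappa> by simp
  qed simp
  also have "\<dots> = DIM(complex^4) / q" using q by (simp add: power2_eq_square)
  finally show ?thesis by (simp add: q_def)
qed

text \<open>A quantitative form of the Rellich compactness theorem.\<close>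

lemma orthonormal_card_bound:
  assumes c: "c > 0" and K: "K \<ge> 0" and R: "R > 0"
  shows "\<exists>M::nat. \<forall>S. finite S \<and> pairwise orthogonal S \<and>
      (\<forall>u\<in>S. norm u = 1 \<and> W1 u \<and> norm (aD u) \<le> K \<and> ennreal c \<le> (\<integral>\<^sup>+x. indicator (ball 0 R) x * ennreal ((norm (fn u x))\<^sup>2) \<partial>lborel))
      \<longrightarrow> card S \<le> M"
proof -
  \<comment> \<open>Makes the averaging error 2 (3 h K)^2 at most c / 2; \<open>K + 1\<close> keeps
    the denominator positive.\<close>
  define h where "h = sqrt (c / 4) / (3 * (K + 1))"
  have h: "h > 0" using c K by (simp add: h_def)
  have hK: "2 * (3 * h * K)\<^sup>2 \<le> c / 2"
  proof -
    have "3 * h * K \<le> 3 * h * (K + 1)" using h by (intro mult_left_mono) auto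
    also have "\<dots> = sqrt (c / 4)"
    proof -
      have "3 * (K + 1) \<noteq> 0" using K by simp
      from iffD1[OF nonzero_eq_divide_eq[OF this] h_def] show ?thesis by (simp only: mult_ac)
    qed
    finally have "(3 * h * K)\<^sup>2 \<le> (sqrt (c / 4))\<^sup>2" using h K by (intro power_mono) auto
    then show ?thesis using c by simp
  qed
  let ?B = "ball (0::real^3) R"
  define q where "q = measure lborel (ball (0::real^3) h)"
  define D where "D = 2 * (DIM(complex^4) / q) * measure lborel ?B"
  have q: "q > 0" unfolding q_def by (rule content_ball_pos[OF h])
  have emB: "emeasure lborel ?B = ennreal (measure lborel ?B)"
    using emeasure_bounded_finite[OF bounded_ball[of "0::real^3" R]] by (intro emeasure_eq_ennreal_measure) auto
  have D0: "D \<ge> 0" using q by (simp add: D_def)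
  show ?thesis
  proof (intro exI allI impI)
    fix S :: "l2 set"
    assume A: "finite S \<and> pairwise orthogonal S \<and> (\<forall>u\<in>S. norm u = 1 \<and> W1 u \<and> norm (aD u) \<le> K
        \<and> ennreal c \<le> (\<integral>\<^sup>+x. indicator ?B x * ennreal ((norm (fn u x))\<^sup>2) \<partial>lborel))"
    have each: "ennreal c \<le> (\<integral>\<^sup>+x. indicator ?B x * ennreal (2 * (norm (ball_av h u x))\<^sup>2) \<partial>lborel) + ennreal (c / 2)"
      if "u \<in> S" for u
    proof -
      have "ennreal c \<le> (\<integral>\<^sup>+x. indicator ?B x * ennreal ((norm (fn u x))\<^sup>2) \<partial>lborel)" using A that by blast
      also have "\<dots> \<le> (\<integral>\<^sup>+x. indicator ?B x * ennreal (2 * (norm (ball_av h u x))\<^sup>2) + ennreal 2 * ennreal ((norm (fn u x - ball_av h u x))\<^sup>2) \<partial>lborel)"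
      proof (rule nn_integral_mono)
        fix x
        have "(norm (fn u x))\<^sup>2 \<le> (norm (ball_av h u x) + norm (fn u x - ball_av h u x))\<^sup>2"
          using norm_triangle_ineq2[of "fn u x" "ball_av h u x"] by (intro power_mono) auto
        also have "\<dots> \<le> 2 * (norm (ball_av h u x))\<^sup>2 + 2 * (norm (fn u x - ball_av h u x))\<^sup>2"
          using sum_squares_bound[of "norm (ball_av h u x)" "norm (fn u x - ball_av h u x)"] by (simp add: power2_sum)
        finally have "ennreal ((norm (fn u x))\<^sup>2) \<le> ennreal (2 * (norm (ball_av h u x))\<^sup>2) + ennreal 2 * ennreal ((norm (fn u x - ball_av h u x))\<^sup>2)"
          by (simp add: ennreal_plus[symmetric] ennreal_mult[symmetric] del: ennreal_plus ennreal_numeral)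
        then show "indicator ?B x * ennreal ((norm (fn u x))\<^sup>2)
            \<le> indicator ?B x * ennreal (2 * (norm (ball_av h u x))\<^sup>2) + ennreal 2 * ennreal ((norm (fn u x - ball_av h u x))\<^sup>2)"
          by (auto simp: indicator_def)
      qed
      also have "\<dots> = (\<integral>\<^sup>+x. indicator ?B x * ennreal (2 * (norm (ball_av h u x))\<^sup>2) \<partial>lborel)
          + ennreal 2 * (\<integral>\<^sup>+x. ennreal ((norm (fn u x - ball_av h u x))\<^sup>2) \<partial>lborel)"
        by (subst nn_integral_add) (auto simp: nn_integral_cmult)
      also have "\<dots> \<le> (\<integral>\<^sup>+x. indicator ?B x * ennreal (2 * (norm (ball_av h u x))\<^sup>2) \<partial>lborel) + ennreal (c / 2)"
      proof (intro add_left_mono)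
        have u: "W1 u" "norm (aD u) \<le> K" using A that by blast+
        have "ennreal 2 * (\<integral>\<^sup>+x. ennreal ((norm (fn u x - ball_av h u x))\<^sup>2) \<partial>lborel) \<le> ennreal 2 * ennreal ((3 * h * norm (aD u))\<^sup>2)"
          by (intro mult_left_mono ball_av_close[OF h u(1)]) auto
        also have "\<dots> = ennreal (2 * (3 * h * norm (aD u))\<^sup>2)" by (rule ennreal_mult[symmetric]) auto
        also have "\<dots> \<le> ennreal (c / 2)"
        proof (rule ennreal_leI)
          have "(3 * h * norm (aD u))\<^sup>2 \<le> (3 * h * K)\<^sup>2" using u(2) h by (intro power_mono mult_left_mono) auto
          then show "2 * (3 * h * norm (aD u))\<^sup>2 \<le> c / 2" using hK by linarith
        qed
        finally show "ennreal 2 * (\<integral>\<^sup>+x. ennreal ((norm (fn u x - ball_av h u x))\<^sup>2) \<partial>lborel) \<le> ennreal (c / 2)" .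
      qed
      finally show ?thesis .
    qed
    have half: "ennreal (c / 2) \<le> (\<integral>\<^sup>+x. indicator ?B x * ennreal (2 * (norm (ball_av h u x))\<^sup>2) \<partial>lborel)" if "u \<in> S" for u
    proof -
      have "ennreal c = ennreal (c / 2) + ennreal (c / 2)" using c by (simp flip: ennreal_plus)
      with each[OF that] have "ennreal (c / 2) + ennreal (c / 2)
          \<le> ennreal (c / 2) + (\<integral>\<^sup>+x. indicator ?B x * ennreal (2 * (norm (ball_av h u x))\<^sup>2) \<partial>lborel)"
        by (simp only: add.commute)
      then show ?thesis by (subst (asm) ennreal_add_left_cancel_le) simp
    qed
    \<comment> \<open>Each member of \<open>S\<close> contributes at least c / 2 through its
      averages, while the sum over \<open>S\<close> is bounded pointwise by a constant on the ball.
      Comparing the integrals bounds the cardinality.\<close>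
    have "ennreal (real (card S) * (c / 2)) = ennreal (real (card S)) * ennreal (c / 2)"
      using c by (intro ennreal_mult) auto
    also have "\<dots> = (\<Sum>u\<in>S. ennreal (c / 2))" by (simp add: ennreal_of_nat_eq_real_of_nat)
    also have "\<dots> \<le> (\<Sum>u\<in>S. \<integral>\<^sup>+x. indicator ?B x * ennreal (2 * (norm (ball_av h u x))\<^sup>2) \<partial>lborel)"
      by (intro sum_mono half)
    also have "\<dots> = (\<integral>\<^sup>+x. (\<Sum>u\<in>S. indicator ?B x * ennreal (2 * (norm (ball_av h u x))\<^sup>2)) \<partial>lborel)"
      by (rule nn_integral_sum[symmetric]) measurable
    also have "\<dots> \<le> (\<integral>\<^sup>+x. indicator ?B x * ennreal (2 * (DIM(complex^4) / q)) \<partial>lborel)"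
    proof (rule nn_integral_mono)
      fix x
      have "(\<Sum>u\<in>S. (norm (ball_av h u x))\<^sup>2) \<le> DIM(complex^4) / q"
        unfolding q_def using A h by (intro ball_av_Bessel) auto
      then have "ennreal (\<Sum>u\<in>S. 2 * (norm (ball_av h u x))\<^sup>2) \<le> ennreal (2 * (DIM(complex^4) / q))"
        by (intro ennreal_leI) (simp flip: sum_distrib_left)
      then show "(\<Sum>u\<in>S. indicator ?B x * ennreal (2 * (norm (ball_av h u x))\<^sup>2)) \<le> indicator ?B x * ennreal (2 * (DIM(complex^4) / q))"
        by (subst (asm) sum_ennreal[symmetric]) (auto simp: indicator_def)
    qed
    also have "\<dots> = ennreal D"
      using emB q by (simp add: nn_integral_multc D_def ennreal_mult[symmetric] mult.commute del: ennreal_numeral)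
    finally have "real (card S) * (c / 2) \<le> D" using D0 by (simp add: ennreal_le_iff)
    then have "real (card S) \<le> D / (c / 2)" using c by (simp add: field_simps)
    also have "\<dots> \<le> real (nat \<lceil>D / (c / 2)\<rceil>)" by (rule real_nat_ceiling_ge)
    finally show "card S \<le> nat \<lceil>D / (c / 2)\<rceil>" by (simp only: of_nat_le_iff)
  qed
qed

section \<open>Eigenfunctions as elements of \<open>l2\<close> and bounds on their number\<close>

definition eigen :: "real \<Rightarrow> (real^3 \<Rightarrow> complex^4^4) \<Rightarrow> real \<Rightarrow> l2 \<Rightarrow> bool" where
  "eigen m V lam u \<longleftrightarrow> W1 u \<and> Hm m u + Mul V u = lam *\<^sub>R u"

lemma eigen_iff_dirac_eq:
  assumes "bounded_field V"
  shows "dirac_eq m V (complex_of_real lam) u (\<lambda>x. 0) \<longleftrightarrow> square_integrable u \<and> eigen m V lam (cls u)"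
  by (auto simp: dirac_eq_l2_iff[OF assms] eigen_def cs_of_real)

lemma is_eigenvalue_iff:
  assumes "bounded_field V"
  shows "is_eigenvalue m V lam \<longleftrightarrow> (\<exists>u. eigen m V lam u \<and> norm u = 1)"
proof
  assume "is_eigenvalue m V lam"
  then obtain u where u: "square_integrable u" "eigen m V lam (cls u)" "\<not> (AE x in lborel. u x = 0)"
    by (auto simp: is_eigenvalue_def eigen_iff_dirac_eq[OF assms])
  have "cls u \<noteq> 0" using u(1,3) cls_eq_iff[OF u(1) square_integrable_zero] by simp
  then have "norm (cls u /\<^sub>R norm (cls u)) = 1" by simp
  moreover have "eigen m V lam (cls u /\<^sub>R norm (cls u))"
    using u(2) by (auto simp: eigen_def W1_scaleR Hm_scaleR Mul_scaleR scaleR_add_right[symmetric])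
  ultimately show "\<exists>u. eigen m V lam u \<and> norm u = 1" by blast
next
  assume "\<exists>u. eigen m V lam u \<and> norm u = 1"
  then obtain u where u: "eigen m V lam u" "norm u = 1" by blast
  have "\<not> (AE x in lborel. fn u x = 0)"
  proof
    assume "AE x in lborel. fn u x = 0"
    then have "u = 0" using cls_eq_iff[OF square_integrable_fn[of u] square_integrable_zero] by simp
    then show False using u(2) by simp
  qed
  then show "is_eigenvalue m V lam"
    using u(1) by (auto simp: is_eigenvalue_def eigen_iff_dirac_eq[OF assms] intro!: exI[of _ "fn u"])
qed

lemma eigen_orthogonal:
  assumes V: "bounded_field V" "\<forall>x. hermitian4 (V x)"
    and u: "eigen m V a u" and v: "eigen m V b v" and "a \<noteq> b"
  shows "u \<bullet> v = 0"
proof -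
  have "a * (u \<bullet> v) = (Hm m u + Mul V u) \<bullet> v" using u by (simp add: eigen_def)
  also have "\<dots> = u \<bullet> (Hm m v + Mul V v)"
  proof -
    have "Hm m u \<bullet> v = u \<bullet> Hm m v" using u v by (intro Hm_symmetric) (auto simp: eigen_def)
    moreover have "Mul V u \<bullet> v = u \<bullet> Mul V v" using V by (intro inner_Mul) (auto intro: hermitian4_adj4)
    ultimately show ?thesis by (simp only: inner_add_left inner_add_right)
  qed
  also have "\<dots> = b * (u \<bullet> v)" using v by (simp add: eigen_def)
  finally show ?thesis using \<open>a \<noteq> b\<close> by simp
qed

text \<open>For real \<lambda> the key bound applies with v = u and f = -V u. A normalised
  eigenfunction then has a weighted norm bounded below, so a fixed amount of its mass lies in a
  fixed ball and \<open>orthonormal_card_bound\<close> applies. Since \<lambda> may vary with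
  \<open>u\<close>, both accumulation of eigenvalues and infinite multiplicity are excluded by this
  one count.\<close>

lemma eigen_card_bound:
  fixes V :: "real^3 \<Rightarrow> complex^4^4"
  assumes m: "m > 0" and C: "C > 0" and eps: "eps > 0"
    and Vm: "V \<in> borel_measurable lborel"
    and Vb: "\<forall>x. norm (V x) \<le> C * (1 + norm x) powr (-(2 + eps))"
    and e: "e > 0"
  shows "\<exists>M::nat. \<forall>S. finite S \<and> pairwise orthogonal S \<and>
      (\<forall>u\<in>S. norm u = 1 \<and> (\<exists>lam. m + e \<le> \<bar>lam\<bar> \<and> \<bar>lam\<bar> \<le> L \<and> eigen m V lam u)) \<longrightarrow> card S \<le> M"
proof (cases "L > 0")
  case False
  have "card S \<le> 0" if "finite S" "\<forall>u\<in>S. norm u = 1 \<and> (\<exists>lam. m + e \<le> \<bar>lam\<bar> \<and> \<bar>lam\<bar> \<le> L \<and> eigen m V lam u)" for S :: "l2 set"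
  proof -
    have "S = {}" using that(2) False m e by fastforce
    then show ?thesis by simp
  qed
  then show ?thesis by blast
next
  case L: True
  note V = bounded_field_potential[OF C eps Vm Vb]
  \<comment> \<open>What is left of the decay of \<open>V\<close> after the virial estimate has used
    up one factor 1 + |x|. That it still tends to 0 at infinity confines mass to a ball.\<close>
  define w where "w x = (1 + norm x) powr (-(1 + eps))" for x :: "real^3"
  have w0: "0 < w x" "w x \<le> 1" for x
  proof -
    have p: "1 + norm x > 0" "1 + norm x \<ge> 1" by (auto simp: add_pos_nonneg)
    show "0 < w x" using less_imp_neq[OF p(1)] by (simp add: w_def)
    have "w x \<le> (1 + norm x) powr 0" unfolding w_def using eps p by (intro powr_mono) auto
    then show "w x \<le> 1" using less_imp_neq[OF p(1)] by simp
  qed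
  have bw: "bfun w"
    unfolding bfun_def
  proof
    show "w \<in> borel_measurable borel" unfolding w_def[abs_def] by measurable
    show "\<exists>K. \<forall>x. \<bar>w x\<bar> \<le> K" using w0 by (intro exI[of _ 1]) (auto simp: abs_of_pos)
  qed
  have Vw: "(1 + norm x) * norm (V x *v v) \<le> C * norm (w x *\<^sub>R v)" for x and v :: "complex^4"
  proof -
    have p: "1 + norm x > 0" by (simp add: add_pos_nonneg)
    have "norm (V x *v v) \<le> C * (1 + norm x) powr (-(2 + eps)) * norm v"
      using Vb by (intro order_trans[OF norm_matrix_vector_le] mult_right_mono) auto
    then have "(1 + norm x) * norm (V x *v v) \<le> (1 + norm x) * (C * (1 + norm x) powr (-(2 + eps)) * norm v)"
      using p by (intro mult_left_mono) auto
    also have "\<dots> = C * ((1 + norm x) powr 1 * (1 + norm x) powr (-(2 + eps))) * norm v" using p by simp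
    also have "(1 + norm x) powr 1 * (1 + norm x) powr (-(2 + eps)) = w x"
      unfolding w_def powr_add[symmetric] by (rule arg_cong[where f = "(powr) (1 + norm x)"]) simp
    finally show ?thesis using w0[of x] by (simp add: abs_of_pos mult.assoc)
  qed
  have mu_V: "norm (ms a (Mul V u)) \<le> C * norm (ms w u)" if a: "bfun a" "\<And>x. \<bar>a x\<bar> \<le> 1 + norm x" for a u
  proof (rule norm_le_AE)
    show "AE x in lborel. norm (fn (ms a (Mul V u)) x) \<le> C * norm (fn (ms w u) x)"
      using fn_ms[OF a(1), of "Mul V u"] fn_Mul[OF V, of u] fn_ms[OF bw, of u]
    proof eventually_elim
      case (elim x)
      have "\<bar>a x\<bar> * norm (V x *v fn u x) \<le> (1 + norm x) * norm (V x *v fn u x)"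
        by (intro mult_right_mono a) auto
      also note Vw[of x "fn u x"]
      finally show ?case using elim by simp
    qed
  qed (use C in auto)
  \<comment> \<open>Obtained by solving \<open>e\<^sup>2 \<le> norm (ms w u) * (C * L * (6 * C + 2 *
    (6 * L + 5)))\<close> for the norm; this inequality is the key bound with
    \<open>F = C * norm (ms w u)\<close> and F <= C.\<close>
  define c where "c = e\<^sup>2 / (C * L * (6 * C + 2 * (6 * L + 5)))"
  have c: "c > 0" unfolding c_def using e C L by (intro divide_pos_pos mult_pos_pos add_pos_pos) auto
  have eig: "norm (aD u) \<le> C + 2 * L" "c \<le> norm (ms w u)"
    if u: "eigen m V lam u" "norm u = 1" and lam: "m + e \<le> \<bar>lam\<bar>" "\<bar>lam\<bar> \<le> L" for u lam
  proof -
    define f where "f = - Mul V u"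
    define F where "F = C * norm (ms w u)"
    have W: "W1 u" and ev: "Hm m u + Mul V u = lam *\<^sub>R u" using u(1) by (simp_all add: eigen_def)
    have eq: "Hm m u - cs (complex_of_real lam) u = f"
      unfolding cs_of_real ev[symmetric] f_def by simp
    have F0: "F \<ge> 0" using C by (simp add: F_def)
    have FC: "F \<le> C"
      using norm_ms_le[OF bw, of 1 u] w0 u(2) C by (simp add: F_def abs_of_pos)
    have msneg: "ms a f = - ms a (Mul V u)" for a
      unfolding f_def by (simp add: ms_def Mul_uminus)
    have F1: "norm (ms (sn k R) f) \<le> F" if "R > 0" for k R
      unfolding F_def msneg norm_minus_cancel
      by (rule mu_V[OF bfun_sn[OF that]]) (rule order_trans[OF abs_sn_le[OF that]], simp)
    have F2: "norm f \<le> F"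
    proof -
      have b1: "bfun (\<lambda>x. 1)" by (auto simp: bfun_def)
      have "ms (\<lambda>x. 1) (Mul V u) = Mul V u"
        using ms_cls[OF b1 square_integrable_fn, of "Mul V u"] by simp
      then show ?thesis using mu_V[OF b1, of u] by (simp add: F_def f_def)
    qed
    have m': "m\<^sup>2 + e\<^sup>2 \<le> lam\<^sup>2"
    proof -
      have "m\<^sup>2 + e\<^sup>2 \<le> (m + e)\<^sup>2" using m e by (simp add: power2_sum)
      also have "\<dots> \<le> \<bar>lam\<bar>\<^sup>2" using lam m e by (intro power_mono) auto
      finally show ?thesis by simp
    qed
    have nz: "norm (complex_of_real lam) = \<bar>lam\<bar>" by simp
    show "norm (aD u) \<le> C + 2 * L"
    proof -
      have "norm (aD u) \<le> norm f + 2 * norm (complex_of_real lam) * norm u"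
        using m e lam by (intro norm_aD_le[OF eq]) auto
      then show ?thesis using lam(2) F2 FC unfolding u(2) nz by linarith
    qed
    have "((Re (complex_of_real lam))\<^sup>2 - m\<^sup>2) * \<bar>u \<bullet> u\<bar> \<le> norm (complex_of_real lam) * F
        * (6 * F + (6 * norm (complex_of_real lam) + 5) * (norm u + norm u))"
    proof (rule key_bound[OF _ _ W eq W _ F1 F2])
      show "m\<^sup>2 < (Re (complex_of_real lam))\<^sup>2" using m' zero_less_power[OF e, of 2] by (simp only: Re_complex_of_real)
      show "Hm m u - cs (cnj (complex_of_real lam)) u = f" using eq by simp
    qed (use m in auto)
    then have "lam\<^sup>2 - m\<^sup>2 \<le> \<bar>lam\<bar> * F * (6 * F + (6 * \<bar>lam\<bar> + 5) * 2)"
    proof -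
      have "u \<bullet> u = 1" using u(2) by (simp flip: power2_norm_eq_inner)
      then show ?thesis
        using \<open>((Re (complex_of_real lam))\<^sup>2 - m\<^sup>2) * \<bar>u \<bullet> u\<bar> \<le> norm (complex_of_real lam) * F
          * (6 * F + (6 * norm (complex_of_real lam) + 5) * (norm u + norm u))\<close>
        unfolding u(2) nz by simp
    qed
    also have "\<dots> \<le> L * F * (6 * C + (6 * L + 5) * 2)"
      using lam F0 FC L C by (intro mult_mono add_mono mult_left_mono) auto
    finally have "e\<^sup>2 \<le> L * F * (6 * C + (6 * L + 5) * 2)" using m' by linarith
    also have "\<dots> = norm (ms w u) * (C * L * (6 * C + 2 * (6 * L + 5)))" by (simp add: F_def mult_ac)
    finally show "c \<le> norm (ms w u)"
      unfolding c_def using C L by (subst pos_divide_le_eq) (auto intro!: mult_pos_pos add_pos_pos)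
  qed
  have "((\<lambda>r. r powr (-(1 + eps))) \<longlongrightarrow> 0) at_top"
    by (rule tendsto_neg_powr) (use eps in \<open>auto simp: filterlim_ident\<close>)
  then have "eventually (\<lambda>r. r powr (-(1 + eps)) < c / 2) at_top"
    using c by (intro order_tendstoD(2)) auto
  then obtain R0 where R0: "\<And>r. r \<ge> R0 \<Longrightarrow> r powr (-(1 + eps)) < c / 2"
    unfolding eventually_at_top_linorder by blast
  \<comment> \<open>From this radius on w is at most c / 2, so the exterior contributes at most c^2
    / 4 to the squared weighted norm of a unit vector.\<close>
  define R where "R = max R0 1"
  have R: "R > 0" and tail: "w x \<le> c / 2" if "norm x \<ge> R" for x
    using R0[of "1 + norm x"] that by (auto simp: R_def w_def)
  have R: "R > 0" by (simp add: R_def)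
  have local: "ennreal (c\<^sup>2 / 2) \<le> (\<integral>\<^sup>+x. indicator (ball 0 R) x * ennreal ((norm (fn u x))\<^sup>2) \<partial>lborel)"
    if u: "norm u = 1" "c \<le> norm (ms w u)" for u
  proof -
    let ?I = "\<integral>\<^sup>+x. indicator (ball 0 R) x * ennreal ((norm (fn u x))\<^sup>2) \<partial>lborel"
    have "ennreal (c\<^sup>2) \<le> ennreal ((norm (ms w u))\<^sup>2)" using u c by (intro ennreal_leI power_mono) auto
    also have "\<dots> = (\<integral>\<^sup>+x. ennreal ((norm (fn (ms w u) x))\<^sup>2) \<partial>lborel)" by (rule nn_integral_fn_sq[symmetric])
    also have "\<dots> \<le> (\<integral>\<^sup>+x. indicator (ball 0 R) x * ennreal ((norm (fn u x))\<^sup>2) + ennreal (c\<^sup>2 / 4) * ennreal ((norm (fn u x))\<^sup>2) \<partial>lborel)"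
    proof (rule nn_integral_mono_AE)
      show "AE x in lborel. ennreal ((norm (fn (ms w u) x))\<^sup>2)
          \<le> indicator (ball 0 R) x * ennreal ((norm (fn u x))\<^sup>2) + ennreal (c\<^sup>2 / 4) * ennreal ((norm (fn u x))\<^sup>2)"
        using fn_ms[OF bw, of u]
      proof eventually_elim
        case (elim x)
        have eqn: "(norm (fn (ms w u) x))\<^sup>2 = (w x)\<^sup>2 * (norm (fn u x))\<^sup>2" using elim by (simp add: power_mult_distrib)
        show ?case
        proof (cases "x \<in> ball 0 R")
          case True
          have "(w x)\<^sup>2 * (norm (fn u x))\<^sup>2 \<le> 1 * (norm (fn u x))\<^sup>2"
            using w0[of x] by (intro mult_right_mono) (auto simp: power_le_one)
          then have "ennreal ((norm (fn (ms w u) x))\<^sup>2) \<le> ennreal ((norm (fn u x))\<^sup>2)" unfolding eqn by (intro ennreal_leI) simp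
          then show ?thesis using True by (simp add: add_increasing2)
        next
          case False
          then have "w x \<le> c / 2" using tail by simp
          then have "(w x)\<^sup>2 \<le> (c / 2)\<^sup>2" using w0[of x] by (intro power_mono) auto
          then have "(w x)\<^sup>2 * (norm (fn u x))\<^sup>2 \<le> c\<^sup>2 / 4 * (norm (fn u x))\<^sup>2"
            by (intro mult_right_mono) (auto simp: power_divide)
          then have "ennreal ((norm (fn (ms w u) x))\<^sup>2) \<le> ennreal (c\<^sup>2 / 4) * ennreal ((norm (fn u x))\<^sup>2)"
            unfolding eqn by (subst ennreal_mult[symmetric]) (auto intro: ennreal_leI)
          then show ?thesis using False by simp
        qed
      qed
    qed
    also have "\<dots> = ?I + ennreal (c\<^sup>2 / 4) * ennreal ((norm u)\<^sup>2)"
      unfolding nn_integral_fn_sq[symmetric] by (subst nn_integral_add) (auto simp: nn_integral_cmult)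
    also have "\<dots> \<le> ?I + ennreal (c\<^sup>2 / 2)" using u(1) by (intro add_left_mono) (auto intro: ennreal_leI)
    finally have "ennreal (c\<^sup>2) \<le> ?I + ennreal (c\<^sup>2 / 2)" .
    moreover have "ennreal (c\<^sup>2) = ennreal (c\<^sup>2 / 2) + ennreal (c\<^sup>2 / 2)" by (simp flip: ennreal_plus)
    ultimately have "ennreal (c\<^sup>2 / 2) + ennreal (c\<^sup>2 / 2) \<le> ennreal (c\<^sup>2 / 2) + ?I" by (simp only: add.commute)
    then show ?thesis by (subst (asm) ennreal_add_left_cancel_le) simp
  qed
  have "c\<^sup>2 / 2 > 0" "C + 2 * L \<ge> 0" using c C L by auto
  from orthonormal_card_bound[OF this R] obtain M :: nat where M: "\<And>S. finite S \<and> pairwise orthogonal S \<and>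
      (\<forall>u\<in>S. norm u = 1 \<and> W1 u \<and> norm (aD u) \<le> C + 2 * L \<and>
        ennreal (c\<^sup>2 / 2) \<le> (\<integral>\<^sup>+x. indicator (ball 0 R) x * ennreal ((norm (fn u x))\<^sup>2) \<partial>lborel)) \<longrightarrow> card S \<le> M"
    by blast
  show ?thesis
  proof (intro exI[of _ M] allI impI)
    fix S :: "l2 set"
    assume S: "finite S \<and> pairwise orthogonal S \<and>
      (\<forall>u\<in>S. norm u = 1 \<and> (\<exists>lam. m + e \<le> \<bar>lam\<bar> \<and> \<bar>lam\<bar> \<le> L \<and> eigen m V lam u))"
    have "norm u = 1 \<and> W1 u \<and> norm (aD u) \<le> C + 2 * L \<and>
        ennreal (c\<^sup>2 / 2) \<le> (\<integral>\<^sup>+x. indicator (ball 0 R) x * ennreal ((norm (fn u x))\<^sup>2) \<partial>lborel)" if "u \<in> S" for u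
    proof -
      from S have "\<forall>u\<in>S. norm u = 1 \<and> (\<exists>lam. m + e \<le> \<bar>lam\<bar> \<and> \<bar>lam\<bar> \<le> L \<and> eigen m V lam u)" by simp
      with that have "norm u = 1 \<and> (\<exists>lam. m + e \<le> \<bar>lam\<bar> \<and> \<bar>lam\<bar> \<le> L \<and> eigen m V lam u)" by (rule bspec[rotated])
      then obtain lam where u: "norm u = 1" "eigen m V lam u" and lam: "m + e \<le> \<bar>lam\<bar>" "\<bar>lam\<bar> \<le> L" by blast
      have W: "W1 u" using u(2) by (simp add: eigen_def)
      show ?thesis
        by (rule conjI[OF u(1) conjI[OF W conjI[OF eig(1)[OF u(2,1) lam] local[OF u(1) eig(2)[OF u(2,1) lam]]]]])
    qed
    then have all: "\<forall>u\<in>S. norm u = 1 \<and> W1 u \<and> norm (aD u) \<le> C + 2 * L \<and>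
        ennreal (c\<^sup>2 / 2) \<le> (\<integral>\<^sup>+x. indicator (ball 0 R) x * ennreal ((norm (fn u x))\<^sup>2) \<partial>lborel)" by (rule ballI)
    have "finite S" "pairwise orthogonal S" using S by simp_all
    from M[THEN mp, OF conjI[OF this(1) conjI[OF this(2) all]]] show "card S \<le> M" .
  qed
qed

text \<open>Eigenvectors for distinct eigenvalues are orthogonal because \<open>V\<close> is
  Hermitian, so infinitely many eigenvalues near \<open>l\<close> would violate
  \<open>eigen_card_bound\<close>.\<close>

lemma eigenvalues_discrete:
  fixes V :: "real^3 \<Rightarrow> complex^4^4"
  assumes m: "m > 0" and C: "C > 0" and eps: "eps > 0"
    and Vm: "V \<in> borel_measurable lborel" and herm: "\<forall>x. hermitian4 (V x)"
    and Vb: "\<forall>x. norm (V x) \<le> C * (1 + norm x) powr (-(2 + eps))"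
    and l: "l \<in> U_set m"
  shows "\<not> l islimpt {lam \<in> U_set m. is_eigenvalue m V lam}"
proof
  note V = bounded_field_potential[OF C eps Vm Vb]
  assume lp: "l islimpt {lam \<in> U_set m. is_eigenvalue m V lam}"
  \<comment> \<open>Half the distance from |l| to the threshold m: every eigenvalue within
    \<open>e\<close> of \<open>l\<close> then satisfies
    \<open>m + e \<le> \<bar>lam\<bar>\<close>.\<close>
  define e where "e = (\<bar>l\<bar> - m) / 2"
  have e: "e > 0" using l by (simp add: e_def U_set_def)
  let ?A = "{lam \<in> U_set m. is_eigenvalue m V lam} \<inter> ball l e"
  have inf: "infinite ?A" using lp e by (simp add: islimpt_eq_infinite_ball)
  obtain M :: nat where M: "\<And>S. finite S \<and> pairwise orthogonal S \<and>
      (\<forall>u\<in>S. norm u = 1 \<and> (\<exists>lam. m + e \<le> \<bar>lam\<bar> \<and> \<bar>lam\<bar> \<le> \<bar>l\<bar> + e \<and> eigen m V lam u)) \<longrightarrow> card S \<le> M"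
    using eigen_card_bound[OF m C eps Vm Vb e, of "\<bar>l\<bar> + e"] by blast
  obtain B where B: "finite B" "card B = Suc M" "B \<subseteq> ?A" using infinite_arbitrarily_large[OF inf] by blast
  have "\<forall>lam\<in>B. \<exists>u. eigen m V lam u \<and> norm u = 1" using B(3) is_eigenvalue_iff[OF V] by blast
  then obtain U where U: "\<And>lam. lam \<in> B \<Longrightarrow> eigen m V lam (U lam) \<and> norm (U lam) = 1" by metis
  have orth: "U a \<bullet> U b = 0" if "a \<in> B" "b \<in> B" "a \<noteq> b" for a b
    using eigen_orthogonal[OF V herm, of m a "U a" b "U b"] U that by blast
  have inj: "inj_on U B"
  proof (rule inj_onI, rule ccontr)
    fix a b assume ab: "a \<in> B" "b \<in> B" "U a = U b" "a \<noteq> b"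
    then have "U a \<bullet> U a = 0" using orth[of a b] by simp
    then show False using U[OF ab(1)] by (simp add: norm_eq_sqrt_inner)
  qed
  have "card (U ` B) \<le> M"
  proof (rule M[rule_format], intro conjI ballI)
    show "finite (U ` B)" using B(1) by simp
    show "pairwise orthogonal (U ` B)" unfolding pairwise_def orthogonal_def using orth by blast
    fix u assume "u \<in> U ` B"
    then obtain lam where lam: "lam \<in> B" "u = U lam" by blast
    then show "norm u = 1" using U by blast
    have "dist l lam < e" using lam(1) B(3) by auto
    then have "m + e \<le> \<bar>lam\<bar> \<and> \<bar>lam\<bar> \<le> \<bar>l\<bar> + e" by (auto simp: e_def dist_real_def abs_if field_simps split: if_splits)
    then show "\<exists>lam. m + e \<le> \<bar>lam\<bar> \<and> \<bar>lam\<bar> \<le> \<bar>l\<bar> + e \<and> eigen m V lam u" using U lam by blast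
  qed
  then show False using B(2) card_image[OF inj] by simp
qed

text \<open>\<open>eigen_card_bound\<close> counts families that are orthonormal over the reals,
  whereas multiplicity is defined by complex independence almost everywhere. The latter restricts to
  real coefficients, and real orthogonalisation within the eigenspace yields an orthonormal family
  at least as large.\<close>

lemma eigenvalues_finite_multiplicity:
  fixes V :: "real^3 \<Rightarrow> complex^4^4"
  assumes m: "m > 0" and C: "C > 0" and eps: "eps > 0"
    and Vm: "V \<in> borel_measurable lborel"
    and Vb: "\<forall>x. norm (V x) \<le> C * (1 + norm x) powr (-(2 + eps))"
    and lam: "lam \<in> U_set m"
  shows "finite_multiplicity m V lam"
proof -
  note V = bounded_field_potential[OF C eps Vm Vb]
  define e where "e = \<bar>lam\<bar> - m"
  have e: "e > 0" using lam by (simp add: e_def U_set_def)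
  obtain M :: nat where M: "\<And>S. finite S \<and> pairwise orthogonal S \<and>
      (\<forall>u\<in>S. norm u = 1 \<and> (\<exists>mu. m + e \<le> \<bar>mu\<bar> \<and> \<bar>mu\<bar> \<le> \<bar>lam\<bar> \<and> eigen m V mu u)) \<longrightarrow> card S \<le> M"
    using eigen_card_bound[OF m C eps Vm Vb e, of "\<bar>lam\<bar>"] by blast
  have sub: "subspace {u. eigen m V lam u}"
  proof (rule subspaceI)
    show "0 \<in> {u. eigen m V lam u}" using Hm_scaleR[OF W1_zero, of m 0] by (simp add: eigen_def W1_zero)
    show "x + y \<in> {u. eigen m V lam u}" if "x \<in> {u. eigen m V lam u}" "y \<in> {u. eigen m V lam u}" for x y
    proof -
      have x: "W1 x" "Hm m x + Mul V x = lam *\<^sub>R x" and y: "W1 y" "Hm m y + Mul V y = lam *\<^sub>R y"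
        using that by (auto simp: eigen_def)
      have "Hm m (x + y) + Mul V (x + y) = (Hm m x + Mul V x) + (Hm m y + Mul V y)"
        using x(1) y(1) by (simp add: Hm_add Mul_add)
      then show ?thesis unfolding x(2) y(2) using x(1) y(1) by (simp add: eigen_def W1_add scaleR_add_right)
    qed
    show "c *\<^sub>R x \<in> {u. eigen m V lam u}" if "x \<in> {u. eigen m V lam u}" for c x
      using that by (auto simp: eigen_def W1_scaleR Hm_scaleR Mul_scaleR scaleR_add_right[symmetric])
  qed
  show ?thesis
    unfolding finite_multiplicity_def
  proof (intro exI[of _ M] allI impI)
    fix k :: nat and us :: "nat \<Rightarrow> real^3 \<Rightarrow> complex^4"
    assume A: "(\<forall>i<k. dirac_eq m V (complex_of_real lam) (us i) (\<lambda>x. 0)) \<and>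
      (\<forall>c :: nat \<Rightarrow> complex. (AE x in lborel. (\<Sum>i<k. c i *s us i x) = 0) \<longrightarrow> (\<forall>i<k. c i = 0))"
    have si: "square_integrable (us i)" and eg: "eigen m V lam (cls (us i))" if "i < k" for i
      using A that by (auto simp: eigen_iff_dirac_eq[OF V])
    have ind: "\<forall>i<k. c i = 0" if c: "(\<Sum>i<k. c i *\<^sub>R cls (us i)) = 0" for c :: "nat \<Rightarrow> real"
    proof -
      have "AE x in lborel. \<forall>i\<in>{..<k}. fn (c i *\<^sub>R cls (us i)) x = complex_of_real (c i) *s us i x"
      proof (rule AE_finite_allI)
        fix i assume "i \<in> {..<k}"
        then show "AE x in lborel. fn (c i *\<^sub>R cls (us i)) x = complex_of_real (c i) *s us i x"
          using fn_cs[of "complex_of_real (c i)" "cls (us i)"] fn_cls[OF si[of i]]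
          unfolding cs_of_real by auto
      qed simp
      moreover have "AE x in lborel. fn (\<Sum>i<k. c i *\<^sub>R cls (us i)) x = (\<Sum>i<k. fn (c i *\<^sub>R cls (us i)) x)"
        by (rule fn_sum) simp
      ultimately have "AE x in lborel. (\<Sum>i<k. complex_of_real (c i) *s us i x) = 0"
        using fn_zero unfolding c by eventually_elim simp
      then show ?thesis using A by fastforce
    qed
    have inj: "inj_on (\<lambda>i. cls (us i)) {..<k}"
    proof (rule inj_onI, rule ccontr)
      fix i j assume ij: "i \<in> {..<k}" "j \<in> {..<k}" "cls (us i) = cls (us j)" "i \<noteq> j"
      \<comment> \<open>Equal classes at two indices would be a linear dependence with coefficients
        1 and -1.\<close>
      define c where "c l = (if l = i then 1 else if l = j then -1 else (0::real))" for l
      have "(\<Sum>l<k. c l *\<^sub>R cls (us l)) = (\<Sum>l\<in>{i, j}. c l *\<^sub>R cls (us l))"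
        by (rule sum.mono_neutral_right) (use ij in \<open>auto simp: c_def\<close>)
      also have "\<dots> = 0" using ij by (simp add: c_def)
      finally have "c i = 0" using ind ij by blast
      then show False by (simp add: c_def)
    qed
    define B where "B = (\<lambda>i. cls (us i)) ` {..<k}"
    have B: "finite B" "card B = k" unfolding B_def by (simp_all add: card_image[OF inj])
    have indB: "independent B"
    proof (rule independent_if_scalars_zero[OF B(1)])
      fix f x assume f: "(\<Sum>x\<in>B. f x *\<^sub>R x) = 0" and x: "x \<in> B"
      have "(\<Sum>i<k. f (cls (us i)) *\<^sub>R cls (us i)) = 0"
        using f unfolding B_def by (simp add: sum.reindex[OF inj])
      from ind[OF this] show "f x = 0" using x by (auto simp: B_def)
    qed
    obtain D where D: "finite D" "span D = span B" "pairwise orthogonal D"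
      using basis_orthogonal[OF B(1)] by blast
    \<comment> \<open>The orthogonal set \<open>D\<close> may contain the zero vector, which cannot
      be normalised.\<close>
    define D' where "D' = D - {0}"
    have D': "finite D'" "span D' = span B" "pairwise orthogonal D'" "0 \<notin> D'"
      using D by (auto simp: D'_def span_delete_0 pairwise_def)
    have kD: "k \<le> card D'"
      using independent_span_bound[OF D'(1) indB] span_superset[of B] D'(2) B(2) by simp
    define S where "S = (\<lambda>u. u /\<^sub>R norm u) ` D'"
    have orth: "u \<bullet> v = 0" if "u \<in> D'" "v \<in> D'" "u \<noteq> v" for u v
      using D'(3) that by (simp add: pairwise_def orthogonal_def)
    have injD: "inj_on (\<lambda>u. u /\<^sub>R norm u) D'"
    proof (rule inj_onI, rule ccontr)
      fix u v assume uv: "u \<in> D'" "v \<in> D'" "u /\<^sub>R norm u = v /\<^sub>R norm v" "u \<noteq> v"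
      have "(u /\<^sub>R norm u) \<bullet> (u /\<^sub>R norm u) = (u /\<^sub>R norm u) \<bullet> (v /\<^sub>R norm v)" using uv(3) by simp
      also have "\<dots> = 0" using orth[OF uv(1,2,4)] by simp
      finally show False using uv(1) D'(4) by auto
    qed
    have "card S \<le> M"
    proof (rule M[rule_format], intro conjI ballI)
      show "finite S" using D'(1) by (simp add: S_def)
      show "pairwise orthogonal S"
        unfolding pairwise_def orthogonal_def S_def using orth by fastforce
      fix u assume "u \<in> S"
      then obtain v where v: "v \<in> D'" "u = v /\<^sub>R norm v" by (auto simp: S_def)
      then have "v \<noteq> 0" using D'(4) by auto
      then show "norm u = 1" using v(2) by simp
      have "v \<in> span B" using v(1) D'(2) span_superset by blast
      moreover have "span B \<subseteq> {u. eigen m V lam u}"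
        by (rule span_minimal[OF _ sub]) (use eg in \<open>auto simp: B_def\<close>)
      ultimately have "v \<in> {u. eigen m V lam u}" by (rule rev_subsetD)
      from subspace_scale[OF sub this, of "inverse (norm v)"] have "eigen m V lam u" by (simp add: v(2))
      then show "\<exists>mu. m + e \<le> \<bar>mu\<bar> \<and> \<bar>mu\<bar> \<le> \<bar>lam\<bar> \<and> eigen m V mu u" by (intro exI[of _ lam]) (simp add: e_def)
    qed
    then show "k \<le> M" using kD card_image[OF injD] by (simp add: S_def)
  qed
qed

theorem theorem6p16:
  fixes m C eps s sg :: real and V :: "real^3 \<Rightarrow> complex^4^4"
  assumes "m > 0" and "C > 0" and "eps > 0"
    and "V \<in> borel_measurable lborel"
    and "\<forall>x. hermitian4 (V x)"
    and "\<forall>x. norm (V x) \<le> C * (1 + norm x) powr (-(2 + eps))"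
    and "1/2 < s" and "s < (1 + eps) / 2"
    and "sg = 1 \<or> sg = -1"
  shows "Sigma_V m V s sg = {lam \<in> U_set m. is_eigenvalue m V lam}
    \<and> (\<forall>l\<in>U_set m. \<not> l islimpt {lam \<in> U_set m. is_eigenvalue m V lam})
    \<and> (\<forall>lam \<in> U_set m. is_eigenvalue m V lam \<longrightarrow> finite_multiplicity m V lam)"
proof (intro conjI ballI impI)
  show "Sigma_V m V s sg = {lam \<in> U_set m. is_eigenvalue m V lam}"
  proof
    show "Sigma_V m V s sg \<subseteq> {lam \<in> U_set m. is_eigenvalue m V lam}"
      using Sigma_in_eigenvalue[OF assms] by (auto simp: Sigma_V_def)
    show "{lam \<in> U_set m. is_eigenvalue m V lam} \<subseteq> Sigma_V m V s sg"
      using eigenvalue_in_Sigma[OF assms(1-4,6-9)] by blast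
  qed
  show "\<not> l islimpt {lam \<in> U_set m. is_eigenvalue m V lam}" if "l \<in> U_set m" for l
    by (rule eigenvalues_discrete[OF assms(1-6) that])
  show "finite_multiplicity m V lam" if "lam \<in> U_set m" for lam
    by (rule eigenvalues_finite_multiplicity[OF assms(1-4,6) that])
qed

end
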